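(* Let $u\in\mathcal{W}_\infty(I)$ be a solution of the unsteady elasto-plastic torsion problem and $z=z^{\mathrm a}\,dt\,dx+z^{\mathrm s}\in\operatorname{ba}(Q;\mathbb{R}^d)$ an associated dual flux, as described in the context. Then, for every $y=y^{\mathrm a}\,dt\,dx+y^{\mathrm s}\in\operatorname{ba}(Q;\mathbb{R}^d)$ and $\lambda\in\mathcal{W}_\infty(I)$ with $\nabla\lambda(t)\in K(t)$ for a.e. $t\in I$ and $L^*y+\partial_t\lambda=f$ in $(L^\infty_{\mathrm w^*}(I;V))^*$, $$\begin{aligned}&\tfrac12\bigl(\mathbb{H}_{\phi^*}^{y^{\mathrm a},z^{\mathrm a}}(y^{\mathrm a}-z^{\mathrm a}),y^{\mathrm a}-z^{\mathrm a}\bigr)_Q+|\zeta y^{\mathrm s}|(Q)-\langle y^{\mathrm s},\nabla u\rangle_{L^\infty(Q;\mathbb{R}^d)}\\&\quad+\tfrac12\|\nabla(\lambda-u)\|_Q^2+\Bigl(\tfrac{|z^{\mathrm a}|}{\zeta}-1,\ \zeta^2-\nabla u\cdot\nabla\lambda\Bigr)_{\{|\nabla u|=\zeta\}}\\&\quad+|\zeta z^{\mathrm s}|(Q)-\langle z^{\mathrm s},\nabla\lambda\rangle_{L^\infty(Q;\mathbb{R}^d)}+\tfrac12\|(\lambda-u)(T)\|_H^2\\&=I_{\phi^*}(y^{\mathrm a})-(y^{\mathrm a},\nabla\lambda)_Q+\tfrac12\|\nabla\lambda\|_Q^2+|\zeta y^{\mathrm s}|(Q)-\langle y^{\mathrm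 s},\nabla\lambda\rangle_{L^\infty(Q;\mathbb{R}^d)}+\tfrac12\|\lambda(0)-u_0\|_H^2 .\end{aligned}$$ Here $\mathbb{H}_{\phi^*}^{y^{\mathrm a},z^{\mathrm a}}\coloneqq2\int_0^1(1-s)\,H_\zeta(\cdot,\cdot,sy^{\mathrm a}+(1-s)z^{\mathrm a})\,ds\colon Q\to\mathbb{R}^{d\times d}$, where for a.e. $(t,x)\in Q$ and $q\in\mathbb{R}^d$: $H_\zeta(t,x,q)=\mathrm{I}_d$ (identity matrix) if $|q|<\zeta(t,x)$, $H_\zeta(t,x,q)=0$ (zero matrix) if $|q|=\zeta(t,x)$, and $H_\zeta(t,x,q)=\frac{\zeta(t,x)}{|q|}\bigl(\mathrm{I}_d-\frac{q\otimes q}{|q|^2}\bigr)$ if $|q|>\zeta(t,x)$.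
   Context: Spaces. $\Omega\subseteq\mathbb{R}^d$ is a bounded Lipschitz domain with boundary split into disjoint relatively open sets $\Gamma_D\ne\emptyset$ and $\Gamma_N$, $\overline\Gamma_D\cup\overline\Gamma_N=\partial\Omega$; $I=(0,T)$, $0<T<\infty$; $Q=I\times\Omega$. $V=W^{1,\infty}_D(\Omega)$ (zero trace on $\Gamma_D$) with norm $\|\nabla\cdot\|_{L^\infty(\Omega)}$, $Y=L^\infty(\Omega;\mathbb{R}^d)$ with predual $Y_*=L^1(\Omega;\mathbb{R}^d)$, $H=L^2(\Omega)$. $V$ has the separable predual $V_*=Y_*/{}^\perp(\nabla V)$, ${}^\perp(\nabla V)=\{y\in Y_*\mid\int_\Omega y\cdot\nabla v\,dx=0\ \forall v\in V\}$; $V\subset H\subset V_*$, where $h\in H$ acts on $V$ by $v\mapsto(h,v)_H$. $L^\infty_{\mathrm w^*}(I;V)$ is the space of $v\colon I\to V$ such that $t\mapsto\int_\Omega\nabla v(t)\cdot w\,dx$ is measurable for all $w\in Y_*$ and $\|v(\cdot)\|_V\in L^\infty(I)$; it is the dual of $L^1(I;V_* )$. $\mathcal{W}_\infty(I)=\{v\in L^\infty_{\mathrm w^*}(I;V)\mid\partial_tv\in L^1(I;V_* )\}\hookrightarrow C^0(\overline I;H)$. Elements of $L^1(I;V_* )$ are regarded as elements of $(L^\infty_{\mathrm w^*}(I;V))^*$. $\operatorname{ba}(Q;\mathbb{R}^d)=(L^\infty(Q;\mathbb{R}^d))^*$ is the space of bounded finitely additive $\mathbb{R}^d$-valued measures on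 the Lebesgue sets of $Q$ vanishing on Lebesgue-null sets. Every $y\in\operatorname{ba}(Q;\mathbb{R}^d)$ has a unique Yosida--Hewitt decomposition $y=y^{\mathrm a}\,dt\,dx+y^{\mathrm s}$ with $y^{\mathrm a}\in L^1(Q;\mathbb{R}^d)$ and $y^{\mathrm s}$ purely finitely additive. $|\zeta y^{\mathrm s}|(Q)$ is the total variation of $\zeta y^{\mathrm s}$, i.e. $\sup\{\langle y^{\mathrm s},q\rangle\mid q\in L^\infty(Q;\mathbb{R}^d),|q|\le\zeta\text{ a.e.}\}$. $L^*\colon\operatorname{ba}(Q;\mathbb{R}^d)\to(L^\infty_{\mathrm w^*}(I;V))^*$ is the adjoint of $\nabla\colon L^\infty_{\mathrm w^*}(I;V)\to L^\infty(Q;\mathbb{R}^d)$; on a fixed time slice $L^*\colon Y^*\to V^*$ is the adjoint of $\nabla\colon V\to Y$. $(a,b)_\omega=\int_\omega a\cdot b$ for measurable $\omega\subseteq Q$, $\|\cdot\|_Q$ is the $L^2(Q)$-norm. Problem. $\zeta\in L^\infty(Q)$, weakly continuous in time with values in $H$ on $\overline I$, $\zeta\ge\zeta_0$ a.e. in $Q$ for a constant $\zeta_0>0$. $K(t)=\{y\in Y\mid|y|\le\zeta(t)\text{ a.e. in }\Omega\}$; $N_{K(t)}(y)=\{y^*\in Y^*\mid\langle y^*,\varphi-y\rangle_Y\le0\ \forall\varphi\in K(t)\}$. $\phi(t,x,a)=\frac12|a|^2$ if $|a|\le\zeta(t,x)$ and $+\infty$ otherwise; its conjugate in $a$ is $\phi^*(t,x,a)=\frac12|a|^2-\frac12(|a|-\zeta(t,x))_+^2$,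 and $I_{\phi^*}(y^{\mathrm a})=\int_Q\phi^*(t,x,y^{\mathrm a}(t,x))\,dt\,dx$. $f\in L^1(I;V_* )$, $u_0\in V$ with $\nabla u_0\in K(0)$. It is assumed that there is a solution $u\in\mathcal{W}_\infty(I)$ of $\partial_tu(t)+(-\Delta)u(t)+L^*N_{K(t)}(\nabla u(t))\ni f(t)$ in $V^*$ for a.e. $t\in I$, $u(0)=u_0$ in $H$, where $\langle(-\Delta)v,w\rangle_V=\int_\Omega\nabla v\cdot\nabla w\,dx$. Dual flux: with $I_G(y)=\int_Q\phi(t,x,y)\,dt\,dx$ on $L^\infty(Q;\mathbb{R}^d)$, $z=z^{\mathrm a}\,dt\,dx+z^{\mathrm s}\in\operatorname{ba}(Q;\mathbb{R}^d)$ is such that $z\in\partial I_G(\nabla u)$ and $L^*z+\partial_tu=f$ in $(L^\infty_{\mathrm w^*}(I;V))^*$; the first condition is equivalent to $\nabla u=\Pi_\zeta(z^{\mathrm a})$ a.e. in $Q$ ($\Pi_{\zeta(t,x)}$ the projection of $\mathbb{R}^d$ onto the closed ball of radius $\zeta(t,x)$) together with $|\zeta z^{\mathrm s}|(Q)=\langle z^{\mathrm s},\nabla u\rangle_{L^\infty(Q;\mathbb{R}^d)}$. *)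

theory Defs
  imports "HOL-Analysis.Analysis" "HOL-Probability.Essential_Supremum"
begin

text \<open>
  Elements of Lebesgue, Sobolev and Bochner spaces are represented by functions; equality in these
  spaces is equality almost everywhere, and every notion below is invariant under it.
\<close>

section \<open>Lebesgue spaces, the dual of \<open>L\<^sup>\<infinity>\<close> and the Yosida--Hewitt decomposition\<close>

definition Linf :: "'a measure \<Rightarrow> ('a \<Rightarrow> 'b::euclidean_space) set" where
  "Linf M = {f \<in> borel_measurable M. esssup M (\<lambda>x. ennreal (norm (f x))) < \<infinity>}"

definition Linf_norm :: "'a measure \<Rightarrow> ('a \<Rightarrow> 'b::euclidean_space) \<Rightarrow> real" where
  "Linf_norm M f = enn2real (esssup M (\<lambda>x. ennreal (norm (f x))))"

definition L2 :: "'a measure \<Rightarrow> ('a \<Rightarrow> 'b::euclidean_space) set" where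
  "L2 M = {f \<in> borel_measurable M. integrable M (\<lambda>x. (norm (f x))\<^sup>2)}"

definition L2_norm :: "'a measure \<Rightarrow> ('a \<Rightarrow> 'b::euclidean_space) \<Rightarrow> real" where
  "L2_norm M f = sqrt (\<integral>x. (norm (f x))\<^sup>2 \<partial>M)"

text \<open>The bound by the essential supremum makes a functional well defined on equivalence classes.
  Values outside \<open>Linf M\<close> are irrelevant.\<close>

definition Linf_dual :: "'a measure \<Rightarrow> (('a \<Rightarrow> 'b::euclidean_space) \<Rightarrow> real) set" where
  "Linf_dual M = {y.
     (\<forall>p\<in>Linf M. \<forall>q\<in>Linf M. y (\<lambda>x. p x + q x) = y p + y q) \<and>
     (\<forall>c. \<forall>q\<in>Linf M. y (\<lambda>x. c *\<^sub>R q x) = c * y q) \<and>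
     (\<exists>C. \<forall>q\<in>Linf M. \<bar>y q\<bar> \<le> C * Linf_norm M q)}"

text \<open>Positive part in the Jordan decomposition of a bounded finitely additive set function.\<close>

definition fa_pos :: "'a measure \<Rightarrow> ('a set \<Rightarrow> real) \<Rightarrow> 'a set \<Rightarrow> real" where
  "fa_pos M \<mu> A = Sup {\<mu> B | B. B \<in> sets M \<and> B \<subseteq> A}"

text \<open>Yosida and Hewitt: a nonnegative finitely additive \<open>\<mu>\<close> is purely finitely additive if the
  only countably additive \<open>N\<close> with \<open>0 \<le> N \<le> \<mu>\<close> is zero; a signed \<open>\<mu>\<close> is so if both its Jordan
  parts are; a vector-valued one if all its components are.\<close>

definition purely_fa_nonneg :: "'a measure \<Rightarrow> ('a set \<Rightarrow> real) \<Rightarrow> bool" where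
  "purely_fa_nonneg M \<mu> \<longleftrightarrow>
     (\<forall>N. sets N = sets M \<and> (\<forall>A\<in>sets M. emeasure N A \<le> ennreal (\<mu> A))
        \<longrightarrow> (\<forall>A\<in>sets M. emeasure N A = 0))"

definition purely_fa :: "'a measure \<Rightarrow> ('a set \<Rightarrow> real) \<Rightarrow> bool" where
  "purely_fa M \<mu> \<longleftrightarrow>
     purely_fa_nonneg M (fa_pos M \<mu>) \<and> purely_fa_nonneg M (fa_pos M (\<lambda>A. - \<mu> A))"

definition yosida_hewitt ::
  "'a measure \<Rightarrow> (('a \<Rightarrow> 'b::euclidean_space) \<Rightarrow> real) \<Rightarrow> ('a \<Rightarrow> 'b) \<Rightarrow> (('a \<Rightarrow> 'b) \<Rightarrow> real) \<Rightarrow> bool"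
  where
  "yosida_hewitt M y ya ys \<longleftrightarrow>
     integrable M ya \<and> ys \<in> Linf_dual M \<and>
     (\<forall>b\<in>Basis. purely_fa M (\<lambda>A. ys (\<lambda>x. indicat_real A x *\<^sub>R b))) \<and>
     (\<forall>q\<in>Linf M. y q = (\<integral>x. ya x \<bullet> q x \<partial>M) + ys q)"

text \<open>The total mass \<open>|\<zeta> y\<^sup>s|(Q)\<close>.\<close>

definition weighted_variation ::
  "'a measure \<Rightarrow> ('a \<Rightarrow> real) \<Rightarrow> (('a \<Rightarrow> 'b::euclidean_space) \<Rightarrow> real) \<Rightarrow> real" where
  "weighted_variation M w ys = Sup {ys q | q. q \<in> Linf M \<and> (AE x in M. norm (q x) \<le> w x)}"


section \<open>Lipschitz domains, test functions and weak gradients\<close>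

text \<open>Near each boundary point, \<open>\<Omega>\<close> is the part above the graph of a Lipschitz function, the
  vertical direction being \<open>\<nu>\<close>.\<close>

definition lipschitz_domain :: "'a::euclidean_space set \<Rightarrow> bool" where
  "lipschitz_domain \<Omega> \<longleftrightarrow>
     open \<Omega> \<and> connected \<Omega> \<and> bounded \<Omega> \<and> \<Omega> \<noteq> {} \<and>
     (\<forall>p\<in>frontier \<Omega>. \<exists>\<nu> \<gamma> L U. norm \<nu> = 1 \<and> L-lipschitz_on {y. y \<bullet> \<nu> = 0} \<gamma> \<and> open U \<and> p \<in> U \<and>
        \<Omega> \<inter> U = {x \<in> U. \<gamma> (x - (x \<bullet> \<nu>) *\<^sub>R \<nu>) < x \<bullet> \<nu>})"

definition partial_deriv :: "'a::euclidean_space \<Rightarrow> ('a \<Rightarrow> real) \<Rightarrow> 'a \<Rightarrow> real" where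
  "partial_deriv b f x = frechet_derivative f (at x) b"

primrec C_k :: "nat \<Rightarrow> ('a::euclidean_space \<Rightarrow> real) \<Rightarrow> bool" where
  "C_k 0 f \<longleftrightarrow> continuous_on UNIV f"
| "C_k (Suc k) f \<longleftrightarrow> (\<forall>x. f differentiable at x) \<and> (\<forall>b\<in>Basis. C_k k (partial_deriv b f))"

definition test_fun :: "'a::euclidean_space set \<Rightarrow> ('a \<Rightarrow> real) set" where
  "test_fun \<Omega> = {\<phi>. (\<forall>k. C_k k \<phi>) \<and> (\<exists>S. compact S \<and> S \<subseteq> \<Omega> \<and> (\<forall>x. x \<notin> S \<longrightarrow> \<phi> x = 0))}"

definition weak_gradient :: "'a::euclidean_space set \<Rightarrow> ('a \<Rightarrow> real) \<Rightarrow> ('a \<Rightarrow> 'a) \<Rightarrow> bool" where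
  "weak_gradient \<Omega> v g \<longleftrightarrow>
     (\<forall>\<phi>\<in>test_fun \<Omega>. \<forall>b\<in>Basis.
        (\<integral>x. v x * partial_deriv b \<phi> x \<partial>lebesgue_on \<Omega>) = - (\<integral>x. (g x \<bullet> b) * \<phi> x \<partial>lebesgue_on \<Omega>))"

definition grad :: "'a::euclidean_space set \<Rightarrow> ('a \<Rightarrow> real) \<Rightarrow> 'a \<Rightarrow> 'a" where
  "grad \<Omega> v = (SOME g. g \<in> Linf (lebesgue_on \<Omega>) \<and> weak_gradient \<Omega> v g)"


section \<open>The spaces \<open>V\<close>, \<open>V\<^sub>*\<close> and \<open>\<W>\<^sub>\<infinity>(I)\<close>\<close>

text \<open>On a bounded Lipschitz domain every \<open>W\<^sup>1\<^sup>,\<^sup>\<infinity>\<close> function has a representative \<open>w\<close> that is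
  continuous up to the boundary, and its trace is the restriction of \<open>w\<close> to the boundary.\<close>

definition W1inf_D :: "'a::euclidean_space set \<Rightarrow> 'a set \<Rightarrow> ('a \<Rightarrow> real) set" where
  "W1inf_D \<Omega> \<Gamma>\<^sub>D = {v \<in> Linf (lebesgue_on \<Omega>).
     (\<exists>g\<in>Linf (lebesgue_on \<Omega>). weak_gradient \<Omega> v g) \<and>
     (\<exists>w. continuous_on (closure \<Omega>) w \<and> (AE x in lebesgue_on \<Omega>. v x = w x) \<and> (\<forall>x\<in>\<Gamma>\<^sub>D. w x = 0))}"

definition V_norm :: "'a::euclidean_space set \<Rightarrow> ('a \<Rightarrow> real) \<Rightarrow> real" where
  "V_norm \<Omega> v = Linf_norm (lebesgue_on \<Omega>) (grad \<Omega> v)"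

text \<open>The class of \<open>w \<in> L\<^sup>1(\<Omega>;\<real>\<^sup>d)\<close> modulo the annihilator of \<open>\<nabla>V\<close> is determined by the
  functional \<open>v \<mapsto> \<integral>w \<bullet> \<nabla>v\<close> on \<open>V\<close>; an element of the quotient \<open>V\<^sub>*\<close> is represented by this
  functional (whose values outside \<open>V\<close> are irrelevant), and \<open>represents_predual\<close> states that \<open>w\<close>
  belongs to the class \<open>l\<close>.  Accordingly \<open>predual_norm\<close> is the quotient norm, and \<open>h \<in> L\<^sup>2(\<Omega>)\<close> is
  identified with \<open>v \<mapsto> \<integral>h v\<close>.\<close>

definition represents_predual ::
  "'a::euclidean_space set \<Rightarrow> 'a set \<Rightarrow> ('a \<Rightarrow> 'a) \<Rightarrow> (('a \<Rightarrow> real) \<Rightarrow> real) \<Rightarrow> bool" where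
  "represents_predual \<Omega> \<Gamma>\<^sub>D w l \<longleftrightarrow> integrable (lebesgue_on \<Omega>) w \<and>
     (\<forall>v\<in>W1inf_D \<Omega> \<Gamma>\<^sub>D. l v = (\<integral>x. w x \<bullet> grad \<Omega> v x \<partial>lebesgue_on \<Omega>))"

definition predual :: "'a::euclidean_space set \<Rightarrow> 'a set \<Rightarrow> (('a \<Rightarrow> real) \<Rightarrow> real) set" where
  "predual \<Omega> \<Gamma>\<^sub>D = {l. \<exists>w. represents_predual \<Omega> \<Gamma>\<^sub>D w l}"

definition predual_norm :: "'a::euclidean_space set \<Rightarrow> 'a set \<Rightarrow> (('a \<Rightarrow> real) \<Rightarrow> real) \<Rightarrow> real" where
  "predual_norm \<Omega> \<Gamma>\<^sub>D l =
     Inf {(\<integral>x. norm (w x) \<partial>lebesgue_on \<Omega>) | w. represents_predual \<Omega> \<Gamma>\<^sub>D w l}"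

abbreviation time_interval :: "real \<Rightarrow> real set" where
  "time_interval T \<equiv> {0<..<T}"

text \<open>The Bochner space \<open>L\<^sup>1(I;V\<^sub>*)\<close>: strong limits a.e. of simple functions with integrable norm.\<close>

definition L1_predual ::
  "'a::euclidean_space set \<Rightarrow> 'a set \<Rightarrow> real \<Rightarrow> (real \<Rightarrow> ('a \<Rightarrow> real) \<Rightarrow> real) set" where
  "L1_predual \<Omega> \<Gamma>\<^sub>D T = {f.
     (\<forall>t\<in>time_interval T. f t \<in> predual \<Omega> \<Gamma>\<^sub>D) \<and>
     (\<exists>s. (\<forall>n. simple_function (lebesgue_on (time_interval T)) (s n) \<and>
               (\<forall>t\<in>time_interval T. s n t \<in> predual \<Omega> \<Gamma>\<^sub>D)) \<and>
          (AE t in lebesgue_on (time_interval T).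
             (\<lambda>n. predual_norm \<Omega> \<Gamma>\<^sub>D (\<lambda>v. s n t v - f t v)) \<longlonglongrightarrow> 0)) \<and>
     integrable (lebesgue_on (time_interval T)) (\<lambda>t. predual_norm \<Omega> \<Gamma>\<^sub>D (f t))}"

definition Linf_wstar ::
  "'a::euclidean_space set \<Rightarrow> 'a set \<Rightarrow> real \<Rightarrow> (real \<Rightarrow> 'a \<Rightarrow> real) set" where
  "Linf_wstar \<Omega> \<Gamma>\<^sub>D T = {v.
     (\<forall>t\<in>time_interval T. v t \<in> W1inf_D \<Omega> \<Gamma>\<^sub>D) \<and>
     (\<forall>w. integrable (lebesgue_on \<Omega>) w \<longrightarrow>
        (\<lambda>t. \<integral>x. grad \<Omega> (v t) x \<bullet> w x \<partial>lebesgue_on \<Omega>)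
          \<in> borel_measurable (lebesgue_on (time_interval T))) \<and>
     (\<lambda>t. V_norm \<Omega> (v t)) \<in> Linf (lebesgue_on (time_interval T))}"

text \<open>The distributional derivative with values in \<open>V\<^sub>*\<close>; the vector-valued identity
  \<open>\<integral>\<phi>' v dt = - \<integral>\<phi> g dt\<close> in \<open>V\<^sub>*\<close> is evaluated on the elements of \<open>V = (V\<^sub>*)\<^sup>*\<close>.\<close>

definition has_time_deriv ::
  "'a::euclidean_space set \<Rightarrow> 'a set \<Rightarrow> real \<Rightarrow> (real \<Rightarrow> 'a \<Rightarrow> real) \<Rightarrow>
     (real \<Rightarrow> ('a \<Rightarrow> real) \<Rightarrow> real) \<Rightarrow> bool" where
  "has_time_deriv \<Omega> \<Gamma>\<^sub>D T v g \<longleftrightarrow> g \<in> L1_predual \<Omega> \<Gamma>\<^sub>D T \<and>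
     (\<forall>\<phi>\<in>test_fun (time_interval T). \<forall>w\<in>W1inf_D \<Omega> \<Gamma>\<^sub>D.
        (\<integral>t. deriv \<phi> t * (\<integral>x. v t x * w x \<partial>lebesgue_on \<Omega>) \<partial>lebesgue_on (time_interval T)) =
        - (\<integral>t. \<phi> t * g t w \<partial>lebesgue_on (time_interval T)))"

definition W_inf ::
  "'a::euclidean_space set \<Rightarrow> 'a set \<Rightarrow> real \<Rightarrow> (real \<Rightarrow> 'a \<Rightarrow> real) set" where
  "W_inf \<Omega> \<Gamma>\<^sub>D T = {v \<in> Linf_wstar \<Omega> \<Gamma>\<^sub>D T. \<exists>g. has_time_deriv \<Omega> \<Gamma>\<^sub>D T v g}"

definition time_deriv ::
  "'a::euclidean_space set \<Rightarrow> 'a set \<Rightarrow> real \<Rightarrow> (real \<Rightarrow> 'a \<Rightarrow> real) \<Rightarrow>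
     real \<Rightarrow> ('a \<Rightarrow> real) \<Rightarrow> real" where
  "time_deriv \<Omega> \<Gamma>\<^sub>D T v = (SOME g. has_time_deriv \<Omega> \<Gamma>\<^sub>D T v g)"

text \<open>Point values in time of \<open>v \<in> \<W>\<^sub>\<infinity>(I)\<close> are those of its representative in
  \<open>C([0,T]; L\<^sup>2(\<Omega>))\<close>, and not those of \<open>v\<close> itself.\<close>

definition continuous_rep ::
  "'a::euclidean_space set \<Rightarrow> real \<Rightarrow> (real \<Rightarrow> 'a \<Rightarrow> real) \<Rightarrow> (real \<Rightarrow> 'a \<Rightarrow> real) \<Rightarrow> bool" where
  "continuous_rep \<Omega> T v w \<longleftrightarrow>
     (\<forall>t\<in>{0..T}. w t \<in> L2 (lebesgue_on \<Omega>)) \<and>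
     (\<forall>t\<in>{0..T}. ((\<lambda>s. L2_norm (lebesgue_on \<Omega>) (\<lambda>x. w s x - w t x)) \<longlongrightarrow> 0) (at t within {0..T})) \<and>
     (AE t in lebesgue_on (time_interval T). AE x in lebesgue_on \<Omega>. w t x = v t x)"

definition at_time ::
  "'a::euclidean_space set \<Rightarrow> real \<Rightarrow> (real \<Rightarrow> 'a \<Rightarrow> real) \<Rightarrow> real \<Rightarrow> 'a \<Rightarrow> real" where
  "at_time \<Omega> T v = (SOME w. continuous_rep \<Omega> T v w)"

abbreviation cylinder :: "real \<Rightarrow> 'a::euclidean_space set \<Rightarrow> (real \<times> 'a) set" where
  "cylinder T \<Omega> \<equiv> time_interval T \<times> \<Omega>"

text \<open>The gradient \<open>L\<^sup>\<infinity>\<^sub>w\<^sub>*(I;V) \<rightarrow> L\<^sup>\<infinity>(Q;\<real>\<^sup>d)\<close>.  The slicewise gradients \<open>grad \<Omega> (v t)\<close> are chosen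
  independently for each \<open>t\<close>, so that a jointly measurable version has to be selected.\<close>

definition grad_Q ::
  "'a::euclidean_space set \<Rightarrow> real \<Rightarrow> (real \<Rightarrow> 'a \<Rightarrow> real) \<Rightarrow> real \<times> 'a \<Rightarrow> 'a" where
  "grad_Q \<Omega> T v = (SOME g. g \<in> Linf (lebesgue_on (cylinder T \<Omega>)) \<and>
     (AE t in lebesgue_on (time_interval T). AE x in lebesgue_on \<Omega>. g (t, x) = grad \<Omega> (v t) x))"

definition L_adj_slice ::
  "'a::euclidean_space set \<Rightarrow> (('a \<Rightarrow> 'a) \<Rightarrow> real) \<Rightarrow> ('a \<Rightarrow> real) \<Rightarrow> real" where
  "L_adj_slice \<Omega> y v = y (grad \<Omega> v)"

definition L_adj ::
  "'a::euclidean_space set \<Rightarrow> real \<Rightarrow> ((real \<times> 'a \<Rightarrow> 'a) \<Rightarrow> real) \<Rightarrow>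
     (real \<Rightarrow> 'a \<Rightarrow> real) \<Rightarrow> real" where
  "L_adj \<Omega> T y v = y (grad_Q \<Omega> T v)"

text \<open>An element of \<open>L\<^sup>1(I;V\<^sub>*)\<close> as a functional on \<open>L\<^sup>\<infinity>\<^sub>w\<^sub>*(I;V)\<close>.\<close>

definition L1_functional ::
  "real \<Rightarrow> (real \<Rightarrow> ('a \<Rightarrow> real) \<Rightarrow> real) \<Rightarrow> (real \<Rightarrow> 'a \<Rightarrow> real) \<Rightarrow> real" where
  "L1_functional T f v = (\<integral>t. f t (v t) \<partial>lebesgue_on (time_interval T))"


section \<open>The elasto-plastic torsion problem\<close>

definition K_set :: "'a::euclidean_space set \<Rightarrow> (real \<Rightarrow> 'a \<Rightarrow> real) \<Rightarrow> real \<Rightarrow> ('a \<Rightarrow> 'a) set" where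
  "K_set \<Omega> \<zeta> t = {y \<in> Linf (lebesgue_on \<Omega>). AE x in lebesgue_on \<Omega>. norm (y x) \<le> \<zeta> t x}"

definition normal_cone ::
  "'a measure \<Rightarrow> ('a \<Rightarrow> 'b::euclidean_space) set \<Rightarrow> ('a \<Rightarrow> 'b) \<Rightarrow> (('a \<Rightarrow> 'b) \<Rightarrow> real) set" where
  "normal_cone M C y = {ystar \<in> Linf_dual M. \<forall>\<phi>\<in>C. ystar (\<lambda>x. \<phi> x - y x) \<le> 0}"

definition admissible_threshold ::
  "'a::euclidean_space set \<Rightarrow> real \<Rightarrow> (real \<Rightarrow> 'a \<Rightarrow> real) \<Rightarrow> bool" where
  "admissible_threshold \<Omega> T \<zeta> \<longleftrightarrow>
     (\<lambda>(t, x). \<zeta> t x) \<in> Linf (lebesgue_on (cylinder T \<Omega>)) \<and>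
     (\<forall>t\<in>{0..T}. \<zeta> t \<in> L2 (lebesgue_on \<Omega>)) \<and>
     (\<forall>h\<in>L2 (lebesgue_on \<Omega>). continuous_on {0..T} (\<lambda>t. \<integral>x. \<zeta> t x * h x \<partial>lebesgue_on \<Omega>)) \<and>
     (\<exists>\<zeta>\<^sub>0>0. AE (t, x) in lebesgue_on (cylinder T \<Omega>). \<zeta>\<^sub>0 \<le> \<zeta> t x)"

definition torsion_solution ::
  "'a::euclidean_space set \<Rightarrow> 'a set \<Rightarrow> real \<Rightarrow> (real \<Rightarrow> 'a \<Rightarrow> real) \<Rightarrow>
     (real \<Rightarrow> ('a \<Rightarrow> real) \<Rightarrow> real) \<Rightarrow> ('a \<Rightarrow> real) \<Rightarrow> (real \<Rightarrow> 'a \<Rightarrow> real) \<Rightarrow> bool" where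
  "torsion_solution \<Omega> \<Gamma>\<^sub>D T \<zeta> f u\<^sub>0 u \<longleftrightarrow>
     u \<in> W_inf \<Omega> \<Gamma>\<^sub>D T \<and>
     (AE t in lebesgue_on (time_interval T).
        \<exists>ystar\<in>normal_cone (lebesgue_on \<Omega>) (K_set \<Omega> \<zeta> t) (grad \<Omega> (u t)). \<forall>w\<in>W1inf_D \<Omega> \<Gamma>\<^sub>D.
          time_deriv \<Omega> \<Gamma>\<^sub>D T u t w + (\<integral>x. grad \<Omega> (u t) x \<bullet> grad \<Omega> w x \<partial>lebesgue_on \<Omega>)
            + L_adj_slice \<Omega> ystar w = f t w) \<and>
     (AE x in lebesgue_on \<Omega>. at_time \<Omega> T u 0 x = u\<^sub>0 x)"

definition phi :: "(real \<Rightarrow> 'a::euclidean_space \<Rightarrow> real) \<Rightarrow> real \<Rightarrow> 'a \<Rightarrow> 'a \<Rightarrow> ennreal" where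
  "phi \<zeta> t x a = (if norm a \<le> \<zeta> t x then ennreal ((norm a)\<^sup>2 / 2) else \<infinity>)"

definition phi_conj :: "(real \<Rightarrow> 'a::euclidean_space \<Rightarrow> real) \<Rightarrow> real \<Rightarrow> 'a \<Rightarrow> 'a \<Rightarrow> real" where
  "phi_conj \<zeta> t x a = (norm a)\<^sup>2 / 2 - (max 0 (norm a - \<zeta> t x))\<^sup>2 / 2"

lemma phi_conj_is_conjugate:
  assumes z: "0 \<le> \<zeta> t x"
  shows "ereal (phi_conj \<zeta> t x b) = (SUP a. ereal (a \<bullet> b) - enn2ereal (phi \<zeta> t x a))"
proof (rule antisym)
  have val: "ereal (a \<bullet> b) - enn2ereal (phi \<zeta> t x a) = ereal (a \<bullet> b - (norm a)\<^sup>2 / 2)"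
    if "norm a \<le> \<zeta> t x" for a
    using that by (simp add: phi_def)
  define a where "a = (if norm b \<le> \<zeta> t x then b else (\<zeta> t x / norm b) *\<^sub>R b)"
  have "norm a \<le> \<zeta> t x" using z by (auto simp: a_def)
  moreover have "a \<bullet> b - (norm a)\<^sup>2 / 2 = phi_conj \<zeta> t x b"
  proof (cases "norm b \<le> \<zeta> t x")
    case False
    then have "norm b \<noteq> 0" using z by linarith
    then have "a \<bullet> b = \<zeta> t x * norm b" "norm a = \<zeta> t x"
      using False z by (auto simp: a_def dot_square_norm power2_eq_square)
    then show ?thesis using False
      by (simp add: phi_conj_def max_def power2_eq_square field_simps)
  qed (simp add: a_def phi_conj_def dot_square_norm)
  ultimately show "ereal (phi_conj \<zeta> t x b) \<le> (SUP a. ereal (a \<bullet> b) - enn2ereal (phi \<zeta> t x a))"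
    by (intro SUP_upper2[of a]) (auto simp: val)
next
  have "ereal (a \<bullet> b) - enn2ereal (phi \<zeta> t x a) \<le> ereal (phi_conj \<zeta> t x b)" for a
  proof (cases "norm a \<le> \<zeta> t x")
    case True
    have "a \<bullet> b - (norm a)\<^sup>2 / 2 \<le> norm a * norm b - (norm a)\<^sup>2 / 2"
      using norm_cauchy_schwarz[of a b] by simp
    also have "\<dots> \<le> phi_conj \<zeta> t x b"
    proof (cases "norm b \<le> \<zeta> t x")
      case True
      then show ?thesis using sum_squares_ge_zero[of "norm a - norm b" 0]
        by (simp add: phi_conj_def power2_eq_square algebra_simps)
    next
      case False
      have "0 \<le> (\<zeta> t x - norm a) * (2 * norm b - \<zeta> t x - norm a)"
        using False True by (intro mult_nonneg_nonneg) auto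
      also have "\<dots> = 2 * (phi_conj \<zeta> t x b - (norm a * norm b - (norm a)\<^sup>2 / 2))"
        using False by (simp add: phi_conj_def max_def power2_eq_square field_simps)
      finally show ?thesis by simp
    qed
    finally show ?thesis using True by (simp add: phi_def)
  qed (simp add: phi_def)
  then show "(SUP a. ereal (a \<bullet> b) - enn2ereal (phi \<zeta> t x a)) \<le> ereal (phi_conj \<zeta> t x b)"
    by (rule SUP_least)
qed

definition I_G ::
  "'a::euclidean_space set \<Rightarrow> real \<Rightarrow> (real \<Rightarrow> 'a \<Rightarrow> real) \<Rightarrow> (real \<times> 'a \<Rightarrow> 'a) \<Rightarrow> ereal" where
  "I_G \<Omega> T \<zeta> q = enn2ereal (\<integral>\<^sup>+(t, x). phi \<zeta> t x (q (t, x)) \<partial>lebesgue_on (cylinder T \<Omega>))"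

definition I_phi_conj ::
  "'a::euclidean_space set \<Rightarrow> real \<Rightarrow> (real \<Rightarrow> 'a \<Rightarrow> real) \<Rightarrow> (real \<times> 'a \<Rightarrow> 'a) \<Rightarrow> real" where
  "I_phi_conj \<Omega> T \<zeta> y = (\<integral>(t, x). phi_conj \<zeta> t x (y (t, x)) \<partial>lebesgue_on (cylinder T \<Omega>))"

definition subdifferential_Linf ::
  "'a measure \<Rightarrow> (('a \<Rightarrow> 'b::euclidean_space) \<Rightarrow> ereal) \<Rightarrow> ('a \<Rightarrow> 'b) \<Rightarrow>
     (('a \<Rightarrow> 'b) \<Rightarrow> real) set" where
  "subdifferential_Linf M F p =
     {y \<in> Linf_dual M. \<forall>q\<in>Linf M. F p + ereal (y (\<lambda>x. q x - p x)) \<le> F q}"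

text \<open>\<open>L\<^sup>* y + \<partial>\<^sub>t v = f\<close> in the dual of \<open>L\<^sup>\<infinity>\<^sub>w\<^sub>*(I;V)\<close>.\<close>

definition balance ::
  "'a::euclidean_space set \<Rightarrow> 'a set \<Rightarrow> real \<Rightarrow> (real \<Rightarrow> ('a \<Rightarrow> real) \<Rightarrow> real) \<Rightarrow>
     ((real \<times> 'a \<Rightarrow> 'a) \<Rightarrow> real) \<Rightarrow> (real \<Rightarrow> 'a \<Rightarrow> real) \<Rightarrow> bool" where
  "balance \<Omega> \<Gamma>\<^sub>D T f y v \<longleftrightarrow>
     (\<forall>w\<in>Linf_wstar \<Omega> \<Gamma>\<^sub>D T.
        L_adj \<Omega> T y w + L1_functional T (time_deriv \<Omega> \<Gamma>\<^sub>D T v) w = L1_functional T f w)"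

definition dual_flux ::
  "'a::euclidean_space set \<Rightarrow> 'a set \<Rightarrow> real \<Rightarrow> (real \<Rightarrow> 'a \<Rightarrow> real) \<Rightarrow>
     (real \<Rightarrow> ('a \<Rightarrow> real) \<Rightarrow> real) \<Rightarrow> (real \<Rightarrow> 'a \<Rightarrow> real) \<Rightarrow>
     ((real \<times> 'a \<Rightarrow> 'a) \<Rightarrow> real) \<Rightarrow> bool" where
  "dual_flux \<Omega> \<Gamma>\<^sub>D T \<zeta> f u z \<longleftrightarrow>
     z \<in> subdifferential_Linf (lebesgue_on (cylinder T \<Omega>)) (I_G \<Omega> T \<zeta>) (grad_Q \<Omega> T u) \<and>
     balance \<Omega> \<Gamma>\<^sub>D T f z u"


section \<open>The averaged generalised Hessian of \<open>\<phi>\<^sup>*\<close>\<close>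

definition outer :: "real^'d \<Rightarrow> real^'d \<Rightarrow> real^'d^'d" where
  "outer a b = (\<chi> i j. a $ i * b $ j)"

definition H_zeta ::
  "(real \<Rightarrow> real^'d \<Rightarrow> real) \<Rightarrow> real \<Rightarrow> real^'d \<Rightarrow> real^'d \<Rightarrow> real^'d^'d" where
  "H_zeta \<zeta> t x q =
     (if norm q < \<zeta> t x then mat 1
      else if norm q = \<zeta> t x then 0
      else (\<zeta> t x / norm q) *\<^sub>R (mat 1 - (1 / (norm q)\<^sup>2) *\<^sub>R outer q q))"

definition HH ::
  "(real \<Rightarrow> real^'d \<Rightarrow> real) \<Rightarrow> (real \<times> (real^'d) \<Rightarrow> real^'d) \<Rightarrow> (real \<times> (real^'d) \<Rightarrow> real^'d) \<Rightarrow>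
     real \<times> (real^'d) \<Rightarrow> real^'d^'d" where
  "HH \<zeta> ya za = (\<lambda>(t, x).
     2 *\<^sub>R (LINT s:{0..1}|lborel. (1 - s) *\<^sub>R H_zeta \<zeta> t x (s *\<^sub>R ya (t, x) + (1 - s) *\<^sub>R za (t, x))))"

definition inner_on ::
  "'a::euclidean_space set \<Rightarrow> ('a \<Rightarrow> 'b::euclidean_space) \<Rightarrow> ('a \<Rightarrow> 'b) \<Rightarrow> real" where
  "inner_on \<omega> a b = (\<integral>p. a p \<bullet> b p \<partial>lebesgue_on \<omega>)"

end

theory Submission
  imports Defs
begin

text \<open>
  Write \<open>p = \<nabla>u\<close> and \<open>l = \<nabla>\<lambda>\<close>.  Optimality of the dual flux gives \<open>p = \<Pi>\<^sub>\<zeta>(z\<^sup>a)\<close> and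
  \<open>|\<zeta> z\<^sup>s|(Q) = \<langle>z\<^sup>s, p\<rangle>\<close>: varying \<open>p\<close> on sets where \<open>z\<^sup>s\<close> is negligible isolates \<open>z\<^sup>a\<close>, and
  varying it on sets of small measure that carry \<open>z\<^sup>s\<close> isolates \<open>z\<^sup>s\<close>.  Since \<open>\<phi>\<^sup>*\<close> is
  \<open>C\<^sup>1\<close> with Lipschitz gradient \<open>\<Pi>\<^sub>\<zeta>\<close>, the Hessian term is the exact Taylor remainder
  \<open>\<phi>\<^sup>*(y\<^sup>a) - \<phi>\<^sup>*(z\<^sup>a) - p \<bullet> (y\<^sup>a - z\<^sup>a)\<close>, while \<open>z\<^sup>a - p\<close> vanishes where \<open>|p| < \<zeta>\<close> and
  equals \<open>(|z\<^sup>a|/\<zeta> - 1) p\<close> where \<open>|p| = \<zeta>\<close>.  Pointwise algebra then reduces the identity to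
  \<open>\<langle>y - z, \<nabla>(\<lambda> - u)\<rangle> + \<parallel>(\<lambda> - u)(T)\<parallel>\<^sup>2/2 - \<parallel>(\<lambda> - u)(0)\<parallel>\<^sup>2/2 = 0\<close>.
  The two balance equations tested with \<open>\<lambda> - u\<close> replace the first term by minus the duality of
  \<open>\<partial>\<^sub>t(\<lambda> - u)\<close> with \<open>\<lambda> - u\<close>, and integration by parts in time concludes.

  The integration by parts avoids smoothing in time: for a.e. pair \<open>s < t\<close> one has
  \<open>v(t) - v(s) = \<integral>\<^sub>s\<^sup>t \<partial>\<^sub>tv\<close> in \<open>V\<^sub>*\<close>, so that \<open>\<parallel>v(t)\<parallel>\<^sup>2 - \<parallel>v(s)\<parallel>\<^sup>2\<close> is the integral of
  \<open>\<langle>\<partial>\<^sub>tv, v(s) + v(t)\<rangle>\<close> over \<open>(s, t)\<close>; summing over finer and finer partitions yields the claim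
  because \<open>t \<mapsto> v(t)\<close> is weak-star continuous in \<open>V\<close> off a null set.
\<close>

section \<open>The dual of \<open>L\<^sup>\<infinity>\<close>\<close>

text \<open>Much of the work comes from choices: \<open>grad\<close>, \<open>grad_Q\<close>,
  \<open>time_deriv\<close> and \<open>at_time\<close> are picked by \<open>SOME\<close>, and the
  slices of \<open>grad\<close> independently for each t. Existence and uniqueness up to null sets
  come before every use, and linearity holds almost everywhere only. For \<open>grad_Q\<close>
  existence is the real obstacle, since \<open>Linf_wstar\<close> gives measurability in time only
  after pairing with a fixed integrable field. Spatial averages of the slices are such pairings and
  are continuous in space, hence jointly measurable, and the gradient is recovered as their limit.
  In time, the derivative acts on \<open>V\<close> only, and the curve has no continuity in the norm
  of \<open>V\<close>. Two facts bridge this. Values in the predual are continuous along sequences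
  that are bounded in \<open>vnorm\<close> and converge in L1. Bounded parts of \<open>V\<close> are
  separable for pointwise convergence, so that one null set serves all test elements. Passing from
  pointwise to L1 convergence takes a bound of v by its gradient, a Poincare inequality in the sup
  norm; there the graph condition on the boundary and a point of \<open>\<Gamma>\<^sub>D\<close>
  enter.\<close>

lemma Linf_iff:
  fixes f :: "'a \<Rightarrow> 'b::euclidean_space"
  shows "f \<in> Linf M \<longleftrightarrow> f \<in> borel_measurable M \<and> (\<exists>C. AE x in M. norm (f x) \<le> C)"
proof (intro iffI conjI)
  assume f: "f \<in> Linf M"
  then show [measurable]: "f \<in> borel_measurable M" by (simp add: Linf_def)
  let ?e = "esssup M (\<lambda>x. ennreal (norm (f x)))"
  have fin: "?e < top" using f by (simp add: Linf_def)
  have "AE x in M. ennreal (norm (f x)) \<le> ?e" by (rule esssup_AE)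
  then have "AE x in M. norm (f x) \<le> enn2real ?e"
  proof eventually_elim
    case (elim x)
    show ?case using enn2real_mono[OF elim fin] by simp
  qed
  then show "\<exists>C. AE x in M. norm (f x) \<le> C" by blast
next
  assume "f \<in> borel_measurable M \<and> (\<exists>C. AE x in M. norm (f x) \<le> C)"
  then obtain C where [measurable]: "f \<in> borel_measurable M" and C: "AE x in M. norm (f x) \<le> C" by blast
  have "esssup M (\<lambda>x. ennreal (norm (f x))) \<le> ennreal C"
    by (rule esssup_I) (use C in \<open>auto simp: ennreal_leI\<close>)
  also have "\<dots> < \<infinity>" by simp
  finally show "f \<in> Linf M" by (simp add: Linf_def)
qed

lemma LinfI: "f \<in> borel_measurable M \<Longrightarrow> AE x in M. norm (f x) \<le> C \<Longrightarrow> f \<in> Linf M"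
  by (rule iffD2[OF Linf_iff], rule conjI, assumption, rule exI)

lemma Linf_measurable: "f \<in> Linf M \<Longrightarrow> f \<in> borel_measurable M"
  by (simp add: Linf_def)

lemma Linf_norm_nonneg: "0 \<le> Linf_norm M f"
  by (simp add: Linf_norm_def)

lemma AE_le_Linf_norm:
  assumes f: "f \<in> Linf M" shows "AE x in M. norm (f x) \<le> Linf_norm M f"
proof -
  let ?e = "esssup M (\<lambda>x. ennreal (norm (f x)))"
  have fin: "?e < top" using f by (simp add: Linf_def)
  have "AE x in M. ennreal (norm (f x)) \<le> ?e" by (rule esssup_AE)
  then show ?thesis
  proof eventually_elim
    case (elim x)
    show ?case using enn2real_mono[OF elim fin] by (simp add: Linf_norm_def)
  qed
qed

lemma Linf_norm_le:
  assumes "f \<in> borel_measurable M" "AE x in M. norm (f x) \<le> C" "0 \<le> C"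
  shows "Linf_norm M f \<le> C"
proof -
  have "esssup M (\<lambda>x. ennreal (norm (f x))) \<le> ennreal C"
    by (rule esssup_I) (use assms in \<open>auto simp: ennreal_leI\<close>)
  then show ?thesis unfolding Linf_norm_def by (rule enn2real_leI[OF assms(3)])
qed

lemma Linf_norm_AE_cong:
  assumes "f \<in> borel_measurable M" "g \<in> borel_measurable M" "AE x in M. f x = g x"
  shows "Linf_norm M f = Linf_norm M g"
proof -
  have "esssup M (\<lambda>x. ennreal (norm (f x))) = esssup M (\<lambda>x. ennreal (norm (g x)))"
    by (rule esssup_AE_cong) (use assms in \<open>auto\<close>)
  then show ?thesis by (simp add: Linf_norm_def)
qed

lemma Linf_add:
  assumes "f \<in> Linf M" "g \<in> Linf M" shows "(\<lambda>x. f x + g x) \<in> Linf M"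
proof (rule LinfI)
  show "(\<lambda>x. f x + g x) \<in> borel_measurable M" using assms[THEN Linf_measurable] by simp
  show "AE x in M. norm (f x + g x) \<le> Linf_norm M f + Linf_norm M g"
    using AE_le_Linf_norm[OF assms(1)] AE_le_Linf_norm[OF assms(2)]
    by eventually_elim (meson add_mono norm_triangle_le)
qed

lemma Linf_scaleR:
  assumes "f \<in> Linf M" shows "(\<lambda>x. c *\<^sub>R f x) \<in> Linf M"
proof (rule LinfI)
  show "(\<lambda>x. c *\<^sub>R f x) \<in> borel_measurable M" using assms[THEN Linf_measurable] by simp
  show "AE x in M. norm (c *\<^sub>R f x) \<le> \<bar>c\<bar> * Linf_norm M f"
    using AE_le_Linf_norm[OF assms(1)] by eventually_elim (simp add: mult_left_mono)
qed

lemma Linf_diff: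
  assumes "f \<in> Linf M" "g \<in> Linf M" shows "(\<lambda>x. f x - g x) \<in> Linf M"
  using Linf_add[OF assms(1) Linf_scaleR[OF assms(2), of "-1"]] by simp

lemma Linf_zero: "(\<lambda>x. 0) \<in> Linf M"
  by (rule LinfI[where C=0]) auto

lemma Linf_indicator:
  assumes "f \<in> Linf M" "A \<in> sets M" shows "(\<lambda>x. indicat_real A x *\<^sub>R f x) \<in> Linf M"
proof (rule LinfI)
  show "(\<lambda>x. indicat_real A x *\<^sub>R f x) \<in> borel_measurable M" using Linf_measurable[OF assms(1)] assms(2) by simp
  show "AE x in M. norm (indicat_real A x *\<^sub>R f x) \<le> Linf_norm M f"
    using AE_le_Linf_norm[OF assms(1)] by eventually_elim (auto simp: indicator_def Linf_norm_nonneg)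
qed

lemma Linf_const: "(\<lambda>x. c) \<in> Linf M"
  by (rule LinfI[where C="norm c"]) auto

lemma integrable_inner_Linf:
  fixes w q :: "'a \<Rightarrow> 'b::euclidean_space"
  assumes "integrable M w" "q \<in> Linf M"
  shows "integrable M (\<lambda>x. w x \<bullet> q x)"
proof (rule Bochner_Integration.integrable_bound[where f="\<lambda>x. Linf_norm M q * norm (w x)"])
  show "integrable M (\<lambda>x. Linf_norm M q * norm (w x))" using assms by simp
  show "(\<lambda>x. w x \<bullet> q x) \<in> borel_measurable M"
    using assms by (auto simp: Linf_def)
  show "AE x in M. norm (w x \<bullet> q x) \<le> norm (Linf_norm M q * norm (w x))"
    using AE_le_Linf_norm[OF assms(2)]
  proof eventually_elim
    case (elim x)
    have "norm (w x \<bullet> q x) \<le> norm (w x) * norm (q x)" using Cauchy_Schwarz_ineq2 by simp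
    also have "\<dots> \<le> norm (w x) * Linf_norm M q" using elim by (simp add: mult_left_mono)
    finally show ?case by (simp add: Linf_norm_nonneg mult.commute)
  qed
qed

lemma integral_inner_Linf_bound:
  fixes w q :: "'a \<Rightarrow> 'b::euclidean_space"
  assumes "integrable M w" "q \<in> Linf M" 
  shows "\<bar>\<integral>x. w x \<bullet> q x \<partial>M\<bar> \<le> (\<integral>x. norm (w x) \<partial>M) * Linf_norm M q"
proof -
  have "\<bar>\<integral>x. w x \<bullet> q x \<partial>M\<bar> \<le> (\<integral>x. norm (w x) * Linf_norm M q \<partial>M)"
  proof (rule order_trans[OF integral_abs_bound integral_mono_AE])
    show "integrable M (\<lambda>x. \<bar>w x \<bullet> q x\<bar>)" using integrable_inner_Linf[OF assms] by simp
    show "integrable M (\<lambda>x. norm (w x) * Linf_norm M q)" using assms by simp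
    show "AE x in M. \<bar>w x \<bullet> q x\<bar> \<le> norm (w x) * Linf_norm M q"
      using AE_le_Linf_norm[OF assms(2)]
      by eventually_elim (meson Cauchy_Schwarz_ineq2 mult_left_mono norm_ge_zero order_trans)
  qed
  then show ?thesis by simp
qed

lemma Linf_integrable:
  assumes "finite_measure M" "f \<in> Linf M" shows "integrable M f"
proof -
  interpret finite_measure M by fact
  show ?thesis
    by (rule integrable_const_bound[OF AE_le_Linf_norm[OF assms(2)] Linf_measurable[OF assms(2)]])
qed

lemma Linf_dualD:
  assumes "y \<in> Linf_dual M"
  shows "\<And>p q. p \<in> Linf M \<Longrightarrow> q \<in> Linf M \<Longrightarrow> y (\<lambda>x. p x + q x) = y p + y q"
    and "\<And>c q. q \<in> Linf M \<Longrightarrow> y (\<lambda>x. c *\<^sub>R q x) = c * y q"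
    and "\<exists>C\<ge>0. \<forall>q\<in>Linf M. \<bar>y q\<bar> \<le> C * Linf_norm M q"
proof -
  show "\<And>p q. p \<in> Linf M \<Longrightarrow> q \<in> Linf M \<Longrightarrow> y (\<lambda>x. p x + q x) = y p + y q"
    and "\<And>c q. q \<in> Linf M \<Longrightarrow> y (\<lambda>x. c *\<^sub>R q x) = c * y q"
    using assms by (auto simp: Linf_dual_def)
  obtain C where "\<forall>q\<in>Linf M. \<bar>y q\<bar> \<le> C * Linf_norm M q" using assms by (auto simp: Linf_dual_def)
  then have "\<forall>q\<in>Linf M. \<bar>y q\<bar> \<le> max 0 C * Linf_norm M q"
    by (meson Linf_norm_nonneg max.cobounded2 mult_right_mono order_trans)
  then show "\<exists>C\<ge>0. \<forall>q\<in>Linf M. \<bar>y q\<bar> \<le> C * Linf_norm M q" by (intro exI[of _ "max 0 C"]) auto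
qed

lemma Linf_dual_diff:
  assumes "y \<in> Linf_dual M" "p \<in> Linf M" "q \<in> Linf M"
  shows "y (\<lambda>x. p x - q x) = y p - y q"
  using Linf_dualD(1)[OF assms(1,2) Linf_scaleR[OF assms(3), of "-1"]] Linf_dualD(2)[OF assms(1,3), of "-1"]
  by simp

text \<open>Boundedness by the essential supremum annihilates differences that vanish almost
  everywhere. This is what allows \<open>y\<close> to be evaluated at any version of a gradient,
  since \<open>grad_Q\<close> is an arbitrary choice.\<close>

lemma Linf_dual_AE_cong:
  assumes "y \<in> Linf_dual M" "p \<in> Linf M" "q \<in> Linf M" "AE x in M. p x = q x"
  shows "y p = y q"
proof -
  obtain C where C: "C \<ge> 0" "\<forall>q\<in>Linf M. \<bar>y q\<bar> \<le> C * Linf_norm M q" using Linf_dualD(3)[OF assms(1)] by blast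
  have "Linf_norm M (\<lambda>x. p x - q x) \<le> 0"
  proof (rule Linf_norm_le)
    show "AE x in M. norm (p x - q x) \<le> 0" using assms(4) by eventually_elim simp
  qed (use Linf_measurable[OF Linf_diff[OF assms(2,3)]] in auto)
  then have "Linf_norm M (\<lambda>x. p x - q x) = 0" using Linf_norm_nonneg by (rule antisym)
  then have "\<bar>y (\<lambda>x. p x - q x)\<bar> \<le> 0" using C(2)[rule_format, OF Linf_diff[OF assms(2,3)]] by simp
  then show ?thesis using Linf_dual_diff[OF assms(1-3)] by simp
qed

lemma Linf_dual_sum:
  assumes "y \<in> Linf_dual M" "finite I" "\<And>i. i \<in> I \<Longrightarrow> p i \<in> Linf M"
  shows "(\<lambda>x. \<Sum>i\<in>I. p i x) \<in> Linf M \<and> y (\<lambda>x. \<Sum>i\<in>I. p i x) = (\<Sum>i\<in>I. y (p i))"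
  using assms(2,3)
proof (induction I rule: finite_induct)
  case empty
  have "y (\<lambda>x. 0 *\<^sub>R 0) = 0 * y (\<lambda>x. 0)" by (rule Linf_dualD(2)[OF assms(1) Linf_zero])
  then show ?case by (simp add: Linf_zero)
next
  case (insert i I)
  have p: "p i \<in> Linf M" and IH: "(\<lambda>x. \<Sum>i\<in>I. p i x) \<in> Linf M"
    "y (\<lambda>x. \<Sum>i\<in>I. p i x) = (\<Sum>i\<in>I. y (p i))" using insert by auto
  have eq: "(\<lambda>x. \<Sum>i\<in>insert i I. p i x) = (\<lambda>x. p i x + (\<Sum>i\<in>I. p i x))"
    using insert(1,2) by simp
  show ?case unfolding eq
    using Linf_dualD(1)[OF assms(1) p IH(1)] Linf_add[OF p IH(1)] IH(2) insert(1,2) by simp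
qed

section \<open>Purely finitely additive functionals\<close>

text \<open>The infimum of \<open>measure M B + m (E - B)\<close> over \<open>B \<subseteq> E\<close> is the lattice meet of \<open>M\<close> and \<open>m\<close>.
  It is countably additive because it lies below \<open>M\<close>, hence it vanishes.\<close>

lemma purely_fa_nonneg_concentrates:
  assumes fin: "finite_measure M"
    and nonneg: "\<And>A. A \<in> sets M \<Longrightarrow> 0 \<le> m A"
    and add: "\<And>A B. A \<in> sets M \<Longrightarrow> B \<in> sets M \<Longrightarrow> A \<inter> B = {} \<Longrightarrow> m (A \<union> B) = m A + m B"
    and pf: "purely_fa_nonneg M m" and e: "0 < (e::real)"
  obtains A where "A \<in> sets M" "measure M A < e" "m (space M - A) < e"
proof -
  interpret finite_measure M by fact
  define V where "V E = {measure M B + m (E - B) | B. B \<in> sets M \<and> B \<subseteq> E}" for E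
  define n where "n E = Inf (V E)" for E
  have Vne: "V E \<noteq> {}" for E
  proof -
    have "measure M {} + m (E - {}) \<in> V E" unfolding V_def by blast
    then show ?thesis by blast
  qed
  have Vge: "0 \<le> x" if "x \<in> V E" "E \<in> sets M" for x E
    using that nonneg by (auto simp: V_def sets.Diff intro!: add_nonneg_nonneg)
  have bdd: "bdd_below (V E)" if "E \<in> sets M" for E using Vge that by (auto intro: bdd_belowI[of _ 0])
  have n0: "0 \<le> n E" if "E \<in> sets M" for E unfolding n_def by (rule cInf_greatest[OF Vne]) (rule Vge[OF _ that])
  have nle: "n E \<le> measure M B + m (E - B)" if "E \<in> sets M" "B \<in> sets M" "B \<subseteq> E" for E B
    unfolding n_def by (rule cInf_lower[OF _ bdd]) (use that in \<open>auto simp: V_def\<close>)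
  have m0: "m {} = 0" using add[of "{}" "{}"] by simp
  have nM: "n E \<le> measure M E" if "E \<in> sets M" for E using nle[OF that that] m0 by simp
  have nm: "n E \<le> m E" if "E \<in> sets M" for E using nle[OF that, of "{}"] by simp
  have nadd: "n (E \<union> F) = n E + n F" if E: "E \<in> sets M" and F: "F \<in> sets M" and d: "E \<inter> F = {}" for E F
  proof (rule antisym)
    show "n (E \<union> F) \<le> n E + n F"
    proof (rule field_le_epsilon)
      fix k :: real assume k: "0 < k"
      obtain x where x: "x \<in> V E" "x < n E + k/2"
        using cInf_lessD[OF Vne, of E "n E + k/2"] k by (auto simp: n_def)
      obtain y where y: "y \<in> V F" "y < n F + k/2"
        using cInf_lessD[OF Vne, of F "n F + k/2"] k by (auto simp: n_def)
      obtain B where B: "B \<in> sets M" "B \<subseteq> E" "x = measure M B + m (E - B)" using x by (auto simp: V_def)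
      obtain C where C: "C \<in> sets M" "C \<subseteq> F" "y = measure M C + m (F - C)" using y by (auto simp: V_def)
      have "n (E \<union> F) \<le> measure M (B \<union> C) + m ((E \<union> F) - (B \<union> C))"
        by (rule nle) (use B C E F in auto)
      also have "(E \<union> F) - (B \<union> C) = (E - B) \<union> (F - C)" using B C d by auto
      also have "m \<dots> = m (E - B) + m (F - C)" by (rule add) (use B C d E F in auto)
      also have "measure M (B \<union> C) = measure M B + measure M C"
        by (rule finite_measure_Union) (use B C d in auto)
      finally show "n (E \<union> F) \<le> n E + n F + k" using x y B C by simp
    qed
    show "n E + n F \<le> n (E \<union> F)"
      unfolding n_def[of "E \<union> F"]
    proof (rule cInf_greatest[OF Vne])
      fix x assume "x \<in> V (E \<union> F)"
      then obtain B where B: "B \<in> sets M" "B \<subseteq> E \<union> F" "x = measure M B + m ((E \<union> F) - B)" by (auto simp: V_def)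
      have 1: "n E \<le> measure M (B \<inter> E) + m (E - (B \<inter> E))" by (rule nle) (use B E in auto)
      have 2: "n F \<le> measure M (B \<inter> F) + m (F - (B \<inter> F))" by (rule nle) (use B F in auto)
      have "measure M ((B \<inter> E) \<union> (B \<inter> F)) = measure M (B \<inter> E) + measure M (B \<inter> F)"
        by (rule finite_measure_Union) (use B E F d in auto)
      moreover have "(B \<inter> E) \<union> (B \<inter> F) = B" using B by auto
      ultimately have 3: "measure M B = measure M (B \<inter> E) + measure M (B \<inter> F)" by simp
      have "m ((E - (B \<inter> E)) \<union> (F - (B \<inter> F))) = m (E - (B \<inter> E)) + m (F - (B \<inter> F))"
        by (rule add) (use B E F d in auto)
      moreover have "(E - (B \<inter> E)) \<union> (F - (B \<inter> F)) = (E \<union> F) - B" by auto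
      ultimately have "m ((E \<union> F) - B) = m (E - (B \<inter> E)) + m (F - (B \<inter> F))" by simp
      then show "n E + n F \<le> x" using 1 2 3 B by simp
    qed
  qed
  define N where "N = measure_of (space M) (sets M) (\<lambda>A. ennreal (n A))"
  have nempty: "n {} = 0" using nm[of "{}"] n0[of "{}"] m0 by simp
  \<comment> \<open>For a finite additive set function, continuity at the empty set is enough; there
    \<open>n\<close> is squeezed between 0 and \<open>measure M\<close>.\<close>
  have ca: "countably_additive (sets M) (\<lambda>A. ennreal (n A))"
  proof (rule sets.empty_continuous_imp_countably_additive)
    show "positive (sets M) (\<lambda>A. ennreal (n A))" by (simp add: positive_def nempty)
    show "additive (sets M) (\<lambda>A. ennreal (n A))"
      by (auto simp: additive_def nadd n0 ennreal_plus)
    show "\<forall>A\<in>sets M. ennreal (n A) \<noteq> \<infinity>" by simp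
    fix A :: "nat \<Rightarrow> _" assume A: "range A \<subseteq> sets M" "decseq A" "(\<Inter>i. A i) = {}"
    have lim: "(\<lambda>i. measure M (A i)) \<longlonglongrightarrow> 0"
      using finite_Lim_measure_decseq[OF A(1,2)] A(3) by simp
    have "(\<lambda>i. n (A i)) \<longlonglongrightarrow> 0"
      by (rule tendsto_sandwich[OF _ _ tendsto_const lim]) (use A n0 nM in \<open>auto simp: image_subset_iff\<close>)
    then show "(\<lambda>i. ennreal (n (A i))) \<longlonglongrightarrow> 0"
      using tendsto_ennrealI[of _ 0] by simp
  qed
  have eN: "emeasure N A = ennreal (n A)" if "A \<in> sets M" for A
    unfolding N_def
    by (rule emeasure_measure_of_sigma) (use that ca in \<open>auto simp: sets.sigma_algebra_axioms positive_def nempty\<close>)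
  have sN: "sets N = sets M" unfolding N_def by simp
  have "emeasure N (space M) = 0"
  proof -
    have "\<forall>A\<in>sets M. emeasure N A \<le> ennreal (m A)" using eN nm by (simp add: ennreal_leI)
    then show ?thesis using pf sN unfolding purely_fa_nonneg_def by blast
  qed
  then have "ennreal (n (space M)) = 0" using eN[OF sets.top] by simp
  then have "n (space M) = 0" using n0[OF sets.top] ennreal_eq_0_iff by fastforce
  \<comment> \<open>An infimum equal to zero supplies one splitting whose two nonnegative terms sum
    to less than \<open>e\<close>; its \<open>B\<close> is the set sought.\<close>
  then have "Inf (V (space M)) < e" using e by (simp add: n_def)
  then obtain x where "x \<in> V (space M)" "x < e" using cInf_lessD[OF Vne] by blast
  then obtain B where B: "B \<in> sets M" "measure M B + m (space M - B) < e" by (auto simp: V_def)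
  moreover have "0 \<le> m (space M - B)" using nonneg B(1) by blast
  ultimately show ?thesis
    using that[OF B(1)] measure_nonneg[of M B] by linarith
qed

text \<open>Supplies for the Jordan positive part the hypotheses of
  \<open>purely_fa_nonneg_concentrates\<close>. Additivity holds because a measurable subset of a
  disjoint union splits into its two traces; the upper bound \<open>K\<close> keeps the suprema
  finite.\<close>

lemma fa_pos_props:
  assumes add: "\<And>A B. A \<in> sets M \<Longrightarrow> B \<in> sets M \<Longrightarrow> A \<inter> B = {} \<Longrightarrow> \<mu> (A \<union> B) = \<mu> A + (\<mu> B :: real)"
    and bd: "\<And>A. A \<in> sets M \<Longrightarrow> \<mu> A \<le> K"
  shows "\<And>A. A \<in> sets M \<Longrightarrow> 0 \<le> fa_pos M \<mu> A"
    and "\<And>A. A \<in> sets M \<Longrightarrow> \<mu> A \<le> fa_pos M \<mu> A"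
    and "\<And>A B. A \<in> sets M \<Longrightarrow> B \<in> sets M \<Longrightarrow> A \<inter> B = {} \<Longrightarrow> fa_pos M \<mu> (A \<union> B) = fa_pos M \<mu> A + fa_pos M \<mu> B"
proof -
  define V where "V A = {\<mu> B | B. B \<in> sets M \<and> B \<subseteq> A}" for A
  have V: "fa_pos M \<mu> A = Sup (V A)" for A by (simp add: fa_pos_def V_def)
  have m0: "\<mu> {} = 0" using add[of "{}" "{}"] by simp
  have Vne: "V A \<noteq> {}" for A
  proof -
    have "\<mu> {} \<in> V A" unfolding V_def by blast
    then show ?thesis by blast
  qed
  have bdd: "bdd_above (V A)" for A by (rule bdd_aboveI[of _ K]) (auto simp: V_def bd)
  have up: "\<mu> B \<le> fa_pos M \<mu> A" if "B \<in> sets M" "B \<subseteq> A" for A B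
    unfolding V by (rule cSup_upper[OF _ bdd]) (use that in \<open>auto simp: V_def\<close>)
  show "\<And>A. A \<in> sets M \<Longrightarrow> 0 \<le> fa_pos M \<mu> A" using up[of "{}"] m0 by simp
  show "\<And>A. A \<in> sets M \<Longrightarrow> \<mu> A \<le> fa_pos M \<mu> A" using up by simp
  fix A B assume AB: "A \<in> sets M" "B \<in> sets M" "A \<inter> B = {}"
  show "fa_pos M \<mu> (A \<union> B) = fa_pos M \<mu> A + fa_pos M \<mu> B"
  proof (rule antisym)
    show "fa_pos M \<mu> (A \<union> B) \<le> fa_pos M \<mu> A + fa_pos M \<mu> B"
      unfolding V[of "A \<union> B"]
    proof (rule cSup_least[OF Vne])
      fix x assume "x \<in> V (A \<union> B)"
      then obtain C where C: "C \<in> sets M" "C \<subseteq> A \<union> B" "x = \<mu> C" by (auto simp: V_def)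
      have "\<mu> ((C \<inter> A) \<union> (C \<inter> B)) = \<mu> (C \<inter> A) + \<mu> (C \<inter> B)"
        by (rule add) (use C AB in auto)
      moreover have "(C \<inter> A) \<union> (C \<inter> B) = C" using C by auto
      ultimately have "\<mu> C = \<mu> (C \<inter> A) + \<mu> (C \<inter> B)" by simp
      then show "x \<le> fa_pos M \<mu> A + fa_pos M \<mu> B"
        using up[of "C \<inter> A" A] up[of "C \<inter> B" B] C AB by (simp add: sets.Int)
    qed
    show "fa_pos M \<mu> A + fa_pos M \<mu> B \<le> fa_pos M \<mu> (A \<union> B)"
    proof (rule field_le_epsilon)
      fix k :: real assume k: "0 < k"
      obtain x where x: "x \<in> V A" "x > fa_pos M \<mu> A - k/2"
        using less_cSupD[OF Vne, of "fa_pos M \<mu> A - k/2" A] k unfolding V[of A] by auto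
      obtain y where y: "y \<in> V B" "y > fa_pos M \<mu> B - k/2"
        using less_cSupD[OF Vne, of "fa_pos M \<mu> B - k/2" B] k unfolding V[of B] by auto
      obtain C where C: "C \<in> sets M" "C \<subseteq> A" "x = \<mu> C" using x by (auto simp: V_def)
      obtain D where D: "D \<in> sets M" "D \<subseteq> B" "y = \<mu> D" using y by (auto simp: V_def)
      have "\<mu> (C \<union> D) = \<mu> C + \<mu> D" by (rule add) (use C D AB in auto)
      moreover have "\<mu> (C \<union> D) \<le> fa_pos M \<mu> (A \<union> B)" by (rule up) (use C D in auto)
      ultimately show "fa_pos M \<mu> A + fa_pos M \<mu> B \<le> fa_pos M \<mu> (A \<union> B) + k" using x y C D by simp
    qed
  qed
qed

lemma fa_sum:
  assumes add: "\<And>A B. A \<in> sets M \<Longrightarrow> B \<in> sets M \<Longrightarrow> A \<inter> B = {} \<Longrightarrow> \<nu> (A \<union> B) = \<nu> A + (\<nu> B :: real)"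
    and "finite I" "\<And>i. i \<in> I \<Longrightarrow> B i \<in> sets M" "\<And>i j. i \<in> I \<Longrightarrow> j \<in> I \<Longrightarrow> i \<noteq> j \<Longrightarrow> B i \<inter> B j = {}"
  shows "\<nu> (\<Union>i\<in>I. B i) = (\<Sum>i\<in>I. \<nu> (B i))"
  using assms(2-)
proof (induction I rule: finite_induct)
  case empty
  show ?case using add[of "{}" "{}"] by simp
next
  case (insert i I)
  have "\<nu> (B i \<union> (\<Union>i\<in>I. B i)) = \<nu> (B i) + \<nu> (\<Union>i\<in>I. B i)"
  proof (rule add)
    show "(\<Union>i\<in>I. B i) \<in> sets M" using insert by (intro sets.finite_UN) auto
    show "B i \<inter> (\<Union>i\<in>I. B i) = {}" using insert(2) insert(5)[of i] by fastforce
  qed (use insert in auto)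
  also have "\<nu> (\<Union>i\<in>I. B i) = (\<Sum>i\<in>I. \<nu> (B i))" using insert(4,5) by (intro insert(3)) auto
  finally show ?case using insert(1,2) by simp
qed

text \<open>Rounding \<open>r\<close> down to multiples of \<open>d\<close> gives a simple function
  whose level sets partition \<open>E\<close>. The values of \<nu> on them add up to at most
  \<open>\<nu> E\<close>, and the rounding error costs \<open>K * d\<close>.\<close>

lemma Linf_functional_le_variation:
  fixes l :: "('a \<Rightarrow> real) \<Rightarrow> real"
  assumes l: "l \<in> Linf_dual M"
    and add: "\<And>A B. A \<in> sets M \<Longrightarrow> B \<in> sets M \<Longrightarrow> A \<inter> B = {} \<Longrightarrow> \<nu> (A \<union> B) = \<nu> A + \<nu> B"
    and nonneg: "\<And>A. A \<in> sets M \<Longrightarrow> 0 \<le> \<nu> A"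
    and le: "\<And>A. A \<in> sets M \<Longrightarrow> \<bar>l (indicat_real A)\<bar> \<le> \<nu> A"
    and E: "E \<in> sets M" and r: "r \<in> Linf M" and C: "AE x in M. \<bar>r x\<bar> \<le> C" "0 \<le> C"
  shows "\<bar>l (\<lambda>x. indicat_real E x * r x)\<bar> \<le> C * \<nu> E"
proof -
  obtain K where K: "K \<ge> 0" "\<And>q. q \<in> Linf M \<Longrightarrow> \<bar>l q\<bar> \<le> K * Linf_norm M q"
    using Linf_dualD(3)[OF l] by blast
  \<comment> \<open>Truncation changes \<open>r\<close> on a null set only and makes the bound by
    \<open>C\<close> hold at every point, so that the rounded function takes finitely many values
    everywhere.\<close>
  define r0 where "r0 x = max (-C) (min C (r x))" for x
  have [measurable]: "r \<in> borel_measurable M" by (rule Linf_measurable[OF r])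
  have [measurable]: "r0 \<in> borel_measurable M" unfolding r0_def by measurable
  have r0C: "\<bar>r0 x\<bar> \<le> C" for x using C(2) by (auto simp: r0_def)
  have step: "\<bar>l (\<lambda>x. indicat_real E x * r x)\<bar> \<le> (C + d) * \<nu> E + K * d" if d: "0 < d" for d
  proof -
    define k where "k x = \<lfloor>r0 x / d\<rfloor>" for x
    define s where "s x = d * of_int (k x)" for x
    define N where "N = \<lceil>C / d\<rceil> + 1"
    define B where "B i = {x \<in> space M. k x = i}" for i
    have [measurable]: "k \<in> measurable M (count_space UNIV)" unfolding k_def by measurable
    have [measurable]: "B i \<in> sets M" for i unfolding B_def by measurable
    have EB[measurable]: "E \<inter> B i \<in> sets M" for i using E by simp
    have [measurable]: "s \<in> borel_measurable M" unfolding s_def by measurable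
    have close: "0 \<le> r0 x - s x \<and> r0 x - s x \<le> d" for x
    proof -
      have "of_int (k x) \<le> r0 x / d" "r0 x / d < of_int (k x) + 1" unfolding k_def by linarith+
      then show ?thesis using d unfolding s_def by (simp add: field_simps)
    qed
    have kN: "k x \<in> {-N..N}" for x
    proof -
      have "r0 x / d \<le> C / d" "- (C / d) \<le> r0 x / d" using r0C[of x] d by (auto simp: field_simps)
      then show ?thesis unfolding k_def N_def by (simp add: floor_le_iff le_floor_iff) linarith
    qed
    have sb: "\<bar>s x\<bar> \<le> C + d" for x using close[of x] r0C[of x] by linarith
    have sumeq: "indicat_real E x * s x = (\<Sum>i\<in>{-N..N}. (d * of_int i) * indicat_real (E \<inter> B i) x)" if x: "x \<in> space M" for x
    proof -
      have "(\<Sum>i\<in>{-N..N}. (d * of_int i) * indicat_real (E \<inter> B i) x) = (\<Sum>i\<in>{-N..N}. if i = k x then indicat_real E x * s x else 0)"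
        by (rule sum.cong) (use x in \<open>auto simp: B_def s_def indicator_def\<close>)
      also have "\<dots> = indicat_real E x * s x" using kN[of x] by simp
      finally show ?thesis by simp
    qed
    have iB: "indicat_real (E \<inter> B i) \<in> Linf M" for i by (rule LinfI[where C=1]) (auto simp: indicator_def)
    have p: "(\<lambda>x. (d * of_int i) * indicat_real (E \<inter> B i) x) \<in> Linf M" for i
      using Linf_scaleR[OF iB] by simp
    have Lr0: "(\<lambda>x. indicat_real E x * r0 x) \<in> Linf M"
      by (rule LinfI[where C=C]) (use E C(2) r0C in \<open>auto simp: indicator_def\<close>)
    have Ls: "(\<lambda>x. indicat_real E x * s x) \<in> Linf M"
      by (rule LinfI[where C="C+d"]) (use E C(2) sb d in \<open>auto simp: indicator_def\<close>)
    have Lr: "(\<lambda>x. indicat_real E x * r x) \<in> Linf M"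
      using Linf_indicator[OF r E] by simp
    have 1: "l (\<lambda>x. indicat_real E x * r x) = l (\<lambda>x. indicat_real E x * r0 x)"
      by (rule Linf_dual_AE_cong[OF l Lr Lr0]) (use C in \<open>auto simp: r0_def\<close>)
    have 2: "l (\<lambda>x. indicat_real E x * s x) = l (\<lambda>x. \<Sum>i\<in>{-N..N}. (d * of_int i) * indicat_real (E \<inter> B i) x)"
    proof (rule Linf_dual_AE_cong[OF l Ls])
      show "(\<lambda>x. \<Sum>i\<in>{-N..N}. (d * of_int i) * indicat_real (E \<inter> B i) x) \<in> Linf M"
        using Linf_dual_sum[OF l, of "{-N..N}" "\<lambda>i x. (d * of_int i) * indicat_real (E \<inter> B i) x"] p by blast
      show "AE x in M. indicat_real E x * s x = (\<Sum>i\<in>{-N..N}. (d * of_int i) * indicat_real (E \<inter> B i) x)"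
        by (rule AE_I2[OF sumeq])
    qed
    have 3: "\<dots> = (\<Sum>i\<in>{-N..N}. (d * of_int i) * l (indicat_real (E \<inter> B i)))"
      using Linf_dual_sum[OF l, of "{-N..N}" "\<lambda>i x. (d * of_int i) * indicat_real (E \<inter> B i) x"] p
        Linf_dualD(2)[OF l iB, where c="d * of_int i" for i] by (simp del: sum.cong)
    have "\<bar>l (\<lambda>x. indicat_real E x * s x)\<bar> \<le> (\<Sum>i\<in>{-N..N}. \<bar>(d * of_int i) * l (indicat_real (E \<inter> B i))\<bar>)"
      unfolding 2 3 by (rule sum_abs)
    also have "\<dots> \<le> (\<Sum>i\<in>{-N..N}. (C + d) * \<nu> (E \<inter> B i))"
    proof (rule sum_mono)
      fix i
      show "\<bar>(d * of_int i) * l (indicat_real (E \<inter> B i))\<bar> \<le> (C + d) * \<nu> (E \<inter> B i)"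
      proof (cases "B i = {}")
        \<comment> \<open>The bound \<open>C + d\<close> on the level comes from a point where the
          level is attained. On an empty level set the functional vanishes instead.\<close>
        case True
        have "l (indicat_real {}) = 0" using Linf_dualD(2)[OF l Linf_zero, of 0] by (simp add: indicator_def[abs_def])
        then show ?thesis using True nonneg[of "{}"] C(2) d by simp
      next
        case False
        then obtain x where "k x = i" by (auto simp: B_def)
        then have "\<bar>d * of_int i\<bar> \<le> C + d" using sb[of x] by (simp add: s_def)
        then show ?thesis unfolding abs_mult[of "d * of_int i"]
          by (intro mult_mono le[OF EB]) auto
      qed
    qed
    also have "\<dots> = (C + d) * \<nu> (\<Union>i\<in>{-N..N}. E \<inter> B i)"
    proof -
      have "\<nu> (\<Union>i\<in>{-N..N}. E \<inter> B i) = (\<Sum>i\<in>{-N..N}. \<nu> (E \<inter> B i))"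
      proof (rule fa_sum[of M])
        show "E \<inter> B i \<in> sets M" for i by (rule EB)
        show "(E \<inter> B i) \<inter> (E \<inter> B j) = {}" if "i \<noteq> j" for i j using that by (auto simp: B_def)
      qed (use add in auto)
      then show ?thesis by (simp only: sum_distrib_left)
    qed
    also have "\<dots> \<le> (C + d) * \<nu> E"
    proof (rule mult_left_mono)
      have U: "(\<Union>i\<in>{-N..N}. E \<inter> B i) \<in> sets M" by (rule sets.finite_UN) (use EB in auto)
      have "\<nu> ((\<Union>i\<in>{-N..N}. E \<inter> B i) \<union> (E - (\<Union>i\<in>{-N..N}. E \<inter> B i))) = \<nu> (\<Union>i\<in>{-N..N}. E \<inter> B i) + \<nu> (E - (\<Union>i\<in>{-N..N}. E \<inter> B i))"
        by (rule add) (use U E in auto)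
      moreover have "(\<Union>i\<in>{-N..N}. E \<inter> B i) \<union> (E - (\<Union>i\<in>{-N..N}. E \<inter> B i)) = E" by auto
      moreover have "0 \<le> \<nu> (E - (\<Union>i\<in>{-N..N}. E \<inter> B i))" by (rule nonneg) (use U E in auto)
      ultimately show "\<nu> (\<Union>i\<in>{-N..N}. E \<inter> B i) \<le> \<nu> E" by simp
    qed (use C(2) d in simp)
    finally have 4: "\<bar>l (\<lambda>x. indicat_real E x * s x)\<bar> \<le> (C + d) * \<nu> E" .
    have "Linf_norm M (\<lambda>x. indicat_real E x * r0 x - indicat_real E x * s x) \<le> d"
    proof (rule Linf_norm_le)
      show "AE x in M. norm (indicat_real E x * r0 x - indicat_real E x * s x) \<le> d"
        using close d by (intro AE_I2) (auto simp: indicator_def)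
    qed (use E d in auto)
    then have "\<bar>l (\<lambda>x. indicat_real E x * r0 x - indicat_real E x * s x)\<bar> \<le> K * d"
      using K(2)[OF Linf_diff[OF Lr0 Ls]] K(1) by (meson mult_left_mono order_trans)
    then show ?thesis using 4 Linf_dual_diff[OF l Lr0 Ls] unfolding 1 by linarith
  qed
  show ?thesis
  proof (rule field_le_epsilon)
    fix e :: real assume e: "0 < e"
    \<comment> \<open>Chosen so that the total error \<open>d * \<nu> E + K * d\<close> is at most
      \<open>e\<close>; the summand 1 keeps the denominator positive.\<close>
    define d where "d = e / (\<nu> E + K + 1)"
    have pos: "0 < \<nu> E + K + 1" using nonneg[OF E] K(1) by linarith
    then have d: "0 < d" using e by (simp add: d_def)
    have "d * (\<nu> E + K + 1) = e" using pos by (simp add: d_def)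
    then have d2: "d * \<nu> E + K * d \<le> e" using d by (simp add: algebra_simps)
    show "\<bar>l (\<lambda>x. indicat_real E x * r x)\<bar> \<le> C * \<nu> E + e"
      using step[OF d] d2 by (simp add: algebra_simps)
  qed
qed

lemma Linf_dual_component:
  fixes y :: "('a \<Rightarrow> 'b::euclidean_space) \<Rightarrow> real"
  assumes y: "y \<in> Linf_dual M"
  shows "(\<lambda>r. y (\<lambda>x. r x *\<^sub>R b)) \<in> Linf_dual M"
proof -
  obtain K where K: "K \<ge> 0" "\<And>q. q \<in> Linf M \<Longrightarrow> \<bar>y q\<bar> \<le> K * Linf_norm M q"
    using Linf_dualD(3)[OF y] by blast
  have mem: "(\<lambda>x. r x *\<^sub>R b) \<in> Linf M \<and> Linf_norm M (\<lambda>x. r x *\<^sub>R b) \<le> norm b * Linf_norm M r"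
    if r: "r \<in> Linf M" for r
  proof
    have m: "(\<lambda>x. r x *\<^sub>R b) \<in> borel_measurable M" using Linf_measurable[OF r] by simp
    have b: "AE x in M. norm (r x *\<^sub>R b) \<le> norm b * Linf_norm M r"
      using AE_le_Linf_norm[OF r] by eventually_elim (simp add: mult.commute[of _ "norm b"] mult_left_mono)
    show "(\<lambda>x. r x *\<^sub>R b) \<in> Linf M" by (rule LinfI[OF m b])
    show "Linf_norm M (\<lambda>x. r x *\<^sub>R b) \<le> norm b * Linf_norm M r"
      by (rule Linf_norm_le[OF m b]) (simp add: Linf_norm_nonneg)
  qed
  have "\<bar>y (\<lambda>x. r x *\<^sub>R b)\<bar> \<le> (K * norm b) * Linf_norm M r" if "r \<in> Linf M" for r
    using K(2)[OF conjunct1[OF mem[OF that]]] mult_left_mono[OF conjunct2[OF mem[OF that]] K(1)] by simp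
  moreover have "y (\<lambda>x. (p x + q x) *\<^sub>R b) = y (\<lambda>x. p x *\<^sub>R b) + y (\<lambda>x. q x *\<^sub>R b)"
    if "p \<in> Linf M" "q \<in> Linf M" for p q
    using Linf_dualD(1)[OF y conjunct1[OF mem[OF that(1)]] conjunct1[OF mem[OF that(2)]]] by (simp add: scaleR_add_left)
  moreover have "y (\<lambda>x. (c *\<^sub>R q x) *\<^sub>R b) = c * y (\<lambda>x. q x *\<^sub>R b)" if "q \<in> Linf M" for c q
    using Linf_dualD(2)[OF y conjunct1[OF mem[OF that]], of c] by simp
  ultimately show ?thesis unfolding Linf_dual_def by blast
qed

text \<open>Each component has two Jordan parts, and each part is carried, up to a small remainder,
  by a set of small measure. The union \<open>A\<close> of these sets still has small measure, and
  outside it the total variation of every component is small.\<close>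

lemma purely_fa_functional_concentrates:
  fixes y :: "('a \<Rightarrow> 'b::euclidean_space) \<Rightarrow> real"
  assumes fin: "finite_measure M" and y: "y \<in> Linf_dual M"
    and pf: "\<And>b. b \<in> Basis \<Longrightarrow> purely_fa M (\<lambda>A. y (\<lambda>x. indicat_real A x *\<^sub>R b))"
    and e: "0 < (e::real)"
  obtains A where "A \<in> sets M" "measure M A < e"
    "\<And>q C. q \<in> Linf M \<Longrightarrow> AE x in M. norm (q x) \<le> C \<Longrightarrow> 0 \<le> C \<Longrightarrow>
       \<bar>y (\<lambda>x. indicat_real (space M - A) x *\<^sub>R q x)\<bar> \<le> e * C"
proof -
  interpret finite_measure M by fact
  define l where "l b r = y (\<lambda>x. r x *\<^sub>R b)" for b and r :: "'a \<Rightarrow> real"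
  define m where "m b A = l b (indicat_real A)" for b A
  define D where "D = real (DIM('b))"
  have D: "0 < D" by (simp add: D_def)
  have l: "l b \<in> Linf_dual M" for b unfolding l_def[abs_def] by (rule Linf_dual_component[OF y])
  have ind: "indicat_real A \<in> Linf M" if "A \<in> sets M" for A
    by (rule LinfI[where C=1]) (use that in \<open>auto simp: indicator_def\<close>)
  have madd: "m b (A \<union> B) = m b A + m b B" if "A \<in> sets M" "B \<in> sets M" "A \<inter> B = {}" for b A B
  proof -
    have "indicat_real (A \<union> B) = (\<lambda>x. indicat_real A x + indicat_real B x)"
      using that(3) by (auto simp: indicator_def fun_eq_iff)
    then show ?thesis unfolding m_def using Linf_dualD(1)[OF l ind[OF that(1)] ind[OF that(2)]] by simp
  qed
  have "\<exists>K. \<forall>A\<in>sets M. \<bar>m b A\<bar> \<le> K" for b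
  proof -
    obtain K where K: "K \<ge> 0" "\<And>q. q \<in> Linf M \<Longrightarrow> \<bar>l b q\<bar> \<le> K * Linf_norm M q"
      using Linf_dualD(3)[OF l] by blast
    have "\<bar>m b A\<bar> \<le> K * 1" if "A \<in> sets M" for A
    proof -
      have "Linf_norm M (indicat_real A) \<le> 1"
        by (rule Linf_norm_le) (use that in \<open>auto simp: indicator_def\<close>)
      then show ?thesis unfolding m_def using K(2)[OF ind[OF that]] K(1) by (meson mult_left_mono order_trans)
    qed
    then show ?thesis by blast
  qed
  then obtain K where K: "\<And>b A. A \<in> sets M \<Longrightarrow> \<bar>m b A\<bar> \<le> K b" by metis
  have mle: "m b A \<le> K b" "- m b A \<le> K b" if "A \<in> sets M" for b A using K[OF that, of b] by linarith+
  have nadd: "- m b (A \<union> B) = - m b A + - m b B" if "A \<in> sets M" "B \<in> sets M" "A \<inter> B = {}" for b A B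
    using madd[OF that, of b] by simp
  have P: "A \<in> sets M \<Longrightarrow> 0 \<le> fa_pos M (m b) A" "A \<in> sets M \<Longrightarrow> (m b) A \<le> fa_pos M (m b) A"
    "A \<in> sets M \<Longrightarrow> B \<in> sets M \<Longrightarrow> A \<inter> B = {} \<Longrightarrow>
      fa_pos M (m b) (A \<union> B) = fa_pos M (m b) A + fa_pos M (m b) B" for b A B
    using fa_pos_props[of M "m b" "K b"] madd[of _ _ b] mle(1)[of _ b] by blast+
  have Q: "A \<in> sets M \<Longrightarrow> 0 \<le> fa_pos M (\<lambda>A. - m b A) A" "A \<in> sets M \<Longrightarrow> (\<lambda>A. - m b A) A \<le> fa_pos M (\<lambda>A. - m b A) A"
    "A \<in> sets M \<Longrightarrow> B \<in> sets M \<Longrightarrow> A \<inter> B = {} \<Longrightarrow>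
      fa_pos M (\<lambda>A. - m b A) (A \<union> B) = fa_pos M (\<lambda>A. - m b A) A + fa_pos M (\<lambda>A. - m b A) B" for b A B
    using fa_pos_props[of M "\<lambda>A. - m b A" "K b"] nadd[of _ _ b] mle(2)[of _ b] by blast+
  have pf': "purely_fa_nonneg M (fa_pos M (m b))" "purely_fa_nonneg M (fa_pos M (\<lambda>A. - m b A))" if "b \<in> Basis" for b
    using pf[OF that] unfolding purely_fa_def m_def[abs_def] l_def by auto
  \<comment> \<open>Two exceptional sets per component are united, so each gets the share
    \<open>e / (2 * D)\<close> of the measure and of the mass left outside.\<close>
  have e': "0 < e / (2 * D)" using e D by simp
  have ex: "\<exists>A. A \<in> sets M \<and> measure M A < k \<and> f (space M - A) < k"
    if "k > 0" "\<And>A. A \<in> sets M \<Longrightarrow> 0 \<le> f A"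
      "\<And>A B. A \<in> sets M \<Longrightarrow> B \<in> sets M \<Longrightarrow> A \<inter> B = {} \<Longrightarrow> f (A \<union> B) = f A + f B"
      "purely_fa_nonneg M f" for f :: "'a set \<Rightarrow> real" and k :: real
    by (rule purely_fa_nonneg_concentrates[OF fin that(2,3,4,1)]) blast+
  have "\<forall>b\<in>Basis. \<exists>A. A \<in> sets M \<and> measure M A < e / (2 * D) \<and> fa_pos M (m b) (space M - A) < e / (2 * D)"
    by (rule ballI, rule ex, (rule e' P(1) P(3) pf'(1); assumption)+)
  then obtain A1 where A1: "\<And>b. b \<in> Basis \<Longrightarrow> A1 b \<in> sets M" "\<And>b. b \<in> Basis \<Longrightarrow> measure M (A1 b) < e / (2 * D)"
    "\<And>b. b \<in> Basis \<Longrightarrow> fa_pos M (m b) (space M - A1 b) < e / (2 * D)" by metis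
  have "\<forall>b\<in>Basis. \<exists>A. A \<in> sets M \<and> measure M A < e / (2 * D) \<and> fa_pos M (\<lambda>A. - m b A) (space M - A) < e / (2 * D)"
    by (rule ballI, rule ex, (rule e' Q(1) Q(3) pf'(2); assumption)+)
  then obtain A2 where A2: "\<And>b. b \<in> Basis \<Longrightarrow> A2 b \<in> sets M" "\<And>b. b \<in> Basis \<Longrightarrow> measure M (A2 b) < e / (2 * D)"
    "\<And>b. b \<in> Basis \<Longrightarrow> fa_pos M (\<lambda>A. - m b A) (space M - A2 b) < e / (2 * D)" by metis
  define A where "A = (\<Union>b\<in>Basis. A1 b \<union> A2 b)"
  have A: "A \<in> sets M" unfolding A_def using A1(1) A2(1) by (intro sets.finite_UN) auto
  have "measure M A \<le> (\<Sum>b\<in>(Basis::'b set). measure M (A1 b \<union> A2 b))"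
    unfolding A_def by (rule finite_measure_subadditive_finite) (use A1(1) A2(1) in auto)
  also have "\<dots> < (\<Sum>b\<in>(Basis::'b set). e / D)"
  proof (rule sum_strict_mono)
    fix b :: 'b assume b: "b \<in> Basis"
    have "measure M (A1 b \<union> A2 b) \<le> measure M (A1 b) + measure M (A2 b)"
      by (rule measure_Un_le) (use A1(1)[OF b] A2(1)[OF b] in auto)
    also have "\<dots> < e / D" using A1(2)[OF b] A2(2)[OF b] by (simp add: field_simps)
    finally show "measure M (A1 b \<union> A2 b) < e / D" .
  qed auto
  also have "\<dots> = e" using D by (simp add: D_def)
  finally have mA: "measure M A < e" .
  define E where "E = space M - A"
  have E: "E \<in> sets M" using A by (auto simp: E_def)
  \<comment> \<open>The total variation of the component along \<open>b\<close>, in the form in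
    which \<open>Linf_functional_le_variation\<close> takes it.\<close>
  define nu where "nu b B = fa_pos M (m b) B + fa_pos M (\<lambda>A. - m b A) B" for b B
  have mono: "f E \<le> f B" if B: "B \<in> sets M" "E \<subseteq> B" and f: "\<And>A. A \<in> sets M \<Longrightarrow> 0 \<le> f A"
    "\<And>A B. A \<in> sets M \<Longrightarrow> B \<in> sets M \<Longrightarrow> A \<inter> B = {} \<Longrightarrow> f (A \<union> B) = f A + (f B::real)" for f B
  proof -
    have "f (E \<union> (B - E)) = f E + f (B - E)" by (rule f(2)) (use E B in auto)
    moreover have "E \<union> (B - E) = B" using B by auto
    moreover have "0 \<le> f (B - E)" by (rule f(1)) (use E B in auto)
    ultimately show ?thesis by simp
  qed
  have nuE: "nu b E \<le> e / D" if b: "b \<in> Basis" for b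
  proof -
    have "fa_pos M (m b) E \<le> fa_pos M (m b) (space M - A1 b)"
      by (rule mono[OF _ _ P(1) P(3)]) (use A1(1)[OF b] b in \<open>auto simp: E_def A_def\<close>)
    moreover have "fa_pos M (\<lambda>A. - m b A) E \<le> fa_pos M (\<lambda>A. - m b A) (space M - A2 b)"
      by (rule mono[OF _ _ Q(1) Q(3)]) (use A2(1)[OF b] b in \<open>auto simp: E_def A_def\<close>)
    ultimately show ?thesis using A1(3)[OF b] A2(3)[OF b] unfolding nu_def by (simp add: field_simps)
  qed
  have main: "\<bar>y (\<lambda>x. indicat_real E x *\<^sub>R q x)\<bar> \<le> e * C"
    if q: "q \<in> Linf M" and qC: "AE x in M. norm (q x) \<le> C" and C: "0 \<le> C" for q C
  proof -
    have qb: "(\<lambda>x. q x \<bullet> b) \<in> Linf M" "AE x in M. \<bar>q x \<bullet> b\<bar> \<le> C" if b: "b \<in> Basis" for b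
    proof -
      show "AE x in M. \<bar>q x \<bullet> b\<bar> \<le> C"
        using qC by eventually_elim (use Basis_le_norm[OF b] order_trans in blast)
      then show "(\<lambda>x. q x \<bullet> b) \<in> Linf M" using Linf_measurable[OF q] by (intro LinfI[where C=C]) auto
    qed
    have bound: "\<bar>l b (\<lambda>x. indicat_real E x * (q x \<bullet> b))\<bar> \<le> C * (e / D)" if b: "b \<in> Basis" for b
    proof -
      have "\<bar>l b (\<lambda>x. indicat_real E x * (q x \<bullet> b))\<bar> \<le> C * nu b E"
      proof (rule Linf_functional_le_variation[OF l _ _ _ E qb[OF b] C])
        fix A B assume AB: "A \<in> sets M" "B \<in> sets M" "A \<inter> B = {}"
        show "nu b (A \<union> B) = nu b A + nu b B" unfolding nu_def using P(3)[OF AB] Q(3)[OF AB] by simp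
      next
        fix A assume A: "A \<in> sets M"
        show "0 \<le> nu b A" unfolding nu_def using P(1)[OF A] Q(1)[OF A] by simp
        show "\<bar>l b (indicat_real A)\<bar> \<le> nu b A" unfolding nu_def m_def[symmetric]
          using P(1)[OF A, of b] Q(1)[OF A, of b] P(2)[OF A, of b] Q(2)[OF A, of b] by linarith
      qed
      also have "\<dots> \<le> C * (e / D)" using nuE[OF b] C by (rule mult_left_mono)
      finally show ?thesis .
    qed
    have eq: "(\<lambda>x. indicat_real E x *\<^sub>R q x) = (\<lambda>x. \<Sum>b\<in>Basis. (indicat_real E x * (q x \<bullet> b)) *\<^sub>R b)"
    proof
      fix x
      have "indicat_real E x *\<^sub>R q x = indicat_real E x *\<^sub>R (\<Sum>b\<in>Basis. (q x \<bullet> b) *\<^sub>R b)"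
        by (simp only: euclidean_representation)
      then show "indicat_real E x *\<^sub>R q x = (\<Sum>b\<in>Basis. (indicat_real E x * (q x \<bullet> b)) *\<^sub>R b)"
        by (simp only: scaleR_sum_right scaleR_scaleR)
    qed
    have mem: "(\<lambda>x. (indicat_real E x * (q x \<bullet> b)) *\<^sub>R b) \<in> Linf M" if b: "b \<in> Basis" for b
    proof (rule LinfI)
      show "(\<lambda>x. (indicat_real E x * (q x \<bullet> b)) *\<^sub>R b) \<in> borel_measurable M"
        by (intro borel_measurable_scaleR borel_measurable_times borel_measurable_inner
            borel_measurable_indicator E Linf_measurable[OF q] borel_measurable_const)
      show "AE x in M. norm ((indicat_real E x * (q x \<bullet> b)) *\<^sub>R b) \<le> C"
        using qb(2)[OF b] by eventually_elim (use b C in \<open>simp add: indicator_def\<close>)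
    qed
    have "y (\<lambda>x. indicat_real E x *\<^sub>R q x) = (\<Sum>b\<in>Basis. l b (\<lambda>x. indicat_real E x * (q x \<bullet> b)))"
      unfolding eq l_def using Linf_dual_sum[OF y finite_Basis, of "\<lambda>b x. (indicat_real E x * (q x \<bullet> b)) *\<^sub>R b"] mem
      by blast
    then have "\<bar>y (\<lambda>x. indicat_real E x *\<^sub>R q x)\<bar> \<le> (\<Sum>b\<in>(Basis::'b set). C * (e / D))"
      using order_trans[OF sum_abs sum_mono[OF bound]] by simp
    also have "\<dots> = e * C" using D by (simp add: D_def)
    finally show ?thesis .
  qed
  show ?thesis by (rule that[OF A mA]) (use main in \<open>auto simp: E_def\<close>)
qed

section \<open>Optimality of the dual flux\<close>

definition proj_ball :: "real \<Rightarrow> 'b::euclidean_space \<Rightarrow> 'b" where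
  "proj_ball r q = (if norm q \<le> r then q else (r / norm q) *\<^sub>R q)"

lemma norm_proj_ball: "0 \<le> r \<Longrightarrow> norm (proj_ball r q) \<le> r"
  by (auto simp: proj_ball_def)

text \<open>The function |p|^2 / 2 - z . p is strongly convex, and the projection minimises it over
  the ball. The quadratic excess is the point: a comparison of integrals then forces equality with
  the projection almost everywhere, and not merely equal energies.\<close>

lemma proj_ball_strong_min:
  assumes r: "0 \<le> r" and p: "norm p \<le> r"
  shows "(norm (p - proj_ball r z))\<^sup>2 / 2 \<le>
    ((norm p)\<^sup>2 / 2 - z \<bullet> p) - ((norm (proj_ball r z))\<^sup>2 / 2 - z \<bullet> proj_ball r z)"
proof -
  let ?P = "proj_ball r z"
  have key: "0 \<le> (?P - z) \<bullet> (p - ?P)"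
  proof (cases "norm z \<le> r")
    case False
    then have nz: "norm z > 0" "r / norm z \<le> 1" using r by (auto simp: divide_le_eq)
    have P: "?P = (r / norm z) *\<^sub>R z" using False by (simp add: proj_ball_def)
    have "z \<bullet> p \<le> norm z * norm p" by (rule norm_cauchy_schwarz)
    also have "\<dots> \<le> norm z * r" using p by (simp add: mult_left_mono)
    finally have "z \<bullet> p \<le> r * norm z" by (simp add: mult.commute)
    moreover have "z \<bullet> ?P = r * norm z" unfolding P using nz
      by (simp add: dot_square_norm power2_eq_square)
    ultimately have "z \<bullet> (p - ?P) \<le> 0" by (simp add: inner_diff_right)
    moreover have "?P - z = (r / norm z - 1) *\<^sub>R z" unfolding P by (simp add: scaleR_diff_left)
    ultimately show ?thesis using nz by (simp add: mult_nonpos_nonpos)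
  qed (simp add: proj_ball_def)
  \<comment> \<open>Expanding the squares leaves exactly the variational inequality of the
    projection, which is \<open>key\<close>.\<close>
  have "((norm p)\<^sup>2 / 2 - z \<bullet> p) - ((norm ?P)\<^sup>2 / 2 - z \<bullet> ?P) - (norm (p - ?P))\<^sup>2 / 2 = (?P - z) \<bullet> (p - ?P)"
    by (simp add: power2_norm_eq_inner inner_diff_left inner_diff_right inner_commute field_simps)
  then show ?thesis using key by linarith
qed

lemma measurable_proj_ball:
  assumes [measurable]: "w \<in> borel_measurable M" "z \<in> borel_measurable M"
  shows "(\<lambda>x. proj_ball (w x) (z x)) \<in> borel_measurable M"
  unfolding proj_ball_def by measurable

text \<open>Indicators of sets with vanishing measure tend to zero in L1, hence almost everywhere
  along a subsequence, and there dominated convergence applies. A subsequence is enough because the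
  estimates in \<open>flux_optimality\<close> hold for every index.\<close>

lemma integral_small_sets_subseq:
  fixes f :: "'a \<Rightarrow> real"
  assumes fin: "finite_measure M" and f: "integrable M f"
    and A: "\<And>n. A n \<in> sets M" and lim: "(\<lambda>n. measure M (A n)) \<longlonglongrightarrow> 0"
  obtains r where "strict_mono (r :: nat \<Rightarrow> nat)" "(\<lambda>n. \<integral>x. indicat_real (A (r n)) x * f x \<partial>M) \<longlonglongrightarrow> 0"
proof -
  interpret finite_measure M by fact
  have "\<exists>r::nat\<Rightarrow>nat. strict_mono r \<and> (AE x in M. (\<lambda>n. indicat_real (A (r n)) x) \<longlonglongrightarrow> 0)"
  proof (rule tendsto_L1_AE_subseq)
    show "integrable M (indicat_real (A n))" for n
      by (rule integrable_real_indicator[OF A]) (simp add: emeasure_eq_measure)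
    show "(\<lambda>n. \<integral>x. norm (indicat_real (A n) x) \<partial>M) \<longlonglongrightarrow> 0"
      using lim A sets.sets_into_space by (simp add: Int_absorb2)
  qed
  then obtain r :: "nat \<Rightarrow> nat" where r: "strict_mono r" "AE x in M. (\<lambda>n. indicat_real (A (r n)) x) \<longlonglongrightarrow> 0" by blast
  have "(\<lambda>n. \<integral>x. indicat_real (A (r n)) x * f x \<partial>M) \<longlonglongrightarrow> (\<integral>x. 0 \<partial>M)"
  proof (rule integral_dominated_convergence)
    show "integrable M (\<lambda>x. \<bar>f x\<bar>)" using f by simp
    show "(\<lambda>x. indicat_real (A (r i)) x * f x) \<in> borel_measurable M" for i
      using A f by (intro borel_measurable_times borel_measurable_indicator) auto
    show "AE x in M. (\<lambda>n. indicat_real (A (r n)) x * f x) \<longlonglongrightarrow> 0"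
      using r(2) by eventually_elim (auto intro: tendsto_mult_left_zero)
    show "AE x in M. norm (indicat_real (A (r i)) x * f x) \<le> \<bar>f x\<bar>" for i
      by (intro AE_I2) (auto simp: indicator_def)
  qed simp
  then show ?thesis using that r(1) by simp
qed

lemma flux_optimality:
  fixes p za :: "'a \<Rightarrow> 'b::euclidean_space"
  assumes fin: "finite_measure M"
    and w: "w \<in> Linf M" and wpos: "AE x in M. 0 \<le> w x"
    and p: "p \<in> Linf M" and yh: "yosida_hewitt M z za zs"
    and sub: "z \<in> subdifferential_Linf M
      (\<lambda>q. enn2ereal (\<integral>\<^sup>+x. (if norm (q x) \<le> w x then ennreal ((norm (q x))\<^sup>2 / 2) else \<infinity>) \<partial>M)) p"
  shows "AE x in M. norm (p x) \<le> w x"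
    and "AE x in M. p x = proj_ball (w x) (za x)"
    and "weighted_variation M w zs = zs p"
proof -
  interpret finite_measure M by fact
  define G where "G q = (\<integral>\<^sup>+x. (if norm (q x) \<le> w x then ennreal ((norm (q x))\<^sup>2 / 2) else \<infinity>) \<partial>M)" for q :: "'a \<Rightarrow> 'b"
  have [measurable]: "w \<in> borel_measurable M" by (rule Linf_measurable[OF w])
  have [measurable]: "p \<in> borel_measurable M" by (rule Linf_measurable[OF p])
  have za: "integrable M za" and zs: "zs \<in> Linf_dual M"
    and pf: "\<And>b. b \<in> Basis \<Longrightarrow> purely_fa M (\<lambda>A. zs (\<lambda>x. indicat_real A x *\<^sub>R b))"
    and zq: "\<And>q. q \<in> Linf M \<Longrightarrow> z q = (\<integral>x. za x \<bullet> q x \<partial>M) + zs q"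
    using yh by (auto simp: yosida_hewitt_def)
  have [measurable]: "za \<in> borel_measurable M" using za by simp
  have sub': "enn2ereal (G p) + ereal (z (\<lambda>x. q x - p x)) \<le> enn2ereal (G q)" if "q \<in> Linf M" for q
    using sub that by (auto simp: subdifferential_Linf_def G_def)
  have "G (\<lambda>x. 0) = 0"
  proof -
    have "G (\<lambda>x. 0) = (\<integral>\<^sup>+x. 0 \<partial>M)" unfolding G_def
      by (rule nn_integral_cong_AE) (use wpos in \<open>eventually_elim, simp\<close>)
    then show ?thesis by simp
  qed
  \<comment> \<open>The zero field is always admissible and has energy zero. An infinite value at
    \<open>p\<close> would contradict the subgradient inequality there, so \<open>p\<close>
    satisfies the constraint.\<close>
  then have "enn2ereal (G p) + ereal (z (\<lambda>x. 0 - p x)) \<le> 0" using sub'[OF Linf_zero] by (simp add: zero_ennreal.rep_eq)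
  then have Gp: "G p \<noteq> \<infinity>" by (cases "G p") auto
  have "AE x in M. (if norm (p x) \<le> w x then ennreal ((norm (p x))\<^sup>2 / 2) else \<infinity>) \<noteq> \<infinity>"
    by (rule nn_integral_PInf_AE) (use Gp in \<open>auto simp: G_def\<close>)
  then show pw: "AE x in M. norm (p x) \<le> w x" by eventually_elim (auto split: if_splits)
  define K where "K = {q :: 'a \<Rightarrow> 'b. q \<in> Linf M \<and> (AE x in M. norm (q x) \<le> w x)}"
  have pK: "p \<in> K" using p pw by (simp add: K_def)
  have sq: "integrable M (\<lambda>x. (norm (q x))\<^sup>2 / 2)" if "q \<in> Linf M" for q :: "'a \<Rightarrow> 'b"
  proof -
    have "(\<lambda>x. (norm (q x))\<^sup>2 / 2) \<in> Linf M"
    proof (rule LinfI)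
      show "(\<lambda>x. (norm (q x))\<^sup>2 / 2) \<in> borel_measurable M" using Linf_measurable[OF that] by simp
      show "AE x in M. norm ((norm (q x))\<^sup>2 / 2) \<le> (Linf_norm M q)\<^sup>2 / 2"
        using AE_le_Linf_norm[OF that] by eventually_elim (simp add: power_mono)
    qed
    then show ?thesis by (rule Linf_integrable[OF fin])
  qed
  have GK: "enn2ereal (G q) = ereal (\<integral>x. (norm (q x))\<^sup>2 / 2 \<partial>M)" if "q \<in> K" for q :: "'a \<Rightarrow> 'b"
  proof -
    have q: "q \<in> Linf M" "AE x in M. norm (q x) \<le> w x" using that by (auto simp: K_def)
    have "G q = (\<integral>\<^sup>+x. ennreal ((norm (q x))\<^sup>2 / 2) \<partial>M)" unfolding G_def
      by (rule nn_integral_cong_AE) (use q(2) in \<open>eventually_elim, simp\<close>)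
    also have "\<dots> = ennreal (\<integral>x. (norm (q x))\<^sup>2 / 2 \<partial>M)"
      by (rule nn_integral_eq_integral[OF sq[OF q(1)]]) simp
    finally have "G q = ennreal (\<integral>x. (norm (q x))\<^sup>2 / 2 \<partial>M)" .
    moreover have "0 \<le> (\<integral>x. (norm (q x))\<^sup>2 / 2 \<partial>M)" by (rule Bochner_Integration.integral_nonneg) simp
    ultimately show ?thesis by (simp add: enn2ereal_ennreal)
  qed
  define h where "h q x = (norm (q x))\<^sup>2 / 2 - za x \<bullet> q x" for q x
  have hint: "integrable M (h q)" if "q \<in> Linf M" for q
    unfolding h_def[abs_def] using sq[OF that] integrable_inner_Linf[OF za that] by (rule Bochner_Integration.integrable_diff)
  define J where "J q = (\<integral>x. h q x \<partial>M)" for q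
  \<comment> \<open>\<open>J\<close> gathers everything countably additive, so the subgradient
    inequality becomes a comparison between the increments of \<open>zs\<close> and of
    \<open>J\<close>, ready to be decoupled.\<close>
  have basic: "zs q - zs p \<le> J q - J p" if qK: "q \<in> K" for q
  proof -
    have q: "q \<in> Linf M" using qK by (simp add: K_def)
    have "(\<integral>x. (norm (p x))\<^sup>2 / 2 \<partial>M) + z (\<lambda>x. q x - p x) \<le> (\<integral>x. (norm (q x))\<^sup>2 / 2 \<partial>M)"
      using sub'[OF q] unfolding GK[OF qK] GK[OF pK] by simp
    moreover have "z (\<lambda>x. q x - p x) = (\<integral>x. za x \<bullet> q x \<partial>M) - (\<integral>x. za x \<bullet> p x \<partial>M) + (zs q - zs p)"
      unfolding zq[OF Linf_diff[OF q p]] Linf_dual_diff[OF zs q p] inner_diff_right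
      using Bochner_Integration.integral_diff[OF integrable_inner_Linf[OF za q] integrable_inner_Linf[OF za p]] by simp
    moreover have "J q = (\<integral>x. (norm (q x))\<^sup>2 / 2 \<partial>M) - (\<integral>x. za x \<bullet> q x \<partial>M)"
      "J p = (\<integral>x. (norm (p x))\<^sup>2 / 2 \<partial>M) - (\<integral>x. za x \<bullet> p x \<partial>M)"
      unfolding J_def h_def using Bochner_Integration.integral_diff[OF sq integrable_inner_Linf[OF za]] q p by auto
    ultimately show ?thesis by linarith
  qed
  have "\<exists>A. A \<in> sets M \<and> measure M A < 1 / Suc n \<and> (\<forall>q C. q \<in> Linf M \<longrightarrow> (AE x in M. norm (q x) \<le> C) \<longrightarrow> 0 \<le> C \<longrightarrow>
       \<bar>zs (\<lambda>x. indicat_real (space M - A) x *\<^sub>R q x)\<bar> \<le> 1 / Suc n * C)" for n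
    by (rule purely_fa_functional_concentrates[OF fin zs pf, of "1 / Suc n"]) (assumption, simp, blast)
  then obtain A where A: "\<And>n. A n \<in> sets M" "\<And>n. measure M (A n) < 1 / Suc n"
    "\<And>n q C. q \<in> Linf M \<Longrightarrow> AE x in M. norm (q x) \<le> C \<Longrightarrow> 0 \<le> C \<Longrightarrow>
       \<bar>zs (\<lambda>x. indicat_real (space M - A n) x *\<^sub>R q x)\<bar> \<le> 1 / Suc n * C" by metis
  have A0: "(\<lambda>n. measure M (A n)) \<longlonglongrightarrow> 0"
    by (rule tendsto_sandwich[OF _ _ tendsto_const LIMSEQ_inverse_real_of_nat])
      (use A(2) in \<open>auto simp: inverse_eq_divide less_imp_le\<close>)
  have zsA: "(\<lambda>n. zs (\<lambda>x. indicat_real (space M - A n) x *\<^sub>R q x)) \<longlonglongrightarrow> 0" if q: "q \<in> Linf M" for q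
  proof (rule tendsto_rabs_zero_cancel, rule tendsto_sandwich[OF _ _ tendsto_const])
    show "\<forall>\<^sub>F n in sequentially. \<bar>zs (\<lambda>x. indicat_real (space M - A n) x *\<^sub>R q x)\<bar> \<le> 1 / Suc n * Linf_norm M q"
      using A(3)[OF q AE_le_Linf_norm[OF q] Linf_norm_nonneg] by simp
    show "(\<lambda>n. 1 / Suc n * Linf_norm M q) \<longlonglongrightarrow> 0"
      using tendsto_mult_left_zero[OF LIMSEQ_inverse_real_of_nat] by (simp add: inverse_eq_divide)
  qed simp
  \<comment> \<open>The constraint is pointwise, hence \<open>K\<close> is stable under pasting
    along measurable sets. The decoupling rests on this.\<close>
  have mix: "(\<lambda>x. if x \<in> B then q x else r x) \<in> K" if "q \<in> K" "r \<in> K" "B \<in> sets M" for q r B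
  proof -
    have m: "(\<lambda>x. if x \<in> B then q x else r x) \<in> borel_measurable M"
      using that by (intro measurable_If_set) (auto simp: K_def Linf_measurable)
    have b: "AE x in M. norm (if x \<in> B then q x else r x) \<le> w x" using that unfolding K_def by auto
    have "AE x in M. norm (if x \<in> B then q x else r x) \<le> Linf_norm M w"
      using b AE_le_Linf_norm[OF w] by eventually_elim auto
    then show ?thesis using b LinfI[OF m] by (simp add: K_def)
  qed
  have both: "zs q \<le> zs p \<and> J p \<le> J q" if qK: "q \<in> K" for q
  proof -
    have q: "q \<in> Linf M" using qK by (simp add: K_def)
    have hd: "integrable M (\<lambda>x. h q x - h p x)" using hint[OF q] hint[OF p] by simp
    obtain r where r: "strict_mono (r :: nat \<Rightarrow> nat)"
      and l1: "(\<lambda>n. \<integral>x. indicat_real (A (r n)) x * (h q x - h p x) \<partial>M) \<longlonglongrightarrow> 0"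
      using integral_small_sets_subseq[OF fin hd A(1) A0] by blast
    define c where "c n = zs (\<lambda>x. indicat_real (space M - A (r n)) x *\<^sub>R (q x - p x))" for n
    have c: "c \<longlonglongrightarrow> 0" unfolding c_def
      using LIMSEQ_subseq_LIMSEQ[OF zsA[OF Linf_diff[OF q p]] r] by (simp add: o_def)
    define d where "d n = (\<integral>x. indicat_real (A (r n)) x * (h q x - h p x) \<partial>M)" for n
    have d: "d \<longlonglongrightarrow> 0" using l1 by (simp add: d_def[abs_def])
    have compl: "indicat_real (A (r n)) x = 1 - indicat_real (space M - A (r n)) x" if "x \<in> space M" for x n
      using that by (auto simp: indicator_def)
    have di: "integrable M (\<lambda>x. indicat_real B x * (h q x - h p x))" if "B \<in> sets M" for B
      using integrable_mult_indicator[OF that hd] by simp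
    have ic: "space M - A (r n) \<in> sets M" for n using A(1) by auto
    \<comment> \<open>The competitor equals \<open>q\<close> only on the small set
      \<open>A (r n)\<close>: it sees the increment of \<open>zs\<close> up to \<open>c n\<close>,
      but of \<open>J\<close> only the small part \<open>d n\<close>.\<close>
    have 1: "zs q - zs p - c n \<le> d n" for n
    proof -
      let ?q = "\<lambda>x. if x \<in> A (r n) then q x else p x"
      have k: "?q \<in> K" by (rule mix[OF qK pK A(1)])
      have L: "?q \<in> Linf M" using k by (simp add: K_def)
      have Lc: "(\<lambda>x. indicat_real (space M - A (r n)) x *\<^sub>R (q x - p x)) \<in> Linf M"
        by (rule Linf_indicator[OF Linf_diff[OF q p] ic])
      have "zs ?q - zs p = zs (\<lambda>x. ?q x - p x)" by (rule Linf_dual_diff[OF zs L p, symmetric])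
      also have "\<dots> = zs (\<lambda>x. (q x - p x) - indicat_real (space M - A (r n)) x *\<^sub>R (q x - p x))"
        by (rule Linf_dual_AE_cong[OF zs Linf_diff[OF L p] Linf_diff[OF Linf_diff[OF q p] Lc]])
          (auto intro!: AE_I2 simp: indicator_def)
      also have "\<dots> = zs q - zs p - c n"
        unfolding c_def Linf_dual_diff[OF zs Linf_diff[OF q p] Lc] Linf_dual_diff[OF zs q p] ..
      finally have "zs ?q - zs p = zs q - zs p - c n" .
      moreover have "J ?q - J p = d n"
        unfolding J_def d_def Bochner_Integration.integral_diff[OF hint[OF L] hint[OF p], symmetric]
        by (rule Bochner_Integration.integral_cong) (auto simp: h_def)
      ultimately show ?thesis using basic[OF k] by simp
    qed
    \<comment> \<open>The opposite pasting: \<open>q\<close> off the small set, so that nearly the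
      full increment of \<open>J\<close> meets only the error \<open>c n\<close> of
      \<open>zs\<close>.\<close>
    have 2: "c n \<le> J q - J p - d n" for n
    proof -
      let ?q = "\<lambda>x. if x \<in> A (r n) then p x else q x"
      have k: "?q \<in> K" by (rule mix[OF pK qK A(1)])
      have L: "?q \<in> Linf M" using k by (simp add: K_def)
      have Lc: "(\<lambda>x. indicat_real (space M - A (r n)) x *\<^sub>R (q x - p x)) \<in> Linf M"
        by (rule Linf_indicator[OF Linf_diff[OF q p] ic])
      have "zs ?q - zs p = zs (\<lambda>x. ?q x - p x)" by (rule Linf_dual_diff[OF zs L p, symmetric])
      also have "\<dots> = c n" unfolding c_def
        by (rule Linf_dual_AE_cong[OF zs Linf_diff[OF L p] Lc])
          (auto intro!: AE_I2 simp: indicator_def)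
      finally have "zs ?q - zs p = c n" .
      moreover have "J ?q - J p = (J q - J p) - d n"
        unfolding J_def d_def Bochner_Integration.integral_diff[OF hint[OF L] hint[OF p], symmetric]
          Bochner_Integration.integral_diff[OF hint[OF q] hint[OF p], symmetric]
          Bochner_Integration.integral_diff[OF hd di[OF A(1)], symmetric]
        by (rule Bochner_Integration.integral_cong) (auto simp: h_def)
      ultimately show ?thesis using basic[OF k] by simp
    qed
    have "zs q - zs p - 0 \<le> 0"
      by (rule LIMSEQ_le[OF tendsto_diff[OF tendsto_const c] d]) (use 1 in auto)
    moreover have "0 \<le> J q - J p - 0"
      by (rule LIMSEQ_le[OF c tendsto_diff[OF tendsto_const d]]) (use 2 in auto)
    ultimately show ?thesis by simp
  qed
  show "weighted_variation M w zs = zs p"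
    unfolding weighted_variation_def
    by (rule cSup_eq_maximum) (use p pw both in \<open>auto simp: K_def\<close>)
  define P where "P x = proj_ball (w x) (za x)" for x
  have Pm: "P \<in> borel_measurable M" unfolding P_def[abs_def] by (rule measurable_proj_ball) auto
  have Pw: "AE x in M. norm (P x) \<le> w x" using wpos by eventually_elim (simp add: P_def norm_proj_ball)
  have PL: "P \<in> Linf M"
    by (rule LinfI[OF Pm, of "Linf_norm M w"]) (use Pw AE_le_Linf_norm[OF w] in \<open>eventually_elim, auto\<close>)
  have PK: "P \<in> K" using PL Pw by (simp add: K_def)
  have "J p \<le> J P" using both[OF PK] by simp
  have si: "integrable M (\<lambda>x. (norm (p x - P x))\<^sup>2 / 2)" by (rule sq[OF Linf_diff[OF p PL]])
  have "(\<integral>x. (norm (p x - P x))\<^sup>2 / 2 \<partial>M) \<le> (\<integral>x. h p x - h P x \<partial>M)"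
  proof (rule integral_mono_AE[OF si])
    show "integrable M (\<lambda>x. h p x - h P x)" using hint[OF p] hint[OF PL] by simp
    show "AE x in M. (norm (p x - P x))\<^sup>2 / 2 \<le> h p x - h P x"
      using wpos pw unfolding P_def h_def by eventually_elim (rule proj_ball_strong_min)
  qed
  also have "\<dots> = J p - J P" unfolding J_def using hint[OF p] hint[OF PL] by simp
  also have "\<dots> \<le> 0" using \<open>J p \<le> J P\<close> by simp
  finally have "(\<integral>x. (norm (p x - P x))\<^sup>2 / 2 \<partial>M) \<le> 0" .
  moreover have "0 \<le> (\<integral>x. (norm (p x - P x))\<^sup>2 / 2 \<partial>M)" by (rule Bochner_Integration.integral_nonneg) simp
  ultimately have "(\<integral>x. (norm (p x - P x))\<^sup>2 / 2 \<partial>M) = 0" by linarith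
  then have "AE x in M. (norm (p x - P x))\<^sup>2 / 2 = 0"
    using integral_nonneg_eq_0_iff_AE[OF si] by simp
  then show "AE x in M. p x = proj_ball (w x) (za x)" by eventually_elim (simp add: P_def)
qed

section \<open>The Taylor formula for \<open>\<phi>\<^sup>*\<close>\<close>

lemma norm_vec_le_sum: "norm (x :: ('b::real_normed_vector)^'n) \<le> (\<Sum>i\<in>UNIV. norm (x $ i))"
  unfolding norm_vec_def by (rule L2_set_le_sum) simp

text \<open>The constant counts the matrix entries. Its use is that \<open>H_zeta\<close> is bounded
  uniformly in its argument.\<close>

lemma norm_outer_le: "norm (outer q q) \<le> (real CARD('n))\<^sup>2 * (norm (q :: real^'n))\<^sup>2"
proof -
  have "norm (outer q q) \<le> (\<Sum>i\<in>UNIV. \<Sum>j\<in>UNIV. norm ((outer q q) $ i $ j))"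
    by (rule order_trans[OF norm_vec_le_sum sum_mono]) (rule norm_vec_le_sum)
  also have "\<dots> \<le> (\<Sum>i\<in>(UNIV::'n set). \<Sum>j\<in>(UNIV::'n set). norm q * norm q)"
    by (intro sum_mono) (auto simp: outer_def abs_mult intro!: mult_mono component_le_norm_cart)
  also have "\<dots> = (real CARD('n))\<^sup>2 * (norm q)\<^sup>2" by (simp add: power2_eq_square)
  finally show ?thesis .
qed

lemma outer_mult_inner: "(outer q q *v d) \<bullet> d = (q \<bullet> d)\<^sup>2"
proof -
  have "outer q q *v d = (q \<bullet> d) *\<^sub>R q"
    by (simp add: vec_eq_iff outer_def matrix_vector_mult_def inner_vec_def sum_distrib_left sum_distrib_right mult.assoc mult.commute mult.left_commute)
  then show ?thesis by (simp add: power2_eq_square)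
qed

lemma scaleR_matrix_vector: "(c *\<^sub>R (A :: real^'n^'m)) *v d = c *\<^sub>R (A *v d)"
  by (simp add: vec_eq_iff matrix_vector_mult_def sum_distrib_left mult.assoc)

lemma bounded_linear_quadratic_form: "bounded_linear (\<lambda>A :: real^'n^'n. (A *v d) \<bullet> d)"
  unfolding linear_conv_bounded_linear[symmetric]
  by (rule linearI) (simp_all add: matrix_vector_mult_add_rdistrib inner_add_left scaleR_matrix_vector)

lemma isCont_outer: "continuous_on UNIV (\<lambda>q :: real^'n. outer q q)"
  unfolding outer_def by (intro continuous_intros)

text \<open>The supremum that defines the conjugate is attained at the projection of
  \<open>a\<close>: this is the equality case of Fenchel's inequality. In this form the growth in
  \<open>a\<close> is visibly linear.\<close>

lemma phi_conj_alt:
  assumes "0 < \<zeta> t x"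
  shows "phi_conj \<zeta> t x a = proj_ball (\<zeta> t x) a \<bullet> a - (norm (proj_ball (\<zeta> t x) a))\<^sup>2 / 2"
proof (cases "norm a \<le> \<zeta> t x")
  case True
  then show ?thesis by (simp add: phi_conj_def proj_ball_def dot_square_norm)
next
  case False
  then have "norm a > 0" using assms by linarith
  then show ?thesis using False assms
    by (simp add: phi_conj_def proj_ball_def dot_square_norm power2_eq_square field_simps)
qed

text \<open>Taylor's formula with integral remainder along the segment from \<open>za\<close> to
  \<open>ya\<close>, at one point of the cylinder. The gradient of the conjugate is the projection,
  and \<open>H_zeta\<close> is its derivative off the sphere of radius \<zeta>. A nondegenerate
  segment meets the sphere at most twice, so the jump there is invisible to the integral.\<close>

lemma HH_taylor:
  fixes za ya :: "real \<times> (real^'d) \<Rightarrow> real^'d"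
  assumes r: "0 < \<zeta> t x"
  shows "1/2 * ((HH \<zeta> ya za (t, x) *v (ya (t, x) - za (t, x))) \<bullet> (ya (t, x) - za (t, x))) =
    phi_conj \<zeta> t x (ya (t, x)) - phi_conj \<zeta> t x (za (t, x))
      - proj_ball (\<zeta> t x) (za (t, x)) \<bullet> (ya (t, x) - za (t, x))"
proof -
  define r where "r = \<zeta> t x"
  define a where "a = ya (t, x)"
  define b where "b = za (t, x)"
  define d where "d = a - b"
  define q where "q s = b + s *\<^sub>R d" for s :: real
  have r0: "0 < r" using assms by (simp add: r_def)
  have qeq: "s *\<^sub>R ya (t, x) + (1 - s) *\<^sub>R za (t, x) = q s" for s
    by (simp add: q_def d_def a_def b_def algebra_simps)
  define M where "M s = (1 - s) *\<^sub>R H_zeta \<zeta> t x (q s)" for s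
  \<comment> \<open>a continuous antiderivative of \<open>s \<mapsto> M s *v d \<bullet> d\<close> off the finitely many \<open>s\<close> with \<open>norm (q s) = r\<close>\<close>
  define F where "F s = (1 - s) * (proj_ball r (q s) \<bullet> d) + phi_conj \<zeta> t x (q s)" for s
  have qcont: "continuous_on A q" for A unfolding q_def by (intro continuous_intros)
  have qm[measurable]: "q \<in> borel_measurable lborel"
    using borel_measurable_continuous_onI[OF qcont] by simp
  have om[measurable]: "(\<lambda>s. outer (q s) (q s)) \<in> borel_measurable lborel"
    using borel_measurable_continuous_onI[OF continuous_on_compose2[OF isCont_outer qcont]] by simp
  have Mm: "M \<in> borel_measurable lborel"
    unfolding M_def[abs_def] H_zeta_def by measurable
  \<comment> \<open>Integrability rests on boundedness, because \<open>H_zeta\<close> jumps across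
    the sphere.\<close>
  have Hb: "norm (H_zeta \<zeta> t x p) \<le> norm (mat 1 :: real^'d^'d) + (real CARD('d))\<^sup>2" for p
  proof -
    consider "norm p < \<zeta> t x" | "norm p = \<zeta> t x" | "norm p > \<zeta> t x" by linarith
    then show ?thesis
    proof cases
      case 3
      then have np: "norm p > 0" using assms by linarith
      have "norm ((1 / (norm p)\<^sup>2) *\<^sub>R outer p p) \<le> (real CARD('d))\<^sup>2"
        using norm_outer_le[of p] np by (simp add: divide_le_eq)
      then have "norm (mat 1 - (1 / (norm p)\<^sup>2) *\<^sub>R outer p p) \<le> norm (mat 1 :: real^'d^'d) + (real CARD('d))\<^sup>2"
        by (meson add_left_mono norm_triangle_ineq4 order_trans)
      moreover have "\<bar>\<zeta> t x / norm p\<bar> \<le> 1" using 3 assms by (simp add: divide_le_eq)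
      ultimately have "\<bar>\<zeta> t x / norm p\<bar> * norm (mat 1 - (1 / (norm p)\<^sup>2) *\<^sub>R outer p p) \<le> 1 * (norm (mat 1 :: real^'d^'d) + (real CARD('d))\<^sup>2)"
        by (intro mult_mono) auto
      then show ?thesis using 3 by (simp add: H_zeta_def)
    qed (auto simp: H_zeta_def)
  qed
  have Mi: "set_integrable lborel {0..1} M"
    unfolding set_integrable_def
  proof (rule integrableI_bounded_set_indicator)
    show "AE s in lborel. s \<in> {0..1} \<longrightarrow> norm (M s) \<le> norm (mat 1 :: real^'d^'d) + (real CARD('d))\<^sup>2"
    proof (intro AE_I2 impI)
      fix s :: real assume "s \<in> {0..1}"
      then have "\<bar>1 - s\<bar> * norm (H_zeta \<zeta> t x (q s)) \<le> 1 * (norm (mat 1 :: real^'d^'d) + (real CARD('d))\<^sup>2)"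
        by (intro mult_mono Hb) auto
      then show "norm (M s) \<le> norm (mat 1 :: real^'d^'d) + (real CARD('d))\<^sup>2" by (simp add: M_def)
    qed
  qed (use Mm in auto)
  have bl: "bounded_linear (\<lambda>A :: real^'d^'d. (A *v d) \<bullet> d)" by (rule bounded_linear_quadratic_form)
  define m where "m s = (M s *v d) \<bullet> d" for s
  have eqm: "(LINT s:{0..1}|lborel. m s) = ((LINT s:{0..1}|lborel. M s) *v d) \<bullet> d"
    unfolding set_lebesgue_integral_def m_def
    using integral_bounded_linear[OF bl Mi[unfolded set_integrable_def]] by (simp add: scaleR_matrix_vector)
  have mi: "set_integrable lborel {0..1} m"
    using integrable_bounded_linear[OF bl Mi[unfolded set_integrable_def]]
    by (simp add: set_integrable_def m_def scaleR_matrix_vector)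
  have "1/2 * ((HH \<zeta> ya za (t, x) *v (ya (t, x) - za (t, x))) \<bullet> (ya (t, x) - za (t, x))) = (LINT s:{0..1}|lborel. m s)"
    unfolding HH_def case_prod_conv qeq M_def[symmetric] eqm
    by (simp add: scaleR_matrix_vector d_def a_def b_def)
  also have "\<dots> = integral {0..1} m" by (rule set_borel_integral_eq_integral(2)[OF mi])
  also have "\<dots> = F 1 - F 0"
  proof (cases "d = 0")
    \<comment> \<open>The segment is a single point, which may lie on the sphere for all s, and then
      the set \<open>S\<close> of the other case would be infinite. Here the quadratic form and the
      increment of \<open>F\<close> both vanish.\<close>
    case True
    then show ?thesis by (simp add: m_def[abs_def] F_def q_def)
  next
    case False
    define A where "A = d \<bullet> d"
    define B where "B = b \<bullet> d"
    define C where "C = b \<bullet> b"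
    define P where "P s = A * s\<^sup>2 + 2 * B * s + C" for s
    have A0: "A \<noteq> 0" using False by (simp add: A_def)
    have nq2: "(norm (q s))\<^sup>2 = P s" for s
      unfolding power2_norm_eq_inner q_def P_def A_def B_def C_def
      by (simp add: inner_add_left inner_add_right inner_commute power2_eq_square algebra_simps)
    then have nq: "norm (q s) = sqrt (P s)" for s by (metis norm_ge_zero real_sqrt_unique)
    have qd: "q s \<bullet> d = A * s + B" for s
      by (simp add: q_def A_def B_def inner_add_left)
    define S where "S = {s. norm (q s) = r}"
    \<comment> \<open>Hitting the sphere is a quadratic equation in s whose leading coefficient d .
      d is nonzero.\<close>
    have "S \<subseteq> {s. poly [:C - r\<^sup>2, 2 * B, A:] s = 0}"
      unfolding S_def using nq2 by (auto simp: P_def power2_eq_square algebra_simps)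
    moreover have "finite {s. poly [:C - r\<^sup>2, 2 * B, A:] s = 0}" by (rule poly_roots_finite) (use A0 in simp)
    ultimately have Sfin: "finite S" by (rule finite_subset)
    \<comment> \<open>Written with a maximum in place of the case distinction, the projection is
      visibly continuous.\<close>
    have pb: "proj_ball r p = (r / max r (norm p)) *\<^sub>R p" for p :: "real^'d"
      using r0 by (auto simp: proj_ball_def max_def)
    have cont: "continuous_on {0..1} F"
      unfolding F_def pb phi_conj_def
      by (intro continuous_intros qcont) (use r0 in auto)
    have der: "(F has_vector_derivative m s) (at s)" if s: "s \<notin> S" for s
    proof (cases "norm (q s) < r")
      case True
      have op: "open {s. norm (q s) < r}"
        by (intro open_Collect_less continuous_intros qcont)
      have D: "((\<lambda>s. (1 - s) * (A * s + B) + P s / 2) has_real_derivative (1 - s) * A) (at s)"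
        unfolding P_def by (auto intro!: derivative_eq_intros simp: algebra_simps)
      have "(F has_real_derivative (1 - s) * A) (at s)"
        by (rule has_field_derivative_transform_within_open[OF D op])
          (use True in \<open>auto simp: F_def proj_ball_def phi_conj_def qd nq2 r_def[symmetric]\<close>)
      moreover have "m s = (1 - s) * A"
        using True by (simp add: m_def M_def H_zeta_def r_def[symmetric] scaleR_matrix_vector A_def)
      ultimately show ?thesis by (simp add: has_real_derivative_iff_has_vector_derivative)
    next
      case False
      then have gt: "r < norm (q s)" using s by (auto simp: S_def)
      have rs: "r < sqrt (P s)" using gt nq[of s] by simp
      have "0 < sqrt (P s)" using r0 rs by (rule less_trans)
      then have Pp: "0 < P s" "r < sqrt (P s)" using rs by (simp_all only: real_sqrt_gt_0_iff)
      have op: "open {s. r < norm (q s)}"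
        by (intro open_Collect_less continuous_intros qcont)
      define n where "n = sqrt (P s)"
      have n: "n > 0" "n\<^sup>2 = P s" using Pp by (auto simp: n_def)
      have DP: "(P has_real_derivative 2 * (A * s + B)) (at s)"
        unfolding P_def by (auto intro!: derivative_eq_intros simp: algebra_simps)
      have Dn: "((\<lambda>s. sqrt (P s)) has_real_derivative (A * s + B) / n) (at s)"
      proof (rule DERIV_cong[OF DERIV_chain2[OF DERIV_real_sqrt[OF Pp(1)] DP]])
        show "inverse (sqrt (P s)) / 2 * (2 * (A * s + B)) = (A * s + B) / n" using n(1) by (simp add: n_def field_simps)
      qed
      have Di: "((\<lambda>s. r / sqrt (P s)) has_real_derivative - (r * ((A * s + B) / n)) / n\<^sup>2) (at s)"
        by (rule DERIV_cong[OF DERIV_divide[OF DERIV_const Dn]])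
          (use n(1) in \<open>simp_all add: n_def[symmetric] power2_eq_square\<close>)
      have D1: "((\<lambda>s. 1 - s) has_real_derivative -1) (at s)" by (auto intro!: derivative_eq_intros)
      have D2: "((\<lambda>s. A * s + B) has_real_derivative A) (at s)" by (auto intro!: derivative_eq_intros)
      have D3: "((\<lambda>s. r * sqrt (P s) - r\<^sup>2 / 2) has_real_derivative r * ((A * s + B) / n)) (at s)"
        by (rule DERIV_cong[OF DERIV_diff[OF DERIV_cmult[OF Dn] DERIV_const]]) simp
      have D: "((\<lambda>s. (1 - s) * (r / sqrt (P s) * (A * s + B)) + (r * sqrt (P s) - r\<^sup>2 / 2)) has_real_derivative
          (1 - s) * (r / n * (A - (A * s + B)\<^sup>2 / n\<^sup>2))) (at s)"
        by (rule DERIV_cong[OF DERIV_add[OF DERIV_mult[OF D1 DERIV_mult[OF Di D2]] D3]])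
          (use n(1) in \<open>simp add: n_def[symmetric] field_simps power2_eq_square\<close>)
      have "(F has_real_derivative (1 - s) * (r / n * (A - (A * s + B)\<^sup>2 / n\<^sup>2))) (at s)"
      proof (rule has_field_derivative_transform_within_open[OF D op])
        fix s' assume "s' \<in> {s. r < norm (q s)}"
        then have g: "r < norm (q s')" by simp
        then have "(norm (q s'))\<^sup>2 / 2 - (norm (q s') - r)\<^sup>2 / 2 = r * norm (q s') - r\<^sup>2 / 2"
          by (simp add: power2_eq_square field_simps)
        then show "(1 - s') * (r / sqrt (P s') * (A * s' + B)) + (r * sqrt (P s') - r\<^sup>2 / 2) = F s'"
          using g by (simp add: F_def proj_ball_def phi_conj_def qd nq[symmetric] r_def[symmetric])
      qed (use gt in simp)
      moreover have "m s = (1 - s) * (r / n * (A - (A * s + B)\<^sup>2 / n\<^sup>2))"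
        using gt nq[of s] by (simp add: m_def M_def H_zeta_def r_def[symmetric] scaleR_matrix_vector A_def
          matrix_vector_mult_diff_rdistrib inner_diff_left outer_mult_inner qd n_def[symmetric])
      ultimately show ?thesis by (simp add: has_real_derivative_iff_has_vector_derivative)
    qed
    have "(m has_integral F 1 - F 0) {0..1}"
      by (rule fundamental_theorem_of_calculus_interior_strong[OF Sfin _ _ cont]) (use der in auto)
    then show ?thesis by (rule integral_unique)
  qed
  \<comment> \<open>The weight 1 - s kills the boundary term at s = 1 and leaves the first-order
    term at s = 0.\<close>
  also have "\<dots> = phi_conj \<zeta> t x a - phi_conj \<zeta> t x b - proj_ball r b \<bullet> d"
    by (simp add: F_def q_def d_def)
  finally show ?thesis by (simp add: a_def b_def d_def r_def)
qed

section \<open>Test functions\<close>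

text \<open>The classical smooth function that is flat at 0, with an extra power of 1 / x so that
  the family is closed under differentiation. The rate \<open>c\<close> is kept free: as it tends to
  0, the member with \<open>m = 0\<close> tends to the indicator of the positive reals.\<close>

definition expinv :: "real \<Rightarrow> nat \<Rightarrow> real \<Rightarrow> real" where
  "expinv c m x = (if 0 < x then (1 / x) ^ m * exp (- (c / x)) else 0)"

lemma expinv_tendsto_0:
  assumes c: "0 < c" shows "(expinv c m \<longlongrightarrow> 0) (at_right 0)"
proof -
  have lim: "filterlim (\<lambda>x::real. c / x) at_top (at_right 0)"
    using filterlim_tendsto_pos_mult_at_top[OF tendsto_const[of c] c filterlim_inverse_at_top_right]
    by (simp add: divide_inverse)
  have "((\<lambda>x. (c / x) ^ m / exp (c / x)) \<longlongrightarrow> 0) (at_right 0)"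
    using filterlim_compose[OF tendsto_power_div_exp_0 lim] by simp
  then have "((\<lambda>x. (1 / c) ^ m * ((c / x) ^ m / exp (c / x))) \<longlongrightarrow> 0) (at_right 0)"
    by (rule tendsto_mult_right_zero)
  moreover have "\<forall>\<^sub>F x in at_right 0. (1 / c) ^ m * ((c / x) ^ m / exp (c / x)) = expinv c m x"
    by (rule eventually_at_right_less[THEN eventually_mono])
      (use c in \<open>auto simp: expinv_def exp_minus power_divide field_simps\<close>)
  ultimately show ?thesis by (rule Lim_transform_eventually)
qed

text \<open>The derivative combines two further members of the family, which lets smoothness be
  proved by induction for all \<open>m\<close> at once. At 0 the right difference quotient is
  \<open>expinv c (Suc m)\<close> itself.\<close>

lemma DERIV_expinv:
  assumes c: "0 < c"
  shows "(expinv c m has_real_derivative - real m * expinv c (Suc m) x + c * expinv c (Suc (Suc m)) x) (at x)"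
proof -
  consider "x < 0" | "x > 0" | "x = 0" by linarith
  then show ?thesis
  proof cases
    case 1
    have "((\<lambda>x. 0) has_real_derivative 0) (at x)" by simp
    then have "(expinv c m has_real_derivative 0) (at x)"
      by (rule has_field_derivative_transform_within_open[where S="{..<0}"]) (use 1 in \<open>auto simp: expinv_def\<close>)
    then show ?thesis using 1 by (simp add: expinv_def)
  next
    case 2
    have d1: "((\<lambda>x. 1 / x) has_real_derivative - ((1 / x) ^ 2)) (at x)"
      using 2 by (auto intro!: derivative_eq_intros simp: power2_eq_square field_simps)
    have d2: "((\<lambda>x. (1 / x) ^ m) has_real_derivative real m * (1 / x) ^ (m - 1) * (- ((1 / x) ^ 2))) (at x)"
      using DERIV_power[OF d1, of m] by (simp add: mult_ac)
    have d3: "((\<lambda>x. exp (- (c / x))) has_real_derivative exp (- (c / x)) * (c * (1 / x) ^ 2)) (at x)"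
      using DERIV_fun_exp[OF DERIV_minus[OF DERIV_cmult[OF d1, of c]]] by (simp add: mult_ac)
    have "real m * (1 / x) ^ (m - 1) * (1 / x) ^ 2 = real m * (1 / x) ^ Suc m"
      by (cases m) (simp_all add: power2_eq_square mult_ac)
    then have "real m * (1 / x) ^ (m - 1) * (- ((1 / x) ^ 2)) * exp (- (c / x)) + exp (- (c / x)) * (c * (1 / x) ^ 2) * (1 / x) ^ m
       = - real m * expinv c (Suc m) x + c * expinv c (Suc (Suc m)) x"
      using 2 by (simp add: expinv_def power2_eq_square mult_ac)
    then have "((\<lambda>x. (1 / x) ^ m * exp (- (c / x))) has_real_derivative - real m * expinv c (Suc m) x + c * expinv c (Suc (Suc m)) x) (at x)"
      using DERIV_mult[OF d2 d3] by simp
    then show ?thesis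
      by (rule has_field_derivative_transform_within_open[where S="{0<..}"]) (use 2 in \<open>auto simp: expinv_def\<close>)
  next
    case 3
    have "((\<lambda>h. expinv c m h / h) \<longlongrightarrow> 0) (at 0)"
    proof (rule filterlim_split_at)
      have "\<forall>\<^sub>F h in at_left 0. 0 = expinv c m h / h"
        by (rule eventually_at_left_real[of "-1" 0, THEN eventually_mono]) (auto simp: expinv_def)
      then show "((\<lambda>h. expinv c m h / h) \<longlongrightarrow> 0) (at_left 0)" by (rule Lim_transform_eventually[OF tendsto_const])
      have "\<forall>\<^sub>F h in at_right 0. expinv c (Suc m) h = expinv c m h / h"
        by (rule eventually_at_right_less[THEN eventually_mono]) (auto simp: expinv_def)
      then show "((\<lambda>h. expinv c m h / h) \<longlongrightarrow> 0) (at_right 0)"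
        by (rule Lim_transform_eventually[OF expinv_tendsto_0[OF c]])
    qed
    then have "(expinv c m has_real_derivative 0) (at 0)"
      unfolding DERIV_def by (simp add: expinv_def[of _ _ 0])
    then show ?thesis using 3 by (simp add: expinv_def)
  qed
qed

lemma C_k_const: "C_k k (\<lambda>x. c)"
  by (induction k arbitrary: c) (simp_all add: partial_deriv_def[abs_def])

lemma C_k_differentiable_continuous: "C_k k f \<Longrightarrow> continuous_on UNIV f"
proof (cases k)
  case (Suc n)
  assume "C_k k f"
  then have "\<forall>x. f differentiable at x" using Suc by simp
  then show ?thesis by (auto intro!: continuous_at_imp_continuous_on differentiable_imp_continuous_within)
qed simp

lemma C_k_Suc_lower: "C_k (Suc k) f \<Longrightarrow> C_k k f"
proof (induction k arbitrary: f)
  case 0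
  then show ?case using C_k_differentiable_continuous by fastforce
next
  case (Suc k)
  show ?case unfolding C_k.simps(2)[of k]
  proof (intro conjI ballI)
    show "\<forall>x. f differentiable at x" using Suc.prems by simp
    fix b :: 'a assume "b \<in> Basis"
    then have "C_k (Suc k) (partial_deriv b f)" using Suc.prems C_k.simps(2)[of "Suc k" f] by blast
    then show "C_k k (partial_deriv b f)" by (rule Suc.IH)
  qed
qed

lemma partial_deriv_eqI: "(f has_derivative f') (at x) \<Longrightarrow> partial_deriv b f x = f' b"
  unfolding partial_deriv_def using frechet_derivative_at by metis

lemma has_derivative_partial_deriv:
  assumes "f differentiable at x"
  shows "(f has_derivative frechet_derivative f (at x)) (at x)"
  using assms by (simp add: frechet_derivative_works)

lemma C_k_add: "C_k k f \<Longrightarrow> C_k k g \<Longrightarrow> C_k k (\<lambda>x. f x + g x)"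
proof (induction k arbitrary: f g)
  case 0
  then show ?case by (simp add: continuous_on_add)
next
  case (Suc k)
  have d: "\<And>x. f differentiable at x" "\<And>x. g differentiable at x" using Suc.prems by auto
  have "partial_deriv b (\<lambda>x. f x + g x) = (\<lambda>x. partial_deriv b f x + partial_deriv b g x)" for b
    unfolding partial_deriv_def[of b f] partial_deriv_def[of b g]
    by (rule ext, rule partial_deriv_eqI) (intro has_derivative_add has_derivative_partial_deriv d)
  then show ?case using Suc d by simp
qed

lemma C_k_mult: "C_k k f \<Longrightarrow> C_k k g \<Longrightarrow> C_k k (\<lambda>x. f x * g x)"
proof (induction k arbitrary: f g)
  case 0
  then show ?case by (simp add: continuous_on_mult)
next
  case (Suc k)
  have d: "\<And>x. f differentiable at x" "\<And>x. g differentiable at x" using Suc.prems by auto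
  have eq: "partial_deriv b (\<lambda>x. f x * g x) = (\<lambda>x. f x * partial_deriv b g x + partial_deriv b f x * g x)" for b
    unfolding partial_deriv_def[of b f] partial_deriv_def[of b g]
    by (rule ext, rule trans[OF partial_deriv_eqI[OF has_derivative_mult[OF
      has_derivative_partial_deriv[OF d(1)] has_derivative_partial_deriv[OF d(2)]]]]) simp
  \<comment> \<open>The product rule leaves one factor undifferentiated, and the induction
    hypothesis wants that factor at order \<open>k\<close>.\<close>
  have low: "C_k k f" "C_k k g" using Suc.prems C_k_Suc_lower by blast+
  have "C_k k (partial_deriv b (\<lambda>x. f x * g x))" if "b \<in> Basis" for b
    unfolding eq using Suc.prems that low by (intro C_k_add Suc.IH) auto
  then show ?case using d by simp
qed

lemma C_k_prod: "finite I \<Longrightarrow> (\<And>i. i \<in> I \<Longrightarrow> C_k k (f i)) \<Longrightarrow> C_k k (\<lambda>x. \<Prod>i\<in>I. f i x)"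
  by (induction I rule: finite_induct) (auto intro: C_k_const C_k_mult)

lemma C_k_expinv:
  fixes v :: "'a::euclidean_space"
  assumes c: "0 < c"
  shows "C_k k (\<lambda>z. expinv c m (\<alpha> * (z \<bullet> v) + \<beta>))"
proof (induction k arbitrary: m)
  case 0
  have "continuous_on UNIV (expinv c m)"
    using DERIV_expinv[OF c] by (auto intro!: continuous_at_imp_continuous_on DERIV_isCont)
  then have "continuous_on UNIV (\<lambda>z::'a. expinv c m (\<alpha> * (z \<bullet> v) + \<beta>))"
    by (rule continuous_on_compose2) (auto intro!: continuous_intros)
  then show ?case by simp
next
  case (Suc k)
  have D: "((\<lambda>z. expinv c m (\<alpha> * (z \<bullet> v) + \<beta>)) has_derivative
     (\<lambda>h. (- real m * expinv c (Suc m) (\<alpha> * (z \<bullet> v) + \<beta>) + c * expinv c (Suc (Suc m)) (\<alpha> * (z \<bullet> v) + \<beta>)) * (\<alpha> * (h \<bullet> v)))) (at z)" for z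
  proof -
    have 1: "((\<lambda>z. \<alpha> * (z \<bullet> v) + \<beta>) has_derivative (\<lambda>h. \<alpha> * (h \<bullet> v))) (at z)"
      by (auto intro!: derivative_eq_intros)
    have 2: "(expinv c m has_derivative (*) (- real m * expinv c (Suc m) (\<alpha> * (z \<bullet> v) + \<beta>) + c * expinv c (Suc (Suc m)) (\<alpha> * (z \<bullet> v) + \<beta>))) (at (\<alpha> * (z \<bullet> v) + \<beta>))"
      using DERIV_expinv[OF c] unfolding has_field_derivative_def .
    show ?thesis using has_derivative_compose[OF 1 2] .
  qed
  have "partial_deriv b (\<lambda>z. expinv c m (\<alpha> * (z \<bullet> v) + \<beta>)) =
    (\<lambda>z. (- real m * expinv c (Suc m) (\<alpha> * (z \<bullet> v) + \<beta>) + c * expinv c (Suc (Suc m)) (\<alpha> * (z \<bullet> v) + \<beta>)) * (\<alpha> * (b \<bullet> v)))" for b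
    by (rule ext, rule partial_deriv_eqI[OF D])
  moreover have "C_k k (\<lambda>z. (- real m * expinv c (Suc m) (\<alpha> * (z \<bullet> v) + \<beta>) + c * expinv c (Suc (Suc m)) (\<alpha> * (z \<bullet> v) + \<beta>)) * (\<alpha> * (b \<bullet> v)))" for b
    by (intro C_k_mult C_k_add C_k_const Suc.IH)
  moreover have "(\<lambda>z. expinv c m (\<alpha> * (z \<bullet> v) + \<beta>)) differentiable at z" for z
    using D unfolding differentiable_def by blast
  ultimately show ?case by simp
qed

text \<open>A product of one-dimensional cutoffs, positive exactly on the open box. With
  \<open>c = 1\<close> it serves as mollification kernel, with \<open>c\<close> tending to 0 as
  approximation of the indicator of the box.\<close>

definition box_bump :: "real \<Rightarrow> 'a::euclidean_space \<Rightarrow> 'a \<Rightarrow> 'a \<Rightarrow> real" where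
  "box_bump c a b z = (\<Prod>i\<in>Basis. expinv c 0 (z \<bullet> i - a \<bullet> i) * expinv c 0 (b \<bullet> i - z \<bullet> i))"

lemma box_bump_smooth: "0 < c \<Longrightarrow> C_k k (box_bump c a b)"
proof -
  assume c: "0 < c"
  have 1: "C_k k (\<lambda>z. expinv c 0 (z \<bullet> i - a \<bullet> i))" for i using C_k_expinv[OF c, of k 0 1 i "- (a \<bullet> i)"] by simp
  have 2: "C_k k (\<lambda>z. expinv c 0 (b \<bullet> i - z \<bullet> i))" for i using C_k_expinv[OF c, of k 0 "-1" i "b \<bullet> i"] by (simp add: add.commute)
  show ?thesis unfolding box_bump_def[abs_def] by (intro C_k_prod C_k_mult 1 2) simp
qed

lemma expinv_0: "0 < c \<Longrightarrow> 0 \<le> expinv c 0 x \<and> expinv c 0 x \<le> 1"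
  by (auto simp: expinv_def)

lemma box_bump_range: assumes c: "0 < c" shows "0 \<le> box_bump c a b z" "box_bump c a b z \<le> 1"
proof -
  show "0 \<le> box_bump c a b z" unfolding box_bump_def by (intro prod_nonneg mult_nonneg_nonneg ballI) (use expinv_0[OF c] in auto)
  show "box_bump c a b z \<le> 1" unfolding box_bump_def
    by (intro prod_le_1 conjI mult_nonneg_nonneg mult_le_one) (use expinv_0[OF c] in auto)
qed

lemma box_bump_zero: "z \<notin> box a b \<Longrightarrow> box_bump c a b z = 0"
  unfolding box_bump_def mem_box by (rule prod_zero) (auto simp: expinv_def)

lemma box_bump_pos: "z \<in> box a b \<Longrightarrow> 0 < box_bump c a b z"
  unfolding box_bump_def mem_box by (intro prod_pos) (auto simp: expinv_def)

lemma box_bump_test_fun: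
  assumes "0 < c" "cbox a b \<subseteq> \<Omega>" shows "box_bump c a b \<in> test_fun \<Omega>"
  unfolding test_fun_def
  using box_bump_smooth[OF assms(1)] box_bump_zero[OF contra_subsetD[OF box_subset_cbox]] assms(2)
  by (auto intro!: exI[of _ "cbox a b"] compact_cbox)

lemma box_bump_tendsto: "(\<lambda>n. box_bump (1 / Suc n) a b z) \<longlonglongrightarrow> indicat_real (box a b) z"
proof (cases "z \<in> box a b")
  case True
  have e: "(\<lambda>n. expinv (1 / Suc n) 0 x) \<longlonglongrightarrow> 1" if "0 < x" for x
  proof -
    have "(\<lambda>n. exp (- (inverse (real (Suc n)) / x))) \<longlonglongrightarrow> exp (- (0 / x))"
      by (intro tendsto_intros LIMSEQ_inverse_real_of_nat) (use that in auto)
    then show ?thesis using that by (simp add: expinv_def inverse_eq_divide)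
  qed
  have "(\<lambda>n. box_bump (1 / Suc n) a b z) \<longlonglongrightarrow> (\<Prod>i\<in>(Basis::'a set). 1 * 1)"
    unfolding box_bump_def by (intro tendsto_prod tendsto_mult e) (use True in \<open>auto simp: mem_box\<close>)
  then show ?thesis using True by simp
qed (simp add: box_bump_zero)

lemma test_funI:
  assumes "\<And>k. C_k k \<phi>" "compact S" "S \<subseteq> \<Omega>" "\<And>x. x \<notin> S \<Longrightarrow> \<phi> x = 0"
  shows "\<phi> \<in> test_fun \<Omega>"
  using assms unfolding test_fun_def by blast

lemma test_funE:
  assumes "\<phi> \<in> test_fun \<Omega>"
  obtains S where "compact S" "S \<subseteq> \<Omega>" "\<And>x. x \<notin> S \<Longrightarrow> \<phi> x = 0"
  using assms unfolding test_fun_def by blast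

lemma test_fun_C_k: "\<phi> \<in> test_fun \<Omega> \<Longrightarrow> C_k k \<phi>"
  by (simp add: test_fun_def)

lemma test_fun_continuous: "\<phi> \<in> test_fun \<Omega> \<Longrightarrow> continuous_on UNIV \<phi>"
  using test_fun_C_k[of \<phi> \<Omega> 0] by simp

lemma test_fun_differentiable: "\<phi> \<in> test_fun \<Omega> \<Longrightarrow> \<phi> differentiable at x"
  using test_fun_C_k[of \<phi> \<Omega> "Suc 0"] by simp

lemma test_fun_measurable: "\<phi> \<in> test_fun \<Omega> \<Longrightarrow> \<phi> \<in> borel_measurable borel"
  by (rule borel_measurable_continuous_onI[OF test_fun_continuous])

lemma test_fun_bounded:
  assumes p: "\<phi> \<in> test_fun \<Omega>" obtains B where "0 \<le> B" "\<And>x. \<bar>\<phi> x\<bar> \<le> B"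
proof -
  obtain S where S: "compact S" "\<And>x. x \<notin> S \<Longrightarrow> \<phi> x = 0" using test_funE[OF p] by metis
  have "compact (\<phi> ` S)"
    using S(1) test_fun_continuous[OF p] by (meson compact_continuous_image continuous_on_subset top_greatest)
  then obtain B where B: "\<And>y. y \<in> \<phi> ` S \<Longrightarrow> norm y \<le> B" using compact_imp_bounded bounded_iff by metis
  have "\<bar>\<phi> x\<bar> \<le> max 0 B" for x using B[of "\<phi> x"] S(2)[of x] by (cases "x \<in> S") auto
  then show ?thesis using that[of "max 0 B"] by auto
qed

lemma test_fun_outside: "\<phi> \<in> test_fun \<Omega> \<Longrightarrow> x \<notin> \<Omega> \<Longrightarrow> \<phi> x = 0"
  unfolding test_fun_def by blast

lemma test_fun_partial_deriv:
  assumes p: "\<phi> \<in> test_fun \<Omega>" and b: "b \<in> Basis" shows "partial_deriv b \<phi> \<in> test_fun \<Omega>"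
proof -
  obtain S where S: "compact S" "S \<subseteq> \<Omega>" "\<And>x. x \<notin> S \<Longrightarrow> \<phi> x = 0" using test_funE[OF p] by metis
  have "partial_deriv b \<phi> x = 0" if "x \<notin> S" for x
  proof -
    have "((\<lambda>x. 0) has_derivative (\<lambda>h. 0)) (at x)" by simp
    then have "(\<phi> has_derivative (\<lambda>h. 0)) (at x)"
      by (rule has_derivative_transform_within_open[where s="- S"])
        (use that S compact_imp_closed in auto)
    then show ?thesis by (rule partial_deriv_eqI)
  qed
  moreover have "C_k k (partial_deriv b \<phi>)" for k using test_fun_C_k[OF p, of "Suc k"] b by simp
  ultimately show ?thesis unfolding test_fun_def using S by blast
qed

lemma test_fun_add:
  assumes "f \<in> test_fun \<Omega>" "g \<in> test_fun \<Omega>" shows "(\<lambda>x. f x + g x) \<in> test_fun \<Omega>"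
proof -
  obtain S where S: "compact S" "S \<subseteq> \<Omega>" "\<And>x. x \<notin> S \<Longrightarrow> f x = 0" using test_funE[OF assms(1)] by metis
  obtain R where R: "compact R" "R \<subseteq> \<Omega>" "\<And>x. x \<notin> R \<Longrightarrow> g x = 0" using test_funE[OF assms(2)] by metis
  show ?thesis
    by (rule test_funI[of _ "S \<union> R"])
      (use S R in \<open>auto intro: C_k_add test_fun_C_k[OF assms(1)] test_fun_C_k[OF assms(2)] compact_Un\<close>)
qed

lemma test_fun_mult:
  assumes "f \<in> test_fun \<Omega>" "\<And>k. C_k k g" shows "(\<lambda>x. g x * f x) \<in> test_fun \<Omega>"
proof -
  obtain S where S: "compact S" "S \<subseteq> \<Omega>" "\<And>x. x \<notin> S \<Longrightarrow> f x = 0" using test_funE[OF assms(1)] by metis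
  show ?thesis
    by (rule test_funI[of _ S]) (use S in \<open>auto intro: C_k_mult test_fun_C_k[OF assms(1)] assms(2)\<close>)
qed

lemma test_fun_cmult: "f \<in> test_fun \<Omega> \<Longrightarrow> (\<lambda>x. c * f x) \<in> test_fun \<Omega>"
  by (rule test_fun_mult) (auto intro: C_k_const)

lemma lebesgue_measurable_of_continuous: "continuous_on UNIV (f :: 'a::euclidean_space \<Rightarrow> 'b::euclidean_space) \<Longrightarrow> f \<in> borel_measurable (lebesgue_on S)"
  by (rule measurable_restrict_space1, rule measurable_completion, simp, rule borel_measurable_continuous_onI)

lemma test_fun_measurable_lebesgue: "\<phi> \<in> test_fun \<Omega> \<Longrightarrow> \<phi> \<in> borel_measurable (lebesgue_on S)"
  by (rule lebesgue_measurable_of_continuous[OF test_fun_continuous])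

section \<open>Density of test functions in L1\<close>

lemma test_fun_integrable:
  assumes p: "\<phi> \<in> test_fun \<Omega>" shows "integrable lebesgue \<phi>"
proof -
  obtain S where S: "compact S" "S \<subseteq> \<Omega>" "\<And>x. x \<notin> S \<Longrightarrow> \<phi> x = 0" using test_funE[OF p] by metis
  obtain B where B: "0 \<le> B" "\<And>x. \<bar>\<phi> x\<bar> \<le> B" using test_fun_bounded[OF p] by metis
  show ?thesis
  proof (rule Bochner_Integration.integrable_bound[where f="\<lambda>x. B * indicat_real S x"])
    show "integrable lebesgue (\<lambda>x. B * indicat_real S x)"
      using lmeasurable_compact[OF S(1)] by (intro integrable_mult_right integrable_real_indicator) (auto simp: fmeasurable_def)
    show "\<phi> \<in> borel_measurable lebesgue" using test_fun_measurable_lebesgue[OF p, of UNIV] by simp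
    show "AE x in lebesgue. norm (\<phi> x) \<le> norm (B * indicat_real S x)"
      using B S(3) by (intro AE_I2) (auto simp: indicator_def)
  qed
qed

text \<open>The bounds 0 and 1 on the approximant belong to the notion because they make it stable
  under unions, where products of approximants have to be controlled in L1.\<close>

definition test_approx :: "'a::euclidean_space set \<Rightarrow> 'a set \<Rightarrow> bool" where
  "test_approx \<Omega> A \<longleftrightarrow> A \<in> lmeasurable \<and> (\<forall>\<epsilon>>0. \<exists>\<phi>\<in>test_fun \<Omega>. (\<forall>x. 0 \<le> \<phi> x \<and> \<phi> x \<le> 1) \<and>
     (\<integral>x. \<bar>indicat_real A x - \<phi> x\<bar> \<partial>lebesgue) < \<epsilon>)"

lemma lmeasurable_indicator_integrable: "A \<in> lmeasurable \<Longrightarrow> integrable lebesgue (indicat_real A)"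
  by (intro integrable_real_indicator) (auto simp: fmeasurable_def)

lemma test_approx_cbox:
  assumes "cbox a b \<subseteq> \<Omega>" shows "test_approx \<Omega> (cbox a b)"
  unfolding test_approx_def
proof (intro conjI allI impI)
  show "cbox a b \<in> lmeasurable" by simp
  fix \<epsilon> :: real assume e: "0 < \<epsilon>"
  let ?f = "\<lambda>n. box_bump (1 / Suc n) a b"
  have tf: "?f n \<in> test_fun \<Omega>" for n by (rule box_bump_test_fun) (use assms in auto)
  have "(\<lambda>n. \<integral>x. \<bar>indicat_real (cbox a b) x - ?f n x\<bar> \<partial>lebesgue) \<longlonglongrightarrow> (\<integral>x. 0 \<partial>(lebesgue :: 'a measure))"
  proof (rule integral_dominated_convergence[where w="indicat_real (cbox a b)"])
    show "integrable lebesgue (indicat_real (cbox a b))" by (rule lmeasurable_indicator_integrable) simp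
    show "(\<lambda>x. \<bar>indicat_real (cbox a b) x - ?f i x\<bar>) \<in> borel_measurable lebesgue" for i
      using test_fun_measurable_lebesgue[OF tf, where S=UNIV]
      by (intro borel_measurable_abs borel_measurable_diff borel_measurable_indicator) (auto simp: lebesgue_on_UNIV_eq)
    \<comment> \<open>The bumps tend to the indicator of the open box, which differs from that of
      the closed one on a null set.\<close>
    have "AE x in lebesgue. x \<notin> cbox a b - box a b"
      using negligible_frontier_interval[of a b] unfolding negligible_iff_null_sets by (rule AE_not_in)
    then show "AE x in lebesgue. (\<lambda>n. \<bar>indicat_real (cbox a b) x - ?f n x\<bar>) \<longlonglongrightarrow> 0"
    proof eventually_elim
      case (elim x)
      then have "indicat_real (cbox a b) x = indicat_real (box a b) x" using box_subset_cbox[of a b] by (auto simp: indicator_def)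
      then show ?case using tendsto_rabs[OF tendsto_diff[OF tendsto_const box_bump_tendsto[of a b x]], of "indicat_real (cbox a b) x"] by simp
    qed
    show "AE x in lebesgue. norm \<bar>indicat_real (cbox a b) x - ?f i x\<bar> \<le> indicat_real (cbox a b) x" for i
    proof (rule AE_I2)
      fix x :: 'a
      show "norm \<bar>indicat_real (cbox a b) x - ?f i x\<bar> \<le> indicat_real (cbox a b) x"
        using box_bump_range[of "1 / Suc i" a b x] box_bump_zero[of x a b "1 / Suc i"] box_subset_cbox[of a b]
        by (cases "x \<in> cbox a b") (auto simp: indicator_def)
    qed
  qed simp_all
  then have "(\<lambda>n. \<integral>x. \<bar>indicat_real (cbox a b) x - ?f n x\<bar> \<partial>lebesgue) \<longlonglongrightarrow> 0" by simp
  from order_tendstoD(2)[OF this e] obtain n where "(\<integral>x. \<bar>indicat_real (cbox a b) x - ?f n x\<bar> \<partial>lebesgue) < \<epsilon>"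
    unfolding eventually_sequentially by blast
  then show "\<exists>\<phi>\<in>test_fun \<Omega>. (\<forall>x. 0 \<le> \<phi> x \<and> \<phi> x \<le> 1) \<and> (\<integral>x. \<bar>indicat_real (cbox a b) x - \<phi> x\<bar> \<partial>lebesgue) < \<epsilon>"
    using tf[of n] box_bump_range[of "1 / Suc n" a b] by (intro bexI[of _ "?f n"] conjI allI) simp_all
qed

lemma test_approx_Un:
  assumes A: "test_approx \<Omega> A" and B: "test_approx \<Omega> B" shows "test_approx \<Omega> (A \<union> B)"
  unfolding test_approx_def
proof (intro conjI allI impI)
  have lA: "A \<in> lmeasurable" and lB: "B \<in> lmeasurable" using A B by (auto simp: test_approx_def)
  then show lAB: "A \<union> B \<in> lmeasurable" by (rule fmeasurable.Un)
  fix \<epsilon> :: real assume e: "0 < \<epsilon>"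
  obtain f where f: "f \<in> test_fun \<Omega>" "\<And>x. 0 \<le> f x \<and> f x \<le> 1" "(\<integral>x. \<bar>indicat_real A x - f x\<bar> \<partial>lebesgue) < \<epsilon> / 2"
    using A e unfolding test_approx_def by (meson half_gt_zero)
  obtain g where g: "g \<in> test_fun \<Omega>" "\<And>x. 0 \<le> g x \<and> g x \<le> 1" "(\<integral>x. \<bar>indicat_real B x - g x\<bar> \<partial>lebesgue) < \<epsilon> / 2"
    using B e unfolding test_approx_def by (meson half_gt_zero)
  \<comment> \<open>This is 1 - (1 - f)(1 - g), the analogue of a union, spelled as a sum of
    products so that the closure rules for \<open>C_k\<close> apply.\<close>
  define h where "h x = f x + (1 + (-1) * f x) * g x" for x
  have h: "h \<in> test_fun \<Omega>" unfolding h_def[abs_def]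
    by (rule test_fun_add[OF f(1)], rule test_fun_mult[OF g(1)])
      (intro C_k_add C_k_const C_k_mult test_fun_C_k[OF f(1)])
  have hr: "0 \<le> h x \<and> h x \<le> 1" for x
  proof -
    have "1 - h x = (1 - f x) * (1 - g x)" by (simp add: h_def algebra_simps)
    moreover have "0 \<le> (1 - f x) * (1 - g x)" "(1 - f x) * (1 - g x) \<le> 1"
      using f(2)[of x] g(2)[of x] by (auto intro: mult_le_one)
    ultimately show ?thesis by linarith
  qed
  have le: "\<bar>indicat_real (A \<union> B) x - h x\<bar> \<le> \<bar>indicat_real A x - f x\<bar> + \<bar>indicat_real B x - g x\<bar>" for x
  proof -
    let ?a = "indicat_real A x" and ?b = "indicat_real B x"
    have "indicat_real (A \<union> B) x - h x = (?a - f x) * (1 - ?b) + (?b - g x) * (1 - f x)"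
      by (auto simp: h_def indicator_def algebra_simps)
    moreover have "\<bar>(?a - f x) * (1 - ?b)\<bar> \<le> \<bar>?a - f x\<bar> * 1" unfolding abs_mult
      by (rule mult_left_mono) (auto simp: indicator_def)
    moreover have "\<bar>(?b - g x) * (1 - f x)\<bar> \<le> \<bar>?b - g x\<bar> * 1" unfolding abs_mult
      by (rule mult_left_mono) (use f(2)[of x] in auto)
    moreover have "\<bar>(?a - f x) * (1 - ?b) + (?b - g x) * (1 - f x)\<bar> \<le> \<bar>(?a - f x) * (1 - ?b)\<bar> + \<bar>(?b - g x) * (1 - f x)\<bar>"
      by (rule abs_triangle_ineq)
    ultimately show ?thesis by simp
  qed
  note i = lmeasurable_indicator_integrable[OF lA] lmeasurable_indicator_integrable[OF lB]
    lmeasurable_indicator_integrable[OF lAB] test_fun_integrable[OF f(1)] test_fun_integrable[OF g(1)] test_fun_integrable[OF h]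
  have "(\<integral>x. \<bar>indicat_real (A \<union> B) x - h x\<bar> \<partial>lebesgue) \<le> (\<integral>x. \<bar>indicat_real A x - f x\<bar> + \<bar>indicat_real B x - g x\<bar> \<partial>lebesgue)"
    by (rule integral_mono) (use le i in \<open>auto intro!: integrable_abs Bochner_Integration.integrable_diff Bochner_Integration.integrable_add\<close>)
  also have "\<dots> = (\<integral>x. \<bar>indicat_real A x - f x\<bar> \<partial>lebesgue) + (\<integral>x. \<bar>indicat_real B x - g x\<bar> \<partial>lebesgue)"
    by (rule Bochner_Integration.integral_add) (use i in \<open>auto intro!: integrable_abs Bochner_Integration.integrable_diff\<close>)
  also have "\<dots> < \<epsilon>" using f(3) g(3) by simp
  finally show "\<exists>\<phi>\<in>test_fun \<Omega>. (\<forall>x. 0 \<le> \<phi> x \<and> \<phi> x \<le> 1) \<and> (\<integral>x. \<bar>indicat_real (A \<union> B) x - \<phi> x\<bar> \<partial>lebesgue) < \<epsilon>"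
    using h hr by blast
qed

lemma test_approx_close:
  assumes A: "A \<in> lmeasurable"
    and B: "\<And>\<epsilon>. 0 < \<epsilon> \<Longrightarrow> \<exists>B. test_approx \<Omega> B \<and> (\<integral>x. \<bar>indicat_real A x - indicat_real B x\<bar> \<partial>lebesgue) < \<epsilon>"
  shows "test_approx \<Omega> A"
  unfolding test_approx_def
proof (intro conjI allI impI A)
  fix \<epsilon> :: real assume e: "0 < \<epsilon>"
  obtain B where B: "test_approx \<Omega> B" "(\<integral>x. \<bar>indicat_real A x - indicat_real B x\<bar> \<partial>lebesgue) < \<epsilon> / 2"
    using B[of "\<epsilon> / 2"] e by auto
  have lB: "B \<in> lmeasurable" using B(1) by (auto simp: test_approx_def)
  obtain f where f: "f \<in> test_fun \<Omega>" "\<And>x. 0 \<le> f x \<and> f x \<le> 1" "(\<integral>x. \<bar>indicat_real B x - f x\<bar> \<partial>lebesgue) < \<epsilon> / 2"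
    using B e unfolding test_approx_def by (meson half_gt_zero)
  note i = lmeasurable_indicator_integrable[OF A] lmeasurable_indicator_integrable[OF lB] test_fun_integrable[OF f(1)]
  have "(\<integral>x. \<bar>indicat_real A x - f x\<bar> \<partial>lebesgue) \<le> (\<integral>x. \<bar>indicat_real A x - indicat_real B x\<bar> + \<bar>indicat_real B x - f x\<bar> \<partial>lebesgue)"
    by (rule integral_mono) (use i in \<open>auto intro!: integrable_abs Bochner_Integration.integrable_diff Bochner_Integration.integrable_add\<close>)
  also have "\<dots> = (\<integral>x. \<bar>indicat_real A x - indicat_real B x\<bar> \<partial>lebesgue) + (\<integral>x. \<bar>indicat_real B x - f x\<bar> \<partial>lebesgue)"
    by (rule Bochner_Integration.integral_add) (use i in \<open>auto intro!: integrable_abs Bochner_Integration.integrable_diff\<close>)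
  also have "\<dots> < \<epsilon>" using f(3) B(2) by simp
  finally show "\<exists>\<phi>\<in>test_fun \<Omega>. (\<forall>x. 0 \<le> \<phi> x \<and> \<phi> x \<le> 1) \<and> (\<integral>x. \<bar>indicat_real A x - \<phi> x\<bar> \<partial>lebesgue) < \<epsilon>"
    using f by blast
qed

lemma integral_indicator_diff:
  assumes "A \<in> lmeasurable" "B \<in> lmeasurable" "B \<subseteq> A"
  shows "(\<integral>x. \<bar>indicat_real A x - indicat_real B x\<bar> \<partial>lebesgue) = measure lebesgue (A - B)"
proof -
  have "(\<lambda>x. \<bar>indicat_real A x - indicat_real B x\<bar>) = indicat_real (A - B)"
    using assms(3) by (auto simp: indicator_def fun_eq_iff)
  then show ?thesis by simp
qed

lemma test_approx_open:
  assumes U: "open U" "U \<subseteq> \<Omega>" "U \<in> lmeasurable" shows "test_approx \<Omega> U"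
proof (rule test_approx_close[OF U(3)])
  fix \<epsilon> :: real assume e: "0 < \<epsilon>"
  obtain D where D: "countable D" "D \<subseteq> Pow U" "\<And>X. X \<in> D \<Longrightarrow> \<exists>a b. X = cbox a b" "\<Union>D = U"
    using open_countable_Union_open_cbox[OF U(1)] by metis
  \<comment> \<open>The empty set is inserted because \<open>from_nat_into\<close> enumerates
    nonempty sets, while \<open>D\<close> may be empty.\<close>
  define f where "f n = from_nat_into (insert {} D) n" for n
  have fD: "f n \<in> insert {} D" for n unfolding f_def by (rule from_nat_into) simp
  have Uf: "(\<Union>n. f n) = U"
  proof -
    have "range (from_nat_into (insert {} D)) = insert {} D" by (rule range_from_nat_into) (use D(1) in auto)
    then have "range f = insert {} D" unfolding f_def[abs_def] .
    then show ?thesis using D(4) by auto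
  qed
  define A where "A n = (\<Union>i\<le>n. f i)" for n
  have app: "test_approx \<Omega> (f n)" for n
  proof (cases "f n = {}")
    case True
    show ?thesis using True test_approx_cbox[of One 0 \<Omega>] empty_as_interval[where 'a='a] by simp
  next
    case False
    then have "f n \<in> D" using fD[of n] by simp
    then obtain a b where ab: "f n = cbox a b" and "f n \<subseteq> U" using D(2,3) by blast
    then have "cbox a b \<subseteq> \<Omega>" using U(2) by blast
    then show ?thesis unfolding ab by (rule test_approx_cbox)
  qed
  have appA: "test_approx \<Omega> (A n)" for n
  proof (induction n)
    case 0
    show ?case using app[of 0] by (simp add: A_def)
  next
    case (Suc n)
    have "A (Suc n) = A n \<union> f (Suc n)" by (auto simp: A_def atMost_Suc)
    then show ?case using test_approx_Un[OF Suc app] by simp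
  qed
  have lA: "A n \<in> lmeasurable" for n using appA by (auto simp: test_approx_def)
  have UA: "(\<Union>n. A n) = U"
  proof
    show "(\<Union>n. A n) \<subseteq> U" unfolding A_def Uf[symmetric] by blast
    show "U \<subseteq> (\<Union>n. A n)" unfolding A_def Uf[symmetric] by blast
  qed
  have "(\<lambda>n. measure lebesgue (A n)) \<longlonglongrightarrow> measure lebesgue (\<Union>n. A n)"
  proof (rule Lim_measure_incseq)
    show "range A \<subseteq> sets lebesgue" using lA by auto
    show "incseq A" unfolding A_def incseq_def by (meson UN_mono atMost_subset_iff order_refl)
    show "emeasure lebesgue (\<Union>n. A n) \<noteq> \<infinity>" unfolding UA using fmeasurableD2[OF U(3)] by simp
  qed
  then have "(\<lambda>n. measure lebesgue U - measure lebesgue (A n)) \<longlonglongrightarrow> measure lebesgue U - measure lebesgue U"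
    unfolding UA by (rule tendsto_diff[OF tendsto_const])
  then have "\<forall>\<^sub>F n in sequentially. measure lebesgue U - measure lebesgue (A n) < \<epsilon>" using e by (intro order_tendstoD(2)) auto
  then obtain n where n: "measure lebesgue U - measure lebesgue (A n) < \<epsilon>" unfolding eventually_sequentially by blast
  have sub: "A n \<subseteq> U" using UA by auto
  have "measure lebesgue (U - A n) = measure lebesgue U - measure lebesgue (A n)"
    by (rule measurable_measure_Diff[OF U(3)]) (use lA sub in auto)
  then show "\<exists>B. test_approx \<Omega> B \<and> (\<integral>x. \<bar>indicat_real U x - indicat_real B x\<bar> \<partial>lebesgue) < \<epsilon>"
    using n appA integral_indicator_diff[OF U(3) lA sub] by (intro exI[of _ "A n"]) simp
qed

lemma test_approx_lmeasurable:
  assumes "open \<Omega>" "A \<subseteq> \<Omega>" "A \<in> lmeasurable" shows "test_approx \<Omega> A"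
proof (rule test_approx_close[OF assms(3)])
  fix \<epsilon> :: real assume e: "0 < \<epsilon>"
  obtain T where T: "open T" "A \<subseteq> T" "T \<in> lmeasurable" "measure lebesgue (T - A) < \<epsilon>"
  proof -
    obtain T where T: "open T" "A \<subseteq> T" "T - A \<in> lmeasurable" "emeasure lebesgue (T - A) < ennreal \<epsilon>"
      using sets_lebesgue_outer_open[OF fmeasurableD[OF assms(3)] e] by metis
    have "T = (T - A) \<union> A" using T(2) by blast
    then have "T \<in> lmeasurable" using T(3) assms(3) by (metis fmeasurable.Un)
    moreover have "measure lebesgue (T - A) < \<epsilon>"
      using T(4) e by (simp add: emeasure_eq_measure2[OF T(3)] ennreal_less_iff)
    ultimately show ?thesis using that T(1,2) by blast
  qed
  \<comment> \<open>Test functions have to be supported in \<Omega>, so the outer open set is cut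
    down to it.\<close>
  have l: "T \<inter> \<Omega> \<in> lmeasurable" using T(3) assms(1) by (simp add: fmeasurable_Int_fmeasurable)
  have "measure lebesgue (T \<inter> \<Omega> - A) \<le> measure lebesgue (T - A)"
    by (rule measure_mono_fmeasurable) (use l T assms in auto)
  then have "(\<integral>x. \<bar>indicat_real (T \<inter> \<Omega>) x - indicat_real A x\<bar> \<partial>lebesgue) < \<epsilon>"
    using integral_indicator_diff[OF l assms(3)] T(2,4) assms(2) by (simp add: Int_greatest)
  moreover have "test_approx \<Omega> (T \<inter> \<Omega>)" by (rule test_approx_open) (use T assms l in auto)
  ultimately show "\<exists>B. test_approx \<Omega> B \<and> (\<integral>x. \<bar>indicat_real A x - indicat_real B x\<bar> \<partial>lebesgue) < \<epsilon>"
    by (auto simp: abs_minus_commute)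
qed

lemma test_fun_integrable_on:
  assumes "open \<Omega>" "\<phi> \<in> test_fun \<Omega>'" shows "integrable (lebesgue_on \<Omega>) \<phi>"
  using integrable_mult_indicator[OF _ test_fun_integrable[OF assms(2)], of \<Omega>] assms(1)
  by (simp add: integrable_restrict_space)

lemma test_fun_dense:
  fixes f :: "'a::euclidean_space \<Rightarrow> real"
  assumes \<Omega>: "open \<Omega>" and f: "integrable (lebesgue_on \<Omega>) f" and e: "0 < \<epsilon>"
  shows "\<exists>\<phi>\<in>test_fun \<Omega>. (\<integral>x. \<bar>f x - \<phi> x\<bar> \<partial>lebesgue_on \<Omega>) < \<epsilon>"
  using f e
proof (induct f arbitrary: \<epsilon> rule: integrable_induct)
  case (base A c)
  have sp: "space (lebesgue_on \<Omega>) = \<Omega>" by simp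
  have \<Omega>s: "\<Omega> \<inter> space lebesgue \<in> sets lebesgue" using \<Omega> by auto
  have A: "A \<subseteq> \<Omega>" "A \<in> sets lebesgue" using base(1) \<Omega>s by (auto simp: sets_restrict_space_iff)
  have "A \<in> lmeasurable" using base(2) A emeasure_restrict_space[OF \<Omega>s A(1)] by (simp add: fmeasurable_def)
  then have "test_approx \<Omega> A" using test_approx_lmeasurable \<Omega> A by blast
  \<comment> \<open>The summand 1 covers c = 0 and makes the final inequality strict.\<close>
  moreover have "0 < \<epsilon> / (\<bar>c\<bar> + 1)" using base(3) by simp
  ultimately obtain \<phi> where p: "\<phi> \<in> test_fun \<Omega>" "(\<integral>x. \<bar>indicat_real A x - \<phi> x\<bar> \<partial>lebesgue) < \<epsilon> / (\<bar>c\<bar> + 1)"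
    unfolding test_approx_def by blast
  have "(\<integral>x. \<bar>indicat_real A x *\<^sub>R c - c * \<phi> x\<bar> \<partial>lebesgue_on \<Omega>) = (\<integral>x. \<bar>c\<bar> * \<bar>indicat_real A x - \<phi> x\<bar> \<partial>lebesgue)"
    unfolding integral_restrict_space[OF \<Omega>s]
  proof (rule Bochner_Integration.integral_cong[OF refl])
    fix x
    show "indicat_real \<Omega> x *\<^sub>R \<bar>indicat_real A x *\<^sub>R c - c * \<phi> x\<bar> = \<bar>c\<bar> * \<bar>indicat_real A x - \<phi> x\<bar>"
      using A(1) test_fun_outside[OF p(1), of x] by (cases "x \<in> \<Omega>") (auto simp: indicator_def abs_mult[symmetric] algebra_simps)
  qed
  also have "\<dots> = \<bar>c\<bar> * (\<integral>x. \<bar>indicat_real A x - \<phi> x\<bar> \<partial>lebesgue)" by simp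
  also have "\<dots> \<le> \<bar>c\<bar> * (\<epsilon> / (\<bar>c\<bar> + 1))" by (rule mult_left_mono) (use p(2) in auto)
  also have "\<dots> < \<epsilon>" using base(3) by (simp add: field_simps)
  finally show ?case using test_fun_cmult[OF p(1), of c] by (intro bexI[of _ "\<lambda>x. c * \<phi> x"])
next
  case (add f g)
  obtain p q where p: "p \<in> test_fun \<Omega>" "(\<integral>x. \<bar>f x - p x\<bar> \<partial>lebesgue_on \<Omega>) < \<epsilon> / 2"
    and q: "q \<in> test_fun \<Omega>" "(\<integral>x. \<bar>g x - q x\<bar> \<partial>lebesgue_on \<Omega>) < \<epsilon> / 2"
    using add(2,4) add(5) by (meson half_gt_zero)
  note i = test_fun_integrable_on[OF \<Omega> p(1)] test_fun_integrable_on[OF \<Omega> q(1)] add(1,3)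
  have "(\<integral>x. \<bar>f x + g x - (p x + q x)\<bar> \<partial>lebesgue_on \<Omega>) \<le> (\<integral>x. \<bar>f x - p x\<bar> + \<bar>g x - q x\<bar> \<partial>lebesgue_on \<Omega>)"
    by (rule integral_mono) (use i in auto)
  also have "\<dots> = (\<integral>x. \<bar>f x - p x\<bar> \<partial>lebesgue_on \<Omega>) + (\<integral>x. \<bar>g x - q x\<bar> \<partial>lebesgue_on \<Omega>)"
    by (rule Bochner_Integration.integral_add) (use i in auto)
  finally show ?case using p(2) q(2) test_fun_add[OF p(1) q(1)] by (intro bexI[of _ "\<lambda>x. p x + q x"]) auto
next
  case (lim f s)
  have "(\<lambda>i. \<integral>x. \<bar>f x - s i x\<bar> \<partial>lebesgue_on \<Omega>) \<longlonglongrightarrow> (\<integral>x. 0 \<partial>lebesgue_on \<Omega>)"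
  proof (rule integral_dominated_convergence[where w="\<lambda>x. 3 * \<bar>f x\<bar>"])
    show "integrable (lebesgue_on \<Omega>) (\<lambda>x. 3 * \<bar>f x\<bar>)" using lim by simp
    show "(\<lambda>x. \<bar>f x - s i x\<bar>) \<in> borel_measurable (lebesgue_on \<Omega>)" for i
      using lim(1)[of i] lim(5) by (intro borel_measurable_abs borel_measurable_diff) auto
    show "AE x in lebesgue_on \<Omega>. (\<lambda>i. \<bar>f x - s i x\<bar>) \<longlonglongrightarrow> 0"
    proof (rule AE_I2)
      fix x assume "x \<in> space (lebesgue_on \<Omega>)"
      from tendsto_rabs[OF tendsto_diff[OF tendsto_const lim(3)[OF this]], of "f x"]
      show "(\<lambda>i. \<bar>f x - s i x\<bar>) \<longlonglongrightarrow> 0" by simp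
    qed
    show "AE x in lebesgue_on \<Omega>. norm \<bar>f x - s i x\<bar> \<le> 3 * \<bar>f x\<bar>" for i
    proof (rule AE_I2)
      fix x assume "x \<in> space (lebesgue_on \<Omega>)"
      from lim(4)[OF this, of i] show "norm \<bar>f x - s i x\<bar> \<le> 3 * \<bar>f x\<bar>" by simp
    qed
  qed simp
  then have "\<forall>\<^sub>F i in sequentially. (\<integral>x. \<bar>f x - s i x\<bar> \<partial>lebesgue_on \<Omega>) < \<epsilon> / 2"
    using lim(6) by (intro order_tendstoD(2)) auto
  then obtain i where i: "(\<integral>x. \<bar>f x - s i x\<bar> \<partial>lebesgue_on \<Omega>) < \<epsilon> / 2" by (auto simp: eventually_sequentially)
  obtain p where p: "p \<in> test_fun \<Omega>" "(\<integral>x. \<bar>s i x - p x\<bar> \<partial>lebesgue_on \<Omega>) < \<epsilon> / 2"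
    using lim(2)[of "\<epsilon> / 2" i] lim(6) by auto
  note ii = test_fun_integrable_on[OF \<Omega> p(1)] lim(1)[of i] lim(5)
  have "(\<integral>x. \<bar>f x - p x\<bar> \<partial>lebesgue_on \<Omega>) \<le> (\<integral>x. \<bar>f x - s i x\<bar> + \<bar>s i x - p x\<bar> \<partial>lebesgue_on \<Omega>)"
    by (rule integral_mono) (use ii in auto)
  also have "\<dots> = (\<integral>x. \<bar>f x - s i x\<bar> \<partial>lebesgue_on \<Omega>) + (\<integral>x. \<bar>s i x - p x\<bar> \<partial>lebesgue_on \<Omega>)"
    by (rule Bochner_Integration.integral_add) (use ii in auto)
  finally show ?case using p i by (intro bexI[of _ p]) auto
qed

section \<open>The fundamental lemma of the calculus of variations and weak gradients\<close>

lemma fundamental_lemma: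
  fixes h :: "'a::euclidean_space \<Rightarrow> real"
  assumes \<Omega>: "open \<Omega>" "bounded \<Omega>" and h: "h \<in> Linf (lebesgue_on \<Omega>)"
    and z: "\<And>\<phi>. \<phi> \<in> test_fun \<Omega> \<Longrightarrow> (\<integral>x. h x * \<phi> x \<partial>lebesgue_on \<Omega>) = 0"
  shows "AE x in lebesgue_on \<Omega>. h x = 0"
proof -
  interpret finite_measure "lebesgue_on \<Omega>"
    by (rule finite_measure_lebesgue_on[OF lmeasurable_open[OF \<Omega>(2,1)]])
  have fm: "finite_measure (lebesgue_on \<Omega>)" by unfold_locales
  have hi: "integrable (lebesgue_on \<Omega>) h" by (rule Linf_integrable[OF fm h])
  define B where "B = Linf_norm (lebesgue_on \<Omega>) h"
  have B: "0 \<le> B" "AE x in lebesgue_on \<Omega>. \<bar>h x\<bar> \<le> B"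
    using AE_le_Linf_norm[OF h] by (auto simp: B_def Linf_norm_nonneg)
  have prod: "integrable (lebesgue_on \<Omega>) (\<lambda>x. h x * g x)" if "integrable (lebesgue_on \<Omega>) g" for g
    using integrable_inner_Linf[OF that h] by (simp add: mult.commute)
  have "(\<integral>x. h x * h x \<partial>lebesgue_on \<Omega>) \<le> 0 + e" if e: "0 < e" for e
  proof -
    have "0 < e / (B + 1)" using e B(1) by simp
    then obtain p where p: "p \<in> test_fun \<Omega>" "(\<integral>x. \<bar>h x - p x\<bar> \<partial>lebesgue_on \<Omega>) < e / (B + 1)"
      using test_fun_dense[OF \<Omega>(1) hi] by blast
    have pi: "integrable (lebesgue_on \<Omega>) p" by (rule test_fun_integrable_on[OF \<Omega>(1) p(1)])
    \<comment> \<open>Orthogonality to \<open>p\<close> lets the square of \<open>h\<close> be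
      replaced by the product of \<open>h\<close> with \<open>h - p\<close>, which the bound on
      \<open>h\<close> estimates by the L1 distance.\<close>
    have "(\<integral>x. h x * h x \<partial>lebesgue_on \<Omega>) = (\<integral>x. h x * h x - h x * p x \<partial>lebesgue_on \<Omega>)"
      using Bochner_Integration.integral_diff[OF prod[OF hi] prod[OF pi]] z[OF p(1)] by simp
    also have "\<dots> \<le> (\<integral>x. B * \<bar>h x - p x\<bar> \<partial>lebesgue_on \<Omega>)"
    proof (rule integral_mono_AE)
      show "integrable (lebesgue_on \<Omega>) (\<lambda>x. h x * h x - h x * p x)" using prod[OF hi] prod[OF pi] by simp
      show "integrable (lebesgue_on \<Omega>) (\<lambda>x. B * \<bar>h x - p x\<bar>)" using hi pi by simp
      show "AE x in lebesgue_on \<Omega>. h x * h x - h x * p x \<le> B * \<bar>h x - p x\<bar>"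
        using B(2)
      proof eventually_elim
        case (elim x)
        have "h x * h x - h x * p x \<le> \<bar>h x * (h x - p x)\<bar>" by (simp add: right_diff_distrib)
        also have "\<dots> \<le> B * \<bar>h x - p x\<bar>" unfolding abs_mult using elim by (simp add: mult_right_mono)
        finally show ?case .
      qed
    qed
    also have "\<dots> = B * (\<integral>x. \<bar>h x - p x\<bar> \<partial>lebesgue_on \<Omega>)" by simp
    also have "\<dots> \<le> B * (e / (B + 1))" using p(2) B(1) by (intro mult_left_mono) auto
    also have "\<dots> \<le> e" using B(1) e by (simp add: field_simps)
    finally show ?thesis by simp
  qed
  then have "(\<integral>x. h x * h x \<partial>lebesgue_on \<Omega>) \<le> 0" by (rule field_le_epsilon)
  moreover have "0 \<le> (\<integral>x. h x * h x \<partial>lebesgue_on \<Omega>)" by (rule Bochner_Integration.integral_nonneg) simp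
  ultimately have "(\<integral>x. h x * h x \<partial>lebesgue_on \<Omega>) = 0" by linarith
  then have "AE x in lebesgue_on \<Omega>. h x * h x = 0"
    using integral_nonneg_eq_0_iff_AE[OF prod[OF hi]] by simp
  then show ?thesis by simp
qed

lemma integrable_Linf_mult:
  fixes v :: "'a \<Rightarrow> real"
  assumes "v \<in> Linf M" "integrable M g" shows "integrable M (\<lambda>x. v x * g x)"
  using integrable_inner_Linf[OF assms(2,1)] by (simp add: mult.commute)

lemma weak_gradientD:
  "weak_gradient \<Omega> v g \<Longrightarrow> \<phi> \<in> test_fun \<Omega> \<Longrightarrow> b \<in> Basis \<Longrightarrow>
    (\<integral>x. v x * partial_deriv b \<phi> x \<partial>lebesgue_on \<Omega>) = - (\<integral>x. (g x \<bullet> b) * \<phi> x \<partial>lebesgue_on \<Omega>)"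
  unfolding weak_gradient_def by blast

lemma Linf_inner_const:
  fixes g :: "'a \<Rightarrow> 'b::euclidean_space"
  assumes "g \<in> Linf M" shows "(\<lambda>x. g x \<bullet> b) \<in> Linf M"
proof (rule LinfI)
  show "(\<lambda>x. g x \<bullet> b) \<in> borel_measurable M" using Linf_measurable[OF assms] by simp
  show "AE x in M. norm (g x \<bullet> b) \<le> Linf_norm M g * norm b"
    using AE_le_Linf_norm[OF assms]
  proof eventually_elim
    case (elim x)
    have "norm (g x \<bullet> b) \<le> norm (g x) * norm b" using Cauchy_Schwarz_ineq2 by simp
    then show ?case using elim by (meson mult_right_mono norm_ge_zero order_trans)
  qed
qed

lemma AE_eq_by_components:
  fixes g h :: "'a \<Rightarrow> 'b::euclidean_space"
  assumes "\<And>b. b \<in> Basis \<Longrightarrow> AE x in M. g x \<bullet> b = h x \<bullet> b"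
  shows "AE x in M. g x = h x"
proof -
  have "AE x in M. \<forall>b\<in>Basis. g x \<bullet> b = h x \<bullet> b"
    using assms by (intro AE_ball_countable[THEN iffD2]) (auto intro: countable_finite)
  then show ?thesis by eventually_elim (auto intro: euclidean_eqI)
qed

lemma weak_gradient_diff:
  assumes \<Omega>: "open \<Omega>" and v: "v \<in> Linf (lebesgue_on \<Omega>)" "w \<in> Linf (lebesgue_on \<Omega>)"
    and g: "g \<in> Linf (lebesgue_on \<Omega>)" "h \<in> Linf (lebesgue_on \<Omega>)"
    and wg: "weak_gradient \<Omega> v g" "weak_gradient \<Omega> w h"
  shows "weak_gradient \<Omega> (\<lambda>x. v x - w x) (\<lambda>x. g x - h x)"
  unfolding weak_gradient_def
proof (intro ballI)
  fix \<phi> b assume p: "\<phi> \<in> test_fun \<Omega>" and b: "b \<in> (Basis :: 'a set)"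
  have i: "integrable (lebesgue_on \<Omega>) (\<lambda>x. v x * partial_deriv b \<phi> x)" "integrable (lebesgue_on \<Omega>) (\<lambda>x. w x * partial_deriv b \<phi> x)"
    using integrable_Linf_mult[OF _ test_fun_integrable_on[OF \<Omega> test_fun_partial_deriv[OF p b]]] v by auto
  have j: "integrable (lebesgue_on \<Omega>) (\<lambda>x. (g x \<bullet> b) * \<phi> x)" "integrable (lebesgue_on \<Omega>) (\<lambda>x. (h x \<bullet> b) * \<phi> x)"
    using integrable_Linf_mult[OF Linf_inner_const test_fun_integrable_on[OF \<Omega> p]] g by auto
  have "(\<integral>x. (v x - w x) * partial_deriv b \<phi> x \<partial>lebesgue_on \<Omega>)
      = (\<integral>x. v x * partial_deriv b \<phi> x \<partial>lebesgue_on \<Omega>) - (\<integral>x. w x * partial_deriv b \<phi> x \<partial>lebesgue_on \<Omega>)"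
    unfolding left_diff_distrib by (rule Bochner_Integration.integral_diff[OF i])
  also have "\<dots> = - ((\<integral>x. (g x \<bullet> b) * \<phi> x \<partial>lebesgue_on \<Omega>) - (\<integral>x. (h x \<bullet> b) * \<phi> x \<partial>lebesgue_on \<Omega>))"
    unfolding weak_gradientD[OF wg(1) p b] weak_gradientD[OF wg(2) p b] by simp
  also have "\<dots> = - (\<integral>x. ((g x - h x) \<bullet> b) * \<phi> x \<partial>lebesgue_on \<Omega>)"
    unfolding inner_diff_left left_diff_distrib by (simp add: Bochner_Integration.integral_diff[OF j])
  finally show "(\<integral>x. (v x - w x) * partial_deriv b \<phi> x \<partial>lebesgue_on \<Omega>) = - (\<integral>x. ((g x - h x) \<bullet> b) * \<phi> x \<partial>lebesgue_on \<Omega>)" .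
qed

lemma weak_gradient_unique:
  assumes \<Omega>: "open \<Omega>" "bounded \<Omega>"
    and g: "g \<in> Linf (lebesgue_on \<Omega>)" "h \<in> Linf (lebesgue_on \<Omega>)"
    and wg: "weak_gradient \<Omega> v g" "weak_gradient \<Omega> v h"
  shows "AE x in lebesgue_on \<Omega>. g x = h x"
proof (rule AE_eq_by_components)
  fix b :: 'a assume b: "b \<in> Basis"
  have "AE x in lebesgue_on \<Omega>. (g x - h x) \<bullet> b = 0"
  proof (rule fundamental_lemma[OF \<Omega> Linf_inner_const[OF Linf_diff[OF g]]])
    fix \<phi> assume p: "\<phi> \<in> test_fun \<Omega>"
    have j: "integrable (lebesgue_on \<Omega>) (\<lambda>x. (g x \<bullet> b) * \<phi> x)" "integrable (lebesgue_on \<Omega>) (\<lambda>x. (h x \<bullet> b) * \<phi> x)"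
      using integrable_Linf_mult[OF Linf_inner_const test_fun_integrable_on[OF \<Omega>(1) p]] g by auto
    show "(\<integral>x. (g x - h x) \<bullet> b * \<phi> x \<partial>lebesgue_on \<Omega>) = 0"
      unfolding inner_diff_left left_diff_distrib Bochner_Integration.integral_diff[OF j]
      using weak_gradientD[OF wg(1) p b] weak_gradientD[OF wg(2) p b] by simp
  qed
  then show "AE x in lebesgue_on \<Omega>. g x \<bullet> b = h x \<bullet> b" by eventually_elim (simp add: inner_diff_left)
qed

lemma frechet_derivative_sum_partial:
  assumes "\<phi> \<in> test_fun \<Omega>"
  shows "(\<phi> has_derivative (\<lambda>h. \<Sum>b\<in>Basis. (h \<bullet> b) * partial_deriv b \<phi> x)) (at x)"
proof -
  have d: "(\<phi> has_derivative frechet_derivative \<phi> (at x)) (at x)"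
    by (rule has_derivative_partial_deriv[OF test_fun_differentiable[OF assms]])
  interpret l: bounded_linear "frechet_derivative \<phi> (at x)" using d by (rule has_derivative_bounded_linear)
  have "frechet_derivative \<phi> (at x) h = (\<Sum>b\<in>Basis. (h \<bullet> b) * partial_deriv b \<phi> x)" for h
  proof -
    have "frechet_derivative \<phi> (at x) h = frechet_derivative \<phi> (at x) (\<Sum>b\<in>Basis. (h \<bullet> b) *\<^sub>R b)"
      by (simp only: euclidean_representation)
    also have "\<dots> = (\<Sum>b\<in>Basis. (h \<bullet> b) * partial_deriv b \<phi> x)"
      by (simp only: l.sum l.scaleR partial_deriv_def real_scaleR_def)
    finally show ?thesis .
  qed
  then show ?thesis using d by presburger
qed

lemma test_fun_translate_partial:
  assumes "K \<in> test_fun \<Omega>'"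
  shows "partial_deriv b (\<lambda>z. K (z - p)) z = partial_deriv b K (z - p)"
proof -
  have d: "(K has_derivative frechet_derivative K (at (z - p))) (at (z - p))"
    by (rule has_derivative_partial_deriv[OF test_fun_differentiable[OF assms]])
  have s: "((\<lambda>z. z - p) has_derivative (\<lambda>h. h)) (at z)"
    by (auto intro!: derivative_eq_intros)
  have "((\<lambda>z. K (z - p)) has_derivative (\<lambda>h. frechet_derivative K (at (z - p)) h)) (at z)"
    using has_derivative_compose[OF s d] .
  then show ?thesis unfolding partial_deriv_def[of b K] by (rule partial_deriv_eqI)
qed

text \<open>Only Fubini's theorem is used, so that nothing has to be differentiated under an integral.\<close>

lemma translation_identity:
  fixes K :: "'a::euclidean_space \<Rightarrow> real"
  assumes \<Omega>: "open \<Omega>" "bounded \<Omega>" and v: "v \<in> Linf (lebesgue_on \<Omega>)" and g: "g \<in> Linf (lebesgue_on \<Omega>)"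
    and wg: "weak_gradient \<Omega> v g"
    and K: "K \<in> test_fun \<Omega>" and Kt: "\<And>s. s \<in> {0..1} \<Longrightarrow> (\<lambda>z. K (z - s *\<^sub>R e)) \<in> test_fun \<Omega>"
  shows "(\<integral>z. v z * K (z - e) \<partial>lebesgue_on \<Omega>) - (\<integral>z. v z * K z \<partial>lebesgue_on \<Omega>) =
    (\<integral>z. g z \<bullet> ((\<integral>s. K (z - s *\<^sub>R e) \<partial>lebesgue_on {0..1}) *\<^sub>R e) \<partial>lebesgue_on \<Omega>)"
proof -
  let ?I = "lebesgue_on {0..1::real}" and ?M = "lebesgue_on \<Omega>"
  interpret M: finite_measure ?M by (rule finite_measure_lebesgue_on[OF lmeasurable_open[OF \<Omega>(2,1)]])
  interpret I: finite_measure ?I by (rule finite_measure_lebesgue_on) simp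
  interpret P: pair_sigma_finite ?I ?M ..
  interpret PF: finite_measure "?I \<Otimes>\<^sub>M ?M" by (rule finite_measure_pair_measure) unfold_locales
  define D where "D z = (\<Sum>b\<in>Basis. (e \<bullet> b) * partial_deriv b K z)" for z
  have vm[measurable]: "v \<in> borel_measurable ?M" by (rule Linf_measurable[OF v])
  have idm[measurable]: "(\<lambda>z. z) \<in> measurable ?M borel"
    by (rule lebesgue_measurable_of_continuous) (rule continuous_on_id)
  have idI[measurable]: "(\<lambda>s. s) \<in> measurable ?I borel"
    by (rule lebesgue_measurable_of_continuous) (rule continuous_on_id)
  have Km[measurable]: "K \<in> borel_measurable borel" by (rule test_fun_measurable[OF K])
  have Dc: "continuous_on UNIV D" unfolding D_def
    by (intro continuous_on_sum continuous_on_mult continuous_on_const test_fun_continuous[OF test_fun_partial_deriv[OF K]])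
  have Dm[measurable]: "D \<in> borel_measurable borel" by (rule borel_measurable_continuous_onI[OF Dc])
  have trm[measurable]: "(\<lambda>(s, z). z - s *\<^sub>R e) \<in> measurable (?I \<Otimes>\<^sub>M ?M) borel" by measurable
  have "\<exists>B\<ge>0. \<forall>z. \<bar>partial_deriv b K z\<bar> \<le> B" if "b \<in> Basis" for b
    using test_fun_bounded[OF test_fun_partial_deriv[OF K that]] by metis
  then obtain BB where BB: "\<And>b z. b \<in> Basis \<Longrightarrow> \<bar>partial_deriv b K z\<bar> \<le> BB b" by metis
  define BD where "BD = (\<Sum>b\<in>Basis. \<bar>e \<bullet> b\<bar> * BB b)"
  have BD: "\<bar>D z\<bar> \<le> BD" for z
    unfolding D_def BD_def by (rule order_trans[OF sum_abs sum_mono]) (simp add: abs_mult mult_left_mono BB)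
  obtain BK where BK: "0 \<le> BK" "\<And>z. \<bar>K z\<bar> \<le> BK" using test_fun_bounded[OF K] by metis
  \<comment> \<open>The bound on \<open>w\<close> holds almost everywhere in \<Omega> and has to be
    lifted to the product slice by slice; both applications of Fubini rest on it.\<close>
  have bint: "integrable (?I \<Otimes>\<^sub>M ?M) (\<lambda>(s, z). w z * h (z - s *\<^sub>R e))"
    if w: "w \<in> Linf ?M" and h: "h \<in> borel_measurable borel" "\<And>z. \<bar>h z\<bar> \<le> B" "0 \<le> B" for w :: "'a \<Rightarrow> real" and h B
  proof -
    have [measurable]: "w \<in> borel_measurable ?M" by (rule Linf_measurable[OF w])
    note [measurable] = h(1)
    have hm: "(\<lambda>p. h (snd p - fst p *\<^sub>R e)) \<in> borel_measurable (?I \<Otimes>\<^sub>M ?M)"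
      using measurable_compose[OF trm h(1)] by (simp add: case_prod_beta')
    have wm: "(\<lambda>p. w (snd p)) \<in> borel_measurable (?I \<Otimes>\<^sub>M ?M)" by measurable
    define N where "N = {z \<in> space ?M. \<not> norm (w z) \<le> Linf_norm ?M w}"
    have "AE p in ?I \<Otimes>\<^sub>M ?M. norm (w (snd p)) \<le> Linf_norm ?M w"
    proof (rule P.AE_pair_measure)
      show "{p \<in> space (?I \<Otimes>\<^sub>M ?M). norm (w (snd p)) \<le> Linf_norm ?M w} \<in> sets (?I \<Otimes>\<^sub>M ?M)" by measurable
      show "AE s in ?I. AE z in ?M. norm (w (snd (s, z))) \<le> Linf_norm ?M w"
        using AE_le_Linf_norm[OF w] by simp
    qed
    then have "AE p in ?I \<Otimes>\<^sub>M ?M. norm (w (snd p) * h (snd p - fst p *\<^sub>R e)) \<le> Linf_norm ?M w * B"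
    proof eventually_elim
      case (elim p)
      then show ?case unfolding norm_mult using h(2)[of "snd p - fst p *\<^sub>R e"]
        by (intro mult_mono) (auto simp: Linf_norm_nonneg)
    qed
    then have "integrable (?I \<Otimes>\<^sub>M ?M) (\<lambda>p. w (snd p) * h (snd p - fst p *\<^sub>R e))"
      by (rule PF.integrable_const_bound) (use hm wm in simp)
    then show ?thesis by (simp add: case_prod_beta')
  qed
  have ftc: "K (z - e) - K z = (\<integral>s. - D (z - s *\<^sub>R e) \<partial>?I)" for z
  proof -
    have der: "((\<lambda>s. K (z - s *\<^sub>R e)) has_vector_derivative - D (z - s *\<^sub>R e)) (at s within {0..1})" for s
    proof -
      have s: "((\<lambda>s. z - s *\<^sub>R e) has_derivative (\<lambda>t. - (t *\<^sub>R e))) (at s within {0..1})"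
        by (auto intro!: derivative_eq_intros)
      have "((\<lambda>s. K (z - s *\<^sub>R e)) has_derivative (\<lambda>t. \<Sum>b\<in>Basis. (- (t *\<^sub>R e) \<bullet> b) * partial_deriv b K (z - s *\<^sub>R e))) (at s within {0..1})"
        by (rule has_derivative_compose[OF s frechet_derivative_sum_partial[OF K]])
      moreover have "(\<Sum>b\<in>Basis. (- (t *\<^sub>R e) \<bullet> b) * partial_deriv b K (z - s *\<^sub>R e)) = t *\<^sub>R (- D (z - s *\<^sub>R e))" for t
        by (simp add: D_def sum_distrib_left sum_negf mult.assoc)
      ultimately show ?thesis unfolding has_vector_derivative_def by simp
    qed
    have hi: "((\<lambda>s. - D (z - s *\<^sub>R e)) has_integral K (z - 1 *\<^sub>R e) - K (z - 0 *\<^sub>R e)) {0..1}"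
      by (rule fundamental_theorem_of_calculus) (use der in auto)
    have ii: "integrable ?I (\<lambda>s. - D (z - s *\<^sub>R e))"
      by (rule continuous_imp_integrable_real) (intro continuous_intros continuous_on_compose2[OF Dc]; simp)
    have "(\<integral>s. - D (z - s *\<^sub>R e) \<partial>?I) = integral {0..1} (\<lambda>s. - D (z - s *\<^sub>R e))"
      by (rule lebesgue_integral_eq_integral[OF ii]) simp
    then show ?thesis using integral_unique[OF hi] by simp
  qed
  have iK: "integrable ?M (\<lambda>z. v z * K (z - s *\<^sub>R e))" if "s \<in> {0..1}" for s
    by (rule integrable_Linf_mult[OF v test_fun_integrable_on[OF \<Omega>(1) Kt[OF that]]])
  \<comment> \<open>Here the weak gradient acts: for fixed s the translated kernel is an admissible
    test function, and the derivative passes from it to \<open>v\<close>.\<close>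
  have slice: "(\<integral>z. v z * D (z - s *\<^sub>R e) \<partial>?M) = - (\<integral>z. (g z \<bullet> e) * K (z - s *\<^sub>R e) \<partial>?M)" if s: "s \<in> {0..1}" for s
  proof -
    have i1: "integrable ?M (\<lambda>z. (e \<bullet> b) * (v z * partial_deriv b K (z - s *\<^sub>R e)))" if b: "b \<in> Basis" for b
    proof -
      have "integrable ?M (\<lambda>z. v z * partial_deriv b (\<lambda>z. K (z - s *\<^sub>R e)) z)"
        by (rule integrable_Linf_mult[OF v test_fun_integrable_on[OF \<Omega>(1) test_fun_partial_deriv[OF Kt[OF s] b]]])
      then show ?thesis unfolding test_fun_translate_partial[OF K] by simp
    qed
    have i2: "integrable ?M (\<lambda>z. (e \<bullet> b) * ((g z \<bullet> b) * K (z - s *\<^sub>R e)))" for b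
      using integrable_Linf_mult[OF Linf_inner_const[OF g] test_fun_integrable_on[OF \<Omega>(1) Kt[OF s]]] by simp
    have "(\<integral>z. v z * D (z - s *\<^sub>R e) \<partial>?M) = (\<integral>z. (\<Sum>b\<in>Basis. (e \<bullet> b) * (v z * partial_deriv b K (z - s *\<^sub>R e))) \<partial>?M)"
      by (simp only: D_def sum_distrib_left mult.left_commute)
    also have "\<dots> = (\<Sum>b\<in>Basis. (e \<bullet> b) * (\<integral>z. v z * partial_deriv b (\<lambda>z. K (z - s *\<^sub>R e)) z \<partial>?M))"
      unfolding test_fun_translate_partial[OF K]
      by (subst Bochner_Integration.integral_sum[OF i1]) simp_all
    also have "\<dots> = (\<Sum>b\<in>Basis. (e \<bullet> b) * - (\<integral>z. (g z \<bullet> b) * K (z - s *\<^sub>R e) \<partial>?M))"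
      by (rule sum.cong[OF refl]) (simp only: weak_gradientD[OF wg Kt[OF s]])
    also have "\<dots> = - (\<integral>z. (\<Sum>b\<in>Basis. (e \<bullet> b) * ((g z \<bullet> b) * K (z - s *\<^sub>R e))) \<partial>?M)"
      by (subst Bochner_Integration.integral_sum[OF i2]) (simp_all add: sum_negf)
    also have "(\<lambda>z. \<Sum>b\<in>Basis. (e \<bullet> b) * ((g z \<bullet> b) * K (z - s *\<^sub>R e))) = (\<lambda>z. (g z \<bullet> e) * K (z - s *\<^sub>R e))"
      by (rule ext, subst euclidean_inner[of _ e]) (simp add: sum_distrib_right sum_distrib_left mult_ac)
    finally show ?thesis .
  qed
  have "(\<integral>z. v z * K (z - e) \<partial>?M) - (\<integral>z. v z * K z \<partial>?M) = (\<integral>z. v z * (K (z - e) - K z) \<partial>?M)"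
    using Bochner_Integration.integral_diff[OF iK[of 1] iK[of 0]] by (simp add: right_diff_distrib)
  also have "\<dots> = (\<integral>z. (\<integral>s. v z * (- D (z - s *\<^sub>R e)) \<partial>?I) \<partial>?M)" unfolding ftc by simp
  also have "\<dots> = (\<integral>s. (\<integral>z. v z * (- D (z - s *\<^sub>R e)) \<partial>?M) \<partial>?I)"
    by (rule P.Fubini_integral) (rule bint[OF v, of "\<lambda>z. - D z" BD], use BD order_trans[OF abs_ge_zero BD] in auto)
  also have "\<dots> = (\<integral>s. (\<integral>z. (g z \<bullet> e) * K (z - s *\<^sub>R e) \<partial>?M) \<partial>?I)"
    by (rule Bochner_Integration.integral_cong[OF refl]) (simp add: slice)
  also have "\<dots> = (\<integral>z. (\<integral>s. (g z \<bullet> e) * K (z - s *\<^sub>R e) \<partial>?I) \<partial>?M)"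
    by (rule P.Fubini_integral[symmetric]) (rule bint[OF Linf_inner_const[OF g] Km BK(2,1)])
  also have "\<dots> = (\<integral>z. g z \<bullet> ((\<integral>s. K (z - s *\<^sub>R e) \<partial>?I) *\<^sub>R e) \<partial>?M)"
    by (rule Bochner_Integration.integral_cong[OF refl]) (simp add: mult.commute)
  finally show ?thesis .
qed

section \<open>Functions in \<open>V\<close>\<close>

locale torsion_domain =
  fixes \<Omega> \<Gamma>\<^sub>D :: "'a::euclidean_space set" and T :: real
  assumes lipschitz: "lipschitz_domain \<Omega>" and \<Gamma>_sub: "\<Gamma>\<^sub>D \<subseteq> frontier \<Omega>" and \<Gamma>_ne: "\<Gamma>\<^sub>D \<noteq> {}"
    and T_pos: "0 < T"
begin

abbreviation "M \<equiv> lebesgue_on \<Omega>"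
abbreviation "V \<equiv> W1inf_D \<Omega> \<Gamma>\<^sub>D"
abbreviation "vnorm \<equiv> V_norm \<Omega>"

lemma open_\<Omega>: "open \<Omega>" and connected_\<Omega>: "connected \<Omega>" and bounded_\<Omega>: "bounded \<Omega>" and \<Omega>_ne: "\<Omega> \<noteq> {}"
  using lipschitz by (auto simp: lipschitz_domain_def)

lemma lmeasurable_\<Omega>: "\<Omega> \<in> lmeasurable"
  by (rule lmeasurable_open[OF bounded_\<Omega> open_\<Omega>])

lemma finite_measure_M: "finite_measure M"
  by (rule finite_measure_lebesgue_on[OF lmeasurable_\<Omega>])

sublocale M: finite_measure M
  by (rule finite_measure_M)

lemma V_Linf: "v \<in> V \<Longrightarrow> v \<in> Linf M"
  by (simp add: W1inf_D_def)

lemma grad_props: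
  assumes "v \<in> V" shows "grad \<Omega> v \<in> Linf M" "weak_gradient \<Omega> v (grad \<Omega> v)"
proof -
  have "\<exists>g. g \<in> Linf M \<and> weak_gradient \<Omega> v g" using assms by (auto simp: W1inf_D_def)
  then have "grad \<Omega> v \<in> Linf M \<and> weak_gradient \<Omega> v (grad \<Omega> v)" unfolding grad_def by (rule someI_ex)
  then show "grad \<Omega> v \<in> Linf M" "weak_gradient \<Omega> v (grad \<Omega> v)" by auto
qed

lemma V_norm_nonneg: "0 \<le> vnorm v"
  by (simp add: V_norm_def Linf_norm_nonneg)

lemma V_diff: assumes "v \<in> V" "w \<in> V" shows "(\<lambda>x. v x - w x) \<in> V"
proof -
  obtain a where a: "continuous_on (closure \<Omega>) a" "AE x in M. v x = a x" "\<forall>x\<in>\<Gamma>\<^sub>D. a x = 0"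
    using assms(1) by (auto simp: W1inf_D_def)
  obtain b where b: "continuous_on (closure \<Omega>) b" "AE x in M. w x = b x" "\<forall>x\<in>\<Gamma>\<^sub>D. b x = 0"
    using assms(2) by (auto simp: W1inf_D_def)
  have "AE x in M. v x - w x = a x - b x" using a(2) b(2) by eventually_elim simp
  then have "\<exists>c. continuous_on (closure \<Omega>) c \<and> (AE x in M. v x - w x = c x) \<and> (\<forall>x\<in>\<Gamma>\<^sub>D. c x = 0)"
    using a b by (intro exI[of _ "\<lambda>x. a x - b x"]) (auto intro: continuous_on_diff)
  moreover have "weak_gradient \<Omega> (\<lambda>x. v x - w x) (\<lambda>x. grad \<Omega> v x - grad \<Omega> w x)"
    by (rule weak_gradient_diff[OF open_\<Omega>]) (use assms V_Linf grad_props in auto)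
  ultimately show ?thesis
    using Linf_diff[OF V_Linf[OF assms(1)] V_Linf[OF assms(2)]]
      Linf_diff[OF grad_props(1)[OF assms(1)] grad_props(1)[OF assms(2)]]
    unfolding W1inf_D_def by blast
qed

lemma grad_unique:
  assumes "v \<in> V" "g \<in> Linf M" "weak_gradient \<Omega> v g"
  shows "AE x in M. grad \<Omega> v x = g x"
  by (rule weak_gradient_unique[OF open_\<Omega> bounded_\<Omega> _ assms(2) _ assms(3)]) (use assms grad_props in auto)

lemma grad_diff:
  assumes "v \<in> V" "w \<in> V" shows "AE x in M. grad \<Omega> (\<lambda>x. v x - w x) x = grad \<Omega> v x - grad \<Omega> w x"
  by (rule grad_unique[OF V_diff[OF assms]])
    (use assms V_Linf grad_props open_\<Omega> in \<open>auto intro: Linf_diff weak_gradient_diff\<close>)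

lemma grad_AE_bound: "v \<in> V \<Longrightarrow> AE x in M. norm (grad \<Omega> v x) \<le> vnorm v"
  unfolding V_norm_def by (rule AE_le_Linf_norm[OF grad_props(1)])

lemma V_norm_diff_le:
  assumes "v \<in> V" "w \<in> V" shows "vnorm (\<lambda>x. v x - w x) \<le> vnorm v + vnorm w"
  unfolding V_norm_def[of _ "\<lambda>x. v x - w x"]
proof (rule Linf_norm_le)
  show "grad \<Omega> (\<lambda>x. v x - w x) \<in> borel_measurable M" using Linf_measurable[OF grad_props(1)[OF V_diff[OF assms]]] .
  show "AE x in M. norm (grad \<Omega> (\<lambda>x. v x - w x) x) \<le> vnorm v + vnorm w"
    using grad_diff[OF assms] grad_AE_bound[OF assms(1)] grad_AE_bound[OF assms(2)]
  proof eventually_elim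
    case (elim x)
    then show ?case using norm_triangle_ineq4[of "grad \<Omega> v x" "grad \<Omega> w x"] by simp
  qed
qed (simp add: V_norm_nonneg)

text \<open>Point values of an element of \<open>V\<close> are taken from this representative. They
  turn statements about classes into statements at points, where chains of segments can be used, and
  they make the boundary condition accessible.\<close>

definition crep :: "('a \<Rightarrow> real) \<Rightarrow> 'a \<Rightarrow> real" where
  "crep v = (SOME w. continuous_on (closure \<Omega>) w \<and> (AE x in M. v x = w x) \<and> (\<forall>x\<in>\<Gamma>\<^sub>D. w x = 0))"

lemma crep_props:
  assumes "v \<in> V"
  shows "continuous_on (closure \<Omega>) (crep v)" "AE x in M. v x = crep v x" "\<And>x. x \<in> \<Gamma>\<^sub>D \<Longrightarrow> crep v x = 0"
proof -
  have "\<exists>w. continuous_on (closure \<Omega>) w \<and> (AE x in M. v x = w x) \<and> (\<forall>x\<in>\<Gamma>\<^sub>D. w x = 0)"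
    using assms by (auto simp: W1inf_D_def)
  then have *: "continuous_on (closure \<Omega>) (crep v) \<and> (AE x in M. v x = crep v x) \<and> (\<forall>x\<in>\<Gamma>\<^sub>D. crep v x = 0)"
    unfolding crep_def by (rule someI_ex)
  then show "continuous_on (closure \<Omega>) (crep v)" "AE x in M. v x = crep v x" "\<And>x. x \<in> \<Gamma>\<^sub>D \<Longrightarrow> crep v x = 0" by auto
qed

lemma crep_measurable: "v \<in> V \<Longrightarrow> crep v \<in> borel_measurable M"
  using crep_props(1)[of v] continuous_on_subset[OF _ closure_subset[of \<Omega>]] open_\<Omega>
  by (intro continuous_imp_measurable_on_sets_lebesgue) auto

section \<open>Mollification and differences of point values\<close>

definition bump :: "real \<Rightarrow> 'a \<Rightarrow> 'a \<Rightarrow> real" where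
  "bump r x = box_bump 1 (x - r *\<^sub>R One) (x + r *\<^sub>R One)"

definition bump_mass :: "real \<Rightarrow> real" where
  "bump_mass r = (\<integral>z. bump r 0 z \<partial>lborel)"

lemma bump_translate: "bump r (x + p) z = bump r x (z - p)"
  unfolding bump_def box_bump_def by (simp add: inner_simps algebra_simps)

lemma box_bump_cbox_cball: "cbox ((x :: 'a) - r *\<^sub>R One) (x + r *\<^sub>R One) \<subseteq> cball x (\<bar>r\<bar> * real DIM('a))"
proof
  fix z assume z: "z \<in> cbox (x - r *\<^sub>R One) (x + r *\<^sub>R One)"
  have "norm (z - x) \<le> (\<Sum>i\<in>Basis. \<bar>(z - x) \<bullet> i\<bar>)" by (rule norm_le_l1)
  also have "\<dots> \<le> (\<Sum>i\<in>(Basis :: 'a set). \<bar>r\<bar>)"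
  proof (rule sum_mono)
    fix i :: 'a assume i: "i \<in> Basis"
    then have "x \<bullet> i - r \<le> z \<bullet> i" "z \<bullet> i \<le> x \<bullet> i + r" using z by (auto simp: mem_box inner_simps)
    then show "\<bar>(z - x) \<bullet> i\<bar> \<le> \<bar>r\<bar>" by (simp add: inner_diff_left)
  qed
  finally show "z \<in> cball x (\<bar>r\<bar> * real DIM('a))" by (simp add: dist_norm norm_minus_commute mult.commute)
qed

lemma bump_test_fun: assumes "cball x (\<bar>r\<bar> * real DIM('a)) \<subseteq> \<Omega>" shows "bump r x \<in> test_fun \<Omega>"
  unfolding bump_def by (rule box_bump_test_fun) (use assms box_bump_cbox_cball[of x r] in auto)

lemma bump_nonneg: "0 \<le> bump r x z"
  unfolding bump_def by (rule box_bump_range) simp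

lemma bump_le_1: "bump r x z \<le> 1"
  unfolding bump_def by (rule box_bump_range) simp

lemma bump_outside: "z \<notin> cball x (\<bar>r\<bar> * real DIM('a)) \<Longrightarrow> bump r x z = 0"
  unfolding bump_def
  by (rule box_bump_zero) (use box_bump_cbox_cball[of x r] box_subset_cbox in blast)

lemma bump_borel: "bump r x \<in> borel_measurable borel"
  unfolding bump_def
  by (rule borel_measurable_continuous_onI) (use box_bump_smooth[of 1 0] in simp)

lemma integral_bump:
  assumes "cball x (\<bar>r\<bar> * real DIM('a)) \<subseteq> \<Omega>" shows "(\<integral>z. bump r x z \<partial>M) = bump_mass r"
proof -
  have "(\<integral>z. bump r x z \<partial>M) = (\<integral>z. indicat_real \<Omega> z *\<^sub>R bump r x z \<partial>lebesgue)"
    by (rule integral_restrict_space) (use open_\<Omega> in auto)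
  also have "\<dots> = (\<integral>z. bump r x z \<partial>lebesgue)"
    by (rule Bochner_Integration.integral_cong[OF refl]) (use bump_outside[of _ x r] assms in \<open>fastforce simp: indicator_def\<close>)
  also have "\<dots> = (\<integral>z. bump r x z \<partial>lborel)" by (rule integral_completion) (use bump_borel in simp)
  also have "\<dots> = (\<integral>z. bump r x z \<partial>distr lborel borel ((+) x))" by (simp add: lborel_distr_plus)
  also have "\<dots> = (\<integral>z. bump r x (x + z) \<partial>lborel)" by (rule integral_distr) (use bump_borel in auto)
  also have "\<dots> = bump_mass r"
    unfolding bump_mass_def using bump_translate[of r 0 x] by (simp add: add.commute)
  finally show ?thesis .
qed

lemma bump_mass_pos: assumes r: "0 < r" shows "0 < bump_mass r"
proof -
  have i: "integrable lborel (bump r 0)"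
  proof -
    have "integrable lebesgue (bump r 0)"
      unfolding bump_def by (rule test_fun_integrable[OF box_bump_test_fun[of 1 _ _ UNIV]]) auto
    then show ?thesis using bump_borel integrable_completion[of "bump r 0" lborel] by simp
  qed
  have "bump_mass r \<noteq> 0"
  proof
    assume "bump_mass r = 0"
    then have "AE z in lborel. bump r 0 z = 0"
      unfolding bump_mass_def using integral_nonneg_eq_0_iff_AE[OF i] bump_nonneg by simp
    then have "AE z in lborel. z \<notin> box (- (r *\<^sub>R One)) (r *\<^sub>R One :: 'a)"
    proof eventually_elim
      case (elim z)
      show ?case
      proof
        assume "z \<in> box (- (r *\<^sub>R One)) (r *\<^sub>R One :: 'a)"
        from box_bump_pos[OF this, of 1] elim show False by (simp add: bump_def)
      qed
    qed
    then have "emeasure lborel (box (- (r *\<^sub>R One)) (r *\<^sub>R One :: 'a)) = 0"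
      by (subst (asm) AE_iff_measurable[OF _ refl]) auto
    moreover have "emeasure lborel (box (- (r *\<^sub>R One)) (r *\<^sub>R One :: 'a)) > 0"
      using r by (subst emeasure_lborel_box_eq) (auto simp: prod_pos inner_simps)
    ultimately show False by simp
  qed
  moreover have "0 \<le> bump_mass r" unfolding bump_mass_def by (rule Bochner_Integration.integral_nonneg) (rule bump_nonneg)
  ultimately show ?thesis by simp
qed

text \<open>Continuity is asked at the single point \<open>x\<close>, so that the lemma serves both
  \<open>crep\<close> at interior points and test functions.\<close>

lemma bump_average_tendsto_isCont:
  assumes v: "v \<in> Linf M" and vw: "AE z in M. v z = w z" and wc: "isCont w x" and x: "x \<in> \<Omega>" and r: "\<And>n. 0 < r n" "r \<longlonglongrightarrow> 0"
  shows "(\<lambda>n. (\<integral>z. v z * bump (r n) x z \<partial>M) / bump_mass (r n)) \<longlonglongrightarrow> w x"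
proof (rule LIMSEQ_I)
  fix e :: real assume e: "0 < e"
  from wc obtain d where d: "0 < d" "\<And>z. dist z x < d \<Longrightarrow> dist (w z) (w x) < e / 2"
    using e unfolding continuous_at_eps_delta by (metis half_gt_zero)
  obtain d' where d': "0 < d'" "ball x d' \<subseteq> \<Omega>" using open_\<Omega> x open_contains_ball by blast
  have "(\<lambda>n. r n * real DIM('a)) \<longlonglongrightarrow> 0 * real DIM('a)" by (intro tendsto_mult r tendsto_const)
  then have "\<forall>\<^sub>F n in sequentially. r n * real DIM('a) < min d d'" using d(1) d'(1) by (intro order_tendstoD(2)) auto
  then obtain N where N: "\<And>n. N \<le> n \<Longrightarrow> r n * real DIM('a) < min d d'" by (auto simp: eventually_sequentially)
  show "\<exists>N. \<forall>n\<ge>N. norm ((\<integral>z. v z * bump (r n) x z \<partial>M) / bump_mass (r n) - w x) < e"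
  proof (intro exI allI impI)
    fix n assume n: "N \<le> n"
    have sub: "cball x (\<bar>r n\<bar> * real DIM('a)) \<subseteq> ball x (min d d')" using N[OF n] r(1)[of n] by auto
    have "ball x (min d d') \<subseteq> ball x d'" by (rule subset_ball) simp
    with sub have cb: "cball x (\<bar>r n\<bar> * real DIM('a)) \<subseteq> \<Omega>" using d'(2) by (meson order_trans)
    note tf = bump_test_fun[OF cb]
    have bi: "integrable M (bump (r n) x)" by (rule test_fun_integrable_on[OF open_\<Omega> tf])
    have vi: "integrable M (\<lambda>z. v z * bump (r n) x z)" by (rule integrable_Linf_mult[OF v bi])
    have c: "0 < bump_mass (r n)" by (rule bump_mass_pos[OF r(1)])
    have "\<bar>(\<integral>z. v z * bump (r n) x z \<partial>M) - w x * bump_mass (r n)\<bar> = \<bar>\<integral>z. v z * bump (r n) x z - w x * bump (r n) x z \<partial>M\<bar>"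
      using Bochner_Integration.integral_diff[OF vi, of "\<lambda>z. w x * bump (r n) x z"] bi integral_bump[OF cb] by simp
    also have "\<dots> \<le> (\<integral>z. (e / 2) * bump (r n) x z \<partial>M)"
    proof (rule order_trans[OF integral_abs_bound integral_mono_AE])
      show "integrable M (\<lambda>z. \<bar>v z * bump (r n) x z - w x * bump (r n) x z\<bar>)" using vi bi by simp
      show "integrable M (\<lambda>z. (e / 2) * bump (r n) x z)" using bi by simp
      show "AE z in M. \<bar>v z * bump (r n) x z - w x * bump (r n) x z\<bar> \<le> (e / 2) * bump (r n) x z"
        using vw
      proof eventually_elim
        case (elim z)
        show ?case
        proof (cases "z \<in> cball x (\<bar>r n\<bar> * real DIM('a))")
          case True
          then have "z \<in> ball x (min d d')" using sub by (rule subsetD[rotated])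
          then have "dist z x < d" by (simp add: dist_commute)
          then have "\<bar>w z - w x\<bar> \<le> e / 2" using d(2)[of z] by (simp add: dist_real_def)
          then show ?thesis unfolding elim left_diff_distrib[symmetric] abs_mult abs_of_nonneg[OF bump_nonneg]
            by (rule mult_right_mono) (rule bump_nonneg)
        qed (simp add: bump_outside)
      qed
    qed
    also have "\<dots> = (e / 2) * bump_mass (r n)" using integral_bump[OF cb] by simp
    finally have "\<bar>(\<integral>z. v z * bump (r n) x z \<partial>M) - w x * bump_mass (r n)\<bar> \<le> (e / 2) * bump_mass (r n)" .
    moreover have "(\<integral>z. v z * bump (r n) x z \<partial>M) / bump_mass (r n) - w x = ((\<integral>z. v z * bump (r n) x z \<partial>M) - w x * bump_mass (r n)) / bump_mass (r n)"
      using c by (simp add: field_simps)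
    ultimately have "\<bar>(\<integral>z. v z * bump (r n) x z \<partial>M) / bump_mass (r n) - w x\<bar> \<le> e / 2"
      using c by (simp add: abs_divide divide_le_eq)
    then show "norm ((\<integral>z. v z * bump (r n) x z \<partial>M) / bump_mass (r n) - w x) < e" using e by simp
  qed
qed

lemma bump_average_tendsto:
  assumes v: "v \<in> V" and x: "x \<in> \<Omega>" and r: "\<And>n. 0 < r n" "r \<longlonglongrightarrow> 0"
  shows "(\<lambda>n. (\<integral>z. v z * bump (r n) x z \<partial>M) / bump_mass (r n)) \<longlonglongrightarrow> crep v x"
proof (rule bump_average_tendsto_isCont[OF V_Linf[OF v] crep_props(2)[OF v] _ x r])
  show "isCont (crep v) x"
    using crep_props(1)[OF v] continuous_on_interior[of "closure \<Omega>" "crep v" x] x open_\<Omega> interior_mono[OF closure_subset[of \<Omega>]]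
    by (auto simp: interior_open)
qed

text \<open>The fields \<psi> are mollified copies of the segment from x to y, and they do not
  depend on v. This pays twice: their L1 bound gives the Lipschitz estimate, and for a curve in
  \<open>Linf_wstar\<close> the pairings are measurable in time, hence so are differences of point
  values.\<close>

lemma crep_difference_limit:
  assumes seg: "closed_segment x y \<subseteq> \<Omega>"
  shows "\<exists>\<psi>::nat \<Rightarrow> 'a \<Rightarrow> 'a. (\<forall>n. integrable M (\<psi> n) \<and> (\<integral>z. norm (\<psi> n z) \<partial>M) \<le> norm (y - x)) \<and>
    (\<forall>v\<in>V. (\<lambda>n. \<integral>z. grad \<Omega> v z \<bullet> \<psi> n z \<partial>M) \<longlonglongrightarrow> crep v y - crep v x)"
proof -
  obtain \<epsilon> where \<epsilon>: "\<epsilon> > 0" "(\<Union>p\<in>closed_segment x y. ball p \<epsilon>) \<subseteq> \<Omega>"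
    using compact_subset_open_imp_ball_epsilon_subset[OF compact_segment open_\<Omega> seg] by blast
  define e where "e = y - x"
  \<comment> \<open>The support of \<open>bump r\<close> lies in a ball of radius
    \<open>r * DIM('a)\<close>; with this choice it stays within \<epsilon> / 2 of the
    segment.\<close>
  define r where "r n = \<epsilon> / (2 * real DIM('a)) * inverse (real (Suc n))" for n
  have D: "0 < real DIM('a)" by simp
  have r: "\<And>n. 0 < r n" using \<epsilon>(1) D by (simp add: r_def)
  have r0: "r \<longlonglongrightarrow> 0" unfolding r_def by (rule tendsto_mult_right_zero[OF LIMSEQ_inverse_real_of_nat])
  have rD: "\<bar>r n\<bar> * real DIM('a) < \<epsilon>" for n
  proof -
    have "r n * real DIM('a) = \<epsilon> / 2 * inverse (real (Suc n))" using D by (simp add: r_def)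
    also have "\<dots> \<le> \<epsilon> / 2 * 1" using \<epsilon>(1) by (intro mult_left_mono) (auto simp: inverse_eq_divide)
    finally show ?thesis using r[of n] \<epsilon>(1) by simp
  qed
  have pt: "x + s *\<^sub>R e \<in> closed_segment x y" if "s \<in> {0..1}" for s
    using that by (auto simp: in_segment e_def algebra_simps intro!: exI[of _ s])
  have cb: "cball (x + s *\<^sub>R e) (\<bar>r n\<bar> * real DIM('a)) \<subseteq> \<Omega>" if "s \<in> {0..1}" for s n
  proof -
    have "cball (x + s *\<^sub>R e) (\<bar>r n\<bar> * real DIM('a)) \<subseteq> ball (x + s *\<^sub>R e) \<epsilon>" using rD[of n] by auto
    then show ?thesis using \<epsilon>(2) pt[OF that] by blast
  qed
  have cbx: "cball x (\<bar>r n\<bar> * real DIM('a)) \<subseteq> \<Omega>" and cby: "cball y (\<bar>r n\<bar> * real DIM('a)) \<subseteq> \<Omega>" for n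
    using cb[of 0 n] cb[of 1 n] by (auto simp: e_def)
  define K where "K n = bump (r n) x" for n
  have Kt: "(\<lambda>z. K n (z - s *\<^sub>R e)) = bump (r n) (x + s *\<^sub>R e)" for n s
    by (simp add: K_def bump_translate fun_eq_iff)
  have Ke: "K n (z - e) = bump (r n) y z" for n z
    using bump_translate[of "r n" x e z] by (simp add: K_def e_def)
  have Ktf: "(\<lambda>z. K n (z - s *\<^sub>R e)) \<in> test_fun \<Omega>" if "s \<in> {0..1}" for n s
    unfolding Kt by (rule bump_test_fun[OF cb[OF that]])
  have K: "K n \<in> test_fun \<Omega>" for n unfolding K_def by (rule bump_test_fun[OF cbx])
  define \<Psi> where "\<Psi> n z = (\<integral>s. K n (z - s *\<^sub>R e) \<partial>lebesgue_on {0..1})" for n z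
  define \<psi> where "\<psi> n z = (\<Psi> n z / bump_mass (r n)) *\<^sub>R e" for n z
  let ?I = "lebesgue_on {0..1::real}"
  interpret I: finite_measure ?I by (rule finite_measure_lebesgue_on) simp
  interpret P: pair_sigma_finite ?I M ..
  interpret PF: finite_measure "?I \<Otimes>\<^sub>M M" by (rule finite_measure_pair_measure) unfold_locales
  have bm: "0 < bump_mass (r n)" for n by (rule bump_mass_pos[OF r])
  have Pi: "integrable (?I \<Otimes>\<^sub>M M) (\<lambda>(s, z). K n (z - s *\<^sub>R e))" for n
  proof -
    have [measurable]: "(\<lambda>z. z) \<in> measurable M borel"
      by (rule lebesgue_measurable_of_continuous) (rule continuous_on_id)
    have [measurable]: "(\<lambda>s. s) \<in> measurable ?I borel"
      by (rule lebesgue_measurable_of_continuous) (rule continuous_on_id)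
    have trm: "(\<lambda>p. snd p - fst p *\<^sub>R e) \<in> measurable (?I \<Otimes>\<^sub>M M) borel" by measurable
    have "integrable (?I \<Otimes>\<^sub>M M) (\<lambda>p. K n (snd p - fst p *\<^sub>R e))"
    proof (rule PF.integrable_const_bound[where B=1])
      show "(\<lambda>p. K n (snd p - fst p *\<^sub>R e)) \<in> borel_measurable (?I \<Otimes>\<^sub>M M)"
        by (rule measurable_compose[OF trm test_fun_measurable[OF K]])
      show "AE p in ?I \<Otimes>\<^sub>M M. norm (K n (snd p - fst p *\<^sub>R e)) \<le> 1"
        by (intro AE_I2) (simp add: K_def bump_nonneg bump_le_1)
    qed
    then show ?thesis by (simp add: case_prod_beta')
  qed
  have \<Psi>i: "integrable M (\<Psi> n)" for n unfolding \<Psi>_def using P.integrable_snd[OF Pi] by simp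
  have \<Psi>0: "0 \<le> \<Psi> n z" for n z unfolding \<Psi>_def
    by (rule Bochner_Integration.integral_nonneg) (simp add: K_def bump_nonneg)
  \<comment> \<open>By Fubini the averaged kernel has the mass of each single translate, so after
    division by it the L1 norm of the field is the length of the segment.\<close>
  have \<Psi>I: "(\<integral>z. \<Psi> n z \<partial>M) = bump_mass (r n)" for n
  proof -
    have "(\<integral>z. \<Psi> n z \<partial>M) = (\<integral>s. (\<integral>z. K n (z - s *\<^sub>R e) \<partial>M) \<partial>?I)"
      unfolding \<Psi>_def by (rule P.Fubini_integral[OF Pi])
    also have "\<dots> = (\<integral>s. bump_mass (r n) \<partial>?I)"
      by (rule Bochner_Integration.integral_cong[OF refl]) (simp add: Kt integral_bump[OF cb])
    also have "\<dots> = bump_mass (r n)" by (simp add: measure_restrict_space)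
    finally show ?thesis .
  qed
  have \<psi>i: "integrable M (\<psi> n)" for n unfolding \<psi>_def using \<Psi>i by simp
  have "(\<integral>z. norm (\<psi> n z) \<partial>M) \<le> norm (y - x)" for n
  proof -
    have "(\<integral>z. norm (\<psi> n z) \<partial>M) = (\<integral>z. \<Psi> n z * (norm e / bump_mass (r n)) \<partial>M)"
      unfolding \<psi>_def using \<Psi>0 bm[of n] by (simp add: abs_of_nonneg less_imp_le)
    also have "\<dots> = bump_mass (r n) * (norm e / bump_mass (r n))" using \<Psi>I[of n] by simp
    finally show ?thesis using bm[of n] by (simp add: e_def)
  qed
  moreover have "(\<lambda>n. \<integral>z. grad \<Omega> v z \<bullet> \<psi> n z \<partial>M) \<longlonglongrightarrow> crep v y - crep v x" if v: "v \<in> V" for v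
  proof -
    have "(\<integral>z. grad \<Omega> v z \<bullet> \<psi> n z \<partial>M) = (\<integral>z. v z * bump (r n) y z \<partial>M) / bump_mass (r n) - (\<integral>z. v z * bump (r n) x z \<partial>M) / bump_mass (r n)" for n
    proof -
      have "(\<integral>z. v z * bump (r n) y z \<partial>M) - (\<integral>z. v z * bump (r n) x z \<partial>M) = (\<integral>z. grad \<Omega> v z \<bullet> (\<Psi> n z *\<^sub>R e) \<partial>M)"
      proof -
        have "(\<integral>z. v z * K n (z - e) \<partial>M) - (\<integral>z. v z * K n z \<partial>M) = (\<integral>z. grad \<Omega> v z \<bullet> (\<Psi> n z *\<^sub>R e) \<partial>M)"
          unfolding \<Psi>_def
          by (rule translation_identity[OF open_\<Omega> bounded_\<Omega> V_Linf[OF v] grad_props[OF v] K]) (rule Ktf)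
        then show ?thesis unfolding Ke unfolding K_def .
      qed
      also have "\<dots> = (\<integral>z. (grad \<Omega> v z \<bullet> \<psi> n z) * bump_mass (r n) \<partial>M)"
        unfolding \<psi>_def using bm[of n] by simp
      finally show ?thesis using bm[of n] by (simp add: field_simps)
    qed
    then show ?thesis
      using tendsto_diff[OF bump_average_tendsto[OF v _ r r0, of y] bump_average_tendsto[OF v _ r r0, of x]] seg by auto
  qed
  ultimately show ?thesis using \<psi>i by (intro exI[of _ \<psi>]) auto
qed

section \<open>Lipschitz estimates and the Poincare inequality\<close>

lemma integral_grad_bound:
  assumes "v \<in> V" "integrable M \<psi>"
  shows "\<bar>\<integral>x. \<psi> x \<bullet> grad \<Omega> v x \<partial>M\<bar> \<le> (\<integral>x. norm (\<psi> x) \<partial>M) * vnorm v"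
  unfolding V_norm_def by (rule integral_inner_Linf_bound[OF assms(2) grad_props(1)[OF assms(1)]])

lemma crep_lipschitz:
  assumes seg: "closed_segment x y \<subseteq> \<Omega>" and v: "v \<in> V"
  shows "\<bar>crep v y - crep v x\<bar> \<le> norm (y - x) * vnorm v"
proof -
  obtain \<psi> :: "nat \<Rightarrow> 'a \<Rightarrow> 'a" where \<psi>: "\<And>n. integrable M (\<psi> n)" "\<And>n. (\<integral>z. norm (\<psi> n z) \<partial>M) \<le> norm (y - x)"
    and lim: "(\<lambda>n. \<integral>z. grad \<Omega> v z \<bullet> \<psi> n z \<partial>M) \<longlonglongrightarrow> crep v y - crep v x"
    using crep_difference_limit[OF seg] v by blast
  have "\<bar>\<integral>z. grad \<Omega> v z \<bullet> \<psi> n z \<partial>M\<bar> \<le> norm (y - x) * vnorm v" for n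
    using order_trans[OF integral_grad_bound[OF v \<psi>(1)] mult_right_mono[OF \<psi>(2) V_norm_nonneg]]
    by (simp add: inner_commute)
  then show ?thesis
    by (intro tendsto_upperbound[OF tendsto_rabs[OF lim]]) auto
qed

text \<open>The constant may depend on the two points but not on v. Being an equivalence relation
  with open classes, it relates any two points of the connected set \<Omega>, although the segment
  between them may leave \<Omega>.\<close>

definition linked :: "'a \<Rightarrow> 'a \<Rightarrow> bool" where
  "linked x y \<longleftrightarrow> (\<exists>C\<ge>0. \<forall>v\<in>V. \<bar>crep v x - crep v y\<bar> \<le> C * vnorm v)"

lemma linked_trans: "linked x y \<Longrightarrow> linked y z \<Longrightarrow> linked x z"
proof -
  assume "linked x y" "linked y z"
  then obtain C D where C: "C \<ge> 0" "\<forall>v\<in>V. \<bar>crep v x - crep v y\<bar> \<le> C * vnorm v"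
    and D: "D \<ge> 0" "\<forall>v\<in>V. \<bar>crep v y - crep v z\<bar> \<le> D * vnorm v" unfolding linked_def by blast
  have "\<bar>crep v x - crep v z\<bar> \<le> (C + D) * vnorm v" if "v \<in> V" for v
    unfolding distrib_right using bspec[OF C(2) that] bspec[OF D(2) that] by linarith
  then show ?thesis unfolding linked_def using C(1) D(1) by (intro exI[of _ "C + D"]) auto
qed

lemma linked_\<Omega>: assumes "x \<in> \<Omega>" "y \<in> \<Omega>" shows "linked x y"
proof (rule connected_equivalence_relation[OF connected_\<Omega> assms])
  show "\<And>x y z. linked x y \<Longrightarrow> linked y z \<Longrightarrow> linked x z" by (rule linked_trans)
  show "\<And>x y. linked x y \<Longrightarrow> linked y x" unfolding linked_def by (simp add: abs_minus_commute)
  fix a assume a: "a \<in> \<Omega>"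
  then obtain d where d: "0 < d" "ball a d \<subseteq> \<Omega>" using open_\<Omega> open_contains_ball by blast
  have "linked a z" if z: "z \<in> ball a d" for z
  proof -
    have "closed_segment z a \<subseteq> ball a d" by (rule closed_segment_subset) (use z d(1) in auto)
    then have "\<bar>crep v a - crep v z\<bar> \<le> norm (a - z) * vnorm v" if "v \<in> V" for v
      using crep_lipschitz[OF _ that] d(2) by blast
    then show ?thesis unfolding linked_def by (intro exI[of _ "norm (a - z)"]) auto
  qed
  then show "\<exists>T. openin (top_of_set \<Omega>) T \<and> a \<in> T \<and> (\<forall>x\<in>T. linked a x)"
    using d by (intro exI[of _ "ball a d"]) (auto simp: open_subset)
qed

text \<open>The constant has to be uniform up to the boundary, while the segment from x to q may
  leave \<Omega>. From x one first climbs by \<open>h\<close> in direction \<nu>, which stays above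
  the graph, and then moves across at that height, which the Lipschitz graph cannot reach near
  \<open>p\<close>.\<close>

lemma near_frontier:
  assumes p: "p \<in> frontier \<Omega>"
  shows "\<exists>\<delta>>0. \<exists>q\<in>\<Omega>. \<exists>C\<ge>0. \<forall>x\<in>\<Omega> \<inter> ball p \<delta>. \<forall>v\<in>V. \<bar>crep v x - crep v q\<bar> \<le> C * vnorm v"
proof -
  have "\<exists>\<nu> \<gamma> L U. norm \<nu> = 1 \<and> L-lipschitz_on {y. y \<bullet> \<nu> = 0} \<gamma> \<and> open U \<and> p \<in> U \<and>
      \<Omega> \<inter> U = {x \<in> U. \<gamma> (x - (x \<bullet> \<nu>) *\<^sub>R \<nu>) < x \<bullet> \<nu>}"
    using lipschitz p unfolding lipschitz_domain_def by blast
  then obtain \<nu> \<gamma> L U where \<nu>: "norm \<nu> = 1" and L: "L-lipschitz_on {y. y \<bullet> \<nu> = 0} \<gamma>"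
    and U: "open U" "p \<in> U" and \<Omega>U: "\<Omega> \<inter> U = {x \<in> U. \<gamma> (x - (x \<bullet> \<nu>) *\<^sub>R \<nu>) < x \<bullet> \<nu>}" by blast
  define \<pi> where "\<pi> x = x - (x \<bullet> \<nu>) *\<^sub>R \<nu>" for x
  have mem: "x \<in> \<Omega> \<longleftrightarrow> \<gamma> (\<pi> x) < x \<bullet> \<nu>" if "x \<in> U" for x using \<Omega>U that by (auto simp: \<pi>_def)
  have \<nu>\<nu>: "\<nu> \<bullet> \<nu> = 1" using \<nu> by (simp add: dot_square_norm)
  have L0: "0 \<le> L" by (rule lipschitz_on_nonneg[OF L])
  have \<pi>0: "\<pi> x \<bullet> \<nu> = 0" for x by (simp add: \<pi>_def inner_diff_left \<nu>\<nu>)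
  have \<pi>s: "\<pi> (x + s *\<^sub>R \<nu>) = \<pi> x" for x s by (simp add: \<pi>_def inner_add_left \<nu>\<nu> algebra_simps)
  have \<pi>d: "norm (\<pi> x - \<pi> y) \<le> 2 * norm (x - y)" for x y
  proof -
    have "\<pi> x - \<pi> y = (x - y) - ((x - y) \<bullet> \<nu>) *\<^sub>R \<nu>" by (simp add: \<pi>_def inner_diff_left algebra_simps)
    also have "norm \<dots> \<le> norm (x - y) + norm (((x - y) \<bullet> \<nu>) *\<^sub>R \<nu>)" by (rule norm_triangle_ineq4)
    also have "norm (((x - y) \<bullet> \<nu>) *\<^sub>R \<nu>) \<le> norm (x - y)" using Cauchy_Schwarz_ineq2[of "x - y" \<nu>] \<nu> by simp
    finally show ?thesis by simp
  qed
  have \<gamma>d: "\<bar>\<gamma> (\<pi> x) - \<gamma> (\<pi> y)\<bar> \<le> 2 * L * norm (x - y)" for x y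
  proof -
    have "\<bar>\<gamma> (\<pi> x) - \<gamma> (\<pi> y)\<bar> \<le> L * norm (\<pi> x - \<pi> y)"
      using lipschitz_onD[OF L, of "\<pi> x" "\<pi> y"] \<pi>0 by (simp add: dist_norm)
    also have "\<dots> \<le> L * (2 * norm (x - y))" by (rule mult_left_mono[OF \<pi>d L0])
    finally show ?thesis by simp
  qed
  have \<nu>d: "\<bar>x \<bullet> \<nu> - y \<bullet> \<nu>\<bar> \<le> norm (x - y)" for x y
    using Cauchy_Schwarz_ineq2[of "x - y" \<nu>] \<nu> by (simp add: inner_diff_left)
  have pc: "p \<in> closure \<Omega>" using p by (simp add: frontier_def)
  \<comment> \<open>\<open>p\<close> lies in the closure only, so it satisfies the graph inequality
    in its weak form, as a limit of points of \<Omega>.\<close>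
  have gp: "\<gamma> (\<pi> p) \<le> p \<bullet> \<nu>"
  proof (rule field_le_epsilon)
    fix e :: real assume e: "0 < e"
    obtain d where d: "0 < d" "ball p d \<subseteq> U" using U open_contains_ball by blast
    have "0 < min d (e / (2 * L + 1))" using d e L0 by simp
    then obtain z where z: "z \<in> \<Omega>" "dist z p < min d (e / (2 * L + 1))" using pc unfolding closure_approachable by blast
    have zU: "z \<in> U" using d(2) z(2) by (auto simp: dist_commute)
    have "\<gamma> (\<pi> z) < z \<bullet> \<nu>" using z(1) mem[OF zU] by simp
    moreover have "\<gamma> (\<pi> p) \<le> \<gamma> (\<pi> z) + 2 * L * norm (z - p)" using \<gamma>d[of z p] by linarith
    moreover have "z \<bullet> \<nu> \<le> p \<bullet> \<nu> + norm (z - p)" using \<nu>d[of z p] by linarith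
    ultimately have "\<gamma> (\<pi> p) \<le> p \<bullet> \<nu> + (2 * L + 1) * norm (z - p)" by (simp add: algebra_simps)
    moreover have "(2 * L + 1) * norm (z - p) \<le> e"
      using z(2) L0 by (simp add: dist_norm field_simps)
    ultimately show "\<gamma> (\<pi> p) \<le> p \<bullet> \<nu> + e" by linarith
  qed
  obtain R where R: "0 < R" "ball p R \<subseteq> U" using U open_contains_ball by blast
  \<comment> \<open>The path has to stay in \<open>ball p R\<close>, which asks for \<delta> +
    \<open>h\<close> < \<open>R\<close>. The climb \<open>h\<close> has to exceed \<delta> (1 + 2
    L), the depth to which a point within \<delta> of \<open>p\<close> may lie below the
    graph.\<close>
  define h where "h = R / 3"
  define \<delta> where "\<delta> = h / (2 + 2 * L)"
  have h: "0 < h" using R by (simp add: h_def)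
  have \<delta>: "0 < \<delta>" using h L0 by (simp add: \<delta>_def)
  have "\<delta> * (2 + 2 * L) = h" using L0 by (simp add: \<delta>_def)
  then have "2 * \<delta> + 2 * (L * \<delta>) = h" by (simp add: algebra_simps)
  moreover have "0 \<le> L * \<delta>" using L0 \<delta> by simp
  ultimately have \<delta>h: "\<delta> * (1 + 2 * L) < h" "\<delta> < h" using \<delta> by (simp_all add: algebra_simps)
  have inU: "z + s *\<^sub>R \<nu> \<in> U" if "norm (z - p) < \<delta>" "0 \<le> s" "s \<le> h" for z s
  proof -
    have "norm ((z + s *\<^sub>R \<nu>) - p) \<le> norm (z - p) + norm (s *\<^sub>R \<nu>)"
      using norm_triangle_ineq[of "z - p" "s *\<^sub>R \<nu>"] by (simp add: algebra_simps)
    also have "\<dots> < \<delta> + h" using that \<nu> by simp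
    also have "\<dots> < R" using \<delta>h(2) h by (simp add: h_def)
    finally show ?thesis using R(2) by (auto simp: dist_norm norm_minus_commute)
  qed
  have top: "z + h *\<^sub>R \<nu> \<in> \<Omega>" if z: "norm (z - p) < \<delta>" for z
  proof -
    have "\<gamma> (\<pi> z) \<le> \<gamma> (\<pi> p) + 2 * L * norm (z - p)" using \<gamma>d[of z p] by linarith
    also have "\<dots> \<le> p \<bullet> \<nu> + 2 * L * norm (z - p)" using gp by simp
    also have "\<dots> \<le> z \<bullet> \<nu> + norm (z - p) + 2 * L * norm (z - p)" using \<nu>d[of z p] by linarith
    also have "\<dots> = z \<bullet> \<nu> + norm (z - p) * (1 + 2 * L)" by (simp add: algebra_simps)
    also have "\<dots> \<le> z \<bullet> \<nu> + \<delta> * (1 + 2 * L)" using z L0 by (intro add_left_mono mult_right_mono) auto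
    also have "\<dots> < z \<bullet> \<nu> + h" using \<delta>h by simp
    finally have "\<gamma> (\<pi> z) < z \<bullet> \<nu> + h" .
    moreover have "z + h *\<^sub>R \<nu> \<in> U" by (rule inU[OF z]) (use h in auto)
    ultimately show ?thesis using mem[of "z + h *\<^sub>R \<nu>"] by (simp add: \<pi>s inner_add_left \<nu>\<nu>)
  qed
  define q where "q = p + h *\<^sub>R \<nu>"
  have q: "q \<in> \<Omega>" unfolding q_def by (rule top) (use \<delta> in simp)
  have main: "\<bar>crep v x - crep v q\<bar> \<le> (h + \<delta>) * vnorm v" if x: "x \<in> \<Omega>" "x \<in> ball p \<delta>" and v: "v \<in> V" for x v
  proof -
    have xp: "norm (x - p) < \<delta>" using x(2) by (simp add: dist_norm norm_minus_commute)
    define y where "y = x + h *\<^sub>R \<nu>"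
    have xU: "x \<in> U" using inU[OF xp, of 0] h by simp
    have s1: "closed_segment x y \<subseteq> \<Omega>"
    proof
      fix z assume "z \<in> closed_segment x y"
      then obtain s where s: "0 \<le> s" "s \<le> 1" "z = (1 - s) *\<^sub>R x + s *\<^sub>R y" by (auto simp: in_segment)
      have z: "z = x + (s * h) *\<^sub>R \<nu>" by (simp add: s(3) y_def algebra_simps)
      have sh: "0 \<le> s * h" "s * h \<le> h" using s h by (auto simp: mult_left_le_one_le)
      have "z \<in> U" unfolding z by (rule inU[OF xp sh])
      moreover have "\<gamma> (\<pi> x) < x \<bullet> \<nu>" using x(1) mem[OF xU] by simp
      ultimately show "z \<in> \<Omega>" using mem[of z] sh(1) by (simp add: z \<pi>s inner_add_left \<nu>\<nu>)
    qed
    have s2: "closed_segment y q \<subseteq> \<Omega>"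
    proof
      fix z assume "z \<in> closed_segment y q"
      then obtain s where s: "0 \<le> s" "s \<le> 1" "z = (1 - s) *\<^sub>R y + s *\<^sub>R q" by (auto simp: in_segment)
      have z: "z = ((1 - s) *\<^sub>R x + s *\<^sub>R p) + h *\<^sub>R \<nu>" by (simp add: s(3) y_def q_def algebra_simps)
      have "((1 - s) *\<^sub>R x + s *\<^sub>R p) - p = (1 - s) *\<^sub>R (x - p)" by (simp add: algebra_simps)
      then have "norm (((1 - s) *\<^sub>R x + s *\<^sub>R p) - p) \<le> 1 * norm (x - p)" using s by (simp add: mult_left_le_one_le)
      then show "z \<in> \<Omega>" unfolding z using xp by (intro top) simp
    qed
    have "\<bar>crep v y - crep v x\<bar> \<le> norm (y - x) * vnorm v" by (rule crep_lipschitz[OF s1 v])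
    moreover have "norm (y - x) = h" using \<nu> h by (simp add: y_def)
    moreover have "\<bar>crep v q - crep v y\<bar> \<le> norm (q - y) * vnorm v" by (rule crep_lipschitz[OF s2 v])
    moreover have "norm (q - y) * vnorm v \<le> \<delta> * vnorm v"
      using xp V_norm_nonneg by (intro mult_right_mono) (auto simp: q_def y_def norm_minus_commute)
    ultimately show ?thesis by (simp add: distrib_right)
  qed
  have A: "\<forall>x\<in>\<Omega> \<inter> ball p \<delta>. \<forall>v\<in>V. \<bar>crep v x - crep v q\<bar> \<le> (h + \<delta>) * vnorm v" using main by blast
  have "0 \<le> h + \<delta>" using h \<delta> by simp
  then show ?thesis using \<delta> q A by blast
qed

lemma near_closure:
  assumes p: "p \<in> closure \<Omega>"
  shows "\<exists>\<delta>>0. \<exists>q\<in>\<Omega>. \<exists>C\<ge>0. \<forall>x\<in>\<Omega> \<inter> ball p \<delta>. \<forall>v\<in>V. \<bar>crep v x - crep v q\<bar> \<le> C * vnorm v"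
proof (cases "p \<in> \<Omega>")
  case False
  then show ?thesis using near_frontier p open_\<Omega> by (simp add: frontier_def interior_open)
next
  case True
  then obtain d where d: "0 < d" "ball p d \<subseteq> \<Omega>" using open_\<Omega> open_contains_ball by blast
  have "\<bar>crep v x - crep v p\<bar> \<le> d * vnorm v" if x: "x \<in> ball p d" and v: "v \<in> V" for x v
  proof -
    have "closed_segment p x \<subseteq> ball p d" by (rule closed_segment_subset) (use x d(1) in auto)
    then have "\<bar>crep v x - crep v p\<bar> \<le> norm (x - p) * vnorm v" using crep_lipschitz[OF _ v] d(2) by blast
    also have "\<dots> \<le> d * vnorm v" using x V_norm_nonneg by (intro mult_right_mono) (auto simp: dist_norm norm_minus_commute)
    finally show ?thesis .
  qed
  then show ?thesis using d True by (intro exI[of _ d] conjI bexI[of _ p] exI[of _ d]) auto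
qed

text \<open>The estimates are at interior points. A Dirichlet boundary point enters as a limit of
  these, through continuity of \<open>crep\<close> on the closure.\<close>

lemma boundary_sequence:
  obtains q :: "nat \<Rightarrow> 'a" where "\<And>n. q n \<in> \<Omega>" "\<And>v. v \<in> V \<Longrightarrow> (\<lambda>n. crep v (q n)) \<longlonglongrightarrow> 0"
proof -
  obtain p where p: "p \<in> \<Gamma>\<^sub>D" using \<Gamma>_ne by blast
  then have pc: "p \<in> closure \<Omega>" using \<Gamma>_sub by (auto simp: frontier_def)
  then obtain q where q: "\<And>n. q n \<in> \<Omega>" "q \<longlonglongrightarrow> p" unfolding closure_sequential by blast
  have "(\<lambda>n. crep v (q n)) \<longlonglongrightarrow> crep v p" if "v \<in> V" for v
    using crep_props(1)[OF that] q pc closure_subset[of \<Omega>] unfolding continuous_on_sequentially by (auto simp: o_def)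
  then show ?thesis using that q(1) crep_props(3) p by fastforce
qed

text \<open>Compactness of the closure leaves finitely many neighbourhoods from
  \<open>near_closure\<close>, and \<open>linked_\<Omega>\<close> joins their reference points to
  one base point. So the oscillation of v is bounded by its gradient norm, and the boundary
  condition fixes the remaining constant.\<close>

theorem poincare: "\<exists>C\<ge>0. \<forall>v\<in>V. \<forall>x\<in>\<Omega>. \<bar>crep v x\<bar> \<le> C * vnorm v"
proof -
  have "\<forall>p. \<exists>\<delta> q C. p \<in> closure \<Omega> \<longrightarrow> \<delta> > 0 \<and> q \<in> \<Omega> \<and> C \<ge> 0 \<and> (\<forall>x\<in>\<Omega> \<inter> ball p \<delta>. \<forall>v\<in>V. \<bar>crep v x - crep v q\<bar> \<le> C * vnorm v)"
    using near_closure by blast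
  then obtain \<delta> Q C where dQC: "\<And>p. p \<in> closure \<Omega> \<Longrightarrow> \<delta> p > 0 \<and> Q p \<in> \<Omega> \<and> C p \<ge> 0 \<and>
      (\<forall>x\<in>\<Omega> \<inter> ball p (\<delta> p). \<forall>v\<in>V. \<bar>crep v x - crep v (Q p)\<bar> \<le> C p * vnorm v)" by metis
  have "compact (closure \<Omega>)" using bounded_\<Omega> by (simp add: compact_closure)
  then obtain P where P: "P \<subseteq> closure \<Omega>" "finite P" "closure \<Omega> \<subseteq> (\<Union>p\<in>P. ball p (\<delta> p))"
    by (rule compactE_image[of _ "closure \<Omega>" "\<lambda>p. ball p (\<delta> p)"]) (use dQC in auto)
  obtain q0 where q0: "q0 \<in> \<Omega>" using \<Omega>_ne by blast
  have "\<forall>p. \<exists>D. p \<in> closure \<Omega> \<longrightarrow> D \<ge> 0 \<and> (\<forall>v\<in>V. \<bar>crep v (Q p) - crep v q0\<bar> \<le> D * vnorm v)"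
    using linked_\<Omega>[OF _ q0] dQC unfolding linked_def by metis
  then obtain D where D: "\<And>p. p \<in> closure \<Omega> \<Longrightarrow> D p \<ge> 0 \<and> (\<forall>v\<in>V. \<bar>crep v (Q p) - crep v q0\<bar> \<le> D p * vnorm v)" by metis
  define E where "E = (\<Sum>p\<in>P. C p + D p)"
  have pos: "0 \<le> C p + D p" if "p \<in> P" for p using dQC D that P(1) by (meson add_nonneg_nonneg subsetD)
  have E0: "0 \<le> E" unfolding E_def by (rule sum_nonneg) (rule pos)
  have unif: "\<bar>crep v x - crep v q0\<bar> \<le> E * vnorm v" if x: "x \<in> \<Omega>" and v: "v \<in> V" for x v
  proof -
    obtain p where p: "p \<in> P" "x \<in> ball p (\<delta> p)" using P(3) x closure_subset by blast
    then have pc: "p \<in> closure \<Omega>" using P(1) by blast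
    have "\<bar>crep v x - crep v (Q p)\<bar> \<le> C p * vnorm v" using dQC[OF pc] x p(2) v by blast
    moreover have "\<bar>crep v (Q p) - crep v q0\<bar> \<le> D p * vnorm v" using D[OF pc] v by blast
    ultimately have "\<bar>crep v x - crep v q0\<bar> \<le> (C p + D p) * vnorm v" unfolding distrib_right by linarith
    also have "\<dots> \<le> E * vnorm v" unfolding E_def
      by (intro mult_right_mono V_norm_nonneg member_le_sum) (use p(1) P(2) pos in auto)
    finally show ?thesis .
  qed
  obtain q where q: "\<And>n. q n \<in> \<Omega>" "\<And>v. v \<in> V \<Longrightarrow> (\<lambda>n. crep v (q n)) \<longlonglongrightarrow> 0" using boundary_sequence by metis
  have "\<bar>crep v q0\<bar> \<le> E * vnorm v" if v: "v \<in> V" for v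
  proof (rule tendsto_upperbound)
    show "(\<lambda>n. \<bar>crep v q0 - crep v (q n)\<bar>) \<longlonglongrightarrow> \<bar>crep v q0\<bar>"
      using tendsto_rabs[OF tendsto_diff[OF tendsto_const q(2)[OF v]], of "crep v q0"] by simp
    show "\<forall>\<^sub>F n in sequentially. \<bar>crep v q0 - crep v (q n)\<bar> \<le> E * vnorm v"
      using unif[OF q(1) v] by (simp add: abs_minus_commute)
  qed simp
  \<comment> \<open>One \<open>E\<close> leads from x to the base point, the other from there to the
    Dirichlet boundary.\<close>
  then have "\<bar>crep v x\<bar> \<le> (2 * E) * vnorm v" if "x \<in> \<Omega>" "v \<in> V" for x v
    using unif[OF that] that(2) by fastforce
  then show ?thesis using E0 by (intro exI[of _ "2 * E"]) auto
qed

lemma poincare_AE: "\<exists>C\<ge>0. \<forall>v\<in>V. AE x in M. \<bar>v x\<bar> \<le> C * vnorm v"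
proof -
  obtain C where C: "C \<ge> 0" "\<And>v x. v \<in> V \<Longrightarrow> x \<in> \<Omega> \<Longrightarrow> \<bar>crep v x\<bar> \<le> C * vnorm v" using poincare by blast
  have "AE x in M. \<bar>v x\<bar> \<le> C * vnorm v" if v: "v \<in> V" for v
    using crep_props(2)[OF v] AE_space by eventually_elim (use C(2)[OF v] in simp)
  then show ?thesis using C(1) by blast
qed

text \<open>Against a test field the gradient is moved onto the field; test fields are dense in \<open>L\<^sup>1\<close>.\<close>

lemma grad_weak_star_zero:
  assumes w: "\<And>k. w k \<in> V" "\<And>k. vnorm (w k) \<le> m" and lim: "(\<lambda>k. \<integral>x. \<bar>w k x\<bar> \<partial>M) \<longlonglongrightarrow> 0"
    and \<psi>: "integrable M \<psi>"
  shows "(\<lambda>k. \<integral>x. \<psi> x \<bullet> grad \<Omega> (w k) x \<partial>M) \<longlonglongrightarrow> 0"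
proof -
  have m0: "0 \<le> m" using w(2)[of 0] V_norm_nonneg[of "w 0"] by linarith
  have gb: "AE x in M. \<bar>grad \<Omega> (w k) x \<bullet> b\<bar> \<le> m" if "b \<in> Basis" for k b
    using grad_AE_bound[OF w(1)[of k]]
    by eventually_elim (use w(2)[of k] Basis_le_norm[OF that] in \<open>meson order_trans\<close>)
  have gL: "(\<lambda>x. grad \<Omega> (w k) x \<bullet> b) \<in> Linf M" for k b by (rule Linf_inner_const[OF grad_props(1)[OF w(1)]])
  have comp: "(\<lambda>k. \<integral>x. (grad \<Omega> (w k) x \<bullet> b) * (\<psi> x \<bullet> b) \<partial>M) \<longlonglongrightarrow> 0" if b: "b \<in> Basis" for b
  proof (rule LIMSEQ_I)
    fix e :: real assume e: "0 < e"
    have \<psi>b: "integrable M (\<lambda>x. \<psi> x \<bullet> b)" using \<psi> by simp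
    \<comment> \<open>The gradients are bounded by \<open>m\<close>, so this accuracy of the test
      function in L1 costs at most e / 2.\<close>
    have "0 < e / (2 * (m + 1))" using e m0 by simp
    then obtain \<phi> where \<phi>: "\<phi> \<in> test_fun \<Omega>" "(\<integral>x. \<bar>\<psi> x \<bullet> b - \<phi> x\<bar> \<partial>M) < e / (2 * (m + 1))"
      using test_fun_dense[OF open_\<Omega> \<psi>b] by blast
    have \<phi>i: "integrable M \<phi>" by (rule test_fun_integrable_on[OF open_\<Omega> \<phi>(1)])
    have \<phi>'i: "integrable M (partial_deriv b \<phi>)" by (rule test_fun_integrable_on[OF open_\<Omega> test_fun_partial_deriv[OF \<phi>(1) b]])
    obtain B where B: "0 \<le> B" "\<And>x. \<bar>partial_deriv b \<phi> x\<bar> \<le> B"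
      using test_fun_bounded[OF test_fun_partial_deriv[OF \<phi>(1) b]] by metis
    have "(\<lambda>k. \<integral>x. w k x * partial_deriv b \<phi> x \<partial>M) \<longlonglongrightarrow> 0"
    proof (rule Lim_null_comparison)
      show "(\<lambda>k. B * (\<integral>x. \<bar>w k x\<bar> \<partial>M)) \<longlonglongrightarrow> 0" using lim by (rule tendsto_mult_right_zero)
      have "\<bar>\<integral>x. w k x * partial_deriv b \<phi> x \<partial>M\<bar> \<le> B * (\<integral>x. \<bar>w k x\<bar> \<partial>M)" for k
      proof -
        have wi: "integrable M (w k)" by (rule Linf_integrable[OF finite_measure_M V_Linf[OF w(1)]])
        have "\<bar>\<integral>x. w k x * partial_deriv b \<phi> x \<partial>M\<bar> \<le> (\<integral>x. B * \<bar>w k x\<bar> \<partial>M)"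
        proof (rule order_trans[OF integral_abs_bound integral_mono])
          show "integrable M (\<lambda>x. \<bar>w k x * partial_deriv b \<phi> x\<bar>)" using integrable_Linf_mult[OF V_Linf[OF w(1)] \<phi>'i] by simp
          show "integrable M (\<lambda>x. B * \<bar>w k x\<bar>)" using wi by simp
          show "\<bar>w k x * partial_deriv b \<phi> x\<bar> \<le> B * \<bar>w k x\<bar>" for x
            unfolding abs_mult mult.commute[of B] by (rule mult_left_mono[OF B(2)]) simp
        qed
        then show ?thesis by simp
      qed
      then show "\<forall>\<^sub>F k in sequentially. norm (\<integral>x. w k x * partial_deriv b \<phi> x \<partial>M) \<le> B * (\<integral>x. \<bar>w k x\<bar> \<partial>M)" by simp
    qed
    then have "(\<lambda>k. - (\<integral>x. w k x * partial_deriv b \<phi> x \<partial>M)) \<longlonglongrightarrow> 0" using tendsto_minus by fastforce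
    moreover have "(\<integral>x. (grad \<Omega> (w k) x \<bullet> b) * \<phi> x \<partial>M) = - (\<integral>x. w k x * partial_deriv b \<phi> x \<partial>M)" for k
      using weak_gradientD[OF grad_props(2)[OF w(1)] \<phi>(1) b] by simp
    ultimately have "(\<lambda>k. \<integral>x. (grad \<Omega> (w k) x \<bullet> b) * \<phi> x \<partial>M) \<longlonglongrightarrow> 0" by simp
    from LIMSEQ_D[OF this half_gt_zero[OF e]]
    obtain N where "\<forall>k\<ge>N. norm ((\<integral>x. (grad \<Omega> (w k) x \<bullet> b) * \<phi> x \<partial>M) - 0) < e / 2" by blast
    then have N: "\<bar>\<integral>x. (grad \<Omega> (w k) x \<bullet> b) * \<phi> x \<partial>M\<bar> < e / 2" if "N \<le> k" for k
      using that unfolding diff_zero real_norm_def by blast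
    show "\<exists>N. \<forall>k\<ge>N. norm ((\<integral>x. (grad \<Omega> (w k) x \<bullet> b) * (\<psi> x \<bullet> b) \<partial>M) - 0) < e"
    proof (intro exI allI impI)
      fix k assume k: "N \<le> k"
      have i1: "integrable M (\<lambda>x. (grad \<Omega> (w k) x \<bullet> b) * \<phi> x)" by (rule integrable_Linf_mult[OF gL \<phi>i])
      have i2: "integrable M (\<lambda>x. (grad \<Omega> (w k) x \<bullet> b) * (\<psi> x \<bullet> b))" by (rule integrable_Linf_mult[OF gL \<psi>b])
      have "\<bar>\<integral>x. (grad \<Omega> (w k) x \<bullet> b) * (\<psi> x \<bullet> b) - (grad \<Omega> (w k) x \<bullet> b) * \<phi> x \<partial>M\<bar> \<le> (\<integral>x. m * \<bar>\<psi> x \<bullet> b - \<phi> x\<bar> \<partial>M)"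
      proof (rule order_trans[OF integral_abs_bound integral_mono_AE])
        show "integrable M (\<lambda>x. \<bar>(grad \<Omega> (w k) x \<bullet> b) * (\<psi> x \<bullet> b) - (grad \<Omega> (w k) x \<bullet> b) * \<phi> x\<bar>)" using i1 i2 by simp
        show "integrable M (\<lambda>x. m * \<bar>\<psi> x \<bullet> b - \<phi> x\<bar>)" using \<psi>b \<phi>i by simp
        show "AE x in M. \<bar>(grad \<Omega> (w k) x \<bullet> b) * (\<psi> x \<bullet> b) - (grad \<Omega> (w k) x \<bullet> b) * \<phi> x\<bar> \<le> m * \<bar>\<psi> x \<bullet> b - \<phi> x\<bar>"
          using gb[OF b, of k]
          by eventually_elim (unfold right_diff_distrib[symmetric] abs_mult, rule mult_right_mono, auto)
      qed
      also have "\<dots> = m * (\<integral>x. \<bar>\<psi> x \<bullet> b - \<phi> x\<bar> \<partial>M)" by simp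
      also have "\<dots> \<le> m * (e / (2 * (m + 1)))" by (rule mult_left_mono) (use \<phi>(2) m0 in auto)
      also have "\<dots> \<le> e / 2" using m0 e by (simp add: field_simps)
      finally have "\<bar>(\<integral>x. (grad \<Omega> (w k) x \<bullet> b) * (\<psi> x \<bullet> b) \<partial>M) - (\<integral>x. (grad \<Omega> (w k) x \<bullet> b) * \<phi> x \<partial>M)\<bar> \<le> e / 2"
        by (simp only: Bochner_Integration.integral_diff[OF i2 i1])
      then show "norm ((\<integral>x. (grad \<Omega> (w k) x \<bullet> b) * (\<psi> x \<bullet> b) \<partial>M) - 0) < e" using N[OF k] unfolding real_norm_def by linarith
    qed
  qed
  have "(\<integral>x. \<psi> x \<bullet> grad \<Omega> (w k) x \<partial>M) = (\<Sum>b\<in>Basis. \<integral>x. (grad \<Omega> (w k) x \<bullet> b) * (\<psi> x \<bullet> b) \<partial>M)" for k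
  proof -
    have "(\<integral>x. \<psi> x \<bullet> grad \<Omega> (w k) x \<partial>M) = (\<integral>x. (\<Sum>b\<in>Basis. (grad \<Omega> (w k) x \<bullet> b) * (\<psi> x \<bullet> b)) \<partial>M)"
      by (subst euclidean_inner) (simp add: mult.commute)
    also have "\<dots> = (\<Sum>b\<in>Basis. \<integral>x. (grad \<Omega> (w k) x \<bullet> b) * (\<psi> x \<bullet> b) \<partial>M)"
      by (rule Bochner_Integration.integral_sum) (use integrable_Linf_mult[OF gL] \<psi> in simp)
    finally show ?thesis .
  qed
  moreover have "(\<lambda>k. \<Sum>b\<in>Basis. \<integral>x. (grad \<Omega> (w k) x \<bullet> b) * (\<psi> x \<bullet> b) \<partial>M) \<longlonglongrightarrow> (\<Sum>b\<in>(Basis::'a set). 0)"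
    by (rule tendsto_sum) (rule comp)
  ultimately show ?thesis by simp
qed

lemma integral_grad_diff:
  assumes "v \<in> V" "w \<in> V" "integrable M \<psi>"
  shows "(\<integral>x. \<psi> x \<bullet> grad \<Omega> (\<lambda>x. v x - w x) x \<partial>M) = (\<integral>x. \<psi> x \<bullet> grad \<Omega> v x \<partial>M) - (\<integral>x. \<psi> x \<bullet> grad \<Omega> w x \<partial>M)"
proof -
  have i: "integrable M (\<lambda>x. \<psi> x \<bullet> grad \<Omega> v x)" if "v \<in> V" for v
    by (rule integrable_inner_Linf[OF assms(3) grad_props(1)[OF that]])
  have "(\<integral>x. \<psi> x \<bullet> grad \<Omega> (\<lambda>x. v x - w x) x \<partial>M) = (\<integral>x. \<psi> x \<bullet> grad \<Omega> v x - \<psi> x \<bullet> grad \<Omega> w x \<partial>M)"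
  proof (rule integral_cong_AE)
    show "AE x in M. \<psi> x \<bullet> grad \<Omega> (\<lambda>x. v x - w x) x = \<psi> x \<bullet> grad \<Omega> v x - \<psi> x \<bullet> grad \<Omega> w x"
      using grad_diff[OF assms(1,2)] by eventually_elim (simp add: inner_diff_right)
  qed (use i[OF V_diff[OF assms(1,2)]] i[OF assms(1)] i[OF assms(2)] in auto)
  then show ?thesis using Bochner_Integration.integral_diff[OF i[OF assms(1)] i[OF assms(2)]] by simp
qed

lemma grad_weak_star:
  assumes w: "\<And>k. w k \<in> V" "\<And>k. vnorm (w k) \<le> m" and v: "v \<in> V"
    and lim: "(\<lambda>k. \<integral>x. \<bar>w k x - v x\<bar> \<partial>M) \<longlonglongrightarrow> 0" and \<psi>: "integrable M \<psi>"
  shows "(\<lambda>k. \<integral>x. \<psi> x \<bullet> grad \<Omega> (w k) x \<partial>M) \<longlonglongrightarrow> (\<integral>x. \<psi> x \<bullet> grad \<Omega> v x \<partial>M)"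
proof -
  have "(\<lambda>k. \<integral>x. \<psi> x \<bullet> grad \<Omega> (\<lambda>x. w k x - v x) x \<partial>M) \<longlonglongrightarrow> 0"
  proof (rule grad_weak_star_zero[OF V_diff[OF w(1) v] _ _ \<psi>])
    show "vnorm (\<lambda>x. w k x - v x) \<le> m + vnorm v" for k using V_norm_diff_le[OF w(1)[of k] v] w(2)[of k] by linarith
  qed (rule lim)
  then show ?thesis unfolding integral_grad_diff[OF w(1) v \<psi>] by (rule LIM_zero_cancel)
qed

end

section \<open>Joint measurability in space and time\<close>

text \<open>Replace x by the first member of a dense sequence at distance less than 1 / (n + 1). The
  result is measurable because only countably many points x occur, and continuity in x gives
  convergence.\<close>

lemma caratheodory_measurable:
  fixes f :: "'b \<Rightarrow> 'a::euclidean_space \<Rightarrow> real"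
  assumes \<Omega>: "open \<Omega>"
    and meas: "\<And>x. x \<in> \<Omega> \<Longrightarrow> (\<lambda>t. f t x) \<in> borel_measurable N"
    and cont: "\<And>t. t \<in> space N \<Longrightarrow> continuous_on \<Omega> (f t)"
  shows "(\<lambda>(t, x). f t x) \<in> borel_measurable (N \<Otimes>\<^sub>M lebesgue_on \<Omega>)"
proof (cases "\<Omega> = {}")
  case True
  then have "space (N \<Otimes>\<^sub>M lebesgue_on \<Omega>) = {}" by (simp add: space_pair_measure)
  then show ?thesis by (intro measurableI) auto
next
  case False
  let ?M = "lebesgue_on \<Omega>"
  obtain D :: "'a set" where D: "countable D" "\<And>X. open X \<Longrightarrow> X \<noteq> {} \<Longrightarrow> \<exists>d\<in>D. d \<in> X"
    using countable_dense_setE by metis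
  have ne: "D \<inter> \<Omega> \<noteq> {}" using D(2)[OF \<Omega> False] by blast
  define d where "d = from_nat_into (D \<inter> \<Omega>)"
  have d\<Omega>: "d n \<in> \<Omega>" for n using from_nat_into[OF ne, of n] by (simp add: d_def)
  have dense: "\<exists>i. dist x (d i) < e" if x: "x \<in> \<Omega>" and e: "0 < e" for x e
  proof -
    have "x \<in> ball x e \<inter> \<Omega>" using x e by simp
    then have "open (ball x e \<inter> \<Omega>)" "ball x e \<inter> \<Omega> \<noteq> {}" using \<Omega> by (simp add: open_Int, blast)
    then obtain p where p: "p \<in> D" "p \<in> ball x e \<inter> \<Omega>" using D(2) by blast
    then have "p \<in> range d" unfolding d_def using range_from_nat_into[OF ne] D(1) by auto
    then obtain i where "p = d i" by blast
    then show ?thesis using p(2) by (intro exI[of _ i]) simp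
  qed
  define k where "k n x = (LEAST i. dist x (d i) < inverse (Suc n))" for n x
  have k: "dist x (d (k n x)) < inverse (Suc n)" if "x \<in> \<Omega>" for n x
    unfolding k_def by (rule LeastI_ex, rule dense[OF that]) simp
  have idm[measurable]: "(\<lambda>x. x) \<in> measurable ?M borel"
    by (rule lebesgue_measurable_of_continuous) (rule continuous_on_id)
  have km[measurable]: "k n \<in> measurable ?M (count_space UNIV)" for n
    unfolding k_def[abs_def] by measurable
  have fm: "(\<lambda>p. f (fst p) (d (k n (snd p)))) \<in> borel_measurable (N \<Otimes>\<^sub>M ?M)" for n
  proof (rule measurable_compose_countable[where f="\<lambda>i p. f (fst p) (d i)" and g="\<lambda>p. k n (snd p)"])
    show "(\<lambda>p. f (fst p) (d i)) \<in> borel_measurable (N \<Otimes>\<^sub>M ?M)" for i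
      by (rule measurable_compose[OF measurable_fst meas[OF d\<Omega>]])
    show "(\<lambda>p. k n (snd p)) \<in> measurable (N \<Otimes>\<^sub>M ?M) (count_space UNIV)" by measurable
  qed
  have "(\<lambda>p. f (fst p) (snd p)) \<in> borel_measurable (N \<Otimes>\<^sub>M ?M)"
  proof (rule borel_measurable_LIMSEQ_metric[OF fm])
    fix p assume "p \<in> space (N \<Otimes>\<^sub>M ?M)"
    then have t: "fst p \<in> space N" and x: "snd p \<in> \<Omega>" by (auto simp: space_pair_measure)
    have "(\<lambda>n. dist (d (k n (snd p))) (snd p)) \<longlonglongrightarrow> 0"
      by (rule tendsto_sandwich[OF _ _ tendsto_const LIMSEQ_inverse_real_of_nat])
        (use k[OF x] in \<open>auto simp: dist_commute less_imp_le\<close>)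
    then have "(\<lambda>n. d (k n (snd p))) \<longlonglongrightarrow> snd p" by (rule tendsto_dist_iff[THEN iffD2])
    then show "(\<lambda>n. f (fst p) (d (k n (snd p)))) \<longlonglongrightarrow> f (fst p) (snd p)"
      using cont[OF t] x d\<Omega> unfolding continuous_on_sequentially by (auto simp: o_def)
  qed
  then show ?thesis by (simp add: case_prod_beta')
qed

text \<open>The essential supremum is at most \<open>c\<close> exactly if the slice of the set where
  \<open>f\<close> exceeds \<open>c\<close> is null, and measures of slices are measurable. This is
  the source of measurability for \<open>vnorm\<close> of a difference.\<close>

lemma esssup_slices_measurable:
  fixes f :: "'b \<times> 'a \<Rightarrow> ennreal"
  assumes M: "sigma_finite_measure M" and f[measurable]: "f \<in> borel_measurable (N \<Otimes>\<^sub>M M)"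
  shows "(\<lambda>t. esssup M (\<lambda>x. f (t, x))) \<in> borel_measurable N"
proof (rule borel_measurableI_le)
  interpret sigma_finite_measure M by fact
  fix c :: ennreal
  define Q where "Q = {p \<in> space (N \<Otimes>\<^sub>M M). c < f p}"
  have Q: "Q \<in> sets (N \<Otimes>\<^sub>M M)" unfolding Q_def by measurable
  have "esssup M (\<lambda>x. f (t, x)) \<le> c \<longleftrightarrow> emeasure M (Pair t -` Q) = 0" if t: "t \<in> space N" for t
  proof -
    have m: "(\<lambda>x. f (t, x)) \<in> borel_measurable M" using t by measurable
    have eq: "Pair t -` Q = {x \<in> space M. \<not> f (t, x) \<le> c}" using t by (auto simp: Q_def space_pair_measure not_le)
    have "esssup M (\<lambda>x. f (t, x)) \<le> c \<longleftrightarrow> (AE x in M. f (t, x) \<le> c)"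
    proof
      assume le: "esssup M (\<lambda>x. f (t, x)) \<le> c"
      show "AE x in M. f (t, x) \<le> c"
        by (rule eventually_mono[OF esssup_AE[where M=M and f="\<lambda>x. f (t, x)"]]) (erule order_trans[OF _ le])
    qed (rule esssup_I[OF m])
    also have "\<dots> \<longleftrightarrow> emeasure M (Pair t -` Q) = 0"
      by (rule AE_iff_measurable[OF _ eq[symmetric]]) (use Q in \<open>auto intro: sets_Pair1\<close>)
    finally show ?thesis .
  qed
  then have "{t \<in> space N. esssup M (\<lambda>x. f (t, x)) \<le> c} = {t \<in> space N. emeasure M (Pair t -` Q) = 0}" by blast
  also have "\<dots> \<in> sets N"
    using measurable_sets[OF measurable_emeasure_Pair[OF Q], of "{0}"] by (simp add: vimage_def Int_def conj_commute)
  finally show "{t \<in> space N. esssup M (\<lambda>x. f (t, x)) \<le> c} \<in> sets N" .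
qed

lemma AE_lebesgue_on_iff:
  assumes "S \<in> sets lebesgue"
  shows "(AE x in lebesgue_on S. P x) \<longleftrightarrow> (AE x in lborel. x \<in> S \<longrightarrow> P x)"
proof -
  have "(AE x in lebesgue_on S. P x) \<longleftrightarrow> (AE x in lebesgue. x \<in> S \<longrightarrow> P x)"
    by (rule AE_restrict_space_iff) (use assms in simp)
  then show ?thesis by (simp add: AE_completion_iff)
qed

text \<open>Lebesgue measure on the product is the completion of a product measure and not the
  product of the completions. The exceptional set is therefore replaced by its Borel part before
  slices are taken; the rest of it is null.\<close>

lemma AE_cylinder_of_slices:
  fixes A :: "'a::euclidean_space set" and B :: "'b::euclidean_space set"
  assumes s: "A \<in> sets lebesgue" "B \<in> sets lebesgue" "A \<times> B \<in> sets lebesgue"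
    and P: "{p \<in> A \<times> B. \<not> P p} \<in> sets lebesgue"
    and ae: "AE t in lebesgue_on A. AE x in lebesgue_on B. P (t, x)"
  shows "AE p in lebesgue_on (A \<times> B). P p"
proof -
  obtain S N N' where N: "{p \<in> A \<times> B. \<not> P p} = S \<union> N" "N \<subseteq> N'" "N' \<in> null_sets lborel" "S \<in> sets lborel"
    by (rule sets_completionE[OF P])
  have "AE t in lborel. t \<in> A \<longrightarrow> (AE x in lborel. x \<in> B \<longrightarrow> P (t, x))"
    using ae s by (simp add: AE_lebesgue_on_iff)
  then have "AE t in lborel. AE x in lborel. (t, x) \<notin> S"
  proof eventually_elim
    case (elim t)
    show ?case
    proof (cases "t \<in> A")
      case True
      then have "AE x in lborel. x \<in> B \<longrightarrow> P (t, x)" using elim by blast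
      then show ?thesis by eventually_elim (use N(1) in auto)
    next
      case False
      then have "(t, x) \<notin> S" for x using N(1) by auto
      then show ?thesis by simp
    qed
  qed
  then have "AE p in lborel \<Otimes>\<^sub>M lborel. p \<notin> S"
  proof (rule lborel_pair.AE_pair_measure[rotated])
    have "space lborel - S \<in> sets (lborel :: ('a \<times> 'b) measure)" using N(4) by blast
    moreover have "space lborel - S = {x \<in> space lborel. x \<notin> S}" by blast
    ultimately show "{x \<in> space (lborel \<Otimes>\<^sub>M lborel). x \<notin> S} \<in> sets (lborel \<Otimes>\<^sub>M lborel)"
      unfolding lborel_prod by (simp only:)
  qed
  then have "AE p in lborel. p \<notin> S" unfolding lborel_prod .
  moreover have "AE p in lborel. p \<notin> N'" using N(3) by (rule AE_not_in)
  ultimately have "AE p in lborel. p \<in> A \<times> B \<longrightarrow> P p" by eventually_elim (use N(1,2) in auto)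
  then show ?thesis using s(3) by (simp add: AE_lebesgue_on_iff)
qed

lemma lborel_null_Times:
  fixes N :: "'a::euclidean_space set"
  assumes "N \<in> null_sets lborel"
  shows "N \<times> (UNIV :: 'b::euclidean_space set) \<in> null_sets lborel" "(UNIV :: 'b set) \<times> N \<in> null_sets lborel"
proof -
  have N: "N \<in> sets lborel" "emeasure lborel N = 0" using assms by auto
  have "emeasure (lborel \<Otimes>\<^sub>M lborel) (N \<times> (UNIV :: 'b set)) = 0"
    by (subst lborel.emeasure_pair_measure_Times) (use N in auto)
  moreover have "N \<times> (UNIV :: 'b set) \<in> sets (lborel \<Otimes>\<^sub>M lborel)" using N(1) by (intro pair_measureI) auto
  ultimately show "N \<times> (UNIV :: 'b set) \<in> null_sets lborel" unfolding null_sets_def lborel_prod by blast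
  have "emeasure (lborel \<Otimes>\<^sub>M lborel) ((UNIV :: 'b set) \<times> N) = 0"
    by (subst lborel.emeasure_pair_measure_Times) (use N in auto)
  moreover have "(UNIV :: 'b set) \<times> N \<in> sets (lborel \<Otimes>\<^sub>M lborel)" using N(1) by (intro pair_measureI) auto
  ultimately show "(UNIV :: 'b set) \<times> N \<in> null_sets lborel" unfolding null_sets_def lborel_prod by blast
qed

lemma sets_lebesgue_Times:
  fixes A :: "'a::euclidean_space set" and B :: "'b::euclidean_space set"
  assumes "A \<in> sets lebesgue" "B \<in> sets lebesgue"
  shows "A \<times> B \<in> sets lebesgue"
proof -
  obtain S N N' where N: "A = S \<union> N" "N \<subseteq> N'" "N' \<in> null_sets lborel" "S \<in> sets lborel"
    by (rule sets_completionE[OF assms(1)])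
  obtain R K K' where K: "B = R \<union> K" "K \<subseteq> K'" "K' \<in> null_sets lborel" "R \<in> sets lborel"
    by (rule sets_completionE[OF assms(2)])
  have eq: "A \<times> B = (S \<times> R) \<union> (A \<times> B - S \<times> R)" using N(1) K(1) by auto
  have sub: "A \<times> B - S \<times> R \<subseteq> (N' \<times> UNIV) \<union> (UNIV \<times> K')" using N K by auto
  have null: "(N' \<times> UNIV) \<union> (UNIV \<times> K') \<in> null_sets (lborel :: ('a \<times> 'b) measure)"
    using lborel_null_Times[OF N(3)] lborel_null_Times[OF K(3)] by auto
  have "S \<times> R \<in> sets (lborel \<Otimes>\<^sub>M lborel)" using N(4) K(4) by (intro pair_measureI)
  then have SR: "S \<times> R \<in> sets (lborel :: ('a \<times> 'b) measure)" by (simp only: lborel_prod)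
  show ?thesis by (rule sets_completionI[OF eq sub null SR])
qed

text \<open>Carries measurability from the product of the two completed spaces, where slicewise
  arguments live, to the Lebesgue sets of the cylinder.\<close>

lemma measurable_cylinder:
  fixes A :: "'a::euclidean_space set" and B :: "'b::euclidean_space set"
  assumes "A \<in> sets lebesgue" "B \<in> sets lebesgue"
  shows "(\<lambda>p. p) \<in> measurable (lebesgue_on (A \<times> B)) (lebesgue_on A \<Otimes>\<^sub>M lebesgue_on B)"
proof (rule measurable_pair_measureI)
  show "(\<lambda>p. p) \<in> space (lebesgue_on (A \<times> B)) \<rightarrow> space (lebesgue_on A) \<times> space (lebesgue_on B)" by auto
  fix a b assume y: "a \<in> sets (lebesgue_on A)" "b \<in> sets (lebesgue_on B)"
  have ab: "a \<in> sets lebesgue" "a \<subseteq> A" "b \<in> sets lebesgue" "b \<subseteq> B" using y assms by (auto simp: sets_restrict_space_iff)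
  have "a \<times> b \<in> sets lebesgue" by (rule sets_lebesgue_Times) (use ab in auto)
  moreover have "(\<lambda>p. p) -` (a \<times> b) \<inter> space (lebesgue_on (A \<times> B)) = a \<times> b" using ab by auto
  moreover have "A \<times> B \<in> sets lebesgue" by (rule sets_lebesgue_Times[OF assms])
  ultimately show "(\<lambda>p. p) -` (a \<times> b) \<inter> space (lebesgue_on (A \<times> B)) \<in> sets (lebesgue_on (A \<times> B))"
    using ab by (auto simp: sets_restrict_space_iff)
qed

context torsion_domain
begin

abbreviation "I \<equiv> time_interval T"
abbreviation "MI \<equiv> lebesgue_on I"
abbreviation "X \<equiv> Linf_wstar \<Omega> \<Gamma>\<^sub>D T"

lemma open_I: "open I" and bounded_I: "bounded I" by auto

lemma lmeasurable_I: "I \<in> lmeasurable" by simp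

lemma finite_measure_MI: "finite_measure MI"
  by (rule finite_measure_lebesgue_on[OF lmeasurable_I])

sublocale MI: finite_measure MI
  by (rule finite_measure_MI)

sublocale P: pair_sigma_finite MI M ..

sublocale PF: finite_measure "MI \<Otimes>\<^sub>M M"
  by (rule finite_measure_pair_measure) unfold_locales

lemma X_V: "v \<in> X \<Longrightarrow> t \<in> I \<Longrightarrow> v t \<in> V"
  by (simp add: Linf_wstar_def)

lemma X_meas: "v \<in> X \<Longrightarrow> integrable M w \<Longrightarrow> (\<lambda>t. \<integral>x. grad \<Omega> (v t) x \<bullet> w x \<partial>M) \<in> borel_measurable MI"
  by (simp add: Linf_wstar_def)

lemma X_norm: assumes "v \<in> X"
  shows "(\<lambda>t. vnorm (v t)) \<in> borel_measurable MI" "\<exists>C\<ge>0. AE t in MI. vnorm (v t) \<le> C"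
proof -
  have L: "(\<lambda>t. vnorm (v t)) \<in> Linf MI" using assms by (simp add: Linf_wstar_def)
  then show "(\<lambda>t. vnorm (v t)) \<in> borel_measurable MI" by (rule Linf_measurable)
  show "\<exists>C\<ge>0. AE t in MI. vnorm (v t) \<le> C"
    using AE_le_Linf_norm[OF L] V_norm_nonneg by (intro exI[of _ "Linf_norm MI (\<lambda>t. vnorm (v t))"]) (auto simp: Linf_norm_nonneg)
qed

text \<open>Differences of point values are limits of measurable pairings along a segment, and sums
  of such along a chain of segments. Letting the second point approach the Dirichlet boundary turns
  the differences into the values themselves.\<close>

lemma crep_slice_measurable:
  assumes v: "v \<in> X" and x: "x \<in> \<Omega>" shows "(\<lambda>t. crep (v t) x) \<in> borel_measurable MI"
proof -
  define R where "R x y \<longleftrightarrow> (\<lambda>t. crep (v t) y - crep (v t) x) \<in> borel_measurable MI" for x y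
  have seg: "R x y" if xy: "closed_segment x y \<subseteq> \<Omega>" for x y
  proof -
    obtain \<psi> :: "nat \<Rightarrow> 'a \<Rightarrow> 'a" where \<psi>: "\<And>n. integrable M (\<psi> n)"
      and lim: "\<And>w. w \<in> V \<Longrightarrow> (\<lambda>n. \<integral>z. grad \<Omega> w z \<bullet> \<psi> n z \<partial>M) \<longlonglongrightarrow> crep w y - crep w x"
      using crep_difference_limit[OF xy] by blast
    show ?thesis unfolding R_def
      by (rule borel_measurable_LIMSEQ_metric[where f="\<lambda>n t. \<integral>z. grad \<Omega> (v t) z \<bullet> \<psi> n z \<partial>M"])
        (use X_meas[OF v \<psi>] lim X_V[OF v] in auto)
  qed
  have R: "R a b" if ab: "a \<in> \<Omega>" "b \<in> \<Omega>" for a b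
  proof (rule connected_equivalence_relation[OF connected_\<Omega> ab, of R])
    show "R y x" if "R x y" for x y
      using borel_measurable_uminus[OF that[unfolded R_def]] by (simp add: R_def)
    show "R x z" if "R x y" "R y z" for x y z
      using borel_measurable_add[OF that(1)[unfolded R_def] that(2)[unfolded R_def]] by (simp add: R_def)
    fix a assume a: "a \<in> \<Omega>"
    then obtain d where d: "0 < d" "ball a d \<subseteq> \<Omega>" using open_\<Omega> open_contains_ball by blast
    have "R a z" if z: "z \<in> ball a d" for z
    proof (rule seg)
      have "closed_segment a z \<subseteq> ball a d" by (rule closed_segment_subset) (use z d(1) in auto)
      then show "closed_segment a z \<subseteq> \<Omega>" using d(2) by blast
    qed
    then show "\<exists>T. openin (top_of_set \<Omega>) T \<and> a \<in> T \<and> (\<forall>x\<in>T. R a x)"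
      using d by (intro exI[of _ "ball a d"]) (auto simp: open_subset)
  qed
  obtain q :: "nat \<Rightarrow> 'a" where q: "\<And>n. q n \<in> \<Omega>" "\<And>v. v \<in> V \<Longrightarrow> (\<lambda>n. crep v (q n)) \<longlonglongrightarrow> 0"
    using boundary_sequence by metis
  show ?thesis
  proof (rule borel_measurable_LIMSEQ_metric)
    show "(\<lambda>t. crep (v t) x - crep (v t) (q n)) \<in> borel_measurable MI" for n using R[OF q(1) x] by (simp add: R_def)
    fix t assume "t \<in> space MI"
    then have "v t \<in> V" using X_V[OF v] by simp
    from tendsto_diff[OF tendsto_const q(2)[OF this], of "crep (v t) x"]
    show "(\<lambda>n. crep (v t) x - crep (v t) (q n)) \<longlonglongrightarrow> crep (v t) x" by simp
  qed
qed

lemma crep_joint_measurable: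
  assumes v: "v \<in> X" shows "(\<lambda>(t, x). crep (v t) x) \<in> borel_measurable (MI \<Otimes>\<^sub>M M)"
  by (rule caratheodory_measurable[OF open_\<Omega> crep_slice_measurable[OF v]])
    (use continuous_on_subset[OF crep_props(1)[OF X_V[OF v]] closure_subset] in auto)

text \<open>The slices of \<open>v\<close> are independent representatives, so \<open>v\<close> need
  not be jointly measurable. Replacing each slice by its \<open>crep\<close> leaves the integrals
  unchanged and gives a jointly measurable integrand.\<close>

lemma integral_product_measurable:
  assumes v: "v \<in> X" and w: "w \<in> borel_measurable M"
  shows "(\<lambda>t. \<integral>x. v t x * w x \<partial>M) \<in> borel_measurable MI"
proof -
  note [measurable] = w crep_joint_measurable[OF v]
  have "(\<lambda>t. \<integral>x. crep (v t) x * w x \<partial>M) \<in> borel_measurable MI"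
  proof (rule M.borel_measurable_lebesgue_integral)
    have "(\<lambda>p. (\<lambda>(t, x). crep (v t) x) p * w (snd p)) \<in> borel_measurable (MI \<Otimes>\<^sub>M M)" by measurable
    then show "(\<lambda>(t, x). crep (v t) x * w x) \<in> borel_measurable (MI \<Otimes>\<^sub>M M)" by (simp add: case_prod_beta')
  qed
  moreover have "(\<integral>x. crep (v t) x * w x \<partial>M) = (\<integral>x. v t x * w x \<partial>M)" if "t \<in> space MI" for t
  proof (rule integral_cong_AE)
    have vt: "v t \<in> V" using that X_V[OF v] by simp
    show "AE x in M. crep (v t) x * w x = v t x * w x" using crep_props(2)[OF vt] by eventually_elim simp
    show "(\<lambda>x. crep (v t) x * w x) \<in> borel_measurable M" using crep_measurable[OF vt] w by simp
    show "(\<lambda>x. v t x * w x) \<in> borel_measurable M" using Linf_measurable[OF V_Linf[OF vt]] w by simp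
  qed
  ultimately show ?thesis by (rule measurable_cong[THEN iffD1, rotated])
qed

section \<open>Spatial averages and a jointly measurable gradient\<close>

definition average :: "real \<Rightarrow> ('a \<Rightarrow> real) \<Rightarrow> 'a \<Rightarrow> real" where
  "average r f x = (\<integral>z. f z * bump r x z \<partial>M) / bump_mass r"

lemma bump_sym: "bump r x z = bump r z x"
  unfolding bump_def box_bump_def by (rule prod.cong[OF refl]) (simp add: inner_simps algebra_simps)

lemma bump_measurable: "bump r x \<in> borel_measurable M"
  by (rule lebesgue_measurable_of_continuous) (use box_bump_smooth[of 1 0] in \<open>simp add: bump_def[abs_def]\<close>)

lemma bump_integrable: "integrable M (bump r x)"
  by (rule M.integrable_const_bound[where B=1, OF _ bump_measurable]) (simp add: bump_nonneg bump_le_1)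

lemma integral_bump_le: "(\<integral>z. bump r x z \<partial>M) \<le> bump_mass r"
proof -
  have i: "integrable lebesgue (bump r x)" for x
    using test_fun_integrable[OF box_bump_test_fun[of 1 _ _ UNIV]] by (simp add: bump_def[abs_def])
  have "(\<integral>z. bump r x z \<partial>M) = (\<integral>z. indicat_real \<Omega> z *\<^sub>R bump r x z \<partial>lebesgue)"
    by (rule integral_restrict_space) (use open_\<Omega> in auto)
  also have "\<dots> \<le> (\<integral>z. bump r x z \<partial>lebesgue)"
    by (rule integral_mono) (use i integrable_mult_indicator[OF _ i, of \<Omega>] open_\<Omega> bump_nonneg in \<open>auto simp: indicator_def\<close>)
  also have "\<dots> = (\<integral>z. bump r x z \<partial>lborel)" by (rule integral_completion) (use bump_borel in simp)
  also have "\<dots> = (\<integral>z. bump r x z \<partial>distr lborel borel ((+) x))" by (simp add: lborel_distr_plus)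
  also have "\<dots> = (\<integral>z. bump r x (x + z) \<partial>lborel)" by (rule integral_distr) (use bump_borel in auto)
  also have "\<dots> = bump_mass r"
    unfolding bump_mass_def using bump_translate[of r 0 x] by (simp add: add.commute)
  finally show ?thesis .
qed

lemma bump_continuous_fst: "continuous_on UNIV (\<lambda>x. bump r x z)"
  unfolding bump_sym[of r _ z] using box_bump_smooth[of 1 0] by (simp add: bump_def[abs_def])

lemma bump_pair_measurable: "(\<lambda>p. bump r (fst p) (snd p)) \<in> borel_measurable (M \<Otimes>\<^sub>M M)"
proof -
  have [measurable]: "(\<lambda>z. z) \<in> measurable M borel"
    by (rule lebesgue_measurable_of_continuous) (rule continuous_on_id)
  have "(\<lambda>p. snd p - fst p) \<in> measurable (M \<Otimes>\<^sub>M M) borel" by measurable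
  from measurable_compose[OF this bump_borel[of r 0]] bump_translate[of r 0]
  show ?thesis by simp
qed

lemma average_pair_integrable:
  assumes f: "f \<in> Linf M" shows "integrable (M \<Otimes>\<^sub>M M) (\<lambda>(x, z). f z * bump r x z)"
proof -
  interpret MM: pair_sigma_finite M M ..
  interpret MMF: finite_measure "M \<Otimes>\<^sub>M M" by (rule finite_measure_pair_measure) unfold_locales
  note [measurable] = bump_pair_measurable Linf_measurable[OF f]
  have fm: "(\<lambda>p. f (snd p)) \<in> borel_measurable (M \<Otimes>\<^sub>M M)" by measurable
  have "AE p in M \<Otimes>\<^sub>M M. norm (f (snd p)) \<le> Linf_norm M f"
  proof (rule MM.AE_pair_measure)
    show "{p \<in> space (M \<Otimes>\<^sub>M M). norm (f (snd p)) \<le> Linf_norm M f} \<in> sets (M \<Otimes>\<^sub>M M)" by measurable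
    show "AE s in M. AE z in M. norm (f (snd (s, z))) \<le> Linf_norm M f" using AE_le_Linf_norm[OF f] by simp
  qed
  then have "AE p in M \<Otimes>\<^sub>M M. norm (f (snd p) * bump r (fst p) (snd p)) \<le> Linf_norm M f * 1"
  proof eventually_elim
    case (elim p)
    then show ?case unfolding norm_mult by (intro mult_mono) (auto simp: Linf_norm_nonneg bump_nonneg bump_le_1)
  qed
  then have "integrable (M \<Otimes>\<^sub>M M) (\<lambda>p. f (snd p) * bump r (fst p) (snd p))"
    by (rule MMF.integrable_const_bound) measurable
  then show ?thesis by (simp add: case_prod_beta')
qed

lemma average_measurable: assumes f: "f \<in> Linf M" shows "average r f \<in> borel_measurable M"
proof -
  have "(\<lambda>x. \<integral>z. f z * bump r x z \<partial>M) \<in> borel_measurable M"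
    by (rule M.borel_measurable_lebesgue_integral) (use average_pair_integrable[OF f] in auto)
  then show ?thesis unfolding average_def[abs_def] by simp
qed

lemma average_bound:
  assumes f: "f \<in> Linf M" "AE z in M. \<bar>f z\<bar> \<le> B" "0 \<le> B" and r: "0 < r"
  shows "\<bar>average r f x\<bar> \<le> B"
proof -
  have "\<bar>\<integral>z. f z * bump r x z \<partial>M\<bar> \<le> (\<integral>z. B * bump r x z \<partial>M)"
  proof (rule order_trans[OF integral_abs_bound integral_mono_AE])
    show "integrable M (\<lambda>z. \<bar>f z * bump r x z\<bar>)" using integrable_Linf_mult[OF f(1) bump_integrable] by simp
    show "integrable M (\<lambda>z. B * bump r x z)" using bump_integrable by simp
    show "AE z in M. \<bar>f z * bump r x z\<bar> \<le> B * bump r x z"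
      using f(2) by eventually_elim (simp add: abs_mult bump_nonneg mult_right_mono)
  qed
  also have "\<dots> \<le> B * bump_mass r" using integral_bump_le[of r x] f(3) by (simp add: mult_left_mono)
  finally show ?thesis unfolding average_def using bump_mass_pos[OF r] by (simp add: abs_divide divide_le_eq)
qed

lemma average_Linf: assumes "f \<in> Linf M" "0 < r" shows "average r f \<in> Linf M"
  by (rule LinfI[OF average_measurable[OF assms(1)], of _ "Linf_norm M f"])
    (use average_bound[OF assms(1) AE_le_Linf_norm[OF assms(1), unfolded real_norm_def] Linf_norm_nonneg assms(2)] in auto)

text \<open>Fubini and the symmetry of the kernel move the integration of the kernel to its other
  variable. Near the boundary part of its mass falls outside \<Omega>, hence the inequality
  \<open>integral_bump_le\<close>.\<close>

lemma average_L1_contraction: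
  assumes f: "f \<in> Linf M" and r: "0 < r"
  shows "(\<integral>x. \<bar>average r f x\<bar> \<partial>M) \<le> (\<integral>x. \<bar>f x\<bar> \<partial>M)"
proof -
  interpret MM: pair_sigma_finite M M ..
  have c: "0 < bump_mass r" by (rule bump_mass_pos[OF r])
  have fa: "(\<lambda>x. \<bar>f x\<bar>) \<in> Linf M"
    by (rule LinfI[of _ _ "Linf_norm M f"]) (use Linf_measurable[OF f] AE_le_Linf_norm[OF f] in auto)
  have fi: "integrable M (\<lambda>z. \<bar>f z\<bar>)" by (rule Linf_integrable[OF finite_measure_M fa])
  note pi = average_pair_integrable[OF fa, of r]
  have "(\<integral>x. \<bar>average r f x\<bar> \<partial>M) \<le> (\<integral>x. (\<integral>z. \<bar>f z\<bar> * bump r x z \<partial>M) / bump_mass r \<partial>M)"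
  proof (rule integral_mono)
    show "integrable M (\<lambda>x. \<bar>average r f x\<bar>)"
      using Linf_integrable[OF finite_measure_M average_Linf[OF f r]] by simp
    show "integrable M (\<lambda>x. (\<integral>z. \<bar>f z\<bar> * bump r x z \<partial>M) / bump_mass r)"
      using MM.integrable_fst[OF pi] by simp
    fix x
    have "\<bar>\<integral>z. f z * bump r x z \<partial>M\<bar> \<le> (\<integral>z. \<bar>f z\<bar> * bump r x z \<partial>M)"
      using integral_abs_bound[of M "\<lambda>z. f z * bump r x z"] by (simp add: abs_mult bump_nonneg)
    then show "\<bar>average r f x\<bar> \<le> (\<integral>z. \<bar>f z\<bar> * bump r x z \<partial>M) / bump_mass r"
      unfolding average_def using c by (simp add: abs_divide divide_right_mono)
  qed
  also have "\<dots> = (\<integral>x. (\<integral>z. \<bar>f z\<bar> * bump r x z \<partial>M) \<partial>M) / bump_mass r" by simp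
  also have "(\<integral>x. (\<integral>z. \<bar>f z\<bar> * bump r x z \<partial>M) \<partial>M) = (\<integral>z. (\<integral>x. \<bar>f z\<bar> * bump r x z \<partial>M) \<partial>M)"
    by (rule MM.Fubini_integral[OF pi, symmetric])
  also have "\<dots> = (\<integral>z. \<bar>f z\<bar> * (\<integral>x. bump r z x \<partial>M) \<partial>M)" by (simp add: bump_sym[of r _ _])
  also have "\<dots> \<le> (\<integral>z. \<bar>f z\<bar> * bump_mass r \<partial>M)"
  proof (rule integral_mono)
    show "integrable M (\<lambda>z. \<bar>f z\<bar> * (\<integral>x. bump r z x \<partial>M))"
      using MM.integrable_snd[OF pi] by (simp add: bump_sym[of r _ _])
  qed (use fi integral_bump_le in \<open>auto intro: mult_left_mono\<close>)
  finally show ?thesis using c by (simp add: divide_le_eq mult.commute)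
qed

lemma average_diff:
  assumes "f \<in> Linf M" "g \<in> Linf M"
  shows "average r (\<lambda>z. f z - g z) x = average r f x - average r g x"
  unfolding average_def left_diff_distrib
    Bochner_Integration.integral_diff[OF integrable_Linf_mult[OF assms(1) bump_integrable] integrable_Linf_mult[OF assms(2) bump_integrable]]
  by (rule diff_divide_distrib)

text \<open>Averaging contracts L1, so by density convergence has to be checked on test functions,
  where it holds pointwise with a uniform bound.\<close>

lemma average_L1_tendsto:
  assumes f: "f \<in> Linf M" and r: "\<And>n. 0 < r n" "r \<longlonglongrightarrow> 0"
  shows "(\<lambda>n. \<integral>x. \<bar>average (r n) f x - f x\<bar> \<partial>M) \<longlonglongrightarrow> 0"
proof (rule LIMSEQ_I)
  fix e :: real assume e: "0 < e"
  have fi: "integrable M f" by (rule Linf_integrable[OF finite_measure_M f])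
  have "0 < e / 3" using e by simp
  then obtain \<phi> where \<phi>: "\<phi> \<in> test_fun \<Omega>" "(\<integral>x. \<bar>f x - \<phi> x\<bar> \<partial>M) < e / 3" using test_fun_dense[OF open_\<Omega> fi] by blast
  obtain B where B: "0 \<le> B" "\<And>x. \<bar>\<phi> x\<bar> \<le> B" using test_fun_bounded[OF \<phi>(1)] by metis
  have \<phi>L: "\<phi> \<in> Linf M" by (rule LinfI[OF test_fun_measurable_lebesgue[OF \<phi>(1)], where C=B]) (use B in auto)
  have \<phi>i: "integrable M \<phi>" by (rule Linf_integrable[OF finite_measure_M \<phi>L])
  have "(\<lambda>n. \<integral>x. \<bar>average (r n) \<phi> x - \<phi> x\<bar> \<partial>M) \<longlonglongrightarrow> (\<integral>x. 0 \<partial>M)"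
  proof (rule integral_dominated_convergence[where w="\<lambda>x. 2 * B"])
    show "AE x in M. (\<lambda>n. \<bar>average (r n) \<phi> x - \<phi> x\<bar>) \<longlonglongrightarrow> 0"
    proof (rule AE_I2)
      fix x assume "x \<in> space M"
      then have x: "x \<in> \<Omega>" by simp
      have c: "isCont \<phi> x" using test_fun_continuous[OF \<phi>(1)] by (simp add: continuous_on_eq_continuous_at)
      have "(\<lambda>n. average (r n) \<phi> x) \<longlonglongrightarrow> \<phi> x" unfolding average_def
        by (rule bump_average_tendsto_isCont[OF \<phi>L _ c x r]) simp
      from tendsto_rabs[OF LIM_zero[OF this]] show "(\<lambda>n. \<bar>average (r n) \<phi> x - \<phi> x\<bar>) \<longlonglongrightarrow> 0" by simp
    qed
    show "(\<lambda>x. \<bar>average (r n) \<phi> x - \<phi> x\<bar>) \<in> borel_measurable M" for n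
      using average_measurable[OF \<phi>L] Linf_measurable[OF \<phi>L] by simp
    show "AE x in M. norm \<bar>average (r n) \<phi> x - \<phi> x\<bar> \<le> 2 * B" for n
    proof (rule AE_I2)
      fix x
      have "\<bar>average (r n) \<phi> x\<bar> \<le> B" by (rule average_bound[OF \<phi>L _ B(1) r(1)]) (use B(2) in simp)
      then show "norm \<bar>average (r n) \<phi> x - \<phi> x\<bar> \<le> 2 * B" using B(2)[of x] by simp
    qed
  qed simp_all
  then have "(\<lambda>n. \<integral>x. \<bar>average (r n) \<phi> x - \<phi> x\<bar> \<partial>M) \<longlonglongrightarrow> 0" by simp
  from LIMSEQ_D[OF this \<open>0 < e / 3\<close>]
  obtain N where N: "\<forall>n\<ge>N. norm ((\<integral>x. \<bar>average (r n) \<phi> x - \<phi> x\<bar> \<partial>M) - 0) < e / 3" by blast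
  show "\<exists>N. \<forall>n\<ge>N. norm ((\<integral>x. \<bar>average (r n) f x - f x\<bar> \<partial>M) - 0) < e"
  proof (intro exI allI impI)
    fix n assume n: "N \<le> n"
    have dL: "(\<lambda>z. f z - \<phi> z) \<in> Linf M" by (rule Linf_diff[OF f \<phi>L])
    note ai = Linf_integrable[OF finite_measure_M average_Linf[OF f r(1)[of n]]]
      Linf_integrable[OF finite_measure_M average_Linf[OF \<phi>L r(1)[of n]]]
      Linf_integrable[OF finite_measure_M average_Linf[OF dL r(1)[of n]]]
    have "(\<integral>x. \<bar>average (r n) f x - f x\<bar> \<partial>M) \<le> (\<integral>x. \<bar>average (r n) (\<lambda>z. f z - \<phi> z) x\<bar> + (\<bar>average (r n) \<phi> x - \<phi> x\<bar> + \<bar>f x - \<phi> x\<bar>) \<partial>M)"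
      by (rule integral_mono) (use ai fi \<phi>i in \<open>auto simp: average_diff[OF f \<phi>L]\<close>)
    also have "\<dots> = (\<integral>x. \<bar>average (r n) (\<lambda>z. f z - \<phi> z) x\<bar> \<partial>M) + ((\<integral>x. \<bar>average (r n) \<phi> x - \<phi> x\<bar> \<partial>M) + (\<integral>x. \<bar>f x - \<phi> x\<bar> \<partial>M))"
      using ai fi \<phi>i by simp
    also have "(\<integral>x. \<bar>average (r n) (\<lambda>z. f z - \<phi> z) x\<bar> \<partial>M) \<le> (\<integral>x. \<bar>f x - \<phi> x\<bar> \<partial>M)"
      by (rule average_L1_contraction[OF dL r(1)])
    finally have "(\<integral>x. \<bar>average (r n) f x - f x\<bar> \<partial>M) < e"
      using \<phi>(2) spec[OF N, of n] n by simp
    moreover have "0 \<le> (\<integral>x. \<bar>average (r n) f x - f x\<bar> \<partial>M)" by (rule Bochner_Integration.integral_nonneg) simp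
    ultimately show "norm ((\<integral>x. \<bar>average (r n) f x - f x\<bar> \<partial>M) - 0) < e" by simp
  qed
qed

lemma average_continuous:
  assumes f: "f \<in> Linf M" shows "continuous_on \<Omega> (average r f)"
proof -
  have "(\<lambda>n. \<integral>z. f z * bump r (x n) z \<partial>M) \<longlonglongrightarrow> (\<integral>z. f z * bump r a z \<partial>M)" if x: "x \<longlonglongrightarrow> a" for x a
  proof (rule integral_dominated_convergence[where w="\<lambda>z. \<bar>f z\<bar>"])
    show "integrable M (\<lambda>z. \<bar>f z\<bar>)" using Linf_integrable[OF finite_measure_M f] by simp
    show "(\<lambda>z. f z * bump r a z) \<in> borel_measurable M" using Linf_measurable[OF f] bump_measurable by simp
    show "(\<lambda>z. f z * bump r (x n) z) \<in> borel_measurable M" for n using Linf_measurable[OF f] bump_measurable by simp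
    show "AE z in M. (\<lambda>n. f z * bump r (x n) z) \<longlonglongrightarrow> f z * bump r a z"
    proof (rule AE_I2)
      fix z
      have "isCont (\<lambda>x. bump r x z) a" using bump_continuous_fst by (simp add: continuous_on_eq_continuous_at)
      then show "(\<lambda>n. f z * bump r (x n) z) \<longlonglongrightarrow> f z * bump r a z"
        using isCont_tendsto_compose x by (intro tendsto_mult tendsto_const) blast
    qed
    show "AE z in M. norm (f z * bump r (x n) z) \<le> \<bar>f z\<bar>" for n
      by (rule AE_I2) (simp add: abs_mult bump_nonneg bump_le_1 mult_left_le)
  qed
  then show ?thesis unfolding continuous_on_sequentially average_def by (auto simp: o_def divide_inverse intro!: tendsto_mult)
qed

text \<open>Each slice \<open>g t\<close> is the L1 limit of its averages, but \<open>g\<close> is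
  not known to be jointly measurable, so it cannot serve as the limit in the product space. The
  averages are jointly measurable by continuity in x; they are Cauchy in L1 of the product, and an
  almost everywhere convergent subsequence defines \<open>G\<close>.\<close>

lemma joint_gradient_component:
  assumes v: "v \<in> X" and b: "b \<in> Basis"
  shows "\<exists>G. G \<in> borel_measurable (MI \<Otimes>\<^sub>M M) \<and> (AE t in MI. AE x in M. G (t, x) = grad \<Omega> (v t) x \<bullet> b)"
proof -
  obtain C where C: "C \<ge> 0" "AE t in MI. vnorm (v t) \<le> C" using X_norm(2)[OF v] by blast
  define r where "r n = inverse (real (Suc n))" for n
  have r: "\<And>n. 0 < r n" "r \<longlonglongrightarrow> 0" unfolding r_def by (simp, rule LIMSEQ_inverse_real_of_nat)
  define g where "g t x = grad \<Omega> (v t) x \<bullet> b" for t x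
  have gL: "g t \<in> Linf M" if "t \<in> I" for t unfolding g_def[abs_def] by (rule Linf_inner_const[OF grad_props(1)[OF X_V[OF v that]]])
  define H where "H n t = average (r n) (g t)" for n t
  have Hm: "(\<lambda>(t, x). H n t x) \<in> borel_measurable (MI \<Otimes>\<^sub>M M)" for n
  proof (rule caratheodory_measurable[OF open_\<Omega>])
    show "continuous_on \<Omega> (H n t)" if "t \<in> space MI" for t unfolding H_def using that by (intro average_continuous gL) simp
    fix x assume "x \<in> \<Omega>"
    have "(\<lambda>t. \<integral>z. grad \<Omega> (v t) z \<bullet> (bump (r n) x z *\<^sub>R b) \<partial>M) \<in> borel_measurable MI"
      by (rule X_meas[OF v]) (use bump_integrable in simp)
    then show "(\<lambda>t. H n t x) \<in> borel_measurable MI" unfolding H_def average_def g_def by (simp add: mult.commute)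
  qed
  have good: "AE t in MI. t \<in> I \<and> (\<forall>n x. \<bar>H n t x\<bar> \<le> C)"
    using C(2) AE_space
  proof eventually_elim
    case (elim t)
    then have t: "t \<in> I" by simp
    have "AE z in M. \<bar>g t z\<bar> \<le> C"
      using grad_AE_bound[OF X_V[OF v t]]
    proof eventually_elim
      case (elim z)
      have "\<bar>g t z\<bar> \<le> norm (grad \<Omega> (v t) z)" unfolding g_def by (rule Basis_le_norm[OF b])
      then show ?case using elim \<open>vnorm (v t) \<le> C\<close> by linarith
    qed
    then show ?case unfolding H_def using average_bound[OF gL[OF t] _ C(1) r(1)] t by blast
  qed
  have Hi: "integrable (MI \<Otimes>\<^sub>M M) (\<lambda>(t, x). H n t x)" for n
  proof (rule PF.integrable_const_bound[OF _ Hm])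
    show "AE p in MI \<Otimes>\<^sub>M M. norm (case p of (t, x) \<Rightarrow> H n t x) \<le> C"
    proof (rule P.AE_pair_measure)
      show "{p \<in> space (MI \<Otimes>\<^sub>M M). norm (case p of (t, x) \<Rightarrow> H n t x) \<le> C} \<in> sets (MI \<Otimes>\<^sub>M M)"
        using Hm[of n] by measurable
      show "AE t in MI. AE x in M. norm (case (t, x) of (t, x) \<Rightarrow> H n t x) \<le> C"
        using good by eventually_elim simp
    qed
  qed
  have L1: "(\<lambda>n. \<integral>x. \<bar>H n t x - g t x\<bar> \<partial>M) \<longlonglongrightarrow> 0" if "t \<in> I" for t
    unfolding H_def by (rule average_L1_tendsto[OF gL[OF that] r])
  have cauchy: "\<exists>N. \<forall>i\<ge>N. \<forall>j\<ge>N. (\<integral>p. norm ((case p of (t, x) \<Rightarrow> H i t x) - (case p of (t, x) \<Rightarrow> H j t x)) \<partial>(MI \<Otimes>\<^sub>M M)) < e"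
    if e: "0 < e" for e
  proof (rule ccontr)
    assume "\<nexists>N. \<forall>i\<ge>N. \<forall>j\<ge>N. (\<integral>p. norm ((case p of (t, x) \<Rightarrow> H i t x) - (case p of (t, x) \<Rightarrow> H j t x)) \<partial>(MI \<Otimes>\<^sub>M M)) < e"
    \<comment> \<open>Failure of the Cauchy property yields index sequences \<open>i\<close> and
      \<open>j\<close>, and along sequences dominated convergence in t is available.\<close>
    then have "\<forall>N. \<exists>i j. i \<ge> N \<and> j \<ge> N \<and> e \<le> (\<integral>p. norm ((case p of (t, x) \<Rightarrow> H i t x) - (case p of (t, x) \<Rightarrow> H j t x)) \<partial>(MI \<Otimes>\<^sub>M M))"
      by (meson not_le)
    then obtain i j where ij: "\<And>N. i N \<ge> N" "\<And>N. j N \<ge> N"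
      "\<And>N. e \<le> (\<integral>p. norm ((case p of (t, x) \<Rightarrow> H (i N) t x) - (case p of (t, x) \<Rightarrow> H (j N) t x)) \<partial>(MI \<Otimes>\<^sub>M M))" by metis
    define D where "D N t = (\<integral>x. \<bar>H (i N) t x - H (j N) t x\<bar> \<partial>M)" for N t
    have pi: "integrable (MI \<Otimes>\<^sub>M M) (\<lambda>(t, x). \<bar>H (i N) t x - H (j N) t x\<bar>)" for N
      using integrable_abs[OF Bochner_Integration.integrable_diff[OF Hi[of "i N"] Hi[of "j N"]]] by (simp add: case_prod_beta')
    have Deq: "(\<integral>p. norm ((case p of (t, x) \<Rightarrow> H (i N) t x) - (case p of (t, x) \<Rightarrow> H (j N) t x)) \<partial>(MI \<Otimes>\<^sub>M M)) = (\<integral>t. D N t \<partial>MI)" for N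
      unfolding D_def using P.integral_fst[OF pi[of N]] by (simp add: case_prod_beta')
    have Dm: "D N \<in> borel_measurable MI" for N
      using P.integrable_fst[OF pi[of N]] unfolding D_def[abs_def] by auto
    have iN: "filterlim i at_top sequentially" "filterlim j at_top sequentially"
      using ij(1,2) by (auto intro!: filterlim_at_top_mono[OF filterlim_ident])
    have Hint: "integrable M (H n t)" if "t \<in> I" for n t
      unfolding H_def by (rule Linf_integrable[OF finite_measure_M average_Linf[OF gL[OF that] r(1)]])
    have gint: "integrable M (g t)" if "t \<in> I" for t by (rule Linf_integrable[OF finite_measure_M gL[OF that]])
    have "(\<lambda>N. \<integral>t. D N t \<partial>MI) \<longlonglongrightarrow> (\<integral>t. 0 \<partial>MI)"
    proof (rule integral_dominated_convergence[where w="\<lambda>t. 2 * C * measure M (space M)"])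
      show "AE t in MI. (\<lambda>N. D N t) \<longlonglongrightarrow> 0"
      proof (rule AE_I2)
        fix t assume "t \<in> space MI"
        then have t: "t \<in> I" by simp
        have up: "D N t \<le> (\<integral>x. \<bar>H (i N) t x - g t x\<bar> \<partial>M) + (\<integral>x. \<bar>H (j N) t x - g t x\<bar> \<partial>M)" for N
        proof -
          have "D N t \<le> (\<integral>x. \<bar>H (i N) t x - g t x\<bar> + \<bar>H (j N) t x - g t x\<bar> \<partial>M)"
            unfolding D_def by (rule integral_mono) (use Hint[OF t] gint[OF t] in auto)
          then show ?thesis using Hint[OF t] gint[OF t] by simp
        qed
        have lim: "(\<lambda>N. (\<integral>x. \<bar>H (i N) t x - g t x\<bar> \<partial>M) + (\<integral>x. \<bar>H (j N) t x - g t x\<bar> \<partial>M)) \<longlonglongrightarrow> 0 + 0"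
          by (intro tendsto_add filterlim_compose[OF L1[OF t]] iN)
        have low: "0 \<le> D N t" for N unfolding D_def by (rule Bochner_Integration.integral_nonneg) simp
        show "(\<lambda>N. D N t) \<longlonglongrightarrow> 0"
          by (rule real_tendsto_sandwich[OF always_eventually always_eventually tendsto_const lim[unfolded add_0_left]])
            (use low up in blast)+
      qed
      show "AE t in MI. norm (D N t) \<le> 2 * C * measure M (space M)" for N
        using good
      proof eventually_elim
        case (elim t)
        then have t: "t \<in> I" and Hb: "\<And>n x. \<bar>H n t x\<bar> \<le> C" by auto
        have "D N t \<le> (\<integral>x. 2 * C \<partial>M)" unfolding D_def
        proof (rule integral_mono)
          fix x show "\<bar>H (i N) t x - H (j N) t x\<bar> \<le> 2 * C" using Hb[of "i N" x] Hb[of "j N" x] by linarith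
        qed (use Hint[OF t] in auto)
        also have "(\<integral>x. 2 * C \<partial>M) = 2 * C * measure M (space M)" by (simp only: lebesgue_integral_const real_scaleR_def mult.commute)
        finally have "D N t \<le> 2 * C * measure M (space M)" .
        moreover have "0 \<le> D N t" unfolding D_def by (rule Bochner_Integration.integral_nonneg) simp
        ultimately show ?case unfolding real_norm_def by linarith
      qed
    qed (use Dm in simp_all)
    then have "(\<lambda>N. \<integral>t. D N t \<partial>MI) \<longlonglongrightarrow> 0" by simp
    from LIMSEQ_D[OF this e] obtain N where "\<forall>n\<ge>N. norm ((\<integral>t. D n t \<partial>MI) - 0) < e" by blast
    then have "norm ((\<integral>t. D N t \<partial>MI) - 0) < e" by blast
    moreover have "e \<le> (\<integral>t. D N t \<partial>MI)" using ij(3)[of N] unfolding Deq .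
    ultimately show False unfolding diff_zero real_norm_def by linarith
  qed
  obtain s where s: "strict_mono (s :: nat \<Rightarrow> nat)" "AE p in MI \<Otimes>\<^sub>M M. Cauchy (\<lambda>i. case p of (t, x) \<Rightarrow> H (s i) t x)"
    by (rule cauchy_L1_AE_cauchy_subseq[OF Hi cauchy])
  define G where "G p = lim (\<lambda>i. case p of (t, x) \<Rightarrow> H (s i) t x)" for p
  have Gm: "G \<in> borel_measurable (MI \<Otimes>\<^sub>M M)" unfolding G_def[abs_def] by (rule borel_measurable_lim_metric[OF Hm])
  have "AE t in MI. AE x in M. Cauchy (\<lambda>i. H (s i) t x)" using P.AE_pair[OF s(2)] by simp
  then have "AE t in MI. AE x in M. G (t, x) = g t x"
    using AE_space
  proof eventually_elim
    case (elim t)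
    then have t: "t \<in> I" by simp
    \<comment> \<open>The subsequence \<open>k\<close> may depend on t: for almost every x the
      sequence already converges, and \<open>k\<close> only serves to identify its limit.\<close>
    have "\<exists>k::nat\<Rightarrow>nat. strict_mono k \<and> (AE x in M. (\<lambda>n. H (s (k n)) t x - g t x) \<longlonglongrightarrow> 0)"
    proof (rule tendsto_L1_AE_subseq[where u="\<lambda>n x. H (s n) t x - g t x"])
      show "integrable M (\<lambda>x. H (s n) t x - g t x)" for n
        unfolding H_def using Linf_integrable[OF finite_measure_M average_Linf[OF gL[OF t] r(1)]] Linf_integrable[OF finite_measure_M gL[OF t]] by simp
      show "(\<lambda>n. \<integral>x. norm (H (s n) t x - g t x) \<partial>M) \<longlonglongrightarrow> 0"
        using LIMSEQ_subseq_LIMSEQ[OF L1[OF t] s(1)] by (simp add: o_def)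
    qed
    then obtain k :: "nat \<Rightarrow> nat" where k: "strict_mono k" "AE x in M. (\<lambda>n. H (s (k n)) t x - g t x) \<longlonglongrightarrow> 0" by blast
    show ?case using elim(1) k(2)
    proof eventually_elim
      case (elim x)
      then have "convergent (\<lambda>i. H (s i) t x)" by (simp only: Cauchy_convergent_iff)
      then obtain l where l: "(\<lambda>i. H (s i) t x) \<longlonglongrightarrow> l" unfolding convergent_def by blast
      have "(\<lambda>n. H (s (k n)) t x) \<longlonglongrightarrow> l" using LIMSEQ_subseq_LIMSEQ[OF l k(1)] by (simp add: o_def)
      moreover have "(\<lambda>n. H (s (k n)) t x) \<longlonglongrightarrow> g t x" using elim(2) by (rule LIM_zero_cancel)
      ultimately have "l = g t x" by (rule LIMSEQ_unique)
      then show ?case unfolding G_def using limI[OF l] by simp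
    qed
  qed
  then show ?thesis using Gm unfolding g_def by (intro exI conjI)
qed

lemma joint_gradient:
  assumes v: "v \<in> X"
  shows "\<exists>G. G \<in> borel_measurable (MI \<Otimes>\<^sub>M M) \<and> (AE t in MI. AE x in M. G (t, x) = grad \<Omega> (v t) x)"
proof -
  have "\<forall>b\<in>Basis. \<exists>G. G \<in> borel_measurable (MI \<Otimes>\<^sub>M M) \<and> (AE t in MI. AE x in M. G (t, x) = grad \<Omega> (v t) x \<bullet> b)"
    using joint_gradient_component[OF v] by blast
  from bchoice[OF this] obtain F where FF: "\<forall>b\<in>Basis. F b \<in> borel_measurable (MI \<Otimes>\<^sub>M M) \<and>
    (AE t in MI. AE x in M. F b (t, x) = grad \<Omega> (v t) x \<bullet> b)" ..
  have F: "F b \<in> borel_measurable (MI \<Otimes>\<^sub>M M)" "AE t in MI. AE x in M. F b (t, x) = grad \<Omega> (v t) x \<bullet> b"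
    if "b \<in> Basis" for b using FF that by simp_all
  define G where "G p = (\<Sum>b\<in>Basis. F b p *\<^sub>R b)" for p
  have "G \<in> borel_measurable (MI \<Otimes>\<^sub>M M)" unfolding G_def[abs_def]
    by (intro borel_measurable_sum borel_measurable_scaleR F(1) borel_measurable_const)
  moreover have "AE t in MI. \<forall>b\<in>Basis. AE x in M. F b (t, x) = grad \<Omega> (v t) x \<bullet> b"
    using F(2) by (intro AE_ball_countable[THEN iffD2]) (auto intro: countable_finite)
  then have "AE t in MI. AE x in M. G (t, x) = grad \<Omega> (v t) x"
  proof eventually_elim
    case (elim t)
    have "AE x in M. \<forall>b\<in>Basis. F b (t, x) = grad \<Omega> (v t) x \<bullet> b"
      using elim by (intro AE_ball_countable[THEN iffD2]) (auto intro: countable_finite)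
    then show ?case by eventually_elim (simp add: G_def euclidean_representation)
  qed
  ultimately show ?thesis by (intro exI conjI)
qed

end

text \<open>By completeness of Lebesgue measure. It provides measurability for functions such as
  slicewise norms or the Hessian integrand, once a measurable version is known.\<close>

lemma lebesgue_on_AE_measurable:
  fixes f g :: "'a::euclidean_space \<Rightarrow> 'b::euclidean_space"
  assumes S: "S \<in> sets lebesgue" and g: "g \<in> borel_measurable (lebesgue_on S)" and ae: "AE x in lebesgue_on S. f x = g x"
  shows "f \<in> borel_measurable (lebesgue_on S)"
proof (rule measurableI)
  obtain N where N: "{x \<in> space (lebesgue_on S). f x \<noteq> g x} \<subseteq> N" "N \<in> null_sets (lebesgue_on S)"
    using ae unfolding eventually_ae_filter by blast
  have Nl: "N \<in> null_sets lebesgue"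
    using N(2) S by (simp add: null_sets_restrict_space)
  fix A :: "'b set" assume A: "A \<in> sets borel"
  have gA: "g -` A \<inter> S \<in> sets lebesgue"
    using measurable_sets[OF g A] S by (simp add: sets_restrict_space_iff)
  have sub: "f -` A \<inter> S \<inter> N \<in> null_sets lebesgue" by (rule null_sets_completion_subset[OF _ Nl]) auto
  have "f -` A \<inter> S = (g -` A \<inter> S - N) \<union> (f -` A \<inter> S \<inter> N)" using N(1) by auto
  moreover have "(g -` A \<inter> S - N) \<union> (f -` A \<inter> S \<inter> N) \<in> sets lebesgue" using gA Nl sub by auto
  ultimately have "f -` A \<inter> S \<in> sets lebesgue" by simp
  then show "f -` A \<inter> space (lebesgue_on S) \<in> sets (lebesgue_on S)"
    using S by (simp add: sets_restrict_space_iff)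
qed auto

section \<open>Gradients on the cylinder\<close>

context torsion_domain
begin

abbreviation "Q \<equiv> cylinder T \<Omega>"
abbreviation "MQ \<equiv> lebesgue_on Q"

lemma open_Q: "open Q" and bounded_Q: "bounded Q"
  using open_\<Omega> bounded_\<Omega> by (auto intro: open_Times bounded_Times)

lemma lmeasurable_Q: "Q \<in> lmeasurable"
  by (rule lmeasurable_open[OF bounded_Q open_Q])

lemma finite_measure_MQ: "finite_measure MQ"
  by (rule finite_measure_lebesgue_on[OF lmeasurable_Q])

lemma sets_I: "I \<in> sets lebesgue" and sets_\<Omega>: "\<Omega> \<in> sets lebesgue" and sets_Q: "Q \<in> sets lebesgue"
  using lmeasurable_\<Omega> lmeasurable_Q by auto

lemma AE_Q_of_slices:
  "{p \<in> space MQ. P p} \<in> sets MQ \<Longrightarrow> AE t in MI. AE x in M. P (t, x) \<Longrightarrow> AE p in MQ. P p"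
proof (rule AE_cylinder_of_slices[OF sets_I sets_\<Omega> sets_Q])
  assume "{p \<in> space MQ. P p} \<in> sets MQ"
  then have "space MQ - {p \<in> space MQ. P p} \<in> sets MQ" by blast
  moreover have "space MQ - {p \<in> space MQ. P p} = {p \<in> Q. \<not> P p}" by auto
  ultimately show "{p \<in> Q. \<not> P p} \<in> sets lebesgue" using sets_Q by (simp add: sets_restrict_space_iff)
qed

text \<open>The choice behind \<open>grad_Q\<close> has a meaning once some bounded measurable
  version of the slicewise gradients is exhibited; \<open>joint_gradient\<close> provides
  it.\<close>

lemma grad_Q_props:
  assumes v: "v \<in> X"
  shows "grad_Q \<Omega> T v \<in> Linf MQ" "AE t in MI. AE x in M. grad_Q \<Omega> T v (t, x) = grad \<Omega> (v t) x"
proof -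
  obtain G where G: "G \<in> borel_measurable (MI \<Otimes>\<^sub>M M)" "AE t in MI. AE x in M. G (t, x) = grad \<Omega> (v t) x"
    using joint_gradient[OF v] by blast
  have Gm: "G \<in> borel_measurable MQ"
    using measurable_compose[OF measurable_cylinder[OF sets_I sets_\<Omega>] G(1)] .
  obtain C where C: "AE t in MI. vnorm (v t) \<le> C" using X_norm(2)[OF v] by blast
  have "AE p in MQ. norm (G p) \<le> C"
  proof (rule AE_Q_of_slices)
    show "{p \<in> space MQ. norm (G p) \<le> C} \<in> sets MQ" using Gm by measurable
    show "AE t in MI. AE x in M. norm (G (t, x)) \<le> C"
      using G(2) C AE_space
    proof eventually_elim
      case (elim t)
      then have "v t \<in> V" using X_V[OF v] by simp
      from elim(1) grad_AE_bound[OF this] show ?case by eventually_elim (use elim(2) in simp)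
    qed
  qed
  then have "G \<in> Linf MQ" by (rule LinfI[OF Gm])
  then have "\<exists>g. g \<in> Linf MQ \<and> (AE t in MI. AE x in M. g (t, x) = grad \<Omega> (v t) x)" using G(2) by blast
  then have "grad_Q \<Omega> T v \<in> Linf MQ \<and> (AE t in MI. AE x in M. grad_Q \<Omega> T v (t, x) = grad \<Omega> (v t) x)"
    unfolding grad_Q_def by (rule someI_ex)
  then show "grad_Q \<Omega> T v \<in> Linf MQ" "AE t in MI. AE x in M. grad_Q \<Omega> T v (t, x) = grad \<Omega> (v t) x" by auto
qed

text \<open>Measurability in time of the norm of a difference does not follow from that of the two
  norms. It is read off jointly measurable gradients by
  \<open>esssup_slices_measurable\<close>.\<close>

lemma X_diff:
  assumes v: "v \<in> X" and w: "w \<in> X" shows "(\<lambda>t x. v t x - w t x) \<in> X"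
proof -
  obtain G where G: "G \<in> borel_measurable (MI \<Otimes>\<^sub>M M)" "AE t in MI. AE x in M. G (t, x) = grad \<Omega> (v t) x"
    using joint_gradient[OF v] by blast
  obtain H where H: "H \<in> borel_measurable (MI \<Otimes>\<^sub>M M)" "AE t in MI. AE x in M. H (t, x) = grad \<Omega> (w t) x"
    using joint_gradient[OF w] by blast
  have memV: "(\<lambda>x. v t x - w t x) \<in> V" if "t \<in> I" for t by (rule V_diff[OF X_V[OF v that] X_V[OF w that]])
  define n where "n t = Linf_norm M (\<lambda>x. G (t, x) - H (t, x))" for t
  have nm: "n \<in> borel_measurable MI"
  proof -
    have "(\<lambda>p. ennreal (norm (G p - H p))) \<in> borel_measurable (MI \<Otimes>\<^sub>M M)" using G(1) H(1) by measurable
    from esssup_slices_measurable[OF _ this] show ?thesis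
      unfolding n_def[abs_def] Linf_norm_def by (simp add: M.sigma_finite_measure_axioms)
  qed
  have ne: "AE t in MI. vnorm (\<lambda>x. v t x - w t x) = n t"
    using G(2) H(2) AE_space
  proof eventually_elim
    case (elim t)
    then have t: "t \<in> I" by simp
    show ?case unfolding n_def V_norm_def
    proof (rule Linf_norm_AE_cong)
      show "grad \<Omega> (\<lambda>x. v t x - w t x) \<in> borel_measurable M" by (rule Linf_measurable[OF grad_props(1)[OF memV[OF t]]])
      have "(\<lambda>p. G p - H p) \<in> borel_measurable (MI \<Otimes>\<^sub>M M)" using G(1) H(1) by simp
      from measurable_Pair2[OF this, of t] t show "(\<lambda>x. G (t, x) - H (t, x)) \<in> borel_measurable M" by simp
      show "AE x in M. grad \<Omega> (\<lambda>x. v t x - w t x) x = G (t, x) - H (t, x)"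
        using grad_diff[OF X_V[OF v t] X_V[OF w t]] elim(1,2) by eventually_elim simp
    qed
  qed
  have m: "(\<lambda>t. vnorm (\<lambda>x. v t x - w t x)) \<in> borel_measurable MI"
    by (rule lebesgue_on_AE_measurable[OF sets_I nm ne])
  obtain C where C: "AE t in MI. vnorm (v t) \<le> C" using X_norm(2)[OF v] by blast
  obtain D where D: "AE t in MI. vnorm (w t) \<le> D" using X_norm(2)[OF w] by blast
  have "(\<lambda>t. vnorm (\<lambda>x. v t x - w t x)) \<in> Linf MI"
  proof (rule LinfI[OF m])
    show "AE t in MI. norm (vnorm (\<lambda>x. v t x - w t x)) \<le> C + D"
      using C D AE_space
    proof eventually_elim
      case (elim t)
      then have t: "t \<in> I" by simp
      show ?case using V_norm_diff_le[OF X_V[OF v t] X_V[OF w t]] elim(1,2) V_norm_nonneg[of "\<lambda>x. v t x - w t x"] by simp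
    qed
  qed
  moreover have "(\<lambda>t. \<integral>x. grad \<Omega> (\<lambda>x. v t x - w t x) x \<bullet> \<psi> x \<partial>M) \<in> borel_measurable MI" if \<psi>: "integrable M \<psi>" for \<psi>
  proof -
    have "(\<lambda>t. (\<integral>x. grad \<Omega> (v t) x \<bullet> \<psi> x \<partial>M) - (\<integral>x. grad \<Omega> (w t) x \<bullet> \<psi> x \<partial>M)) \<in> borel_measurable MI"
      by (rule borel_measurable_diff[OF X_meas[OF v \<psi>] X_meas[OF w \<psi>]])
    moreover have "(\<integral>x. grad \<Omega> (v t) x \<bullet> \<psi> x \<partial>M) - (\<integral>x. grad \<Omega> (w t) x \<bullet> \<psi> x \<partial>M) = (\<integral>x. grad \<Omega> (\<lambda>x. v t x - w t x) x \<bullet> \<psi> x \<partial>M)"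
      if "t \<in> space MI" for t
      using integral_grad_diff[OF X_V[OF v] X_V[OF w] \<psi>, of t t] that by (simp add: inner_commute)
    ultimately show ?thesis by (rule measurable_cong[THEN iffD1, rotated])
  qed
  ultimately show ?thesis using memV unfolding Linf_wstar_def by blast
qed

lemma grad_Q_diff:
  assumes v: "v \<in> X" and w: "w \<in> X"
  shows "AE p in MQ. grad_Q \<Omega> T (\<lambda>t x. v t x - w t x) p = grad_Q \<Omega> T v p - grad_Q \<Omega> T w p"
proof (rule AE_Q_of_slices)
  note d = X_diff[OF v w]
  have [measurable]: "grad_Q \<Omega> T v \<in> borel_measurable MQ" "grad_Q \<Omega> T w \<in> borel_measurable MQ" "grad_Q \<Omega> T (\<lambda>t x. v t x - w t x) \<in> borel_measurable MQ"
    using grad_Q_props(1)[OF v] grad_Q_props(1)[OF w] grad_Q_props(1)[OF d] by (auto intro: Linf_measurable)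
  show "{p \<in> space MQ. grad_Q \<Omega> T (\<lambda>t x. v t x - w t x) p = grad_Q \<Omega> T v p - grad_Q \<Omega> T w p} \<in> sets MQ"
    by measurable
  show "AE t in MI. AE x in M. grad_Q \<Omega> T (\<lambda>t x. v t x - w t x) (t, x) = grad_Q \<Omega> T v (t, x) - grad_Q \<Omega> T w (t, x)"
    using grad_Q_props(2)[OF v] grad_Q_props(2)[OF w] grad_Q_props(2)[OF d] AE_space
  proof eventually_elim
    case (elim t)
    then have t: "t \<in> I" by simp
    show ?case using elim(1-3) grad_diff[OF X_V[OF v t] X_V[OF w t]] by eventually_elim simp
  qed
qed

lemma X_const: assumes w: "w \<in> V" shows "(\<lambda>t. w) \<in> X"
  unfolding Linf_wstar_def using w Linf_const by auto

section \<open>Functionals in the predual and weak time derivatives\<close>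

abbreviation "VS \<equiv> predual \<Omega> \<Gamma>\<^sub>D"
abbreviation "vsnorm \<equiv> predual_norm \<Omega> \<Gamma>\<^sub>D"

lemma predualE:
  assumes "l \<in> VS" obtains \<psi> where "integrable M \<psi>" "\<And>v. v \<in> V \<Longrightarrow> l v = (\<integral>x. \<psi> x \<bullet> grad \<Omega> v x \<partial>M)"
  using assms unfolding predual_def represents_predual_def by blast

lemma predual_diff:
  assumes "l \<in> VS" "k \<in> VS" shows "(\<lambda>v. l v - k v) \<in> VS"
proof -
  obtain \<psi> where \<psi>: "integrable M \<psi>" "\<And>v. v \<in> V \<Longrightarrow> l v = (\<integral>x. \<psi> x \<bullet> grad \<Omega> v x \<partial>M)" by (rule predualE[OF assms(1)]) blast
  obtain \<eta> where \<eta>: "integrable M \<eta>" "\<And>v. v \<in> V \<Longrightarrow> k v = (\<integral>x. \<eta> x \<bullet> grad \<Omega> v x \<partial>M)" by (rule predualE[OF assms(2)]) blast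
  have "l v - k v = (\<integral>x. (\<psi> x - \<eta> x) \<bullet> grad \<Omega> v x \<partial>M)" if v: "v \<in> V" for v
    unfolding \<psi>(2)[OF v] \<eta>(2)[OF v] inner_diff_left
    by (rule Bochner_Integration.integral_diff[symmetric])
      (rule integrable_inner_Linf[OF \<psi>(1) grad_props(1)[OF v]] integrable_inner_Linf[OF \<eta>(1) grad_props(1)[OF v]])+
  moreover have "integrable M (\<lambda>x. \<psi> x - \<eta> x)" using \<psi>(1) \<eta>(1) by simp
  ultimately show ?thesis unfolding predual_def represents_predual_def by blast
qed

lemma predual_norm_bound:
  assumes l: "l \<in> VS" and v: "v \<in> V" shows "\<bar>l v\<bar> \<le> vsnorm l * vnorm v"
proof (cases "vnorm v = 0")
  case True
  obtain \<psi> where \<psi>: "integrable M \<psi>" "\<And>v. v \<in> V \<Longrightarrow> l v = (\<integral>x. \<psi> x \<bullet> grad \<Omega> v x \<partial>M)" by (rule predualE[OF l]) blast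
  show ?thesis using integral_grad_bound[OF v \<psi>(1)] \<psi>(2)[OF v] True by simp
next
  case False
  then have pos: "0 < vnorm v" using V_norm_nonneg[of v] by simp
  have "\<bar>l v\<bar> / vnorm v \<le> vsnorm l"
    unfolding predual_norm_def
  proof (rule cInf_greatest)
    show "{\<integral>x. norm (w x) \<partial>M |w. represents_predual \<Omega> \<Gamma>\<^sub>D w l} \<noteq> {}" using l unfolding predual_def by blast
    fix y assume "y \<in> {\<integral>x. norm (w x) \<partial>M |w. represents_predual \<Omega> \<Gamma>\<^sub>D w l}"
    then obtain w where w: "y = (\<integral>x. norm (w x) \<partial>M)" "integrable M w" "l v = (\<integral>x. w x \<bullet> grad \<Omega> v x \<partial>M)"
      using v unfolding represents_predual_def by blast
    show "\<bar>l v\<bar> / vnorm v \<le> y" using integral_grad_bound[OF v w(2)] pos unfolding w(1,3) by (simp add: divide_le_eq)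
  qed
  then show ?thesis using pos by (simp add: divide_le_eq)
qed

text \<open>The facts about \<open>L1_predual\<close> on which the sequel relies, in a form in which
  a difference of two derivatives is treated by adding the majorants, without approximation by
  simple functions.\<close>

definition good_deriv :: "(real \<Rightarrow> ('a \<Rightarrow> real) \<Rightarrow> real) \<Rightarrow> bool" where
  "good_deriv g \<longleftrightarrow> (\<forall>t\<in>I. g t \<in> VS) \<and>
    (\<exists>\<gamma>. integrable MI \<gamma> \<and> (\<forall>t\<in>I. \<forall>w\<in>V. \<bar>g t w\<bar> \<le> \<gamma> t * vnorm w)) \<and>
    (\<forall>v\<in>X. (\<lambda>t. g t (v t)) \<in> borel_measurable MI)"

text \<open>For a simple function the pairing is a finite sum of functionals from the predual,
  measurable in time by weak-star measurability of v. Strong convergence carries this to the limit,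
  and the majorant is \<open>vsnorm\<close>.\<close>

lemma good_deriv_L1_predual:
  assumes f: "f \<in> L1_predual \<Omega> \<Gamma>\<^sub>D T" shows "good_deriv f"
proof -
  have fV: "\<And>t. t \<in> I \<Longrightarrow> f t \<in> VS" using f by (simp add: L1_predual_def)
  have fi: "integrable MI (\<lambda>t. vsnorm (f t))" using f by (simp add: L1_predual_def)
  obtain s where s: "\<And>n. simple_function MI (s n)" "\<And>n t. t \<in> I \<Longrightarrow> s n t \<in> VS"
    "AE t in MI. (\<lambda>n. vsnorm (\<lambda>v. s n t v - f t v)) \<longlonglongrightarrow> 0" using f unfolding L1_predual_def by blast
  have meas: "(\<lambda>t. f t (v t)) \<in> borel_measurable MI" if v: "v \<in> X" for v
  proof -
    have sm: "(\<lambda>t. s n t (v t)) \<in> borel_measurable MI" for n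
    proof -
      let ?R = "s n ` space MI"
      have fin: "finite ?R" using s(1)[of n] unfolding simple_function_def by blast
      have "(\<lambda>t. indicat_real (s n -` {l} \<inter> space MI) t * l (v t)) \<in> borel_measurable MI" if lR: "l \<in> ?R" for l
      proof -
        have "l \<in> VS" using lR s(2) by auto
        then obtain \<psi> where \<psi>: "integrable M \<psi>" "\<And>v. v \<in> V \<Longrightarrow> l v = (\<integral>x. \<psi> x \<bullet> grad \<Omega> v x \<partial>M)" by (rule predualE) blast
        have "(\<lambda>t. \<integral>x. grad \<Omega> (v t) x \<bullet> \<psi> x \<partial>M) \<in> borel_measurable MI" by (rule X_meas[OF v \<psi>(1)])
        moreover have "(\<integral>x. grad \<Omega> (v t) x \<bullet> \<psi> x \<partial>M) = l (v t)" if "t \<in> space MI" for t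
          using \<psi>(2)[OF X_V[OF v]] that by (simp add: inner_commute)
        ultimately have "(\<lambda>t. l (v t)) \<in> borel_measurable MI" by (rule measurable_cong[THEN iffD1, rotated])
        moreover have "s n -` {l} \<inter> space MI \<in> sets MI" using s(1)[of n] lR unfolding simple_function_def by blast
        ultimately show ?thesis by (intro borel_measurable_times borel_measurable_indicator)
      qed
      then have "(\<lambda>t. \<Sum>l\<in>?R. indicat_real (s n -` {l} \<inter> space MI) t * l (v t)) \<in> borel_measurable MI"
        by (rule borel_measurable_sum)
      moreover have "(\<Sum>l\<in>?R. indicat_real (s n -` {l} \<inter> space MI) t * l (v t)) = s n t (v t)" if t: "t \<in> space MI" for t
      proof -
        have "(\<Sum>l\<in>?R. indicat_real (s n -` {l} \<inter> space MI) t * l (v t)) = (\<Sum>l\<in>?R. if l = s n t then s n t (v t) else 0)"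
          by (rule sum.cong[OF refl]) (use t in \<open>auto simp: indicator_def\<close>)
        also have "\<dots> = s n t (v t)" using fin t by (subst sum.delta) auto
        finally show ?thesis .
      qed
      ultimately show ?thesis by (rule measurable_cong[THEN iffD1, rotated])
    qed
    have "AE t in MI. f t (v t) = lim (\<lambda>n. s n t (v t))"
      using s(3) AE_space
    proof eventually_elim
      case (elim t)
      then have t: "t \<in> I" by simp
      have "(\<lambda>n. s n t (v t) - f t (v t)) \<longlonglongrightarrow> 0"
      proof (rule Lim_null_comparison)
        show "\<forall>\<^sub>F n in sequentially. norm (s n t (v t) - f t (v t)) \<le> vsnorm (\<lambda>v. s n t v - f t v) * vnorm (v t)"
          using predual_norm_bound[OF predual_diff[OF s(2)[OF t] fV[OF t]] X_V[OF v t]] by simp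
        show "(\<lambda>n. vsnorm (\<lambda>v. s n t v - f t v) * vnorm (v t)) \<longlonglongrightarrow> 0"
          using elim(1) by (rule tendsto_mult_left_zero)
      qed
      then have "(\<lambda>n. s n t (v t)) \<longlonglongrightarrow> f t (v t)" by (rule LIM_zero_cancel)
      then show ?case using limI by metis
    qed
    then show ?thesis by (rule lebesgue_on_AE_measurable[OF sets_I borel_measurable_lim_metric[OF sm]])
  qed
  show ?thesis unfolding good_deriv_def using fV fi meas predual_norm_bound by blast
qed

lemma good_deriv_diff:
  assumes "good_deriv g" "good_deriv h" shows "good_deriv (\<lambda>t w. g t w - h t w)"
proof -
  obtain \<gamma> where \<gamma>: "integrable MI \<gamma>" "\<And>t w. t \<in> I \<Longrightarrow> w \<in> V \<Longrightarrow> \<bar>g t w\<bar> \<le> \<gamma> t * vnorm w"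
    using assms(1) unfolding good_deriv_def by blast
  obtain \<eta> where \<eta>: "integrable MI \<eta>" "\<And>t w. t \<in> I \<Longrightarrow> w \<in> V \<Longrightarrow> \<bar>h t w\<bar> \<le> \<eta> t * vnorm w"
    using assms(2) unfolding good_deriv_def by blast
  have "\<bar>g t w - h t w\<bar> \<le> (\<gamma> t + \<eta> t) * vnorm w" if "t \<in> I" "w \<in> V" for t w
    unfolding distrib_right using \<gamma>(2)[OF that] \<eta>(2)[OF that] by linarith
  moreover have "integrable MI (\<lambda>t. \<gamma> t + \<eta> t)" using \<gamma>(1) \<eta>(1) by simp
  ultimately have "\<exists>\<gamma>. integrable MI \<gamma> \<and> (\<forall>t\<in>I. \<forall>w\<in>V. \<bar>g t w - h t w\<bar> \<le> \<gamma> t * vnorm w)" by blast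
  moreover have "(\<lambda>t. g t (v t) - h t (v t)) \<in> borel_measurable MI" if "v \<in> X" for v
    using assms that unfolding good_deriv_def by (intro borel_measurable_diff) blast+
  moreover have "(\<lambda>w. g t w - h t w) \<in> VS" if "t \<in> I" for t
    using assms that predual_diff unfolding good_deriv_def by blast
  ultimately show ?thesis unfolding good_deriv_def by blast
qed

lemma good_deriv_integrable:
  assumes g: "good_deriv g" and v: "v \<in> X" shows "integrable MI (\<lambda>t. g t (v t))"
proof -
  obtain \<gamma> where \<gamma>: "integrable MI \<gamma>" "\<And>t w. t \<in> I \<Longrightarrow> w \<in> V \<Longrightarrow> \<bar>g t w\<bar> \<le> \<gamma> t * vnorm w"
    using g unfolding good_deriv_def by blast
  obtain C where C: "C \<ge> 0" "AE t in MI. vnorm (v t) \<le> C" using X_norm(2)[OF v] by blast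
  show ?thesis
  proof (rule Bochner_Integration.integrable_bound[where f="\<lambda>t. C * \<bar>\<gamma> t\<bar>"])
    show "integrable MI (\<lambda>t. C * \<bar>\<gamma> t\<bar>)" using \<gamma>(1) by simp
    show "(\<lambda>t. g t (v t)) \<in> borel_measurable MI" using g v unfolding good_deriv_def by blast
    show "AE t in MI. norm (g t (v t)) \<le> norm (C * \<bar>\<gamma> t\<bar>)"
      using C(2) AE_space
    proof eventually_elim
      case (elim t)
      then have t: "t \<in> I" by simp
      have "\<bar>g t (v t)\<bar> \<le> \<gamma> t * vnorm (v t)" by (rule \<gamma>(2)[OF t X_V[OF v t]])
      also have "\<dots> \<le> \<bar>\<gamma> t\<bar> * vnorm (v t)" by (rule mult_right_mono) (auto simp: V_norm_nonneg)
      also have "\<dots> \<le> \<bar>\<gamma> t\<bar> * C" using elim(1) by (rule mult_left_mono) simp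
      finally show ?case using C(1) by (simp add: mult.commute)
    qed
  qed
qed

lemma L1_functional_diff:
  assumes "good_deriv g" "good_deriv h" "v \<in> X"
  shows "L1_functional T (\<lambda>t w. g t w - h t w) v = L1_functional T g v - L1_functional T h v"
  unfolding L1_functional_def
  by (rule Bochner_Integration.integral_diff[OF good_deriv_integrable[OF assms(1,3)] good_deriv_integrable[OF assms(2,3)]])

text \<open>\<open>has_time_deriv\<close> with \<open>good_deriv\<close> as the class of
  derivatives. The relation passes to \<open>lam - u\<close> with the difference of the two chosen
  derivatives, which need not be what \<open>time_deriv\<close> would choose for
  \<open>lam - u\<close>.\<close>

definition weak_deriv :: "(real \<Rightarrow> 'a \<Rightarrow> real) \<Rightarrow> (real \<Rightarrow> ('a \<Rightarrow> real) \<Rightarrow> real) \<Rightarrow> bool" where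
  "weak_deriv v g \<longleftrightarrow> good_deriv g \<and>
    (\<forall>\<phi>\<in>test_fun I. \<forall>w\<in>V. (\<integral>t. deriv \<phi> t * (\<integral>x. v t x * w x \<partial>M) \<partial>MI) = - (\<integral>t. \<phi> t * g t w \<partial>MI))"

lemma weak_deriv_time_deriv:
  assumes "v \<in> W_inf \<Omega> \<Gamma>\<^sub>D T" shows "weak_deriv v (time_deriv \<Omega> \<Gamma>\<^sub>D T v)"
proof -
  have "\<exists>g. has_time_deriv \<Omega> \<Gamma>\<^sub>D T v g" using assms by (simp add: W_inf_def)
  then have "has_time_deriv \<Omega> \<Gamma>\<^sub>D T v (time_deriv \<Omega> \<Gamma>\<^sub>D T v)" unfolding time_deriv_def by (rule someI_ex)
  then show ?thesis unfolding weak_deriv_def has_time_deriv_def using good_deriv_L1_predual by blast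
qed

lemma deriv_eq_partial_deriv:
  fixes \<phi> :: "real \<Rightarrow> real" assumes "\<phi> \<in> test_fun I" shows "deriv \<phi> t = partial_deriv 1 \<phi> t"
proof -
  have "(\<phi> has_derivative (\<lambda>h. h * partial_deriv 1 \<phi> t)) (at t)"
    using frechet_derivative_sum_partial[OF assms, of t] by simp
  then have "(\<phi> has_field_derivative partial_deriv 1 \<phi> t) (at t)"
    unfolding has_field_derivative_def by (simp add: mult.commute[of _ "partial_deriv 1 \<phi> t"])
  then show ?thesis by (rule DERIV_imp_deriv)
qed

text \<open>The bound on the gradients becomes a bound on the slices by
  \<open>poincare_AE\<close>.\<close>

lemma X_product_Linf:
  assumes v: "v \<in> X" and w: "w \<in> V" shows "(\<lambda>t. \<integral>x. v t x * w x \<partial>M) \<in> Linf MI"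
proof -
  obtain C where C: "C \<ge> 0" "AE t in MI. vnorm (v t) \<le> C" using X_norm(2)[OF v] by blast
  obtain D where D: "D \<ge> 0" "\<And>v. v \<in> V \<Longrightarrow> AE x in M. \<bar>v x\<bar> \<le> D * vnorm v" using poincare_AE by blast
  have wi: "integrable M w" by (rule Linf_integrable[OF finite_measure_M V_Linf[OF w]])
  show ?thesis
  proof (rule LinfI)
    show "(\<lambda>t. \<integral>x. v t x * w x \<partial>M) \<in> borel_measurable MI"
      by (rule integral_product_measurable[OF v Linf_measurable[OF V_Linf[OF w]]])
    show "AE t in MI. norm (\<integral>x. v t x * w x \<partial>M) \<le> (D * C) * (\<integral>x. \<bar>w x\<bar> \<partial>M)"
      using C(2) AE_space
    proof eventually_elim
      case (elim t)
      then have t: "t \<in> I" by simp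
      have "\<bar>\<integral>x. v t x * w x \<partial>M\<bar> \<le> (\<integral>x. (D * C) * \<bar>w x\<bar> \<partial>M)"
      proof (rule order_trans[OF integral_abs_bound integral_mono_AE])
        show "integrable M (\<lambda>x. \<bar>v t x * w x\<bar>)" using integrable_Linf_mult[OF V_Linf[OF X_V[OF v t]] wi] by simp
        show "integrable M (\<lambda>x. (D * C) * \<bar>w x\<bar>)" using wi by simp
        show "AE x in M. \<bar>v t x * w x\<bar> \<le> (D * C) * \<bar>w x\<bar>"
          using D(2)[OF X_V[OF v t]]
        proof eventually_elim
          case (elim x)
          have "D * vnorm (v t) \<le> D * C" by (rule mult_left_mono[OF \<open>vnorm (v t) \<le> C\<close> D(1)])
          then show ?case unfolding abs_mult using elim by (intro mult_right_mono) auto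
        qed
      qed
      then show ?case by simp
    qed
  qed
qed

lemma weak_deriv_diff:
  assumes v: "v \<in> X" "w \<in> X" and d: "weak_deriv v g" "weak_deriv w h"
  shows "weak_deriv (\<lambda>t x. v t x - w t x) (\<lambda>t u. g t u - h t u)"
  unfolding weak_deriv_def
proof (intro conjI ballI)
  have gd: "good_deriv g" "good_deriv h" using d by (auto simp: weak_deriv_def)
  then show "good_deriv (\<lambda>t u. g t u - h t u)" by (rule good_deriv_diff)
  fix \<phi> :: "real \<Rightarrow> real" and u assume p: "\<phi> \<in> test_fun I" and u: "u \<in> V"
  have dp: "partial_deriv 1 \<phi> \<in> test_fun I" by (rule test_fun_partial_deriv[OF p]) simp
  have L: "(\<lambda>t. \<integral>x. v t x * u x \<partial>M) \<in> Linf MI" "(\<lambda>t. \<integral>x. w t x * u x \<partial>M) \<in> Linf MI"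
    using X_product_Linf v u by auto
  have i1: "integrable MI (\<lambda>t. deriv \<phi> t * (\<integral>x. v t x * u x \<partial>M))" "integrable MI (\<lambda>t. deriv \<phi> t * (\<integral>x. w t x * u x \<partial>M))"
    using integrable_Linf_mult[OF L(1) test_fun_integrable_on[OF open_I dp]] integrable_Linf_mult[OF L(2) test_fun_integrable_on[OF open_I dp]]
    by (simp_all add: deriv_eq_partial_deriv[OF p] mult.commute)
  obtain B where B: "\<And>t. \<bar>\<phi> t\<bar> \<le> B" using test_fun_bounded[OF p] by metis
  have pL: "\<phi> \<in> Linf MI" by (rule LinfI[OF test_fun_measurable_lebesgue[OF p], where C=B]) (use B in simp)
  have i2: "integrable MI (\<lambda>t. \<phi> t * g t u)" "integrable MI (\<lambda>t. \<phi> t * h t u)"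
    using integrable_Linf_mult[OF pL good_deriv_integrable[OF gd(1) X_const[OF u]]]
      integrable_Linf_mult[OF pL good_deriv_integrable[OF gd(2) X_const[OF u]]] by auto
  have "(\<integral>t. deriv \<phi> t * (\<integral>x. (v t x - w t x) * u x \<partial>M) \<partial>MI) = (\<integral>t. deriv \<phi> t * (\<integral>x. v t x * u x \<partial>M) - deriv \<phi> t * (\<integral>x. w t x * u x \<partial>M) \<partial>MI)"
  proof (rule Bochner_Integration.integral_cong[OF refl])
    fix t assume "t \<in> space MI"
    then have t: "t \<in> I" by simp
    have ui: "integrable M u" by (rule Linf_integrable[OF finite_measure_M V_Linf[OF u]])
    have "(\<integral>x. (v t x - w t x) * u x \<partial>M) = (\<integral>x. v t x * u x \<partial>M) - (\<integral>x. w t x * u x \<partial>M)"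
      unfolding left_diff_distrib
      by (rule Bochner_Integration.integral_diff[OF integrable_Linf_mult[OF V_Linf[OF X_V[OF v(1) t]] ui] integrable_Linf_mult[OF V_Linf[OF X_V[OF v(2) t]] ui]])
    then show "deriv \<phi> t * (\<integral>x. (v t x - w t x) * u x \<partial>M) = deriv \<phi> t * (\<integral>x. v t x * u x \<partial>M) - deriv \<phi> t * (\<integral>x. w t x * u x \<partial>M)"
      by (simp add: right_diff_distrib)
  qed
  also have "\<dots> = (\<integral>t. deriv \<phi> t * (\<integral>x. v t x * u x \<partial>M) \<partial>MI) - (\<integral>t. deriv \<phi> t * (\<integral>x. w t x * u x \<partial>M) \<partial>MI)"
    by (rule Bochner_Integration.integral_diff[OF i1])
  also have "\<dots> = - (\<integral>t. \<phi> t * g t u \<partial>MI) - - (\<integral>t. \<phi> t * h t u \<partial>MI)"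
    using d p u unfolding weak_deriv_def by simp
  also have "\<dots> = - (\<integral>t. \<phi> t * (g t u - h t u) \<partial>MI)"
    unfolding right_diff_distrib using Bochner_Integration.integral_diff[OF i2] by simp
  finally show "(\<integral>t. deriv \<phi> t * (\<integral>x. (v t x - w t x) * u x \<partial>M) \<partial>MI) = - (\<integral>t. \<phi> t * (g t u - h t u) \<partial>MI)" .
qed

end

section \<open>Functions with an integrable time derivative\<close>

lemma integral_indicator_partition:
  assumes "finite_measure N" "integrable N (k :: real \<Rightarrow> real)" "{..<s} \<inter> space N \<in> sets N" "{s..<t} \<inter> space N \<in> sets N" "s \<le> t"
  shows "(\<integral>r. indicat_real {..<t} r * k r \<partial>N) - (\<integral>r. indicat_real {..<s} r * k r \<partial>N) = (\<integral>r. indicat_real {s..<t} r * k r \<partial>N)"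
proof -
  have i: "integrable N (\<lambda>r. indicat_real A r * k r)" if "A \<inter> space N \<in> sets N" for A
  proof -
    have "integrable N (\<lambda>r. indicat_real (A \<inter> space N) r * k r)"
      using integrable_mult_indicator[OF that assms(2)] by simp
    moreover have "indicat_real (A \<inter> space N) r * k r = indicat_real A r * k r" if "r \<in> space N" for r
      using that by (simp add: indicator_def)
    ultimately show ?thesis using Bochner_Integration.integrable_cong[OF refl, of N "\<lambda>r. indicat_real (A \<inter> space N) r * k r" "\<lambda>r. indicat_real A r * k r"] by blast
  qed
  have "(\<integral>r. indicat_real {..<t} r * k r \<partial>N) = (\<integral>r. indicat_real {..<s} r * k r + indicat_real {s..<t} r * k r \<partial>N)"
    by (rule Bochner_Integration.integral_cong[OF refl]) (use assms(5) in \<open>auto simp: indicator_def\<close>)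
  also have "\<dots> = (\<integral>r. indicat_real {..<s} r * k r \<partial>N) + (\<integral>r. indicat_real {s..<t} r * k r \<partial>N)"
    by (rule Bochner_Integration.integral_add[OF i i]) (use assms in auto)
  finally show ?thesis by simp
qed

context torsion_domain
begin

text \<open>Vanishing mean is what makes the primitive vanish again to the right of the
  support.\<close>

lemma test_fun_antiderivative:
  fixes \<omega> :: "real \<Rightarrow> real"
  assumes w: "\<omega> \<in> test_fun I" and z: "(\<integral>t. \<omega> t \<partial>MI) = 0"
  shows "\<exists>\<phi>\<in>test_fun I. (\<forall>t. deriv \<phi> t = \<omega> t) \<and> (\<forall>t. \<phi> t = (\<integral>s. indicat_real {..t} s * \<omega> s \<partial>MI))"
proof -
  obtain S where S: "compact S" "S \<subseteq> I" "\<And>t. t \<notin> S \<Longrightarrow> \<omega> t = 0" using test_funE[OF w] by metis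
  obtain \<alpha> \<beta> where ab: "0 < \<alpha>" "\<beta> < T" "S \<subseteq> {\<alpha>..\<beta>}"
  proof (cases "S = {}")
    case True
    then show ?thesis using that[of "T/2" "T/2"] T_pos by simp
  next
    case False
    obtain a where a: "a \<in> S" "\<forall>t\<in>S. a \<le> t" using compact_attains_inf[OF S(1) False] by blast
    obtain b where b: "b \<in> S" "\<forall>t\<in>S. t \<le> b" using compact_attains_sup[OF S(1) False] by blast
    show ?thesis using that[of a b] a b S(2) by fastforce
  qed
  have out: "\<omega> t = 0" if "t < \<alpha> \<or> \<beta> < t" for t using S(3)[of t] ab(3) that by fastforce
  have oI: "\<omega> t = 0" if "t \<notin> I" for t using test_fun_outside[OF w that] .
  define \<phi> where "\<phi> t = (\<integral>s. indicat_real {..t} s * \<omega> s \<partial>MI)" for t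
  \<comment> \<open>Starting the integral at -1 puts all of [0, T] in the interior of [-1, T + 1],
    so the derivative within that interval is a two-sided one.\<close>
  have eq: "\<phi> t = integral {-1..t} \<omega>" for t
  proof -
    have c: "continuous_on {-1..t} \<omega>" by (rule continuous_on_subset[OF test_fun_continuous[OF w]]) simp
    have "integral {-1..t} \<omega> = (\<integral>s. \<omega> s \<partial>lebesgue_on {-1..t})"
      by (rule lebesgue_integral_eq_integral[symmetric, OF continuous_imp_integrable_real[OF c]]) simp
    also have "\<dots> = (\<integral>s. indicat_real {-1..t} s *\<^sub>R \<omega> s \<partial>lebesgue)" by (rule integral_restrict_space) simp
    also have "\<dots> = (\<integral>s. indicat_real I s *\<^sub>R (indicat_real {..t} s * \<omega> s) \<partial>lebesgue)"
      by (rule Bochner_Integration.integral_cong[OF refl]) (use oI in \<open>auto simp: indicator_def\<close>)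
    also have "\<dots> = \<phi> t" unfolding \<phi>_def by (rule integral_restrict_space[symmetric]) simp
    finally show ?thesis by simp
  qed
  have low: "\<phi> t = 0" if "t < \<alpha>" for t
  proof -
    have "\<phi> t = (\<integral>s. 0 \<partial>MI)" unfolding \<phi>_def
      by (rule Bochner_Integration.integral_cong[OF refl]) (use out that in \<open>auto simp: indicator_def\<close>)
    then show ?thesis by simp
  qed
  have high: "\<phi> t = 0" if "\<beta> < t" for t
  proof -
    have "\<phi> t = (\<integral>s. \<omega> s \<partial>MI)" unfolding \<phi>_def
      by (rule Bochner_Integration.integral_cong[OF refl]) (use out that in \<open>auto simp: indicator_def\<close>)
    then show ?thesis using z by simp
  qed
  have der: "(\<phi> has_real_derivative \<omega> t) (at t)" for t
  proof -
    consider "t < \<alpha>" | "\<beta> < t" | "0 \<le> t" "t \<le> T" using ab(1,2) by linarith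
    then show ?thesis
    proof cases
      case 1
      have "((\<lambda>t. 0) has_real_derivative 0) (at t)" by simp
      then have "(\<phi> has_real_derivative 0) (at t)"
        by (rule has_field_derivative_transform_within_open[where S="{..<\<alpha>}"]) (use 1 low in auto)
      then show ?thesis using out 1 by simp
    next
      case 2
      have "((\<lambda>t. 0) has_real_derivative 0) (at t)" by simp
      then have "(\<phi> has_real_derivative 0) (at t)"
        by (rule has_field_derivative_transform_within_open[where S="{\<beta><..}"]) (use 2 high in auto)
      then show ?thesis using out 2 by simp
    next
      case 3
      have "((\<lambda>x. integral {-1..x} \<omega>) has_real_derivative \<omega> t) (at t within {-1..T+1})"
        by (rule integral_has_real_derivative)
          (use 3 continuous_on_subset[OF test_fun_continuous[OF w]] in auto)
      moreover have "at t within {-1..T+1} = at t" by (rule at_within_interior) (use 3 in simp)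
      ultimately show ?thesis unfolding eq[abs_def] by simp
    qed
  qed
  have dif: "\<phi> differentiable at t" for t using der[of t] unfolding has_field_derivative_def differentiable_def by blast
  have pd: "partial_deriv b \<phi> = \<omega>" if "b \<in> Basis" for b
  proof
    fix t
    have "b = 1" using that by simp
    then show "partial_deriv b \<phi> t = \<omega> t"
      using partial_deriv_eqI[OF der[of t, unfolded has_field_derivative_def], of 1] by simp
  qed
  have "C_k k \<phi>" for k
  proof (cases k)
    case 0
    have "C_k (Suc 0) \<phi>" using dif pd test_fun_continuous[OF w] by simp
    then show ?thesis using C_k_Suc_lower 0 by blast
  next
    case (Suc n)
    then show ?thesis using dif pd test_fun_C_k[OF w, of n] by simp
  qed
  then have "\<phi> \<in> test_fun I"
    by (rule test_funI[where S="{\<alpha>..\<beta>}"]) (use ab low high in auto)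
  then show ?thesis using DERIV_imp_deriv[OF der] \<phi>_def by blast
qed

text \<open>Subtracting the primitive \<open>K\<close> of \<open>k\<close> leaves a function
  orthogonal to all test functions of mean zero, and such a function is constant. That
  \<open>K\<close> has weak derivative \<open>k\<close> comes from Fubini on the triangle r <
  t.\<close>

lemma du_bois_reymond:
  assumes h: "h \<in> Linf MI" and k: "integrable MI k"
    and weak: "\<And>\<phi>. \<phi> \<in> test_fun I \<Longrightarrow> (\<integral>t. deriv \<phi> t * h t \<partial>MI) = - (\<integral>t. \<phi> t * k t \<partial>MI)"
  shows "\<exists>c. AE t in MI. h t = c + (\<integral>r. indicat_real {..<t} r * k r \<partial>MI)"
proof -
  define K where "K t = (\<integral>r. indicat_real {..<t} r * k r \<partial>MI)" for t
  interpret II: pair_sigma_finite MI MI ..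
  interpret IIF: finite_measure "MI \<Otimes>\<^sub>M MI" by (rule finite_measure_pair_measure) unfold_locales
  have [measurable]: "(\<lambda>z. z) \<in> measurable MI borel"
    by (rule lebesgue_measurable_of_continuous) (rule continuous_on_id)
  have km[measurable]: "k \<in> borel_measurable MI" using k by simp
  have pm: "{p \<in> space (MI \<Otimes>\<^sub>M MI). snd p < fst p} \<in> sets (MI \<Otimes>\<^sub>M MI)" by measurable
  have kpair: "integrable (MI \<Otimes>\<^sub>M MI) (\<lambda>(t, r). k r)"
  proof (rule II.Fubini_integrable)
    show "(\<lambda>(t, r). k r) \<in> borel_measurable (MI \<Otimes>\<^sub>M MI)" by measurable
    show "integrable MI (\<lambda>x. \<integral>y. norm (case (x, y) of (t, r) \<Rightarrow> k r) \<partial>MI)" by simp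
    show "AE x in MI. integrable MI (\<lambda>y. case (x, y) of (t, r) \<Rightarrow> k r)" using k by simp
  qed
  have Ki: "integrable (MI \<Otimes>\<^sub>M MI) (\<lambda>(t, r). indicat_real {..<t} r * k r)"
  proof (rule Bochner_Integration.integrable_bound[OF kpair])
    have "(\<lambda>p. indicat_real {p \<in> space (MI \<Otimes>\<^sub>M MI). snd p < fst p} p * k (snd p)) \<in> borel_measurable (MI \<Otimes>\<^sub>M MI)"
      using pm by measurable
    moreover have "indicat_real {p \<in> space (MI \<Otimes>\<^sub>M MI). snd p < fst p} p * k (snd p) = (\<lambda>(t, r). indicat_real {..<t} r * k r) p"
      if "p \<in> space (MI \<Otimes>\<^sub>M MI)" for p using that by (auto simp: indicator_def case_prod_beta')
    ultimately show "(\<lambda>(t, r). indicat_real {..<t} r * k r) \<in> borel_measurable (MI \<Otimes>\<^sub>M MI)"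
      by (rule measurable_cong[THEN iffD1, rotated])
  qed (auto simp: indicator_def)
  have Km: "K \<in> borel_measurable MI" unfolding K_def[abs_def] using II.integrable_fst[OF Ki] by auto
  have ind: "integrable MI (\<lambda>r. indicat_real A r * k r)" if "A \<in> sets borel" for A
  proof -
    have "(\<lambda>r. indicat_real A r) \<in> borel_measurable MI" using that by measurable
    then show ?thesis
      by (intro Bochner_Integration.integrable_bound[OF k]) (auto simp: indicator_def)
  qed
  have Kb: "\<bar>K t\<bar> \<le> (\<integral>r. \<bar>k r\<bar> \<partial>MI)" for t
    unfolding K_def
  proof (rule order_trans[OF integral_abs_bound integral_mono])
    show "integrable MI (\<lambda>r. \<bar>indicat_real {..<t} r * k r\<bar>)" by (rule integrable_abs[OF ind]) simp
    show "integrable MI (\<lambda>r. \<bar>k r\<bar>)" by (rule integrable_abs[OF k])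
  qed (simp add: indicator_def)
  have KL: "K \<in> Linf MI" by (rule LinfI[OF Km, where C="\<integral>r. \<bar>k r\<bar> \<partial>MI"]) (use Kb in simp)
  define d where "d t = h t - K t" for t
  have dL: "d \<in> Linf MI" unfolding d_def[abs_def] by (rule Linf_diff[OF h KL])
  have zero: "(\<integral>t. d t * \<omega> t \<partial>MI) = 0" if w: "\<omega> \<in> test_fun I" and z: "(\<integral>t. \<omega> t \<partial>MI) = 0" for \<omega>
  proof -
    obtain \<phi> where \<phi>: "\<phi> \<in> test_fun I" "\<And>t. deriv \<phi> t = \<omega> t" "\<And>t. \<phi> t = (\<integral>s. indicat_real {..t} s * \<omega> s \<partial>MI)"
      using test_fun_antiderivative[OF w z] by blast
    have wi: "integrable MI \<omega>" by (rule test_fun_integrable_on[OF open_I w])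
    obtain B where B: "0 \<le> B" "\<And>t. \<bar>\<omega> t\<bar> \<le> B" using test_fun_bounded[OF w] by metis
    have wm[measurable]: "\<omega> \<in> borel_measurable MI" using wi by simp
    have wki: "integrable (MI \<Otimes>\<^sub>M MI) (\<lambda>(s, t). \<omega> s * (indicat_real {..<s} t * k t))"
    proof (rule Bochner_Integration.integrable_bound[where f="\<lambda>p. B * (case p of (t, r) \<Rightarrow> indicat_real {..<t} r * k r)"])
      show "integrable (MI \<Otimes>\<^sub>M MI) (\<lambda>p. B * (case p of (t, r) \<Rightarrow> indicat_real {..<t} r * k r))"
        using Ki by (rule integrable_mult_right)
      have "(\<lambda>p. \<omega> (fst p) * (\<lambda>(t, r). indicat_real {..<t} r * k r) p) \<in> borel_measurable (MI \<Otimes>\<^sub>M MI)"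
        using Ki by (intro borel_measurable_times measurable_compose[OF measurable_fst wm]) auto
      then show "(\<lambda>(s, t). \<omega> s * (indicat_real {..<s} t * k t)) \<in> borel_measurable (MI \<Otimes>\<^sub>M MI)" by (simp add: case_prod_beta')
      show "AE p in MI \<Otimes>\<^sub>M MI. norm (case p of (s, t) \<Rightarrow> \<omega> s * (indicat_real {..<s} t * k t)) \<le> norm (B * (case p of (t, r) \<Rightarrow> indicat_real {..<t} r * k r))"
        using B by (intro AE_I2) (auto simp: case_prod_beta' abs_mult intro!: mult_right_mono)
    qed
    have ki2: "integrable MI (\<lambda>s. \<omega> s * c)" for c using wi by simp
    have "(\<integral>t. \<phi> t * k t \<partial>MI) = (\<integral>t. (\<integral>s. \<omega> s * (indicat_real {..t} s * k t) \<partial>MI) \<partial>MI)"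
    proof (rule Bochner_Integration.integral_cong[OF refl])
      fix t
      have "\<phi> t * k t = (\<integral>s. (indicat_real {..t} s * \<omega> s) * k t \<partial>MI)"
        unfolding \<phi>(3) by (rule Bochner_Integration.integral_mult_left_zero[symmetric])
      then show "\<phi> t * k t = (\<integral>s. \<omega> s * (indicat_real {..t} s * k t) \<partial>MI)" by (simp add: mult.assoc mult.left_commute)
    qed
    \<comment> \<open>The condition s <= t is written as the complement of t < s, because
      \<open>K s\<close> integrates over t < s; the integral of \<omega> that arises with the full
      indicator is zero.\<close>
    also have "\<dots> = (\<integral>t. (\<integral>s. \<omega> s * k t - \<omega> s * (indicat_real {..<s} t * k t) \<partial>MI) \<partial>MI)"
      by (intro Bochner_Integration.integral_cong refl) (auto simp: indicator_def)
    also have "\<dots> = (\<integral>t. - (\<integral>s. \<omega> s * (indicat_real {..<s} t * k t) \<partial>MI) \<partial>MI)"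
    proof (rule Bochner_Integration.integral_cong[OF refl])
      fix t
      have "integrable MI (\<lambda>s. \<omega> s * (indicat_real {..<s} t * k t))"
      proof (rule Bochner_Integration.integrable_bound[OF ki2[of "k t"]])
        have "(\<lambda>s. indicat_real {t<..} s) \<in> borel_measurable MI" by measurable
        then have "(\<lambda>s. \<omega> s * (indicat_real {t<..} s * k t)) \<in> borel_measurable MI" by measurable
        then show "(\<lambda>s. \<omega> s * (indicat_real {..<s} t * k t)) \<in> borel_measurable MI" by (simp add: indicator_def)
      qed (auto simp: indicator_def)
      then show "(\<integral>s. \<omega> s * k t - \<omega> s * (indicat_real {..<s} t * k t) \<partial>MI) = - (\<integral>s. \<omega> s * (indicat_real {..<s} t * k t) \<partial>MI)"
        using Bochner_Integration.integral_diff[OF ki2[of "k t"]] z by simp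
    qed
    also have "\<dots> = - (\<integral>t. (\<integral>s. \<omega> s * (indicat_real {..<s} t * k t) \<partial>MI) \<partial>MI)" by simp
    also have "(\<integral>t. (\<integral>s. \<omega> s * (indicat_real {..<s} t * k t) \<partial>MI) \<partial>MI) = (\<integral>s. (\<integral>t. \<omega> s * (indicat_real {..<s} t * k t) \<partial>MI) \<partial>MI)"
      by (rule II.Fubini_integral[OF wki])
    also have "\<dots> = (\<integral>s. K s * \<omega> s \<partial>MI)" by (simp add: K_def mult.commute)
    finally have "(\<integral>t. \<phi> t * k t \<partial>MI) = - (\<integral>s. K s * \<omega> s \<partial>MI)" .
    moreover have "(\<integral>t. h t * \<omega> t \<partial>MI) = - (\<integral>t. \<phi> t * k t \<partial>MI)"
      using weak[OF \<phi>(1)] unfolding \<phi>(2) by (simp add: mult.commute)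
    ultimately show ?thesis
      unfolding d_def left_diff_distrib Bochner_Integration.integral_diff[OF integrable_Linf_mult[OF h wi] integrable_Linf_mult[OF KL wi]] by simp
  qed
  \<comment> \<open>A test function with nonzero integral, supported well inside the interval.
    Normalised to \<rho>, it carries the mean of an arbitrary test function.\<close>
  define \<rho>1 :: "real \<Rightarrow> real" where "\<rho>1 = box_bump 1 (T/3) (T/2)"
  have r1: "\<rho>1 \<in> test_fun I" unfolding \<rho>1_def by (rule box_bump_test_fun) (use T_pos in auto)
  have r1i: "integrable MI \<rho>1" by (rule test_fun_integrable_on[OF open_I r1])
  have r1n: "0 \<le> \<rho>1 t" for t unfolding \<rho>1_def by (rule box_bump_range) simp
  have "(\<integral>t. \<rho>1 t \<partial>MI) \<noteq> 0"
  proof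
    assume "(\<integral>t. \<rho>1 t \<partial>MI) = 0"
    then have "AE t in MI. \<rho>1 t = 0" using integral_nonneg_eq_0_iff_AE[OF r1i] r1n by simp
    then have "AE t in lborel. t \<in> I \<longrightarrow> \<rho>1 t = 0" by (simp add: AE_lebesgue_on_iff)
    then have "AE t in lborel. t \<notin> box (T/3) (T/2)"
    proof eventually_elim
      case (elim t)
      show ?case
      proof
        assume t: "t \<in> box (T/3) (T/2)"
        then have "t \<in> I" using T_pos by (auto simp: box_real)
        then show False using elim box_bump_pos[OF t, of 1] by (simp add: \<rho>1_def)
      qed
    qed
    then have "emeasure lborel (box (T/3) (T/2)) = 0" 

      by (subst (asm) AE_iff_measurable[of "box (T/3) (T/2)"]) (auto simp: field_simps)
    then show False using T_pos by (simp add: box_real)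
  qed
  define \<rho> where "\<rho> t = (1 / (\<integral>t. \<rho>1 t \<partial>MI)) * \<rho>1 t" for t
  have \<rho>: "\<rho> \<in> test_fun I" unfolding \<rho>_def[abs_def] by (rule test_fun_cmult[OF r1])
  have \<rho>1: "(\<integral>t. \<rho> t \<partial>MI) = 1" unfolding \<rho>_def using \<open>(\<integral>t. \<rho>1 t \<partial>MI) \<noteq> 0\<close> by simp
  have \<rho>i: "integrable MI \<rho>" by (rule test_fun_integrable_on[OF open_I \<rho>])
  define c where "c = (\<integral>t. d t * \<rho> t \<partial>MI)"
  have "AE t in MI. d t - c = 0"
  proof (rule fundamental_lemma[OF open_I bounded_I Linf_diff[OF dL Linf_const]])
    fix \<theta> :: "real \<Rightarrow> real" assume th: "\<theta> \<in> test_fun I"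
    have ti: "integrable MI \<theta>" by (rule test_fun_integrable_on[OF open_I th])
    define m where "m = (\<integral>t. \<theta> t \<partial>MI)"
    \<comment> \<open>Removing the mean with \<rho> makes \<open>zero\<close> applicable, and
      \<open>c\<close> is the constant that this leaves behind.\<close>
    define \<omega> where "\<omega> t = \<theta> t + (- m) * \<rho> t" for t
    have "\<omega> \<in> test_fun I" unfolding \<omega>_def[abs_def] by (rule test_fun_add[OF th test_fun_cmult[OF \<rho>]])
    moreover have "(\<integral>t. \<omega> t \<partial>MI) = 0" unfolding \<omega>_def using ti \<rho>i \<rho>1 by (simp add: m_def)
    ultimately have "(\<integral>t. d t * \<omega> t \<partial>MI) = 0" by (rule zero)
    moreover have "(\<integral>t. d t * \<omega> t \<partial>MI) = (\<integral>t. d t * \<theta> t \<partial>MI) - m * c"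
    proof -
      have "(\<integral>t. d t * \<omega> t \<partial>MI) = (\<integral>t. d t * \<theta> t - m * (d t * \<rho> t) \<partial>MI)"
        by (rule Bochner_Integration.integral_cong[OF refl]) (simp add: \<omega>_def algebra_simps)
      then show ?thesis unfolding c_def
        using Bochner_Integration.integral_diff[OF integrable_Linf_mult[OF dL ti] integrable_mult_right[OF integrable_Linf_mult[OF dL \<rho>i], of m]] by simp
    qed
    moreover have "(\<integral>t. (d t - c) * \<theta> t \<partial>MI) = (\<integral>t. d t * \<theta> t \<partial>MI) - c * m"
      unfolding left_diff_distrib m_def
      using Bochner_Integration.integral_diff[OF integrable_Linf_mult[OF dL ti] integrable_mult_right[OF ti, of c]] by simp
    ultimately show "(\<integral>t. (d t - c) * \<theta> t \<partial>MI) = 0" by (simp add: mult.commute)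
  qed
  then have "AE t in MI. h t = c + K t"
  proof (rule eventually_mono)
    fix t assume "d t - c = 0"
    then show "h t = c + K t" unfolding d_def by linarith
  qed
  then have "AE t in MI. h t = c + (\<integral>r. indicat_real {..<t} r * k r \<partial>MI)" unfolding K_def .
  then show ?thesis by (rule exI[where x=c])
qed

text \<open>In its norm \<open>V\<close> is not separable. Sampling the continuous representatives
  at a dense sequence of points maps into real sequences with the product topology, where every
  subset has a countable dense part. On a bounded set the Lipschitz estimate spreads convergence
  from the sample points to all of \<Omega>.\<close>

lemma V_separable:
  assumes A: "A \<subseteq> V" "\<And>w. w \<in> A \<Longrightarrow> vnorm w \<le> m"
  shows "\<exists>D. countable D \<and> D \<subseteq> A \<and> (\<forall>w\<in>A. \<exists>u::nat \<Rightarrow> 'a \<Rightarrow> real. (\<forall>k. u k \<in> D) \<and> (\<forall>x\<in>\<Omega>. (\<lambda>k. crep (u k) x) \<longlonglongrightarrow> crep w x))"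
proof -
  obtain D0 :: "'a set" where D0: "countable D0" "\<And>X. open X \<Longrightarrow> X \<noteq> {} \<Longrightarrow> \<exists>d\<in>D0. d \<in> X"
    using countable_dense_setE by metis
  have ne: "D0 \<noteq> {}" using D0(2)[of UNIV] by auto
  define d where "d = from_nat_into D0"
  have rd: "range d = D0" unfolding d_def by (rule range_from_nat_into[OF ne D0(1)])
  define E where "E w = (\<lambda>i::nat. crep w (d i))" for w
  obtain S where S: "countable S" "S \<subseteq> E ` A" "E ` A \<subseteq> closure S" using separable by metis
  define D where "D = inv_into A E ` S"
  have DA: "D \<subseteq> A" unfolding D_def using S(2) by (auto intro: inv_into_into)
  have "\<exists>u::nat \<Rightarrow> 'a \<Rightarrow> real. (\<forall>k. u k \<in> D) \<and> (\<forall>x\<in>\<Omega>. (\<lambda>k. crep (u k) x) \<longlonglongrightarrow> crep w x)" if w: "w \<in> A" for w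
  proof -
    have "E w \<in> closure S" using S(3) w by blast
    then obtain s where s: "\<And>k. s k \<in> S" "s \<longlonglongrightarrow> E w" unfolding closure_sequential by blast
    define u where "u k = inv_into A E (s k)" for k
    have uD: "u k \<in> D" for k unfolding u_def D_def by (rule imageI[OF s(1)])
    have Eu: "E (u k) = s k" for k
      unfolding u_def by (rule f_inv_into_f[OF subsetD[OF S(2) s(1)]])
    have conv: "(\<lambda>k. crep (u k) (d i)) \<longlonglongrightarrow> crep w (d i)" for i
    proof -
      have "isCont (\<lambda>f :: nat \<Rightarrow> real. f i) (E w)"
        by (rule continuous_on_interior[OF continuous_on_product_coordinates]) simp
      from isCont_tendsto_compose[OF this s(2)] have "(\<lambda>k. s k i) \<longlonglongrightarrow> E w i" .
      moreover have "s k i = crep (u k) (d i)" for k using Eu[of k] by (metis E_def)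
      ultimately show ?thesis by (simp add: E_def)
    qed
    have "(\<lambda>k. crep (u k) x) \<longlonglongrightarrow> crep w x" if x: "x \<in> \<Omega>" for x
    proof (rule LIMSEQ_I)
      fix e :: real assume e: "0 < e"
      obtain \<delta> where \<delta>: "0 < \<delta>" "ball x \<delta> \<subseteq> \<Omega>" using open_\<Omega> x open_contains_ball by blast
      \<comment> \<open>Close enough that the segment to the sample point stays in \<Omega> and that
        each element of \<open>A\<close> varies by at most e / 4 along it.\<close>
      define q where "q = min \<delta> (e / (4 * (\<bar>m\<bar> + 1)))"
      have q: "0 < q" using \<delta>(1) e by (simp add: q_def)
      have "open (ball x q)" "ball x q \<noteq> {}" using q by auto
      from D0(2)[OF this] obtain p where p: "p \<in> D0" "p \<in> ball x q" by blast
      then obtain i where i: "p = d i" using rd by blast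
      have dq: "norm (x - d i) < q" using p(2) by (simp add: i dist_norm)
      have seg: "closed_segment (d i) x \<subseteq> \<Omega>"
      proof -
        have "closed_segment (d i) x \<subseteq> ball x \<delta>" by (rule closed_segment_subset) (use p i \<delta>(1) in \<open>auto simp: q_def\<close>)
        then show ?thesis using \<delta>(2) by blast
      qed
      have lip: "\<bar>crep v x - crep v (d i)\<bar> \<le> e / 4" if v: "v \<in> A" for v
      proof -
        have "\<bar>crep v x - crep v (d i)\<bar> \<le> norm (x - d i) * vnorm v" by (rule crep_lipschitz[OF seg]) (use v A(1) in blast)
        also have "\<dots> \<le> (e / (4 * (\<bar>m\<bar> + 1))) * (\<bar>m\<bar> + 1)"
          using dq A(2)[OF v] V_norm_nonneg[of v] e by (intro mult_mono) (auto simp: q_def)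
        also have "\<dots> = e / 4" by (simp add: field_simps)
        finally show ?thesis .
      qed
      obtain N where N: "\<forall>k\<ge>N. norm (crep (u k) (d i) - crep w (d i)) < e / 4" using LIMSEQ_D[OF conv, of "e / 4" i] e by auto
      show "\<exists>N. \<forall>k\<ge>N. norm (crep (u k) x - crep w x) < e"
      proof (intro exI allI impI)
        fix k assume "N \<le> k"
        then have "\<bar>crep (u k) (d i) - crep w (d i)\<bar> < e / 4" using N by simp
        moreover have "\<bar>crep (u k) x - crep (u k) (d i)\<bar> \<le> e / 4" by (rule lip) (use uD DA in blast)
        moreover have "\<bar>crep w x - crep w (d i)\<bar> \<le> e / 4" by (rule lip[OF w])
        ultimately show "norm (crep (u k) x - crep w x) < e" using e unfolding real_norm_def by linarith
      qed
    qed
    then show ?thesis using uD by blast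
  qed
  moreover have "countable D" unfolding D_def using S(1) by simp
  ultimately show ?thesis using DA by blast
qed

end

section \<open>The continuous representative and integration by parts in time\<close>

lemma L2_mult_integrable:
  fixes a b :: "'a \<Rightarrow> real"
  assumes "a \<in> L2 N" "b \<in> L2 N" shows "integrable N (\<lambda>x. a x * b x)"
proof (rule Bochner_Integration.integrable_bound[where f="\<lambda>x. (a x)\<^sup>2 + (b x)\<^sup>2"])
  show "integrable N (\<lambda>x. (a x)\<^sup>2 + (b x)\<^sup>2)" using assms by (simp add: L2_def)
  show "(\<lambda>x. a x * b x) \<in> borel_measurable N" using assms unfolding L2_def by (intro borel_measurable_times) auto
  have "\<bar>a x * b x\<bar> \<le> (a x)\<^sup>2 + (b x)\<^sup>2" for x
  proof -
    have "2 * (\<bar>a x\<bar> * \<bar>b x\<bar>) \<le> (a x)\<^sup>2 + (b x)\<^sup>2" using sum_squares_bound[of "\<bar>a x\<bar>" "\<bar>b x\<bar>"] by (simp add: mult.assoc)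
    moreover have "0 \<le> \<bar>a x\<bar> * \<bar>b x\<bar>" by simp
    ultimately show ?thesis unfolding abs_mult by linarith
  qed
  then show "AE x in N. norm (a x * b x) \<le> norm ((a x)\<^sup>2 + (b x)\<^sup>2)" by simp
qed

lemma L2_diff:
  fixes a b :: "'a \<Rightarrow> real"
  assumes "a \<in> L2 N" "b \<in> L2 N" shows "(\<lambda>x. a x - b x) \<in> L2 N"
proof -
  have "(norm (a x - b x))\<^sup>2 = (a x)\<^sup>2 + (b x)\<^sup>2 - 2 * (a x * b x)" for x by (simp add: power2_eq_square algebra_simps)
  moreover have "integrable N (\<lambda>x. (a x)\<^sup>2 + (b x)\<^sup>2 - 2 * (a x * b x))"
    using assms L2_mult_integrable[OF assms] by (simp add: L2_def)
  moreover have "(\<lambda>x. a x - b x) \<in> borel_measurable N" using assms unfolding L2_def by (intro borel_measurable_diff) auto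
  ultimately show ?thesis by (simp add: L2_def)
qed

lemma L2_triangle:
  fixes a b c :: "'a \<Rightarrow> real"
  assumes "a \<in> L2 N" "b \<in> L2 N" "c \<in> L2 N"
  shows "(\<integral>x. (a x - c x)\<^sup>2 \<partial>N) \<le> 2 * (\<integral>x. (a x - b x)\<^sup>2 \<partial>N) + 2 * (\<integral>x. (b x - c x)\<^sup>2 \<partial>N)"
proof -
  have i: "integrable N (\<lambda>x. (a x - c x)\<^sup>2)" "integrable N (\<lambda>x. (a x - b x)\<^sup>2)" "integrable N (\<lambda>x. (b x - c x)\<^sup>2)"
    using L2_diff assms by (auto simp: L2_def)
  have "(\<integral>x. (a x - c x)\<^sup>2 \<partial>N) \<le> (\<integral>x. 2 * (a x - b x)\<^sup>2 + 2 * (b x - c x)\<^sup>2 \<partial>N)"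
  proof (rule integral_mono[OF i(1)])
    show "integrable N (\<lambda>x. 2 * (a x - b x)\<^sup>2 + 2 * (b x - c x)\<^sup>2)" using i by simp
    show "(a x - c x)\<^sup>2 \<le> 2 * (a x - b x)\<^sup>2 + 2 * (b x - c x)\<^sup>2" for x
      using zero_le_power2[of "(a x - b x) - (b x - c x)"] by (simp add: power2_eq_square algebra_simps)
  qed
  also have "\<dots> = 2 * (\<integral>x. (a x - b x)\<^sup>2 \<partial>N) + 2 * (\<integral>x. (b x - c x)\<^sup>2 \<partial>N)" using i by simp
  finally show ?thesis .
qed

lemma L1_le_L2:
  fixes a :: "'a \<Rightarrow> real"
  assumes N: "finite_measure N" and a: "a \<in> L2 N"
  shows "(\<integral>x. \<bar>a x\<bar> \<partial>N) \<le> sqrt (measure N (space N) * (\<integral>x. (a x)\<^sup>2 \<partial>N))"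
proof -
  interpret finite_measure N by fact
  let ?m = "measure N (space N)" and ?A = "\<integral>x. \<bar>a x\<bar> \<partial>N"
  have i2: "integrable N (\<lambda>x. (a x)\<^sup>2)" using a by (simp add: L2_def)
  have one: "(\<lambda>x. 1::real) \<in> L2 N" by (simp add: L2_def)
  have i1: "integrable N (\<lambda>x. \<bar>a x\<bar>)" using L2_mult_integrable[OF a one] by simp
  \<comment> \<open>Cauchy-Schwarz against the constant 1, obtained by expanding the squared
    deviation of |a| from its mean, scaled by the total mass.\<close>
  have "0 \<le> (\<integral>x. (?m * \<bar>a x\<bar> - ?A)\<^sup>2 \<partial>N)" by simp
  also have "\<dots> = (\<integral>x. ?m\<^sup>2 * (a x)\<^sup>2 - 2 * ?m * ?A * \<bar>a x\<bar> + ?A\<^sup>2 \<partial>N)"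
    by (rule Bochner_Integration.integral_cong[OF refl]) (simp add: power2_diff power_mult_distrib)
  also have "\<dots> = ?m\<^sup>2 * (\<integral>x. (a x)\<^sup>2 \<partial>N) - 2 * ?m * ?A * ?A + ?m * ?A\<^sup>2"
    using i1 i2 by simp
  finally have ge: "?m * ?A\<^sup>2 \<le> ?m * (?m * (\<integral>x. (a x)\<^sup>2 \<partial>N))" by (simp add: power2_eq_square algebra_simps)
  have "?A\<^sup>2 \<le> ?m * (\<integral>x. (a x)\<^sup>2 \<partial>N)"
  proof (cases "?m = 0")
    case True
    then have "AE x in N. False" by (intro AE_I[of _ _ "space N"]) (auto simp: emeasure_eq_measure)
    then have "AE x in N. \<bar>a x\<bar> = 0" by (rule eventually_mono) simp
    then have "?A = 0" by (rule integral_eq_zero_AE)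
    then show ?thesis using True by simp
  next
    case False
    then have "0 < ?m" by (simp add: zero_less_measure_iff)
    then show ?thesis using ge by simp
  qed
  then show ?thesis by (rule real_le_rsqrt)
qed

lemma Linf_L2:
  fixes a :: "'a \<Rightarrow> real"
  assumes N: "finite_measure N" and a: "a \<in> Linf N" shows "a \<in> L2 N"
  using integrable_Linf_mult[OF a Linf_integrable[OF N a]] Linf_measurable[OF a]
  by (simp add: L2_def power2_eq_square)

lemma indicator_sum_step:
  fixes p :: "nat \<Rightarrow> real" and a :: "nat \<Rightarrow> real"
  assumes p: "\<And>i. i < N \<Longrightarrow> p i \<le> p (Suc i)" and j: "j < N" "p j \<le> r" "r < p (Suc j)"
  shows "(\<Sum>i<N. indicat_real {p i..<p (Suc i)} r * a i) = a j"
proof -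
  have mono: "i \<le> k \<Longrightarrow> k \<le> N \<Longrightarrow> p i \<le> p k" for i k
  proof (induction k rule: dec_induct)
    case (step k)
    then show ?case using p[of k] by simp
  qed simp
  have z: "indicat_real {p i..<p (Suc i)} r * a i = 0" if i: "i \<in> {..<N} - {j}" for i
  proof (cases "i < j")
    case True
    then show ?thesis using mono[of "Suc i" j] j by (simp add: indicator_def)
  next
    case False
    then show ?thesis using mono[of "Suc j" i] i j by (auto simp: indicator_def)
  qed
  have "(\<Sum>i<N. indicat_real {p i..<p (Suc i)} r * a i) = indicat_real {p j..<p (Suc j)} r * a j
    + (\<Sum>i\<in>{..<N} - {j}. indicat_real {p i..<p (Suc i)} r * a i)"
    by (rule sum.remove) (use j(1) in simp_all)
  also have "(\<Sum>i\<in>{..<N} - {j}. indicat_real {p i..<p (Suc i)} r * a i) = 0"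
    by (rule sum.neutral) (use z in blast)
  finally show ?thesis using j by simp
qed

lemma step_between:
  fixes p :: "nat \<Rightarrow> real"
  assumes "p 0 \<le> r" "r < p N" shows "\<exists>j<N. p j \<le> r \<and> r < p (Suc j)"
proof -
  define k where "k = (LEAST k. r < p k)"
  have k: "r < p k" "k \<le> N" unfolding k_def using assms(2) by (auto intro: LeastI Least_le)
  have "k \<noteq> 0" using k(1) assms(1) by (metis not_less)
  then obtain j where j: "k = Suc j" by (cases k) auto
  have "\<not> r < p j" using not_less_Least[of j "\<lambda>k. r < p k"] j unfolding k_def by simp
  then show ?thesis using k j by (intro exI[of _ j]) simp
qed

lemma AE_interval_dense:
  assumes ae: "AE t in lebesgue_on {0<..<T}. P t" and ab: "a < b" "a < T" "0 < b" and T: "0 < T"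
  shows "\<exists>s. 0 < s \<and> s < T \<and> a < s \<and> s < b \<and> P (s::real)"
proof (rule ccontr)
  assume no: "\<nexists>s. 0 < s \<and> s < T \<and> a < s \<and> s < b \<and> P s"
  have "AE t in lborel. t \<in> {0<..<T} \<longrightarrow> P t" using ae by (simp add: AE_lebesgue_on_iff)
  then have ne: "AE t in lborel. t \<notin> {max 0 a<..<min T b}"
    by (rule eventually_mono) (use no in auto)
  have "emeasure lborel {max 0 a<..<min T b} = 0"
    using ne by (subst (asm) AE_iff_measurable[of "{max 0 a<..<min T b}"]) auto
  then show False using ab T by simp
qed

section \<open>Good times and the increment formula\<close>

context torsion_domain
begin

lemma V_L2: "v \<in> V \<Longrightarrow> v \<in> L2 M"
  by (rule Linf_L2[OF finite_measure_M V_Linf])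

text \<open>Here it matters that the derivative takes values in the predual and not just in the dual
  of \<open>V\<close>: representation by an integrable field makes a functional weak-star continuous
  on bounded sets.\<close>

lemma predual_continuous:
  assumes l: "l \<in> VS" and w: "\<And>k. w k \<in> V" "\<And>k. vnorm (w k) \<le> m" and v: "v \<in> V"
    and lim: "(\<lambda>k. \<integral>x. \<bar>w k x - v x\<bar> \<partial>M) \<longlonglongrightarrow> 0"
  shows "(\<lambda>k. l (w k)) \<longlonglongrightarrow> l v"
proof -
  obtain \<psi> where \<psi>: "integrable M \<psi>" "\<And>v. v \<in> V \<Longrightarrow> l v = (\<integral>x. \<psi> x \<bullet> grad \<Omega> v x \<partial>M)"
    by (rule predualE[OF l]) blast
  show ?thesis unfolding \<psi>(2)[OF v] \<psi>(2)[OF w(1)] by (rule grad_weak_star[OF w v lim \<psi>(1)])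
qed

text \<open>On bounded parts of \<open>V\<close> pointwise convergence is dominated by a constant,
  which \<open>poincare_AE\<close> provides.\<close>

lemma L1_limit_of_crep_limit:
  assumes w: "\<And>k. w k \<in> V" "\<And>k. vnorm (w k) \<le> m" and v: "v \<in> V"
    and lim: "\<And>x. x \<in> \<Omega> \<Longrightarrow> (\<lambda>k. crep (w k) x) \<longlonglongrightarrow> crep v x"
  shows "(\<lambda>k. \<integral>x. \<bar>w k x - v x\<bar> \<partial>M) \<longlonglongrightarrow> 0"
proof -
  obtain C where C: "C \<ge> 0" "\<And>v. v \<in> V \<Longrightarrow> AE x in M. \<bar>v x\<bar> \<le> C * vnorm v" using poincare_AE by blast
  have "(\<lambda>k. \<integral>x. \<bar>w k x - v x\<bar> \<partial>M) \<longlonglongrightarrow> (\<integral>x. 0 \<partial>M)"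
  proof (rule integral_dominated_convergence)
    show "integrable M (\<lambda>x. C * (m + vnorm v))" by simp
    show "(\<lambda>x. \<bar>w k x - v x\<bar>) \<in> borel_measurable M" for k
      using Linf_measurable[OF V_Linf[OF w(1)[of k]]] Linf_measurable[OF V_Linf[OF v]] by measurable
    show "AE x in M. norm \<bar>w k x - v x\<bar> \<le> C * (m + vnorm v)" for k
      using C(2)[OF w(1)[of k]] C(2)[OF v]
    proof eventually_elim
      case (elim x)
      have "C * vnorm (w k) \<le> C * m" by (rule mult_left_mono[OF w(2) C(1)])
      moreover have "C * (m + vnorm v) = C * m + C * vnorm v" by (rule distrib_left)
      ultimately show ?case using elim by simp
    qed
    have "AE x in M. \<forall>k. w k x = crep (w k) x" unfolding AE_all_countable using crep_props(2)[OF w(1)] by blast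
    then show "AE x in M. (\<lambda>k. \<bar>w k x - v x\<bar>) \<longlonglongrightarrow> 0"
      using crep_props(2)[OF v] AE_space
    proof eventually_elim
      case (elim x)
      have "(\<lambda>k. crep (w k) x) \<longlonglongrightarrow> crep v x" by (rule lim) (use elim(3) in simp)
      then have "(\<lambda>k. w k x - v x) \<longlonglongrightarrow> 0" using elim(1,2) by (simp add: LIM_zero_iff)
      then show ?case by (rule tendsto_rabs_zero)
    qed
  qed simp
  then show ?thesis by simp
qed

text \<open>For a single w, \<open>du_bois_reymond\<close> holds off a null set that depends on w. A
  countable family, dense under bounded pointwise convergence, leaves one null set, and
  \<open>predual_continuous\<close> extends the identity to all of \<open>V\<close>. The unknown
  constants \<open>c w\<close> cancel in differences over time.\<close>

lemma time_slices:
  assumes v: "v \<in> X" and d: "weak_deriv v g" and \<gamma>: "integrable MI \<gamma>" "\<And>t w. t \<in> I \<Longrightarrow> w \<in> V \<Longrightarrow> \<bar>g t w\<bar> \<le> \<gamma> t * vnorm w"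
  shows "\<exists>C\<ge>0. \<exists>G\<subseteq>I. (AE t in MI. t \<in> G) \<and> (\<forall>t\<in>G. vnorm (v t) \<le> C) \<and>
    (\<forall>s\<in>G. \<forall>t\<in>G. \<forall>w\<in>V. s \<le> t \<longrightarrow> (\<integral>x. (v t x - v s x) * w x \<partial>M) = (\<integral>r. indicat_real {s..<t} r * g r w \<partial>MI))"
proof -
  have gd: "good_deriv g" using d by (simp add: weak_deriv_def)
  have gV: "g t \<in> VS" if "t \<in> I" for t using gd that by (simp add: good_deriv_def)
  obtain C where C: "C \<ge> 0" "AE t in MI. vnorm (v t) \<le> C" using X_norm(2)[OF v] by blast
  have gi: "integrable MI (\<lambda>t. g t w)" if "w \<in> V" for w
    by (rule good_deriv_integrable[OF gd X_const[OF that]])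
  \<comment> \<open>The balls of integer radius exhaust \<open>V\<close>. They are treated one at a
    time because the limit passages want a common bound on the approximants.\<close>
  define A where "A m = {w\<in>V. vnorm w \<le> real m}" for m :: nat
  have "\<exists>D. countable D \<and> D \<subseteq> A m \<and> (\<forall>w\<in>A m. \<exists>u::nat \<Rightarrow> 'a \<Rightarrow> real. (\<forall>k. u k \<in> D) \<and> (\<forall>x\<in>\<Omega>. (\<lambda>k. crep (u k) x) \<longlonglongrightarrow> crep w x))" for m
    by (rule V_separable[where m="real m"]) (auto simp: A_def)
  then have "\<forall>m. \<exists>D. countable D \<and> D \<subseteq> A m \<and> (\<forall>w\<in>A m. \<exists>u::nat \<Rightarrow> 'a \<Rightarrow> real. (\<forall>k. u k \<in> D) \<and> (\<forall>x\<in>\<Omega>. (\<lambda>k. crep (u k) x) \<longlonglongrightarrow> crep w x))" ..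
  from choice[OF this] obtain D where D0: "\<forall>m. countable (D m) \<and> D m \<subseteq> A m \<and> (\<forall>w\<in>A m. \<exists>u::nat \<Rightarrow> 'a \<Rightarrow> real. (\<forall>k. u k \<in> D m) \<and> (\<forall>x\<in>\<Omega>. (\<lambda>k. crep (u k) x) \<longlonglongrightarrow> crep w x))" ..
  note D = D0[THEN spec, THEN conjunct1] D0[THEN spec, THEN conjunct2, THEN conjunct1] D0[THEN spec, THEN conjunct2, THEN conjunct2, THEN bspec]
  define D' where "D' = (\<Union>m. D m)"
  have cD: "countable D'" unfolding D'_def using D(1) by simp
  have DV: "w \<in> V" if "w \<in> D'" for w using that D(2) unfolding D'_def A_def by blast
  have "\<forall>w\<in>D'. \<exists>c. AE t in MI. (\<integral>x. v t x * w x \<partial>M) = c + (\<integral>r. indicat_real {..<t} r * g r w \<partial>MI)"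
  proof
    fix w assume w: "w \<in> D'"
    show "\<exists>c. AE t in MI. (\<integral>x. v t x * w x \<partial>M) = c + (\<integral>r. indicat_real {..<t} r * g r w \<partial>MI)"
      by (rule du_bois_reymond[OF X_product_Linf[OF v DV[OF w]] gi[OF DV[OF w]]])
        (use d DV[OF w] in \<open>simp add: weak_deriv_def\<close>)
  qed
  from bchoice[OF this] obtain c where c: "\<forall>w\<in>D'. AE t in MI. (\<integral>x. v t x * w x \<partial>M) = c w + (\<integral>r. indicat_real {..<t} r * g r w \<partial>MI)" ..
  have cc: "AE t in MI. \<forall>w\<in>D'. (\<integral>x. v t x * w x \<partial>M) = c w + (\<integral>r. indicat_real {..<t} r * g r w \<partial>MI)"
    by (subst AE_ball_countable[OF cD]) (rule c)
  define G where "G = {t\<in>I. vnorm (v t) \<le> C \<and> (\<forall>w\<in>D'. (\<integral>x. v t x * w x \<partial>M) = c w + (\<integral>r. indicat_real {..<t} r * g r w \<partial>MI))}"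
  have GI: "G \<subseteq> I" by (auto simp: G_def)
  have GA: "AE t in MI. t \<in> G"
    using C(2) cc AE_space by eventually_elim (simp add: G_def)
  have vw: "integrable M (\<lambda>x. v t x * w x)" if "t \<in> I" "w \<in> V" for t w
    by (rule L2_mult_integrable[OF V_L2[OF X_V[OF v that(1)]] V_L2[OF that(2)]])
  have key: "(\<integral>x. (v t x - v s x) * w x \<partial>M) = (\<integral>r. indicat_real {s..<t} r * g r w \<partial>MI)"
    if s: "s \<in> G" and t: "t \<in> G" and st: "s \<le> t" and w: "w \<in> V" for s t w
  proof -
    have sI: "s \<in> I" and tI: "t \<in> I" using s t GI by auto
    have dense: "(\<integral>x. (v t x - v s x) * w x \<partial>M) = (\<integral>r. indicat_real {s..<t} r * g r w \<partial>MI)" if w: "w \<in> D'" for w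
    proof -
      have "(\<integral>x. v t x * w x \<partial>M) - (\<integral>x. v s x * w x \<partial>M) = (\<integral>r. indicat_real {..<t} r * g r w \<partial>MI) - (\<integral>r. indicat_real {..<s} r * g r w \<partial>MI)"
        using s t w by (simp add: G_def)
      also have "\<dots> = (\<integral>r. indicat_real {s..<t} r * g r w \<partial>MI)"
        by (rule integral_indicator_partition[OF finite_measure_MI gi[OF DV[OF w]] _ _ st]) (auto simp: sets_restrict_space_iff)
      finally show ?thesis
        unfolding left_diff_distrib Bochner_Integration.integral_diff[OF vw[OF tI DV[OF w]] vw[OF sI DV[OF w]]] .
    qed
    obtain m where m: "vnorm w \<le> real m" using real_arch_simple by blast
    have "w \<in> A m" using w m by (simp add: A_def)
    from D(3)[OF this] obtain u :: "nat \<Rightarrow> 'a \<Rightarrow> real" where u: "\<And>k. u k \<in> D m" "\<And>x. x \<in> \<Omega> \<Longrightarrow> (\<lambda>k. crep (u k) x) \<longlonglongrightarrow> crep w x"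
      by blast
    have uD: "u k \<in> D'" for k unfolding D'_def using u(1) by blast
    have uV: "u k \<in> V" for k by (rule DV[OF uD])
    have um: "vnorm (u k) \<le> real m" for k using u(1)[of k] D(2)[of m] by (auto simp: A_def)
    have L1: "(\<lambda>k. \<integral>x. \<bar>u k x - w x\<bar> \<partial>M) \<longlonglongrightarrow> 0" by (rule L1_limit_of_crep_limit[OF uV um w u(2)])
    define h where "h x = v t x - v s x" for x
    have hL: "h \<in> Linf M" unfolding h_def[abs_def] by (rule Linf_diff[OF V_Linf[OF X_V[OF v tI]] V_Linf[OF X_V[OF v sI]]])
    have lim1: "(\<lambda>k. \<integral>x. h x * u k x \<partial>M) \<longlonglongrightarrow> (\<integral>x. h x * w x \<partial>M)"
    proof -
      have ui: "integrable M (u k)" for k by (rule Linf_integrable[OF finite_measure_M V_Linf[OF uV]])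
      have wi: "integrable M w" by (rule Linf_integrable[OF finite_measure_M V_Linf[OF w]])
      have b: "norm ((\<integral>x. h x * u k x \<partial>M) - (\<integral>x. h x * w x \<partial>M)) \<le> (\<integral>x. \<bar>u k x - w x\<bar> \<partial>M) * Linf_norm M h" for k
      proof -
        have "(\<integral>x. h x * u k x \<partial>M) - (\<integral>x. h x * w x \<partial>M) = (\<integral>x. (u k x - w x) \<bullet> h x \<partial>M)"
          unfolding Bochner_Integration.integral_diff[OF integrable_Linf_mult[OF hL ui] integrable_Linf_mult[OF hL wi], symmetric]
          by (rule Bochner_Integration.integral_cong[OF refl]) (simp add: algebra_simps)
        then show ?thesis using integral_inner_Linf_bound[OF Bochner_Integration.integrable_diff[OF ui[of k] wi] hL] by simp
      qed
      have "(\<lambda>k. (\<integral>x. \<bar>u k x - w x\<bar> \<partial>M) * Linf_norm M h) \<longlonglongrightarrow> 0" using tendsto_mult_left_zero[OF L1] .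
      from Lim_null_comparison[OF always_eventually[OF allI[OF b]] this] show ?thesis by (simp add: LIM_zero_iff)
    qed
    have lim2: "(\<lambda>k. \<integral>r. indicat_real {s..<t} r * g r (u k) \<partial>MI) \<longlonglongrightarrow> (\<integral>r. indicat_real {s..<t} r * g r w \<partial>MI)"
    proof (rule integral_dominated_convergence)
      have ind: "(\<lambda>r. indicat_real {s..<t} r) \<in> borel_measurable MI"
      proof -
        have [measurable]: "(\<lambda>z. z) \<in> measurable MI borel"
          by (rule lebesgue_measurable_of_continuous) (rule continuous_on_id)
        show ?thesis by measurable
      qed
      show "(\<lambda>r. indicat_real {s..<t} r * g r w) \<in> borel_measurable MI"
        by (rule borel_measurable_times[OF ind]) (use gi[OF w] in simp)
      show "(\<lambda>r. indicat_real {s..<t} r * g r (u k)) \<in> borel_measurable MI" for k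
        by (rule borel_measurable_times[OF ind]) (use gi[OF uV] in simp)
      show "integrable MI (\<lambda>r. \<bar>\<gamma> r\<bar> * real m)" using \<gamma>(1) by simp
      show "AE r in MI. norm (indicat_real {s..<t} r * g r (u k)) \<le> \<bar>\<gamma> r\<bar> * real m" for k
        using AE_space
      proof eventually_elim
        case (elim r)
        have "\<bar>g r (u k)\<bar> \<le> \<gamma> r * vnorm (u k)" by (rule \<gamma>(2)[OF _ uV]) (use elim in simp)
        also have "\<dots> \<le> \<bar>\<gamma> r\<bar> * real m" by (rule mult_mono) (use um V_norm_nonneg[of "u k"] in auto)
        finally show ?case by (auto simp: indicator_def)
      qed
      show "AE r in MI. (\<lambda>k. indicat_real {s..<t} r * g r (u k)) \<longlonglongrightarrow> indicat_real {s..<t} r * g r w"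
        using AE_space
      proof eventually_elim
        case (elim r)
        have "(\<lambda>k. g r (u k)) \<longlonglongrightarrow> g r w" by (rule predual_continuous[OF gV uV um w L1]) (use elim in simp)
        then show ?case by (rule tendsto_mult_left)
      qed
    qed
    have "(\<lambda>k. \<integral>x. h x * u k x \<partial>M) \<longlonglongrightarrow> (\<integral>r. indicat_real {s..<t} r * g r w \<partial>MI)"
      using lim2 unfolding dense[OF uD, symmetric] h_def .
    from LIMSEQ_unique[OF lim1 this] show ?thesis unfolding h_def .
  qed
  show ?thesis
    by (intro exI[of _ C] exI[of _ G] conjI C(1) GI GA ballI impI key) (simp_all add: G_def)
qed

end

text \<open>The situation that \<open>time_slices\<close> produces, with a nonnegative majorant. At
  the times of \<open>G\<close> the norm bound and the increment formula hold without exception, so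
  partition points and approximating times are always taken from \<open>G\<close>.\<close>

locale time_curve = torsion_domain \<Omega> \<Gamma>\<^sub>D T
  for \<Omega> \<Gamma>\<^sub>D :: "'a::euclidean_space set" and T :: real +
  fixes v :: "real \<Rightarrow> 'a \<Rightarrow> real" and g :: "real \<Rightarrow> ('a \<Rightarrow> real) \<Rightarrow> real"
    and \<gamma> :: "real \<Rightarrow> real" and C :: real and G :: "real set"
  assumes v: "v \<in> X" and gd: "good_deriv g"
    and \<gamma>: "integrable MI \<gamma>" "\<And>t. 0 \<le> \<gamma> t" "\<And>t w. t \<in> I \<Longrightarrow> w \<in> V \<Longrightarrow> \<bar>g t w\<bar> \<le> \<gamma> t * vnorm w"
    and C: "0 \<le> C" and GI: "G \<subseteq> I" and GA: "AE t in MI. t \<in> G" and GC: "\<And>t. t \<in> G \<Longrightarrow> vnorm (v t) \<le> C"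
    and slice_eq: "\<And>s t w. s \<in> G \<Longrightarrow> t \<in> G \<Longrightarrow> s \<le> t \<Longrightarrow> w \<in> V \<Longrightarrow>
      (\<integral>x. (v t x - v s x) * w x \<partial>M) = (\<integral>r. indicat_real {s..<t} r * g r w \<partial>MI)"
begin

text \<open>A primitive of the majorant. Its increments dominate those of the curve and so serve as
  modulus of continuity in time.\<close>

definition \<Psi> :: "real \<Rightarrow> real" where
  "\<Psi> t = (\<integral>r. indicat_real {..<t} r * \<gamma> r \<partial>MI)"

lemma indicator_integrable:
  assumes k: "integrable MI (k :: real \<Rightarrow> real)" and A: "A \<in> sets borel"
  shows "integrable MI (\<lambda>r. indicat_real A r * k r)"
proof -
  have [measurable]: "(\<lambda>z. z) \<in> measurable MI borel"
    by (rule lebesgue_measurable_of_continuous) (rule continuous_on_id)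
  have i: "(\<lambda>r. indicat_real A r) \<in> borel_measurable MI" using A by measurable
  show ?thesis
  proof (rule Bochner_Integration.integrable_bound[OF k])
    show "(\<lambda>r. indicat_real A r * k r) \<in> borel_measurable MI" by (rule borel_measurable_times[OF i borel_measurable_integrable[OF k]])
    show "AE r in MI. norm (indicat_real A r * k r) \<le> norm (k r)" by (intro AE_I2) (simp add: indicator_def)
  qed
qed

lemma \<Psi>_diff: "s \<le> t \<Longrightarrow> \<Psi> t - \<Psi> s = (\<integral>r. indicat_real {s..<t} r * \<gamma> r \<partial>MI)"
  unfolding \<Psi>_def
  by (rule integral_indicator_partition[OF finite_measure_MI \<gamma>(1)]) (simp_all add: sets_restrict_space_iff)

lemma \<Psi>_mono: "s \<le> t \<Longrightarrow> \<Psi> s \<le> \<Psi> t"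
proof -
  assume st: "s \<le> t"
  have "0 \<le> (\<integral>r. indicat_real {s..<t} r * \<gamma> r \<partial>MI)"
    by (rule Bochner_Integration.integral_nonneg) (simp add: \<gamma>(2))
  then show ?thesis using \<Psi>_diff[OF st] by simp
qed

lemma \<Psi>_continuous: assumes s: "s \<longlonglongrightarrow> t" shows "(\<lambda>k. \<Psi> (s k)) \<longlonglongrightarrow> \<Psi> t"
  unfolding \<Psi>_def
proof (rule integral_dominated_convergence[OF _ _ \<gamma>(1)])
  show "(\<lambda>r. indicat_real {..<t} r * \<gamma> r) \<in> borel_measurable MI"
    by (rule borel_measurable_integrable[OF indicator_integrable[OF \<gamma>(1)]]) simp
  show "(\<lambda>r. indicat_real {..<s k} r * \<gamma> r) \<in> borel_measurable MI" for k
    by (rule borel_measurable_integrable[OF indicator_integrable[OF \<gamma>(1)]]) simp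
  show "AE r in MI. norm (indicat_real {..<s k} r * \<gamma> r) \<le> \<gamma> r" for k
    by (intro AE_I2) (simp add: indicator_def \<gamma>(2))
  \<comment> \<open>The indicators may fail to converge at r = t, which is a null set.\<close>
  have "AE r in lborel. r \<noteq> t" by (rule AE_lborel_singleton)
  then have "AE r in MI. r \<noteq> t" by (simp add: AE_lebesgue_on_iff) (erule eventually_mono, simp)
  then show "AE r in MI. (\<lambda>k. indicat_real {..<s k} r * \<gamma> r) \<longlonglongrightarrow> indicat_real {..<t} r * \<gamma> r"
  proof eventually_elim
    case (elim r)
    have "eventually (\<lambda>k. indicat_real {..<s k} r = indicat_real {..<t} r) sequentially"
    proof (cases "r < t")
      case True
      from order_tendstoD(1)[OF s True] show ?thesis by eventually_elim (simp add: True)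
    next
      case False
      then have "t < r" using elim by simp
      from order_tendstoD(2)[OF s this] show ?thesis by eventually_elim (use False in simp)
    qed
    then have "(\<lambda>k. indicat_real {..<s k} r) \<longlonglongrightarrow> indicat_real {..<t} r" by (rule tendsto_eventually)
    then show ?case by (rule tendsto_mult_right)
  qed
qed

lemma \<Psi>_diff_tendsto_zero: assumes s: "s \<longlonglongrightarrow> t" shows "(\<lambda>k. c * \<bar>\<Psi> (s k) - \<Psi> t\<bar>) \<longlonglongrightarrow> 0"
  by (intro tendsto_mult_right_zero tendsto_rabs_zero) (use \<Psi>_continuous[OF s] in \<open>simp add: LIM_zero_iff\<close>)

lemma vV: "t \<in> G \<Longrightarrow> v t \<in> V"
  using X_V[OF v] GI by blast

lemma vL2: "t \<in> G \<Longrightarrow> v t \<in> L2 M"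
  by (rule V_L2[OF vV])

lemma gi: "w \<in> V \<Longrightarrow> integrable MI (\<lambda>r. g r w)"
  by (rule good_deriv_integrable[OF gd X_const])

lemma g_bound: "r \<in> I \<Longrightarrow> t \<in> G \<Longrightarrow> \<bar>g r (v t)\<bar> \<le> C * \<gamma> r"
proof -
  assume r: "r \<in> I" and t: "t \<in> G"
  have "\<bar>g r (v t)\<bar> \<le> \<gamma> r * vnorm (v t)" by (rule \<gamma>(3)[OF r vV[OF t]])
  also have "\<dots> \<le> \<gamma> r * C" by (rule mult_left_mono[OF GC[OF t] \<gamma>(2)])
  finally show ?thesis by (simp add: mult.commute)
qed

lemma slice_bound:
  assumes "s \<in> G" "t \<in> G" "s \<le> t" "p \<in> G"
  shows "\<bar>\<integral>x. (v t x - v s x) * v p x \<partial>M\<bar> \<le> C * (\<Psi> t - \<Psi> s)"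
proof -
  have "\<bar>\<integral>r. indicat_real {s..<t} r * g r (v p) \<partial>MI\<bar> \<le> (\<integral>r. C * (indicat_real {s..<t} r * \<gamma> r) \<partial>MI)"
  proof (rule order_trans[OF integral_abs_bound integral_mono])
    show "integrable MI (\<lambda>r. \<bar>indicat_real {s..<t} r * g r (v p)\<bar>)"
      by (rule integrable_abs[OF indicator_integrable[OF gi[OF vV[OF assms(4)]]]]) simp
    show "integrable MI (\<lambda>r. C * (indicat_real {s..<t} r * \<gamma> r))"
      by (rule integrable_mult_right[OF indicator_integrable[OF \<gamma>(1)]]) simp
    show "\<bar>indicat_real {s..<t} r * g r (v p)\<bar> \<le> C * (indicat_real {s..<t} r * \<gamma> r)" if "r \<in> space MI" for r
      using g_bound[OF _ assms(4), of r] that by (simp add: indicator_def)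
  qed
  then show ?thesis using slice_eq[OF assms(1-3) vV[OF assms(4)]] \<Psi>_diff[OF assms(3)] by simp
qed

text \<open>The increment is tested with itself, that is, with \<open>v t\<close> and
  \<open>v s\<close> separately, and each pairing is controlled by \<open>slice_bound\<close>. Hence
  the curve is uniformly continuous on \<open>G\<close> in L2, although no continuity in the norm of
  \<open>V\<close> is available.\<close>

lemma gap:
  assumes s: "s \<in> G" and t: "t \<in> G" shows "(\<integral>x. (v t x - v s x)\<^sup>2 \<partial>M) \<le> 2 * C * \<bar>\<Psi> t - \<Psi> s\<bar>"
proof -
  have le: "(\<integral>x. (v t x - v s x)\<^sup>2 \<partial>M) \<le> 2 * C * \<bar>\<Psi> t - \<Psi> s\<bar>" if s: "s \<in> G" and t: "t \<in> G" and st: "s \<le> t" for s t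
  proof -
    have h: "(\<lambda>x. v t x - v s x) \<in> L2 M" by (rule L2_diff[OF vL2[OF t] vL2[OF s]])
    have "(\<integral>x. (v t x - v s x)\<^sup>2 \<partial>M) = (\<integral>x. (v t x - v s x) * v t x - (v t x - v s x) * v s x \<partial>M)"
      by (rule Bochner_Integration.integral_cong[OF refl]) (simp add: power2_eq_square algebra_simps)
    also have "\<dots> = (\<integral>x. (v t x - v s x) * v t x \<partial>M) - (\<integral>x. (v t x - v s x) * v s x \<partial>M)"
      by (rule Bochner_Integration.integral_diff[OF L2_mult_integrable[OF h vL2[OF t]] L2_mult_integrable[OF h vL2[OF s]]])
    also have "\<dots> \<le> C * (\<Psi> t - \<Psi> s) + C * (\<Psi> t - \<Psi> s)"
      using slice_bound[OF s t st t] slice_bound[OF s t st s] by linarith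
    also have "\<dots> = 2 * C * \<bar>\<Psi> t - \<Psi> s\<bar>" using \<Psi>_mono[OF st] by simp
    finally show ?thesis .
  qed
  show ?thesis
  proof (cases "s \<le> t")
    case True then show ?thesis by (rule le[OF s t])
  next
    case False
    then have "(\<integral>x. (v s x - v t x)\<^sup>2 \<partial>M) \<le> 2 * C * \<bar>\<Psi> s - \<Psi> t\<bar>" by (intro le[OF t s]) simp
    then show ?thesis by (simp add: power2_commute abs_minus_commute)
  qed
qed

text \<open>\<open>G\<close> has full measure and so meets every interval around t. At the end
  points the half of the interval inside (0, T) suffices.\<close>

lemma approximating_times:
  assumes t: "t \<in> {0..T}" shows "\<exists>s::nat \<Rightarrow> real. (\<forall>k. s k \<in> G) \<and> s \<longlonglongrightarrow> t"
proof -
  have "\<forall>k::nat. \<exists>s. s \<in> G \<and> \<bar>s - t\<bar> < inverse (real (Suc k))"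
  proof
    fix k :: nat
    have "0 < inverse (real (Suc k))" by simp
    then have "\<exists>s. 0 < s \<and> s < T \<and> t - inverse (real (Suc k)) < s \<and> s < t + inverse (real (Suc k)) \<and> s \<in> G"
      using t by (intro AE_interval_dense[OF GA _ _ _ T_pos]) (simp_all only: atLeastAtMost_iff, linarith+)
    then obtain s where s: "t - inverse (real (Suc k)) < s" "s < t + inverse (real (Suc k))" "s \<in> G" by blast
    then have "\<bar>s - t\<bar> < inverse (real (Suc k))" by linarith
    then show "\<exists>s. s \<in> G \<and> \<bar>s - t\<bar> < inverse (real (Suc k))" using s(3) by blast
  qed
  from choice[OF this] obtain s where s: "\<forall>k. s k \<in> G \<and> \<bar>s k - t\<bar> < inverse (real (Suc k))" ..
  have "(\<lambda>k. s k - t) \<longlonglongrightarrow> 0"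
    by (rule Lim_null_comparison[OF _ LIMSEQ_inverse_real_of_nat]) (use s in \<open>auto intro!: always_eventually less_imp_le\<close>)
  then have "s \<longlonglongrightarrow> t" by (simp add: LIM_zero_iff)
  then show ?thesis using s by blast
qed

text \<open>\<open>near B t w\<close> states that \<open>w\<close> is the value at time \<open>t\<close> of the continuous representative.\<close>

definition near :: "real \<Rightarrow> real \<Rightarrow> ('a \<Rightarrow> real) \<Rightarrow> bool" where
  "near B t w \<longleftrightarrow> w \<in> L2 M \<and> (AE x in M. \<bar>w x\<bar> \<le> B) \<and>
    (\<forall>s\<in>G. (\<integral>x. (v s x - w x)\<^sup>2 \<partial>M) \<le> 2 * C * \<bar>\<Psi> s - \<Psi> t\<bar>)"

text \<open>Along times of \<open>G\<close> tending to t the curve is Cauchy in L2 by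
  \<open>gap\<close>, hence in L1, and an almost everywhere convergent subsequence provides the
  value at t. The bound \<open>B\<close> dominates the passage to the limit in
  \<open>gap\<close>.\<close>

lemma limit_exists:
  assumes B: "\<And>s. s \<in> G \<Longrightarrow> AE x in M. \<bar>v s x\<bar> \<le> B" and t: "t \<in> {0..T}"
  shows "\<exists>w. near B t w"
proof -
  obtain s where s: "\<And>k. s k \<in> G" "s \<longlonglongrightarrow> t" using approximating_times[OF t] by blast
  have vi: "integrable M (v (s k))" for k by (rule Linf_integrable[OF finite_measure_M V_Linf[OF vV[OF s(1)]]])
  have vm[measurable]: "v (s k) \<in> borel_measurable M" for k using vi by simp
  let ?m = "measure M (space M)"
  obtain r where r: "strict_mono r" "AE x in M. Cauchy (\<lambda>i. v (s (r i)) x)"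
  proof (rule cauchy_L1_AE_cauchy_subseq[of M "\<lambda>k. v (s k)"])
    fix e :: real assume e: "0 < e"
    have "(\<lambda>k. 2 * C * \<bar>\<Psi> (s k) - \<Psi> t\<bar>) \<longlonglongrightarrow> 0" by (rule \<Psi>_diff_tendsto_zero[OF s(2)])
    \<comment> \<open>Two such terms make the squared L2 distance at most e^2 / (2 (m + 1)).
      Cauchy-Schwarz multiplies by the total mass m, which leaves an L1 distance of at most e / sqrt
      2.\<close>
    moreover have e': "0 < e\<^sup>2 / (4 * (?m + 1))" using e by (intro divide_pos_pos) (auto intro: add_nonneg_pos)
    ultimately obtain N where N: "\<And>k. N \<le> k \<Longrightarrow> \<bar>2 * C * \<bar>\<Psi> (s k) - \<Psi> t\<bar>\<bar> < e\<^sup>2 / (4 * (?m + 1))"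
      using LIMSEQ_D[of _ 0 "e\<^sup>2 / (4 * (?m + 1))"] by fastforce
    show "\<exists>N. \<forall>i\<ge>N. \<forall>j\<ge>N. (\<integral>x. norm (v (s i) x - v (s j) x) \<partial>M) < e"
    proof (intro exI allI impI)
      fix i j assume ij: "N \<le> i" "N \<le> j"
      let ?d = "\<integral>x. (v (s i) x - v (s j) x)\<^sup>2 \<partial>M"
      have "?d \<le> 2 * C * \<bar>\<Psi> (s i) - \<Psi> (s j)\<bar>" by (rule gap[OF s(1) s(1)])
      also have "\<dots> \<le> 2 * C * \<bar>\<Psi> (s i) - \<Psi> t\<bar> + 2 * C * \<bar>\<Psi> (s j) - \<Psi> t\<bar>"
        unfolding distrib_left[symmetric] by (rule mult_left_mono) (use C in auto)
      also have "\<dots> \<le> e\<^sup>2 / (4 * (?m + 1)) + e\<^sup>2 / (4 * (?m + 1))" using N[OF ij(1)] N[OF ij(2)] by linarith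
      also have "\<dots> = e\<^sup>2 / (2 * (?m + 1))"
      proof -
        have "a / (4 * q) + a / (4 * q) = a / (2 * q)" for a q :: real by (cases "q = 0") (simp_all add: field_simps)
        then show ?thesis .
      qed
      finally have d: "?d \<le> e\<^sup>2 / (2 * (?m + 1))" .
      have "(\<integral>x. \<bar>v (s i) x - v (s j) x\<bar> \<partial>M) \<le> sqrt (?m * ?d)"
        by (rule L1_le_L2[OF finite_measure_M L2_diff[OF vL2[OF s(1)] vL2[OF s(1)]]])
      also have "?m * ?d \<le> (?m + 1) * (e\<^sup>2 / (2 * (?m + 1)))" by (rule mult_mono) (use d in auto)
      also have "\<dots> = e\<^sup>2 / 2"
      proof -
        have "?m + 1 \<noteq> 0" using measure_nonneg[of M "space M"] by linarith
        then show ?thesis by (simp add: field_simps)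
      qed
      also have "sqrt (e\<^sup>2 / 2) < e" using e by (intro real_less_lsqrt) auto
      finally show "(\<integral>x. norm (v (s i) x - v (s j) x) \<partial>M) < e" by simp
    qed
  qed (rule vi)
  have rt: "(\<lambda>i. s (r i)) \<longlonglongrightarrow> t" using LIMSEQ_subseq_LIMSEQ[OF s(2) r(1)] by (simp add: comp_def)
  define w where "w x = lim (\<lambda>i. v (s (r i)) x)" for x
  have wm: "w \<in> borel_measurable M" unfolding w_def[abs_def] by measurable
  have wl: "AE x in M. (\<lambda>i. v (s (r i)) x) \<longlonglongrightarrow> w x"
    using r(2) by eventually_elim (simp add: w_def Cauchy_convergent_iff convergent_LIMSEQ_iff)
  have vb: "AE x in M. \<forall>i. \<bar>v (s (r i)) x\<bar> \<le> B" unfolding AE_all_countable using B[OF s(1)] by blast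
  have wb: "AE x in M. \<bar>w x\<bar> \<le> B"
    using wl vb
  proof eventually_elim
    case (elim x)
    show ?case by (rule LIMSEQ_le_const2[OF tendsto_rabs[OF elim(1)]]) (use elim(2) in blast)
  qed
  have wL: "w \<in> L2 M" by (rule Linf_L2[OF finite_measure_M LinfI[OF wm]]) (use wb in simp)
  have "(\<integral>x. (v p x - w x)\<^sup>2 \<partial>M) \<le> 2 * C * \<bar>\<Psi> p - \<Psi> t\<bar>" if p: "p \<in> G" for p
  proof -
    have "(\<lambda>i. \<integral>x. (v p x - v (s (r i)) x)\<^sup>2 \<partial>M) \<longlonglongrightarrow> (\<integral>x. (v p x - w x)\<^sup>2 \<partial>M)"
    proof (rule integral_dominated_convergence)
      have pm[measurable]: "v p \<in> borel_measurable M" by (rule Linf_measurable[OF V_Linf[OF vV[OF p]]])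
      show "(\<lambda>x. (v p x - w x)\<^sup>2) \<in> borel_measurable M" using wm by measurable
      show "(\<lambda>x. (v p x - v (s (r i)) x)\<^sup>2) \<in> borel_measurable M" for i by measurable
      show "integrable M (\<lambda>x. (2 * B)\<^sup>2)" by simp
      show "AE x in M. norm ((v p x - v (s (r i)) x)\<^sup>2) \<le> (2 * B)\<^sup>2" for i
        using B[OF p] B[OF s(1)[of "r i"]]
      proof eventually_elim
        case (elim x)
        then have "\<bar>v p x - v (s (r i)) x\<bar> \<le> 2 * B" by linarith
        then have "\<bar>v p x - v (s (r i)) x\<bar>\<^sup>2 \<le> (2 * B)\<^sup>2" by (rule power_mono) simp
        then show ?case by simp
      qed
      show "AE x in M. (\<lambda>i. (v p x - v (s (r i)) x)\<^sup>2) \<longlonglongrightarrow> (v p x - w x)\<^sup>2"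
        using wl by eventually_elim (intro tendsto_intros)
    qed
    moreover have "(\<lambda>i. 2 * C * \<bar>\<Psi> p - \<Psi> (s (r i))\<bar>) \<longlonglongrightarrow> 2 * C * \<bar>\<Psi> p - \<Psi> t\<bar>"
      by (intro tendsto_intros \<Psi>_continuous rt)
    ultimately show ?thesis by (rule LIMSEQ_le) (intro exI[of _ 0] allI impI gap[OF s(1) p])
  qed
  then have "near B t w" unfolding near_def by (intro conjI ballI wL wb)
  then show ?thesis by (rule exI[where x=w])
qed

lemma near_L2: "near B t w \<Longrightarrow> w \<in> L2 M"
  by (simp add: near_def)

lemma near_gap: "near B t w \<Longrightarrow> s \<in> G \<Longrightarrow> (\<integral>x. (v s x - w x)\<^sup>2 \<partial>M) \<le> 2 * C * \<bar>\<Psi> s - \<Psi> t\<bar>"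
  by (simp add: near_def)

text \<open>The two values are compared through times of \<open>G\<close> tending to t; the factor
  is 4 because \<open>L2_triangle\<close> doubles each gap.\<close>

lemma near_near_gap:
  assumes w: "near B t w" and w': "near B t' w'" and t: "t \<in> {0..T}"
  shows "(\<integral>x. (w' x - w x)\<^sup>2 \<partial>M) \<le> 4 * C * \<bar>\<Psi> t' - \<Psi> t\<bar>"
proof -
  obtain s where s: "\<And>k. s k \<in> G" "s \<longlonglongrightarrow> t" using approximating_times[OF t] by blast
  have le: "(\<integral>x. (w' x - w x)\<^sup>2 \<partial>M) \<le> 4 * C * \<bar>\<Psi> (s k) - \<Psi> t'\<bar> + 4 * C * \<bar>\<Psi> (s k) - \<Psi> t\<bar>" for k
  proof -
    have "(\<integral>x. (w' x - w x)\<^sup>2 \<partial>M) \<le> 2 * (\<integral>x. (w' x - v (s k) x)\<^sup>2 \<partial>M) + 2 * (\<integral>x. (v (s k) x - w x)\<^sup>2 \<partial>M)"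
      by (rule L2_triangle[OF near_L2[OF w'] vL2[OF s(1)] near_L2[OF w]])
    moreover have "(\<integral>x. (w' x - v (s k) x)\<^sup>2 \<partial>M) \<le> 2 * C * \<bar>\<Psi> (s k) - \<Psi> t'\<bar>"
      using near_gap[OF w' s(1)] by (subst power2_commute)
    moreover have "(\<integral>x. (v (s k) x - w x)\<^sup>2 \<partial>M) \<le> 2 * C * \<bar>\<Psi> (s k) - \<Psi> t\<bar>" by (rule near_gap[OF w s(1)])
    ultimately show ?thesis by linarith
  qed
  have "(\<lambda>k. 4 * C * \<bar>\<Psi> (s k) - \<Psi> t'\<bar> + 4 * C * \<bar>\<Psi> (s k) - \<Psi> t\<bar>) \<longlonglongrightarrow> 4 * C * \<bar>\<Psi> t - \<Psi> t'\<bar> + 4 * C * \<bar>\<Psi> t - \<Psi> t\<bar>"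
    by (intro tendsto_intros \<Psi>_continuous s(2))
  then have "(\<integral>x. (w' x - w x)\<^sup>2 \<partial>M) \<le> 4 * C * \<bar>\<Psi> t - \<Psi> t'\<bar> + 4 * C * \<bar>\<Psi> t - \<Psi> t\<bar>"
    by (rule LIMSEQ_le_const) (use le in blast)
  then show ?thesis by (simp add: abs_minus_commute)
qed

text \<open>The common bound \<open>B\<close> controls a difference of squares by
  \<open>2 * B\<close> times the L1 distance, and the gap controls that distance.\<close>

lemma near_energy:
  assumes w: "near B t w" and B0: "0 \<le> B" and B: "\<And>s. s \<in> G \<Longrightarrow> AE x in M. \<bar>v s x\<bar> \<le> B" and s: "\<And>k. s k \<in> G" "s \<longlonglongrightarrow> t"
  shows "(\<lambda>k. \<integral>x. (v (s k) x)\<^sup>2 \<partial>M) \<longlonglongrightarrow> (\<integral>x. (w x)\<^sup>2 \<partial>M)"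
proof -
  let ?m = "measure M (space M)"
  have wb: "AE x in M. \<bar>w x\<bar> \<le> B" using w by (simp add: near_def)
  have b: "norm ((\<integral>x. (v (s k) x)\<^sup>2 \<partial>M) - (\<integral>x. (w x)\<^sup>2 \<partial>M)) \<le> 2 * B * sqrt (?m * (2 * C * \<bar>\<Psi> (s k) - \<Psi> t\<bar>))" for k
  proof -
    have d: "(\<lambda>x. v (s k) x - w x) \<in> L2 M" by (rule L2_diff[OF vL2[OF s(1)] near_L2[OF w]])
    have one: "(\<lambda>x. 1::real) \<in> L2 M" by (simp add: L2_def)
    have i1: "integrable M (\<lambda>x. \<bar>v (s k) x - w x\<bar>)" using L2_mult_integrable[OF d one] by simp
    have i2: "integrable M (\<lambda>x. (v (s k) x)\<^sup>2)" "integrable M (\<lambda>x. (w x)\<^sup>2)"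
      using vL2[OF s(1)[of k]] near_L2[OF w] by (simp_all add: L2_def)
    have ab: "AE x in M. \<bar>(v (s k) x)\<^sup>2 - (w x)\<^sup>2\<bar> \<le> 2 * B * \<bar>v (s k) x - w x\<bar>"
      using wb B[OF s(1)[of k]]
    proof eventually_elim
      case (elim x)
      have "\<bar>(v (s k) x)\<^sup>2 - (w x)\<^sup>2\<bar> = \<bar>v (s k) x + w x\<bar> * \<bar>v (s k) x - w x\<bar>"
        unfolding abs_mult[symmetric] by (simp add: power2_eq_square algebra_simps)
      also have "\<dots> \<le> 2 * B * \<bar>v (s k) x - w x\<bar>" by (rule mult_right_mono) (use elim in auto)
      finally show ?case .
    qed
    have "norm ((\<integral>x. (v (s k) x)\<^sup>2 \<partial>M) - (\<integral>x. (w x)\<^sup>2 \<partial>M)) = \<bar>\<integral>x. (v (s k) x)\<^sup>2 - (w x)\<^sup>2 \<partial>M\<bar>"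
      using i2 by simp
    also have "\<dots> \<le> (\<integral>x. 2 * B * \<bar>v (s k) x - w x\<bar> \<partial>M)"
    proof (rule order_trans[OF integral_abs_bound integral_mono_AE])
      show "integrable M (\<lambda>x. \<bar>(v (s k) x)\<^sup>2 - (w x)\<^sup>2\<bar>)" using i2 by simp
      show "integrable M (\<lambda>x. 2 * B * \<bar>v (s k) x - w x\<bar>)" by (rule integrable_mult_right[OF i1])
    qed (rule ab)
    also have "\<dots> = 2 * B * (\<integral>x. \<bar>v (s k) x - w x\<bar> \<partial>M)" by simp
    also have "\<dots> \<le> 2 * B * sqrt (?m * (2 * C * \<bar>\<Psi> (s k) - \<Psi> t\<bar>))"
    proof (rule mult_left_mono[OF order_trans[OF L1_le_L2[OF finite_measure_M d]]])
      show "sqrt (?m * (\<integral>x. (v (s k) x - w x)\<^sup>2 \<partial>M)) \<le> sqrt (?m * (2 * C * \<bar>\<Psi> (s k) - \<Psi> t\<bar>))"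
        by (intro real_sqrt_le_mono mult_left_mono near_gap[OF w s(1)]) simp
    qed (use B0 in simp)
    finally show ?thesis .
  qed
  have "(\<lambda>k. 2 * B * sqrt (?m * (2 * C * \<bar>\<Psi> (s k) - \<Psi> t\<bar>))) \<longlonglongrightarrow> 2 * B * sqrt (?m * (2 * C * \<bar>\<Psi> t - \<Psi> t\<bar>))"
    by (intro tendsto_intros \<Psi>_continuous s(2))
  then have "(\<lambda>k. 2 * B * sqrt (?m * (2 * C * \<bar>\<Psi> (s k) - \<Psi> t\<bar>))) \<longlonglongrightarrow> 0" by simp
  from Lim_null_comparison[OF always_eventually[OF allI[OF b]] this] show ?thesis by (simp add: LIM_zero_iff)
qed

lemma near_continuous_rep:
  assumes W: "\<And>t. t \<in> {0..T} \<Longrightarrow> near B t (W t)" shows "continuous_rep \<Omega> T v W"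
  unfolding continuous_rep_def
proof (intro conjI ballI)
  show "W t \<in> L2 M" if "t \<in> {0..T}" for t by (rule near_L2[OF W[OF that]])
  show "((\<lambda>s. L2_norm M (\<lambda>x. W s x - W t x)) \<longlongrightarrow> 0) (at t within {0..T})" if t: "t \<in> {0..T}" for t
    unfolding tendsto_at_iff_sequentially
  proof -
    show "\<forall>X. (\<forall>i. X i \<in> {0..T} - {t}) \<longrightarrow> X \<longlonglongrightarrow> t \<longrightarrow> ((\<lambda>s. L2_norm M (\<lambda>x. W s x - W t x)) \<circ> X) \<longlonglongrightarrow> 0"
    proof (intro allI impI)
      fix S assume S: "\<forall>i. S i \<in> {0..T} - {t}" "S \<longlonglongrightarrow> t"
      have b: "norm (L2_norm M (\<lambda>x. W (S i) x - W t x)) \<le> sqrt (4 * C * \<bar>\<Psi> (S i) - \<Psi> t\<bar>)" for i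
        using near_near_gap[OF W[OF t] W t, of "S i"] S(1) by (simp add: L2_norm_def)
      have "(\<lambda>i. sqrt (4 * C * \<bar>\<Psi> (S i) - \<Psi> t\<bar>)) \<longlonglongrightarrow> sqrt 0"
        by (rule tendsto_real_sqrt[OF \<Psi>_diff_tendsto_zero[OF S(2)]])
      then have z: "(\<lambda>i. sqrt (4 * C * \<bar>\<Psi> (S i) - \<Psi> t\<bar>)) \<longlonglongrightarrow> 0" by simp
      show "((\<lambda>s. L2_norm M (\<lambda>x. W s x - W t x)) \<circ> S) \<longlonglongrightarrow> 0"
        unfolding comp_def by (rule Lim_null_comparison[OF always_eventually[OF allI[OF b]] z])
    qed
  qed
  show "AE t in MI. AE x in M. W t x = v t x"
    using GA AE_space
  proof eventually_elim
    case (elim t)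
    have t: "t \<in> {0..T}" using elim by simp
    have "(\<integral>x. (v t x - W t x)\<^sup>2 \<partial>M) \<le> 0" using near_gap[OF W[OF t] elim(1)] by simp
    moreover have "0 \<le> (\<integral>x. (v t x - W t x)\<^sup>2 \<partial>M)" by (rule Bochner_Integration.integral_nonneg) simp
    ultimately have z: "(\<integral>x. (v t x - W t x)\<^sup>2 \<partial>M) = 0" by (rule antisym)
    have i: "integrable M (\<lambda>x. (v t x - W t x)\<^sup>2)"
      using L2_diff[OF vL2[OF elim(1)] near_L2[OF W[OF t]]] by (simp add: L2_def)
    have "AE x in M. (v t x - W t x)\<^sup>2 = 0"
      using integral_nonneg_eq_0_iff_AE[OF i] z by simp
    then show ?case by (rule eventually_mono) simp
  qed
qed

end

section \<open>Integration by parts over partitions\<close>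

lemma half_sum_bound: "\<bar>a\<bar> \<le> c \<Longrightarrow> \<bar>b\<bar> \<le> c \<Longrightarrow> \<bar>(a + b) / 2\<bar> \<le> c" for a b c :: real
  by (simp add: abs_le_iff field_simps)

lemma half_sum_close: "\<bar>a - c\<bar> < e \<Longrightarrow> \<bar>b - c\<bar> < e \<Longrightarrow> \<bar>(a + b) / 2 - c\<bar> < e" for a b c e :: real
  by (simp add: abs_less_iff field_simps)

context time_curve
begin

text \<open>\<open>gap\<close> gives L1 convergence of the slices and \<open>C\<close> bounds their
  norms, which is what \<open>predual_continuous\<close> asks for. The modulus \<delta> depends on
  r, so the step functions built on partitions converge pointwise in r and are then
  dominated.\<close>

lemma functional_continuous:
  assumes r: "r \<in> G" and e: "0 < e"
  shows "\<exists>\<delta>>0. \<forall>s\<in>G. \<bar>s - r\<bar> < \<delta> \<longrightarrow> \<bar>g r (v s) - g r (v r)\<bar> < e"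
proof (rule ccontr)
  assume no: "\<not> (\<exists>\<delta>>0. \<forall>s\<in>G. \<bar>s - r\<bar> < \<delta> \<longrightarrow> \<bar>g r (v s) - g r (v r)\<bar> < e)"
  have "\<forall>k::nat. \<exists>s. s \<in> G \<and> \<bar>s - r\<bar> < inverse (real (Suc k)) \<and> e \<le> \<bar>g r (v s) - g r (v r)\<bar>"
  proof
    fix k :: nat
    have "0 < inverse (real (Suc k))" by simp
    then show "\<exists>s. s \<in> G \<and> \<bar>s - r\<bar> < inverse (real (Suc k)) \<and> e \<le> \<bar>g r (v s) - g r (v r)\<bar>"
      using no unfolding not_less[symmetric] by blast
  qed
  from choice[OF this] obtain s where s: "\<forall>k. s k \<in> G \<and> \<bar>s k - r\<bar> < inverse (real (Suc k)) \<and> e \<le> \<bar>g r (v (s k)) - g r (v r)\<bar>" ..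
  note sG = s[THEN spec, THEN conjunct1] and sd = s[THEN spec, THEN conjunct2, THEN conjunct1] and se = s[THEN spec, THEN conjunct2, THEN conjunct2]
  have "(\<lambda>k. s k - r) \<longlonglongrightarrow> 0"
    by (rule Lim_null_comparison[OF _ LIMSEQ_inverse_real_of_nat], rule always_eventually, rule allI)
      (use sd in \<open>simp add: less_imp_le\<close>)
  then have sr: "s \<longlonglongrightarrow> r" by (simp add: LIM_zero_iff)
  let ?m = "measure M (space M)"
  have b: "norm (\<integral>x. \<bar>v (s k) x - v r x\<bar> \<partial>M) \<le> sqrt (?m * (2 * C * \<bar>\<Psi> (s k) - \<Psi> r\<bar>))" for k
  proof -
    have "(\<integral>x. \<bar>v (s k) x - v r x\<bar> \<partial>M) \<le> sqrt (?m * (\<integral>x. (v (s k) x - v r x)\<^sup>2 \<partial>M))"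
      by (rule L1_le_L2[OF finite_measure_M L2_diff[OF vL2[OF sG] vL2[OF r]]])
    also have "\<dots> \<le> sqrt (?m * (2 * C * \<bar>\<Psi> (s k) - \<Psi> r\<bar>))"
      by (intro real_sqrt_le_mono mult_left_mono gap[OF r sG]) simp
    finally show ?thesis by simp
  qed
  have "(\<lambda>k. sqrt (?m * (2 * C * \<bar>\<Psi> (s k) - \<Psi> r\<bar>))) \<longlonglongrightarrow> sqrt (?m * 0)"
    by (rule tendsto_real_sqrt[OF tendsto_mult_left[OF \<Psi>_diff_tendsto_zero[OF sr]]])
  then have z: "(\<lambda>k. sqrt (?m * (2 * C * \<bar>\<Psi> (s k) - \<Psi> r\<bar>))) \<longlonglongrightarrow> 0" by simp
  have L1: "(\<lambda>k. \<integral>x. \<bar>v (s k) x - v r x\<bar> \<partial>M) \<longlonglongrightarrow> 0"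
    by (rule Lim_null_comparison[OF always_eventually[OF allI[OF b]] z])
  have rV: "g r \<in> VS" using gd r GI unfolding good_deriv_def by blast
  have "(\<lambda>k. g r (v (s k))) \<longlonglongrightarrow> g r (v r)"
    by (rule predual_continuous[OF rV vV[OF sG] GC[OF sG] vV[OF r] L1])
  then have "(\<lambda>k. \<bar>g r (v (s k)) - g r (v r)\<bar>) \<longlonglongrightarrow> 0" by (simp add: LIM_zero tendsto_rabs_zero)
  from order_tendstoD(2)[OF this e] obtain k where "\<bar>g r (v (s k)) - g r (v r)\<bar> < e"
    unfolding eventually_sequentially by blast
  then show False using se[of k] by simp
qed

text \<open>One good time from each of the n + 1 equal cells of (0, T). The cells are equidistant
  and the nodes are not, because a prescribed time may fall outside \<open>G\<close>.\<close>

definition node :: "nat \<Rightarrow> nat \<Rightarrow> real" where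
  "node n i = (SOME s. s \<in> G \<and> real i * T / real (Suc n) < s \<and> s < real (Suc i) * T / real (Suc n))"

lemma node:
  assumes "i \<le> n"
  shows "node n i \<in> G" "real i * T / real (Suc n) < node n i" "node n i < real (Suc i) * T / real (Suc n)"
proof -
  have "\<exists>s. 0 < s \<and> s < T \<and> real i * T / real (Suc n) < s \<and> s < real (Suc i) * T / real (Suc n) \<and> s \<in> G"
  proof (rule AE_interval_dense[OF GA _ _ _ T_pos])
    show "real i * T / real (Suc n) < real (Suc i) * T / real (Suc n)"
      by (intro divide_strict_right_mono mult_strict_right_mono) (use T_pos in auto)
    show "real i * T / real (Suc n) < T" using assms T_pos by (simp add: divide_less_eq mult.commute)
    show "0 < real (Suc i) * T / real (Suc n)" using T_pos by simp
  qed
  then have "\<exists>s. s \<in> G \<and> real i * T / real (Suc n) < s \<and> s < real (Suc i) * T / real (Suc n)" by blast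
  then have *: "node n i \<in> G \<and> real i * T / real (Suc n) < node n i \<and> node n i < real (Suc i) * T / real (Suc n)"
    unfolding node_def by (rule someI_ex)
  from * show "node n i \<in> G" by (rule conjunct1)
  from * show "real i * T / real (Suc n) < node n i" by blast
  from * show "node n i < real (Suc i) * T / real (Suc n)" by blast
qed

lemma node_step:
  assumes "i < n" shows "node n i < node n (Suc i)" "node n (Suc i) - node n i < 2 * T / real (Suc n)"
proof -
  have "node n i < real (Suc i) * T / real (Suc n)" "real i * T / real (Suc n) < node n i" using node[of i n] assms by auto
  moreover have "real (Suc i) * T / real (Suc n) < node n (Suc i)" "node n (Suc i) < real (Suc (Suc i)) * T / real (Suc n)"
    using node[of "Suc i" n] assms by auto
  moreover have "real (Suc (Suc i)) * T / real (Suc n) = real i * T / real (Suc n) + 2 * T / real (Suc n)"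
    unfolding add_divide_distrib[symmetric] by (simp add: algebra_simps)
  ultimately show "node n i < node n (Suc i)" "node n (Suc i) - node n i < 2 * T / real (Suc n)" by linarith+
qed

lemma inverse_times_tendsto: "(\<lambda>n. T / real (Suc n)) \<longlonglongrightarrow> 0"
  using tendsto_mult_right_zero[OF LIMSEQ_inverse_real_of_nat, of T] by (simp add: divide_inverse)

lemma node_first: "(\<lambda>n. node n 0) \<longlonglongrightarrow> 0"
proof (rule Lim_null_comparison[OF _ inverse_times_tendsto], rule always_eventually, rule allI)
  show "norm (node n 0) \<le> T / real (Suc n)" for n using node(2,3)[of 0 n] by simp
qed

lemma node_last_gap: "\<bar>node n n - T\<bar> \<le> T / real (Suc n)"
proof -
  have a: "T - T / real (Suc n) = real n * T / real (Suc n)" by (simp add: field_simps)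
  have b: "real (Suc n) * T / real (Suc n) = T" by simp
  show ?thesis using node(2,3)[of n n] unfolding b a[symmetric] by simp
qed

lemma node_last: "(\<lambda>n. node n n) \<longlonglongrightarrow> T"
proof -
  have "(\<lambda>n. node n n - T) \<longlonglongrightarrow> 0"
    by (rule Lim_null_comparison[OF _ inverse_times_tendsto], rule always_eventually, rule allI) (use node_last_gap in simp)
  then show ?thesis by (simp add: LIM_zero_iff)
qed

text \<open>On each partition interval the functional is applied to the mean of the two end values,
  since a^2 - b^2 is (a - b) times (a + b). With this symmetric choice the integral telescopes
  exactly, whatever the mesh.\<close>

definition step_form :: "nat \<Rightarrow> real \<Rightarrow> real" where
  "step_form n r = (\<Sum>i<n. indicat_real {node n i..<node n (Suc i)} r * ((g r (v (node n i)) + g r (v (node n (Suc i)))) / 2))"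

lemma step_form_eq:
  assumes "j < n" "node n j \<le> r" "r < node n (Suc j)"
  shows "step_form n r = (g r (v (node n j)) + g r (v (node n (Suc j)))) / 2"
  unfolding step_form_def
  by (rule indicator_sum_step[where a="\<lambda>i. (g r (v (node n i)) + g r (v (node n (Suc i)))) / 2"])
    (use assms node_step(1) in \<open>auto intro: less_imp_le\<close>)

lemma half_pair_integrable:
  assumes "i < n"
  shows "integrable MI (\<lambda>r. indicat_real {node n i..<node n (Suc i)} r * ((g r (v (node n i)) + g r (v (node n (Suc i)))) / 2))"
proof (rule indicator_integrable)
  have "integrable MI (\<lambda>r. g r (v (node n i)))" "integrable MI (\<lambda>r. g r (v (node n (Suc i))))"
    using assms by (intro gi vV node(1); simp)+
  then show "integrable MI (\<lambda>r. (g r (v (node n i)) + g r (v (node n (Suc i)))) / 2)" by simp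
qed simp

lemma step_form_integral:
  "(\<integral>r. step_form n r \<partial>MI) = (\<integral>x. (v (node n n) x)\<^sup>2 \<partial>M) / 2 - (\<integral>x. (v (node n 0) x)\<^sup>2 \<partial>M) / 2"
proof -
  let ?E = "\<lambda>i. (\<integral>x. (v (node n i) x)\<^sup>2 \<partial>M) / 2"
  have inc: "(\<integral>r. indicat_real {node n i..<node n (Suc i)} r * ((g r (v (node n i)) + g r (v (node n (Suc i)))) / 2) \<partial>MI) = ?E (Suc i) - ?E i"
    if i: "i < n" for i
  proof -
    let ?s = "node n i" and ?t = "node n (Suc i)"
    have s: "?s \<in> G" and t: "?t \<in> G" using node(1)[of i n] node(1)[of "Suc i" n] i by auto
    have st: "?s \<le> ?t" using node_step(1)[OF i] by simp
    have h: "(\<lambda>x. v ?t x - v ?s x) \<in> L2 M" by (rule L2_diff[OF vL2[OF t] vL2[OF s]])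
    have i2: "integrable M (\<lambda>x. (v ?t x)\<^sup>2)" "integrable M (\<lambda>x. (v ?s x)\<^sup>2)"
      using vL2[OF s] vL2[OF t] by (simp_all add: L2_def)
    have int_s: "integrable MI (\<lambda>r. indicat_real {?s..<?t} r * g r (v ?s))" by (rule indicator_integrable[OF gi[OF vV[OF s]]]) simp
    have int_t: "integrable MI (\<lambda>r. indicat_real {?s..<?t} r * g r (v ?t))" by (rule indicator_integrable[OF gi[OF vV[OF t]]]) simp
    have "?E (Suc i) - ?E i = (\<integral>x. (v ?t x)\<^sup>2 - (v ?s x)\<^sup>2 \<partial>M) / 2"
      unfolding Bochner_Integration.integral_diff[OF i2] by simp
    also have "(\<integral>x. (v ?t x)\<^sup>2 - (v ?s x)\<^sup>2 \<partial>M) = (\<integral>x. (v ?t x - v ?s x) * v ?s x + (v ?t x - v ?s x) * v ?t x \<partial>M)"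
      by (rule Bochner_Integration.integral_cong[OF refl]) (simp add: power2_eq_square algebra_simps)
    also have "\<dots> = (\<integral>x. (v ?t x - v ?s x) * v ?s x \<partial>M) + (\<integral>x. (v ?t x - v ?s x) * v ?t x \<partial>M)"
      by (rule Bochner_Integration.integral_add[OF L2_mult_integrable[OF h vL2[OF s]] L2_mult_integrable[OF h vL2[OF t]]])
    also have "\<dots> = (\<integral>r. indicat_real {?s..<?t} r * g r (v ?s) \<partial>MI) + (\<integral>r. indicat_real {?s..<?t} r * g r (v ?t) \<partial>MI)"
      unfolding slice_eq[OF s t st vV[OF s]] slice_eq[OF s t st vV[OF t]] ..
    also have "\<dots> / 2 = (\<integral>r. (indicat_real {?s..<?t} r * g r (v ?s) + indicat_real {?s..<?t} r * g r (v ?t)) / 2 \<partial>MI)"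
      unfolding Bochner_Integration.integral_add[OF int_s int_t, symmetric] by simp
    also have "\<dots> = (\<integral>r. indicat_real {?s..<?t} r * ((g r (v ?s) + g r (v ?t)) / 2) \<partial>MI)"
      by (rule Bochner_Integration.integral_cong[OF refl]) (simp add: distrib_left)
    finally show ?thesis by (rule sym)
  qed
  have "(\<integral>r. step_form n r \<partial>MI) = (\<Sum>i<n. \<integral>r. indicat_real {node n i..<node n (Suc i)} r * ((g r (v (node n i)) + g r (v (node n (Suc i)))) / 2) \<partial>MI)"
    unfolding step_form_def by (rule Bochner_Integration.integral_sum, rule half_pair_integrable) simp
  also have "\<dots> = (\<Sum>i<n. ?E (Suc i) - ?E i)"
    by (rule sum.cong[OF refl], rule inc) simp
  also have "\<dots> = ?E n - ?E 0" by (rule sum_lessThan_telescope)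
  finally show ?thesis .
qed

lemma step_form_bound:
  assumes r: "r \<in> I" shows "\<bar>step_form n r\<bar> \<le> C * \<gamma> r"
proof (cases "\<exists>j<n. node n j \<le> r \<and> r < node n (Suc j)")
  case True
  then obtain j where j: "j < n" "node n j \<le> r" "r < node n (Suc j)" by blast
  have "\<bar>g r (v (node n j))\<bar> \<le> C * \<gamma> r" "\<bar>g r (v (node n (Suc j)))\<bar> \<le> C * \<gamma> r"
    using j(1) by (intro g_bound[OF r] node(1); simp)+
  then show ?thesis unfolding step_form_eq[OF j] by (rule half_sum_bound)
next
  case False
  have "step_form n r = 0" unfolding step_form_def
  proof (rule sum.neutral, rule ballI)
    fix i assume "i \<in> {..<n}"
    then have "r \<notin> {node n i..<node n (Suc i)}" using False unfolding atLeastLessThan_iff lessThan_iff by blast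
    then show "indicat_real {node n i..<node n (Suc i)} r * ((g r (v (node n i)) + g r (v (node n (Suc i)))) / 2) = 0" by simp
  qed
  then show ?thesis using C \<gamma>(2) by simp
qed

lemma step_form_tendsto:
  assumes r: "r \<in> G" shows "(\<lambda>n. step_form n r) \<longlonglongrightarrow> g r (v r)"
proof (rule LIMSEQ_I)
  fix e :: real assume e: "0 < e"
  obtain \<delta> where \<delta>: "0 < \<delta>" "\<And>s. s \<in> G \<Longrightarrow> \<bar>s - r\<bar> < \<delta> \<Longrightarrow> \<bar>g r (v s) - g r (v r)\<bar> < e"
    using functional_continuous[OF r e] by blast
  have rI: "0 < r" "r < T" using r GI by auto
  \<comment> \<open>Half of \<delta> because neighbouring nodes are up to two cells apart; the other
    two entries put r between the first and the last node.\<close>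
  define q where "q = min (\<delta> / 2) (min r (T - r))"
  have "0 < q" using \<delta>(1) rI by (simp add: q_def)
  from LIMSEQ_D[OF inverse_times_tendsto this] obtain N where N: "\<And>n. N \<le> n \<Longrightarrow> T / real (Suc n) < q"
    using T_pos by auto
  show "\<exists>N. \<forall>n\<ge>N. norm (step_form n r - g r (v r)) < e"
  proof (intro exI allI impI)
    fix n assume "N \<le> n"
    then have q: "T / real (Suc n) < \<delta> / 2" "T / real (Suc n) < r" "T / real (Suc n) < T - r" using N[of n] by (auto simp: q_def)
    have lo: "node n 0 \<le> r" using node(3)[of 0 n] q(2) by simp
    have hi: "r < node n n" using node_last_gap[of n] q(3) by linarith
    from step_between[of "node n" r n, OF lo hi] obtain j where j: "j < n" "node n j \<le> r" "r < node n (Suc j)" by blast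
    have "2 * T / real (Suc n) < \<delta>" using q(1) by (simp add: field_simps)
    then have d: "node n (Suc j) - node n j < \<delta>" using node_step(2)[OF j(1)] by linarith
    have "\<bar>g r (v (node n j)) - g r (v r)\<bar> < e" by (rule \<delta>(2)[OF node(1)]) (use j d in linarith)+
    moreover have "\<bar>g r (v (node n (Suc j))) - g r (v r)\<bar> < e" by (rule \<delta>(2)[OF node(1)]) (use j d in linarith)+
    ultimately show "norm (step_form n r - g r (v r)) < e"
      unfolding step_form_eq[OF j] real_norm_def by (rule half_sum_close)
  qed
qed

lemma integration_by_parts_near:
  assumes B: "0 \<le> B" "\<And>s. s \<in> G \<Longrightarrow> AE x in M. \<bar>v s x\<bar> \<le> B"
    and w: "near B T w" and w0: "near B 0 w0"
  shows "(\<integral>r. g r (v r) \<partial>MI) = (\<integral>x. (w x)\<^sup>2 \<partial>M) / 2 - (\<integral>x. (w0 x)\<^sup>2 \<partial>M) / 2"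
proof (rule LIMSEQ_unique)
  show "(\<lambda>n. \<integral>r. step_form n r \<partial>MI) \<longlonglongrightarrow> (\<integral>r. g r (v r) \<partial>MI)"
  proof (rule integral_dominated_convergence)
    show "(\<lambda>r. g r (v r)) \<in> borel_measurable MI" by (rule borel_measurable_integrable[OF good_deriv_integrable[OF gd v]])
    show "step_form n \<in> borel_measurable MI" for n
      unfolding step_form_def[abs_def] by (rule borel_measurable_sum) (use half_pair_integrable in \<open>auto intro: borel_measurable_integrable\<close>)
    show "integrable MI (\<lambda>r. C * \<gamma> r)" by (rule integrable_mult_right[OF \<gamma>(1)])
    show "AE r in MI. norm (step_form n r) \<le> C * \<gamma> r" for n using AE_space by eventually_elim (use step_form_bound in simp)
    show "AE r in MI. (\<lambda>n. step_form n r) \<longlonglongrightarrow> g r (v r)" using GA by eventually_elim (rule step_form_tendsto)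
  qed
  show "(\<lambda>n. \<integral>r. step_form n r \<partial>MI) \<longlonglongrightarrow> (\<integral>x. (w x)\<^sup>2 \<partial>M) / 2 - (\<integral>x. (w0 x)\<^sup>2 \<partial>M) / 2"
    unfolding step_form_integral
    by (intro tendsto_diff tendsto_divide tendsto_const near_energy[OF w B _ node_last] near_energy[OF w0 B _ node_first] node(1)) simp_all
qed

end

section \<open>Independence of the choice of representative\<close>

context torsion_domain
begin

text \<open>Two representatives agree at almost every time, and continuity in L2 extends this to
  each time, in particular to 0 and \<open>T\<close>. The values of \<open>at_time\<close>, an
  arbitrary choice, are thereby determined.\<close>

lemma continuous_rep_unique:
  assumes W: "continuous_rep \<Omega> T v W" and U: "continuous_rep \<Omega> T v U" and t: "t \<in> {0..T}"
  shows "AE x in M. W t x = U t x"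
proof -
  have L: "W s \<in> L2 M" "U s \<in> L2 M" if "s \<in> {0..T}" for s using W U that by (simp_all add: continuous_rep_def)
  have ae: "AE s in MI. AE x in M. W s x = U s x"
  proof -
    have "AE s in MI. AE x in M. W s x = v s x" "AE s in MI. AE x in M. U s x = v s x"
      using W U by (simp_all add: continuous_rep_def)
    then show ?thesis
    proof eventually_elim
      case (elim s)
      then show ?case by eventually_elim simp
    qed
  qed
  have "\<forall>k::nat. \<exists>s. 0 < s \<and> s < T \<and> t - inverse (real (Suc k)) < s \<and> s < t + inverse (real (Suc k)) \<and> (AE x in M. W s x = U s x)"
  proof
    fix k :: nat
    have "0 < inverse (real (Suc k))" by simp
    then show "\<exists>s. 0 < s \<and> s < T \<and> t - inverse (real (Suc k)) < s \<and> s < t + inverse (real (Suc k)) \<and> (AE x in M. W s x = U s x)"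
      using t by (intro AE_interval_dense[OF ae _ _ _ T_pos]) (simp_all only: atLeastAtMost_iff, linarith+)
  qed
  from choice[OF this] obtain s where s: "\<forall>k. 0 < s k \<and> s k < T \<and> t - inverse (real (Suc k)) < s k \<and> s k < t + inverse (real (Suc k)) \<and> (AE x in M. W (s k) x = U (s k) x)" ..
  have sI: "s k \<in> {0..T}" for k using s[THEN spec, of k] by simp
  have sd: "\<bar>s k - t\<bar> \<le> inverse (real (Suc k))" for k using s[THEN spec, of k] by linarith
  have sa: "AE x in M. W (s k) x = U (s k) x" for k using s[THEN spec, of k] by blast
  have "(\<lambda>k. s k - t) \<longlonglongrightarrow> 0"
    by (rule Lim_null_comparison[OF _ LIMSEQ_inverse_real_of_nat], rule always_eventually, rule allI) (use sd in simp)
  then have st: "s \<longlonglongrightarrow> t" by (simp add: LIM_zero_iff)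
  have conv: "(\<lambda>k. \<integral>x. (Y (s k) x - Y t x)\<^sup>2 \<partial>M) \<longlonglongrightarrow> 0" if Y: "continuous_rep \<Omega> T v Y" for Y
  proof -
    define N where "N r = L2_norm M (\<lambda>x. Y r x - Y t x)" for r
    have lim: "(N \<longlongrightarrow> 0) (at t within {0..T})" using Y t unfolding continuous_rep_def N_def by blast
    have "N t = 0" by (simp add: N_def L2_norm_def)
    then have "continuous (at t within {0..T}) N" unfolding continuous_within using lim by simp
    then have "(\<lambda>k. N (s k)) \<longlonglongrightarrow> N t" unfolding continuous_within_sequentially comp_def using sI st by blast
    then have "(\<lambda>k. (N (s k))\<^sup>2) \<longlonglongrightarrow> 0\<^sup>2" using \<open>N t = 0\<close> by (intro tendsto_power) simp
    moreover have "(N r)\<^sup>2 = (\<integral>x. (Y r x - Y t x)\<^sup>2 \<partial>M)" for r by (simp add: N_def L2_norm_def)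
    ultimately show ?thesis by simp
  qed
  have le: "(\<integral>x. (W t x - U t x)\<^sup>2 \<partial>M) \<le> 2 * (\<integral>x. (W (s k) x - W t x)\<^sup>2 \<partial>M) + 2 * (\<integral>x. (U (s k) x - U t x)\<^sup>2 \<partial>M)" for k
  proof -
    have "(\<integral>x. (W t x - U t x)\<^sup>2 \<partial>M) \<le> 2 * (\<integral>x. (W t x - W (s k) x)\<^sup>2 \<partial>M) + 2 * (\<integral>x. (W (s k) x - U t x)\<^sup>2 \<partial>M)"
      by (rule L2_triangle[OF L(1)[OF t] L(1)[OF sI] L(2)[OF t]])
    \<comment> \<open>At the times \<open>s k\<close> the two representatives coincide almost
      everywhere, so one may be exchanged for the other.\<close>
    also have "(\<integral>x. (W (s k) x - U t x)\<^sup>2 \<partial>M) = (\<integral>x. (U (s k) x - U t x)\<^sup>2 \<partial>M)"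
    proof (rule integral_cong_AE)
      show "(\<lambda>x. (W (s k) x - U t x)\<^sup>2) \<in> borel_measurable M" "(\<lambda>x. (U (s k) x - U t x)\<^sup>2) \<in> borel_measurable M"
        using L2_diff[OF L(1)[OF sI] L(2)[OF t]] L2_diff[OF L(2)[OF sI] L(2)[OF t]] unfolding L2_def by (auto intro: borel_measurable_power)
      show "AE x in M. (W (s k) x - U t x)\<^sup>2 = (U (s k) x - U t x)\<^sup>2" using sa[of k] by eventually_elim simp
    qed
    finally show ?thesis by (simp add: power2_commute)
  qed
  have "(\<lambda>k. 2 * (\<integral>x. (W (s k) x - W t x)\<^sup>2 \<partial>M) + 2 * (\<integral>x. (U (s k) x - U t x)\<^sup>2 \<partial>M)) \<longlonglongrightarrow> 2 * 0 + 2 * 0"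
    by (intro tendsto_intros conv W U)
  then have "(\<integral>x. (W t x - U t x)\<^sup>2 \<partial>M) \<le> 2 * 0 + 2 * 0" by (rule LIMSEQ_le_const) (intro exI[of _ 0] allI impI le)
  moreover have "0 \<le> (\<integral>x. (W t x - U t x)\<^sup>2 \<partial>M)" by (rule Bochner_Integration.integral_nonneg) simp
  ultimately have z: "(\<integral>x. (W t x - U t x)\<^sup>2 \<partial>M) = 0" by linarith
  have i: "integrable M (\<lambda>x. (W t x - U t x)\<^sup>2)"
    using L2_diff[OF L[OF t]] by (simp add: L2_def)
  have "AE x in M. (W t x - U t x)\<^sup>2 = 0" using integral_nonneg_eq_0_iff_AE[OF i] z by simp
  then show ?thesis by (rule eventually_mono) simp
qed

text \<open>The gap identity contains \<open>at_time\<close> of \<open>lam - u\<close> and of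
  \<open>lam\<close>, which are separate choices; together with uniqueness this relates
  them.\<close>

lemma continuous_rep_diff:
  assumes W: "continuous_rep \<Omega> T v W" and U: "continuous_rep \<Omega> T u U"
  shows "continuous_rep \<Omega> T (\<lambda>t x. v t x - u t x) (\<lambda>t x. W t x - U t x)"
  unfolding continuous_rep_def
proof (intro conjI ballI)
  have L: "W s \<in> L2 M" "U s \<in> L2 M" if "s \<in> {0..T}" for s using W U that by (simp_all add: continuous_rep_def)
  show "(\<lambda>x. W t x - U t x) \<in> L2 M" if "t \<in> {0..T}" for t by (rule L2_diff[OF L[OF that]])
  show "((\<lambda>s. L2_norm M (\<lambda>x. (W s x - U s x) - (W t x - U t x))) \<longlongrightarrow> 0) (at t within {0..T})" if t: "t \<in> {0..T}" for t
  proof -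
    define N where "N s = L2_norm M (\<lambda>x. W s x - W t x)" for s
    define N' where "N' s = L2_norm M (\<lambda>x. U s x - U t x)" for s
    have lim: "(N \<longlongrightarrow> 0) (at t within {0..T})" "(N' \<longlongrightarrow> 0) (at t within {0..T})"
      using W U t unfolding continuous_rep_def N_def N'_def by blast+
    have b: "norm (L2_norm M (\<lambda>x. (W s x - U s x) - (W t x - U t x))) \<le> sqrt (2 * (N s)\<^sup>2 + 2 * (N' s)\<^sup>2)"
      if s: "s \<in> {0..T}" for s
    proof -
      have z: "(\<lambda>x. 0::real) \<in> L2 M" by (simp add: L2_def)
      have "(\<integral>x. ((W s x - W t x) - (U s x - U t x))\<^sup>2 \<partial>M) \<le> 2 * (\<integral>x. ((W s x - W t x) - 0)\<^sup>2 \<partial>M) + 2 * (\<integral>x. (0 - (U s x - U t x))\<^sup>2 \<partial>M)"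
        by (rule L2_triangle[OF L2_diff[OF L(1)[OF s] L(1)[OF t]] z L2_diff[OF L(2)[OF s] L(2)[OF t]]])
      moreover have "(W s x - W t x) - (U s x - U t x) = (W s x - U s x) - (W t x - U t x)" for x by simp
      moreover have "(0 - (U s x - U t x))\<^sup>2 = (U s x - U t x)\<^sup>2" for x by (simp add: power2_commute)
      ultimately have "(\<integral>x. ((W s x - U s x) - (W t x - U t x))\<^sup>2 \<partial>M) \<le> 2 * (N s)\<^sup>2 + 2 * (N' s)\<^sup>2"
        by (simp only: N_def N'_def L2_norm_def real_norm_def power2_abs real_sqrt_pow2 Bochner_Integration.integral_nonneg zero_le_power2 diff_zero)
      then show ?thesis by (simp add: L2_norm_def)
    qed
    have "((\<lambda>s. sqrt (2 * (N s)\<^sup>2 + 2 * (N' s)\<^sup>2)) \<longlongrightarrow> sqrt (2 * 0\<^sup>2 + 2 * 0\<^sup>2)) (at t within {0..T})"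
      by (intro tendsto_intros lim)
    then have z: "((\<lambda>s. sqrt (2 * (N s)\<^sup>2 + 2 * (N' s)\<^sup>2)) \<longlongrightarrow> 0) (at t within {0..T})" by simp
    show ?thesis
    proof (rule Lim_null_comparison[OF _ z])
      show "\<forall>\<^sub>F s in at t within {0..T}. norm (L2_norm M (\<lambda>x. (W s x - U s x) - (W t x - U t x))) \<le> sqrt (2 * (N s)\<^sup>2 + 2 * (N' s)\<^sup>2)"
        unfolding eventually_at_filter by (rule always_eventually) (use b in blast)
    qed
  qed
  have "AE t in MI. AE x in M. W t x = v t x" "AE t in MI. AE x in M. U t x = u t x"
    using W U by (simp_all add: continuous_rep_def)
  then show "AE t in MI. AE x in M. W t x - U t x = v t x - u t x"
  proof eventually_elim
    case (elim t)
    then show ?case by eventually_elim simp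
  qed
qed

lemma integration_by_parts:
  assumes v: "v \<in> X" and d: "weak_deriv v g"
  shows "\<exists>W. continuous_rep \<Omega> T v W \<and>
    L1_functional T g v = (\<integral>x. (W T x)\<^sup>2 \<partial>M) / 2 - (\<integral>x. (W 0 x)\<^sup>2 \<partial>M) / 2"
proof -
  have gd: "good_deriv g" using d by (simp add: weak_deriv_def)
  then obtain \<gamma>0 where \<gamma>0: "integrable MI \<gamma>0" "\<And>t w. t \<in> I \<Longrightarrow> w \<in> V \<Longrightarrow> \<bar>g t w\<bar> \<le> \<gamma>0 t * vnorm w"
    unfolding good_deriv_def by blast
  \<comment> \<open>\<open>good_deriv\<close> fixes no sign for the majorant, and its primitive has
    to be monotone.\<close>
  define \<gamma> where "\<gamma> t = \<bar>\<gamma>0 t\<bar>" for t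
  have \<gamma>: "integrable MI \<gamma>" unfolding \<gamma>_def[abs_def] by (rule integrable_abs[OF \<gamma>0(1)])
  have \<gamma>b: "\<bar>g t w\<bar> \<le> \<gamma> t * vnorm w" if "t \<in> I" "w \<in> V" for t w
  proof (rule order_trans[OF \<gamma>0(2)[OF that]])
    show "\<gamma>0 t * vnorm w \<le> \<gamma> t * vnorm w" by (rule mult_right_mono[OF _ V_norm_nonneg]) (simp add: \<gamma>_def)
  qed
  obtain C G where C: "0 \<le> C" and GI: "G \<subseteq> I" and GA: "AE t in MI. t \<in> G" and GC: "\<forall>t\<in>G. vnorm (v t) \<le> C"
    and eq: "\<forall>s\<in>G. \<forall>t\<in>G. \<forall>w\<in>V. s \<le> t \<longrightarrow> (\<integral>x. (v t x - v s x) * w x \<partial>M) = (\<integral>r. indicat_real {s..<t} r * g r w \<partial>MI)"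
    using time_slices[OF v d \<gamma> \<gamma>b] by blast
  interpret tc: time_curve \<Omega> \<Gamma>\<^sub>D T v g \<gamma> C G
    by unfold_locales (use v gd \<gamma> \<gamma>b C GI GA GC eq in \<open>simp_all add: \<gamma>_def\<close>)
  obtain K where K: "K \<ge> 0" "\<And>v. v \<in> V \<Longrightarrow> AE x in M. \<bar>v x\<bar> \<le> K * vnorm v" using poincare_AE by blast
  have B0: "0 \<le> K * C" using K(1) C by simp
  have B: "AE x in M. \<bar>v s x\<bar> \<le> K * C" if s: "s \<in> G" for s
  proof (rule eventually_mono[OF K(2)[OF tc.vV[OF s]]])
    fix x assume "\<bar>v s x\<bar> \<le> K * vnorm (v s)"
    also have "\<dots> \<le> K * C" by (rule mult_left_mono[OF tc.GC[OF s] K(1)])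
    finally show "\<bar>v s x\<bar> \<le> K * C" .
  qed
  have "\<forall>t\<in>{0..T}. \<exists>w. tc.near (K * C) t w" using tc.limit_exists[OF B] by (intro ballI)
  from bchoice[OF this] obtain W where W: "\<forall>t\<in>{0..T}. tc.near (K * C) t (W t)" ..
  have W': "tc.near (K * C) t (W t)" if "t \<in> {0..T}" for t by (rule bspec[OF W that])
  have "L1_functional T g v = (\<integral>x. (W T x)\<^sup>2 \<partial>M) / 2 - (\<integral>x. (W 0 x)\<^sup>2 \<partial>M) / 2"
    unfolding L1_functional_def
    by (rule tc.integration_by_parts_near[OF B0 B W' W']) (use T_pos in simp_all)
  moreover have "continuous_rep \<Omega> T v W" by (rule tc.near_continuous_rep[OF W'])
  ultimately show ?thesis by (intro exI[of _ W] conjI)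
qed

lemma integration_by_parts_rep:
  assumes v: "v \<in> X" and d: "weak_deriv v g" and U: "continuous_rep \<Omega> T v U"
  shows "L1_functional T g v = (\<integral>x. (U T x)\<^sup>2 \<partial>M) / 2 - (\<integral>x. (U 0 x)\<^sup>2 \<partial>M) / 2"
proof -
  obtain W where W: "continuous_rep \<Omega> T v W" "L1_functional T g v = (\<integral>x. (W T x)\<^sup>2 \<partial>M) / 2 - (\<integral>x. (W 0 x)\<^sup>2 \<partial>M) / 2"
    using integration_by_parts[OF v d] by blast
  have "(\<integral>x. (W t x)\<^sup>2 \<partial>M) = (\<integral>x. (U t x)\<^sup>2 \<partial>M)" if t: "t \<in> {0..T}" for t
  proof (rule integral_cong_AE)
    have "W t \<in> L2 M" "U t \<in> L2 M" using W(1) U t by (simp_all add: continuous_rep_def)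
    then show "(\<lambda>x. (W t x)\<^sup>2) \<in> borel_measurable M" "(\<lambda>x. (U t x)\<^sup>2) \<in> borel_measurable M" unfolding L2_def by (auto intro: borel_measurable_power)
    show "AE x in M. (W t x)\<^sup>2 = (U t x)\<^sup>2" using continuous_rep_unique[OF W(1) U t] by eventually_elim simp
  qed
  from this[of T] this[of 0] show ?thesis using W(2) T_pos by simp
qed

lemma at_time_rep:
  assumes "v \<in> X" "weak_deriv v g" shows "continuous_rep \<Omega> T v (at_time \<Omega> T v)"
proof -
  obtain W where "continuous_rep \<Omega> T v W" using integration_by_parts[OF assms] by blast
  then show ?thesis unfolding at_time_def by (rule someI[where P="continuous_rep \<Omega> T v"])
qed

end

section \<open>The primal-dual gap identity\<close>

text \<open>On the contact set the excess b - p of the flux is |b| / r - 1 times p, and off it p =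
  b. The multiplier term of the identity is therefore the product of the excess with p - l, over the
  whole cylinder.\<close>

lemma contact_term:
  fixes b p l :: "'b::euclidean_space"
  assumes r: "0 < r" and p: "p = proj_ball r b"
  shows "(if norm p = r then (norm b / r - 1) * (r\<^sup>2 - p \<bullet> l) else 0) = (b - p) \<bullet> (p - l)"
proof (cases "norm b \<le> r")
  case True
  then have pb: "p = b" using p by (simp add: proj_ball_def)
  show ?thesis using r by (simp add: pb)
next
  case False
  then have b: "0 < norm b" using r by linarith
  have pb: "p = (r / norm b) *\<^sub>R b" using p False by (simp add: proj_ball_def)
  have np: "norm p = r" using b r by (simp add: pb)
  have bp: "b = (norm b / r) *\<^sub>R p" using b r by (simp add: pb)
  have "(b - p) \<bullet> (p - l) = (norm b / r - 1) * (p \<bullet> (p - l))"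
    by (subst bp) (simp add: inner_diff_left left_diff_distrib)
  also have "p \<bullet> (p - l) = r\<^sup>2 - p \<bullet> l" by (simp add: inner_diff_right np[symmetric] dot_square_norm)
  finally show ?thesis using np by simp
qed

text \<open>With \<open>c\<close> as the conjugate at \<open>a\<close> and
  \<open>p \<bullet> b - (norm p)\<^sup>2 / 2\<close> as the conjugate at \<open>b\<close>, the
  first bracket is the Taylor remainder. The last term on the right is the one that the balance
  equations evaluate.\<close>

lemma gap_identity_pointwise:
  fixes a b p l :: "'b::euclidean_space"
  shows "(c - (p \<bullet> b - (norm p)\<^sup>2 / 2) - p \<bullet> (a - b)) + (norm (l - p))\<^sup>2 / 2 + (b - p) \<bullet> (p - l)
    = (c - a \<bullet> l) + (norm l)\<^sup>2 / 2 + (a - b) \<bullet> (l - p)"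
  unfolding power2_norm_eq_inner by (simp add: inner_simps inner_commute field_simps)

text \<open>The conjugate looks quadratic but grows linearly: by \<open>phi_conj_alt\<close> it
  pairs the integrable \<open>a\<close> with a bounded field.\<close>

lemma integrable_phi_conj:
  fixes a :: "real \<times> 'b::euclidean_space \<Rightarrow> 'b"
  assumes N: "finite_measure N" and w: "(\<lambda>(t, x). \<zeta> t x) \<in> Linf N" and pos: "AE q in N. 0 < (case q of (t, x) \<Rightarrow> \<zeta> t x)"
    and a: "integrable N a"
  shows "integrable N (\<lambda>(t, x). phi_conj \<zeta> t x (a (t, x)))"
proof -
  let ?w = "\<lambda>q. case q of (t, x) \<Rightarrow> \<zeta> t x"
  have wm[measurable]: "?w \<in> borel_measurable N" by (rule Linf_measurable[OF w])
  have am[measurable]: "a \<in> borel_measurable N" using a by simp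
  define p where "p q = proj_ball (?w q) (a q)" for q
  have pm[measurable]: "p \<in> borel_measurable N" unfolding p_def[abs_def] by (rule measurable_proj_ball[OF wm am])
  have pL: "p \<in> Linf N"
  proof (rule LinfI[OF pm])
    show "AE q in N. norm (p q) \<le> Linf_norm N ?w"
      using AE_le_Linf_norm[OF w] pos
    proof eventually_elim
      case (elim q)
      have "norm (p q) \<le> ?w q" unfolding p_def by (rule norm_proj_ball) (use elim(2) in simp)
      then show ?case using elim(1) by simp
    qed
  qed
  have i1: "integrable N (\<lambda>q. a q \<bullet> p q)" by (rule integrable_inner_Linf[OF a pL])
  have i2: "integrable N (\<lambda>q. p q \<bullet> p q)" by (rule integrable_inner_Linf[OF Linf_integrable[OF N pL] pL])
  have i: "integrable N (\<lambda>q. a q \<bullet> p q - p q \<bullet> p q / 2)" by (intro Bochner_Integration.integrable_diff i1 integrable_divide i2)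
  have ae: "AE q in N. a q \<bullet> p q - p q \<bullet> p q / 2 = (case q of (t, x) \<Rightarrow> phi_conj \<zeta> t x (a (t, x)))"
    using pos
  proof eventually_elim
    case (elim q)
    obtain t x where q: "q = (t, x)" by (cases q)
    then have "0 < \<zeta> t x" using elim by simp
    from phi_conj_alt[of \<zeta> t x "a q", OF this] show ?case
      by (simp add: q p_def power2_norm_eq_inner inner_commute)
  qed
  have "(\<lambda>q. (norm (a q))\<^sup>2 / 2 - (max 0 (norm (a q) - ?w q))\<^sup>2 / 2) \<in> borel_measurable N" by measurable
  then have "(\<lambda>(t, x). phi_conj \<zeta> t x (a (t, x))) \<in> borel_measurable N"
    by (simp add: phi_conj_def case_prod_beta')
  from integrable_cong_AE_imp[OF i this ae] show ?thesis .
qed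

theorem lemma5p13:
  fixes \<Omega> \<Gamma>\<^sub>D \<Gamma>\<^sub>N :: "(real^'d) set" and T :: real
    and \<zeta> :: "real \<Rightarrow> real^'d \<Rightarrow> real"
    and f :: "real \<Rightarrow> (real^'d \<Rightarrow> real) \<Rightarrow> real"
    and u\<^sub>0 :: "real^'d \<Rightarrow> real"
    and u lam :: "real \<Rightarrow> real^'d \<Rightarrow> real"
    and y z ys zs :: "(real \<times> (real^'d) \<Rightarrow> real^'d) \<Rightarrow> real"
    and ya za :: "real \<times> (real^'d) \<Rightarrow> real^'d"
  assumes "lipschitz_domain \<Omega>"
    and "openin (top_of_set (frontier \<Omega>)) \<Gamma>\<^sub>D" and "openin (top_of_set (frontier \<Omega>)) \<Gamma>\<^sub>N"
    and "\<Gamma>\<^sub>D \<noteq> {}" and "\<Gamma>\<^sub>D \<inter> \<Gamma>\<^sub>N = {}" and "closure \<Gamma>\<^sub>D \<union> closure \<Gamma>\<^sub>N = frontier \<Omega>"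
    and "0 < T"
    and "admissible_threshold \<Omega> T \<zeta>"
    and "f \<in> L1_predual \<Omega> \<Gamma>\<^sub>D T"
    and "u\<^sub>0 \<in> W1inf_D \<Omega> \<Gamma>\<^sub>D" and "grad \<Omega> u\<^sub>0 \<in> K_set \<Omega> \<zeta> 0"
    and "torsion_solution \<Omega> \<Gamma>\<^sub>D T \<zeta> f u\<^sub>0 u"
    and "z \<in> Linf_dual (lebesgue_on (cylinder T \<Omega>))" and "yosida_hewitt (lebesgue_on (cylinder T \<Omega>)) z za zs"
    and "dual_flux \<Omega> \<Gamma>\<^sub>D T \<zeta> f u z"
    and "y \<in> Linf_dual (lebesgue_on (cylinder T \<Omega>))" and "yosida_hewitt (lebesgue_on (cylinder T \<Omega>)) y ya ys"
    and "lam \<in> W_inf \<Omega> \<Gamma>\<^sub>D T"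
    and "AE t in lebesgue_on (time_interval T). grad \<Omega> (lam t) \<in> K_set \<Omega> \<zeta> t"
    and "balance \<Omega> \<Gamma>\<^sub>D T f y lam"
  shows
    "1/2 * inner_on (cylinder T \<Omega>) (\<lambda>p. HH \<zeta> ya za p *v (ya p - za p)) (\<lambda>p. ya p - za p)
       + weighted_variation (lebesgue_on (cylinder T \<Omega>)) (\<lambda>(t, x). \<zeta> t x) ys - ys (grad_Q \<Omega> T u)
       + 1/2 * (L2_norm (lebesgue_on (cylinder T \<Omega>)) (grad_Q \<Omega> T (\<lambda>t x. lam t x - u t x)))\<^sup>2
       + inner_on {(t, x) \<in> cylinder T \<Omega>. norm (grad_Q \<Omega> T u (t, x)) = \<zeta> t x}
           (\<lambda>(t, x). norm (za (t, x)) / \<zeta> t x - 1)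
           (\<lambda>(t, x). (\<zeta> t x)\<^sup>2 - grad_Q \<Omega> T u (t, x) \<bullet> grad_Q \<Omega> T lam (t, x))
       + weighted_variation (lebesgue_on (cylinder T \<Omega>)) (\<lambda>(t, x). \<zeta> t x) zs - zs (grad_Q \<Omega> T lam)
       + 1/2 * (L2_norm (lebesgue_on \<Omega>) (at_time \<Omega> T (\<lambda>t x. lam t x - u t x) T))\<^sup>2
     = I_phi_conj \<Omega> T \<zeta> ya - inner_on (cylinder T \<Omega>) ya (grad_Q \<Omega> T lam)
       + 1/2 * (L2_norm (lebesgue_on (cylinder T \<Omega>)) (grad_Q \<Omega> T lam))\<^sup>2
       + weighted_variation (lebesgue_on (cylinder T \<Omega>)) (\<lambda>(t, x). \<zeta> t x) ys - ys (grad_Q \<Omega> T lam)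
       + 1/2 * (L2_norm (lebesgue_on \<Omega>) (\<lambda>x. at_time \<Omega> T lam 0 x - u\<^sub>0 x))\<^sup>2"
proof -
  interpret torsion_domain \<Omega> \<Gamma>\<^sub>D T
    by unfold_locales (use assms(1,2,4,7) openin_imp_subset[OF assms(2)] in simp_all)
  let ?g = "time_deriv \<Omega> \<Gamma>\<^sub>D T"
  define d where "d = (\<lambda>t x. lam t x - u t x)"
  have uW: "u \<in> W_inf \<Omega> \<Gamma>\<^sub>D T" using assms(12) by (simp add: torsion_solution_def)
  have uX: "u \<in> X" and lX: "lam \<in> X" using uW assms(18) by (simp_all add: W_inf_def)
  have dX: "d \<in> X" unfolding d_def by (rule X_diff[OF lX uX])
  have wu: "weak_deriv u (?g u)" by (rule weak_deriv_time_deriv[OF uW])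
  have wl: "weak_deriv lam (?g lam)" by (rule weak_deriv_time_deriv[OF assms(18)])
  \<comment> \<open>The derivative of \<open>d\<close> is taken to be the difference of the two
    chosen ones, which is the combination that the balance equations produce.\<close>
  have wd: "weak_deriv d (\<lambda>t w. ?g lam t w - ?g u t w)" unfolding d_def by (rule weak_deriv_diff[OF lX uX wl wu])

  define w where "w = (\<lambda>q::real \<times> (real^'d). case q of (t, x) \<Rightarrow> \<zeta> t x)"
  define p where "p = grad_Q \<Omega> T u"
  define l where "l = grad_Q \<Omega> T lam"
  have wL: "w \<in> Linf MQ" using assms(8) by (simp add: admissible_threshold_def w_def)
  obtain \<zeta>0 where z0: "0 < \<zeta>0" "AE (t, x) in MQ. \<zeta>0 \<le> \<zeta> t x" using assms(8) unfolding admissible_threshold_def by blast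
  have wpos: "AE q in MQ. 0 < w q" using z0(2) by eventually_elim (use z0(1) in \<open>auto simp: w_def\<close>)
  have pL: "p \<in> Linf MQ" and lL: "l \<in> Linf MQ" unfolding p_def l_def by (rule grad_Q_props(1)[OF uX], rule grad_Q_props(1)[OF lX])
  have lpL: "(\<lambda>q. l q - p q) \<in> Linf MQ" by (rule Linf_diff[OF lL pL])
  have gd: "AE q in MQ. grad_Q \<Omega> T d q = l q - p q" unfolding d_def l_def p_def by (rule grad_Q_diff[OF lX uX])

  have sub: "z \<in> subdifferential_Linf MQ (\<lambda>q. enn2ereal (\<integral>\<^sup>+x. (if norm (q x) \<le> w x then ennreal ((norm (q x))\<^sup>2 / 2) else \<infinity>) \<partial>MQ)) p"
  proof -
    have "I_G \<Omega> T \<zeta> = (\<lambda>q. enn2ereal (\<integral>\<^sup>+x. (if norm (q x) \<le> w x then ennreal ((norm (q x))\<^sup>2 / 2) else \<infinity>) \<partial>MQ))"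
      by (rule ext) (simp add: I_G_def phi_def w_def case_prod_beta' cong: if_cong)
    then show ?thesis using assms(15) by (simp add: dual_flux_def p_def)
  qed
  have w0: "AE q in MQ. 0 \<le> w q" using wpos by eventually_elim simp
  note opt = flux_optimality[OF finite_measure_MQ wL w0 pL assms(14) sub]
  have yh: "integrable MQ ya" "ys \<in> Linf_dual MQ" "\<And>q. q \<in> Linf MQ \<Longrightarrow> y q = (\<integral>x. ya x \<bullet> q x \<partial>MQ) + ys q"
    using assms(17) by (simp_all add: yosida_hewitt_def)
  have zh: "integrable MQ za" "zs \<in> Linf_dual MQ" "\<And>q. q \<in> Linf MQ \<Longrightarrow> z q = (\<integral>x. za x \<bullet> q x \<partial>MQ) + zs q"
    using assms(14) by (simp_all add: yosida_hewitt_def)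
  have [measurable]: "w \<in> borel_measurable MQ" "p \<in> borel_measurable MQ" "l \<in> borel_measurable MQ" "ya \<in> borel_measurable MQ" "za \<in> borel_measurable MQ"
    using Linf_measurable wL pL lL yh(1) zh(1) by auto

  \<comment> \<open>Both balances are tested with \<open>d\<close>, and \<open>f\<close> cancels.
    The gradient of \<open>d\<close> on the cylinder is a choice of its own and is exchanged for
    \<open>l - p\<close> inside \<open>y\<close> and \<open>z\<close> by
    \<open>Linf_dual_AE_cong\<close>.\<close>
  have flux_balance: "(\<integral>q. (ya q - za q) \<bullet> (l q - p q) \<partial>MQ) + (ys l - ys p) - (zs l - zs p) + L1_functional T (\<lambda>t w. ?g lam t w - ?g u t w) d = 0"
  proof -
    have gdL: "grad_Q \<Omega> T d \<in> Linf MQ" by (rule grad_Q_props(1)[OF dX])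
    have "y (grad_Q \<Omega> T d) + L1_functional T (?g lam) d = L1_functional T f d"
      using assms(20) dX by (simp add: balance_def L_adj_def)
    moreover have "z (grad_Q \<Omega> T d) + L1_functional T (?g u) d = L1_functional T f d"
      using assms(15) dX by (simp add: dual_flux_def balance_def L_adj_def)
    moreover have "L1_functional T (\<lambda>t w. ?g lam t w - ?g u t w) d = L1_functional T (?g lam) d - L1_functional T (?g u) d"
      by (rule L1_functional_diff[OF _ _ dX]) (use wl wu in \<open>simp_all add: weak_deriv_def\<close>)
    moreover have "y (grad_Q \<Omega> T d) = (\<integral>q. ya q \<bullet> (l q - p q) \<partial>MQ) + (ys l - ys p)"
      unfolding Linf_dual_AE_cong[OF assms(16) gdL lpL gd] yh(3)[OF lpL] Linf_dual_diff[OF yh(2) lL pL] ..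
    moreover have "z (grad_Q \<Omega> T d) = (\<integral>q. za q \<bullet> (l q - p q) \<partial>MQ) + (zs l - zs p)"
      unfolding Linf_dual_AE_cong[OF assms(13) gdL lpL gd] zh(3)[OF lpL] Linf_dual_diff[OF zh(2) lL pL] ..
    moreover have "(\<integral>q. (ya q - za q) \<bullet> (l q - p q) \<partial>MQ) = (\<integral>q. ya q \<bullet> (l q - p q) \<partial>MQ) - (\<integral>q. za q \<bullet> (l q - p q) \<partial>MQ)"
      unfolding inner_diff_left
      by (rule Bochner_Integration.integral_diff[OF integrable_inner_Linf[OF yh(1) lpL] integrable_inner_Linf[OF zh(1) lpL]])
    ultimately show ?thesis by linarith
  qed

  have time: "L1_functional T (\<lambda>t w. ?g lam t w - ?g u t w) d
    = 1/2 * (L2_norm M (at_time \<Omega> T d T))\<^sup>2 - 1/2 * (L2_norm M (\<lambda>x. at_time \<Omega> T lam 0 x - u\<^sub>0 x))\<^sup>2"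
  proof -
    have rd: "continuous_rep \<Omega> T d (at_time \<Omega> T d)" by (rule at_time_rep[OF dX wd])
    \<comment> \<open>A second representative of \<open>d\<close>; comparing it with the chosen one
      ties the initial value of \<open>d\<close> to those of \<open>lam\<close> and of
      \<open>u\<close>.\<close>
    have rlu: "continuous_rep \<Omega> T d (\<lambda>t x. at_time \<Omega> T lam t x - at_time \<Omega> T u t x)"
      unfolding d_def by (rule continuous_rep_diff[OF at_time_rep[OF lX wl] at_time_rep[OF uX wu]])
    have t0: "0 \<in> {0..T}" using T_pos by simp
    have u0: "AE x in M. at_time \<Omega> T u 0 x = u\<^sub>0 x" using assms(12) by (simp add: torsion_solution_def)
    have "AE x in M. at_time \<Omega> T d 0 x = at_time \<Omega> T lam 0 x - u\<^sub>0 x"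
      using continuous_rep_unique[OF rd rlu t0] u0 by eventually_elim simp
    then have ae: "AE x in M. (at_time \<Omega> T d 0 x)\<^sup>2 = (at_time \<Omega> T lam 0 x - u\<^sub>0 x)\<^sup>2" by eventually_elim simp
    have "(\<integral>x. (at_time \<Omega> T d 0 x)\<^sup>2 \<partial>M) = (\<integral>x. (at_time \<Omega> T lam 0 x - u\<^sub>0 x)\<^sup>2 \<partial>M)"
    proof (rule integral_cong_AE[OF _ _ ae])
      have "at_time \<Omega> T d 0 \<in> L2 M" "at_time \<Omega> T lam 0 \<in> L2 M"
        using rd at_time_rep[OF lX wl] t0 by (simp_all add: continuous_rep_def)
      moreover have "u\<^sub>0 \<in> L2 M" by (rule V_L2[OF assms(10)])
      ultimately have [measurable]: "at_time \<Omega> T d 0 \<in> borel_measurable M" "at_time \<Omega> T lam 0 \<in> borel_measurable M" "u\<^sub>0 \<in> borel_measurable M"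
        unfolding L2_def by auto
      show "(\<lambda>x. (at_time \<Omega> T d 0 x)\<^sup>2) \<in> borel_measurable M" "(\<lambda>x. (at_time \<Omega> T lam 0 x - u\<^sub>0 x)\<^sup>2) \<in> borel_measurable M"
        by measurable
    qed
    then show ?thesis unfolding integration_by_parts_rep[OF dX wd rd] by (simp add: L2_norm_def)
  qed

  have ppos: "AE q in MQ. 0 < (case q of (t, x) \<Rightarrow> \<zeta> t x)" using wpos by (simp add: w_def)
  define A where "A q = (case q of (t, x) \<Rightarrow> phi_conj \<zeta> t x (ya (t, x)))" for q
  have Ai: "integrable MQ A" unfolding A_def[abs_def]
    by (rule integrable_phi_conj[OF finite_measure_MQ wL[unfolded w_def] ppos yh(1)])
  have pi: "integrable MQ p" and li: "integrable MQ l" by (rule Linf_integrable[OF finite_measure_MQ pL], rule Linf_integrable[OF finite_measure_MQ lL])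
  have pbi: "integrable MQ (\<lambda>q. p q \<bullet> za q)" using integrable_inner_Linf[OF zh(1) pL] by (simp add: inner_commute)
  have pai: "integrable MQ (\<lambda>q. p q \<bullet> ya q)" using integrable_inner_Linf[OF yh(1) pL] by (simp add: inner_commute)
  have lbi: "integrable MQ (\<lambda>q. za q \<bullet> l q)" by (rule integrable_inner_Linf[OF zh(1) lL])
  have ali: "integrable MQ (\<lambda>q. ya q \<bullet> l q)" by (rule integrable_inner_Linf[OF yh(1) lL])
  have ppi: "integrable MQ (\<lambda>q. (norm (p q))\<^sup>2)" using integrable_inner_Linf[OF pi pL] by (simp add: power2_norm_eq_inner)
  have lli: "integrable MQ (\<lambda>q. (norm (l q))\<^sup>2)" using integrable_inner_Linf[OF li lL] by (simp add: power2_norm_eq_inner)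
  have lpi: "integrable MQ (\<lambda>q. (norm (l q - p q))\<^sup>2)"
    using integrable_inner_Linf[OF Linf_integrable[OF finite_measure_MQ lpL] lpL] by (simp add: power2_norm_eq_inner)
  \<comment> \<open>The Taylor remainder with the conjugate at \<open>za\<close> already expressed
    through \<open>p\<close>, so that it splits into terms integrable one by one.\<close>
  define B where "B q = A q - (p q \<bullet> za q - (norm (p q))\<^sup>2 / 2) - p q \<bullet> (ya q - za q)" for q
  have Bi: "integrable MQ B" unfolding B_def[abs_def] inner_diff_right
    by (intro Bochner_Integration.integrable_diff Ai pbi pai integrable_divide ppi)
  define S where "S q = (za q - p q) \<bullet> (p q - l q)" for q
  have Si: "integrable MQ S"
  proof -
    have "S q = p q \<bullet> za q - za q \<bullet> l q - p q \<bullet> p q + p q \<bullet> l q" for q by (simp add: S_def inner_simps inner_commute)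
    then show ?thesis unfolding S_def[abs_def]
      using Bochner_Integration.integrable_add[OF Bochner_Integration.integrable_diff[OF Bochner_Integration.integrable_diff[OF pbi lbi] integrable_inner_Linf[OF pi pL]] integrable_inner_Linf[OF pi lL]]
      by (simp add: S_def)
  qed
  \<comment> \<open>The cross term, which \<open>flux_balance\<close> trades for the singular parts
    and the time term.\<close>
  define D where "D q = (ya q - za q) \<bullet> (l q - p q)" for q
  have Di: "integrable MQ D" unfolding D_def[abs_def]
    by (rule integrable_inner_Linf[OF Bochner_Integration.integrable_diff[OF yh(1) zh(1)] lpL])

  have bulk: "(\<integral>q. B q \<partial>MQ) + (\<integral>q. (norm (l q - p q))\<^sup>2 \<partial>MQ) / 2 + (\<integral>q. S q \<partial>MQ)
    = (\<integral>q. A q \<partial>MQ) - (\<integral>q. ya q \<bullet> l q \<partial>MQ) + (\<integral>q. (norm (l q))\<^sup>2 \<partial>MQ) / 2 + (\<integral>q. D q \<partial>MQ)"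
  proof -
    have "(\<integral>q. B q \<partial>MQ) + (\<integral>q. (norm (l q - p q))\<^sup>2 \<partial>MQ) / 2 + (\<integral>q. S q \<partial>MQ) = (\<integral>q. B q + (norm (l q - p q))\<^sup>2 / 2 + S q \<partial>MQ)"
      using Bi lpi Si by simp
    also have "\<dots> = (\<integral>q. (A q - ya q \<bullet> l q) + (norm (l q))\<^sup>2 / 2 + D q \<partial>MQ)"
      by (rule Bochner_Integration.integral_cong[OF refl]) (unfold B_def S_def D_def, rule gap_identity_pointwise)
    also have "\<dots> = (\<integral>q. A q \<partial>MQ) - (\<integral>q. ya q \<bullet> l q \<partial>MQ) + (\<integral>q. (norm (l q))\<^sup>2 \<partial>MQ) / 2 + (\<integral>q. D q \<partial>MQ)"
      using Ai ali lli Di by simp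
    finally show ?thesis .
  qed

  have hess: "1/2 * inner_on Q (\<lambda>p. HH \<zeta> ya za p *v (ya p - za p)) (\<lambda>p. ya p - za p) = (\<integral>q. B q \<partial>MQ)"
  proof -
    have ae: "AE q in MQ. (HH \<zeta> ya za q *v (ya q - za q)) \<bullet> (ya q - za q) = 2 * B q"
      using wpos opt(2)
    proof eventually_elim
      case (elim q)
      obtain t x where q: "q = (t, x)" by (cases q)
      have r: "0 < \<zeta> t x" and pz: "p q = proj_ball (\<zeta> t x) (za q)" using elim by (simp_all add: q w_def)
      have "1/2 * ((HH \<zeta> ya za q *v (ya q - za q)) \<bullet> (ya q - za q)) = B q"
        unfolding B_def pz using HH_taylor[of \<zeta> t x ya za, OF r] phi_conj_alt[of \<zeta> t x "za q", OF r] by (simp add: q A_def)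
      then show ?case by simp
    qed
    \<comment> \<open>The equality \<open>ae\<close> also yields measurability of the Hessian
      integrand, whose inner integral over s is not examined in its dependence on the point.\<close>
    have bm: "(\<lambda>q. 2 * B q) \<in> borel_measurable MQ" using Bi by simp
    have "inner_on Q (\<lambda>p. HH \<zeta> ya za p *v (ya p - za p)) (\<lambda>p. ya p - za p) = (\<integral>q. 2 * B q \<partial>MQ)"
      unfolding inner_on_def by (rule integral_cong_AE[OF lebesgue_on_AE_measurable[OF sets_Q bm ae] bm ae])
    then show ?thesis by simp
  qed

  define E where "E = {q \<in> Q. norm (p q) = w q}"
  have EE: "E = {(t, x) \<in> Q. norm (p (t, x)) = \<zeta> t x}" by (auto simp: E_def w_def)
  have contact: "inner_on E (\<lambda>(t, x). norm (za (t, x)) / \<zeta> t x - 1) (\<lambda>(t, x). (\<zeta> t x)\<^sup>2 - p (t, x) \<bullet> l (t, x)) = (\<integral>q. S q \<partial>MQ)"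
  proof -
    define k where "k q = (norm (za q) / w q - 1) * ((w q)\<^sup>2 - p q \<bullet> l q)" for q
    \<comment> \<open>The contact set has to be Lebesgue measurable for the integral over it to
      become one over the cylinder with an indicator.\<close>
    have "{q \<in> space MQ. norm (p q) = w q} \<in> sets MQ" by measurable
    then have El: "E \<in> sets lebesgue" using sets_Q by (simp add: E_def sets_restrict_space_iff)
    have km: "k \<in> borel_measurable MQ" unfolding k_def[abs_def] by measurable
    have im: "(\<lambda>q. indicat_real E q *\<^sub>R k q) \<in> borel_measurable MQ"
    proof (intro borel_measurable_scaleR km borel_measurable_indicator)
      show "E \<in> sets MQ" using El sets_Q by (auto simp: sets_restrict_space_iff E_def)
    qed
    have "inner_on E (\<lambda>(t, x). norm (za (t, x)) / \<zeta> t x - 1) (\<lambda>(t, x). (\<zeta> t x)\<^sup>2 - p (t, x) \<bullet> l (t, x)) = (\<integral>q. k q \<partial>lebesgue_on E)"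
      unfolding inner_on_def by (rule Bochner_Integration.integral_cong[OF refl]) (simp add: k_def w_def case_prod_beta')
    also have "\<dots> = (\<integral>q. indicat_real E q *\<^sub>R k q \<partial>lebesgue)" by (rule integral_restrict_space) (use El in simp)
    also have "\<dots> = (\<integral>q. indicat_real Q q *\<^sub>R (indicat_real E q *\<^sub>R k q) \<partial>lebesgue)"
      by (rule Bochner_Integration.integral_cong[OF refl]) (auto simp: indicator_def E_def)
    also have "\<dots> = (\<integral>q. indicat_real E q *\<^sub>R k q \<partial>MQ)" by (rule integral_restrict_space[symmetric]) (use sets_Q in simp)
    also have "\<dots> = (\<integral>q. S q \<partial>MQ)"
    proof (rule integral_cong_AE[OF im borel_measurable_integrable[OF Si]])
      show "AE q in MQ. indicat_real E q *\<^sub>R k q = S q"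
        using wpos opt(2) AE_space
      proof eventually_elim
        case (elim q)
        have "indicat_real E q *\<^sub>R k q = (if norm (p q) = w q then k q else 0)" using elim(3) by (simp add: E_def)
        also have "\<dots> = S q" unfolding k_def S_def by (rule contact_term[OF elim(1,2)])
        finally show ?case .
      qed
    qed
    finally show ?thesis .
  qed

  have grad_d: "(L2_norm MQ (grad_Q \<Omega> T d))\<^sup>2 = (\<integral>q. (norm (l q - p q))\<^sup>2 \<partial>MQ)"
  proof -
    have [measurable]: "grad_Q \<Omega> T d \<in> borel_measurable MQ" by (rule Linf_measurable[OF grad_Q_props(1)[OF dX]])
    have "(\<integral>q. (norm (grad_Q \<Omega> T d q))\<^sup>2 \<partial>MQ) = (\<integral>q. (norm (l q - p q))\<^sup>2 \<partial>MQ)"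
    proof (rule integral_cong_AE)
      show "AE q in MQ. (norm (grad_Q \<Omega> T d q))\<^sup>2 = (norm (l q - p q))\<^sup>2" using gd by eventually_elim simp
    qed measurable
    then show ?thesis by (simp add: L2_norm_def)
  qed
  have grad_l: "(L2_norm MQ l)\<^sup>2 = (\<integral>q. (norm (l q))\<^sup>2 \<partial>MQ)" by (simp add: L2_norm_def)
  have conj_l: "I_phi_conj \<Omega> T \<zeta> ya = (\<integral>q. A q \<partial>MQ)" by (simp add: I_phi_conj_def A_def)
  have inner_l: "inner_on Q ya l = (\<integral>q. ya q \<bullet> l q \<partial>MQ)" by (simp add: inner_on_def)
  note folds = d_def[symmetric] w_def[symmetric] p_def[symmetric] l_def[symmetric]
  \<comment> \<open>What remains is linear: \<open>opt(3)\<close> turns the variation of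
    \<open>zs\<close> into \<open>zs p\<close>, the variation of \<open>ys\<close> stands on both
    sides, and the singular pairings cancel against those in \<open>flux_balance\<close>.\<close>
  show ?thesis
    unfolding folds
    unfolding EE[symmetric]
    unfolding hess contact grad_d grad_l conj_l inner_l opt(3)
    using bulk[unfolded D_def] time flux_balance by linarith
qed

end
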